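(* Let $z_1,z_2,\dots$ be formal indeterminates. The series $$\tau_\infty:=\sum_{\sigma_X\in\mathrm{SP}_\infty}\sigma\,z_X^{-1}\otimes p_{\mathrm{cyc}(\sigma_X)}$$ is a $\tau$-function of the KP hierarchy, with coefficients in (a commutative subalgebra of) $\mathbb{C}[\mathfrak{S}_\infty][[z_1^{-1},z_2^{-1},\dots]]$.
   Context: $\mathfrak{S}_\infty$ is the group of permutations of $\{1,2,3,\dots\}$ fixing all but finitely many elements. A supported permutation of $\mathfrak{S}_\infty$ is a pair $\sigma_X=(\sigma,X)$ where $X$ is a finite subset of $\{1,2,3,\dots\}$ and $\sigma\in\mathfrak{S}_\infty$ is a permutation of $X$ (fixing every element outside $X$); $\mathrm{SP}_\infty$ is the set of all of these. $\mathrm{cyc}(\sigma_X)$ is the partition of $|X|$ giving the cycle type of $\sigma$ restricted to $X$, and $z_X^{-1}:=\prod_{i\in X}z_i^{-1}$. $\Lambda$ is the $\mathbb{C}$-algebra of symmetric functions in $x_1,x_2,\dots$, with power sums $p_\mu=p_{\mu_1}p_{\mu_2}\cdots$, elementary $e_k$, complete homogeneous $h_k$, and Hall inner product (Schur functions orthonormal); $\widehat\Lambda$ is its completion, allowing infinite linear combinations of basis elements. $f^\perp$ is the adjoint of multiplication by $f$. Put $\mathsf{H}(t)=\sum_k h_kt^k$, $\mathsf{E}(t)=\sum_k e_kt^k$ (multiplication operators), $\mathsf{H}^\perp(t)=\sum_k h_k^\perp t^k$, $\mathsf{E}^\perp(t)=\sum_k e_k^\perp t^k$, and $$\mathsf{B}(t):=\mathsf{H}(t)\mathsf{E}^\perp(-t^{-1}),\qquad\mathsf{B}^\perp(t):=\mathsf{E}(-t^{-1})\mathsf{H}^\perp(t).$$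 For $R$ a commutative $\mathbb{C}$-algebra, $\tau\in\widehat\Lambda_R$ (operators extended $R$-linearly) is a $\tau$-function of the KP hierarchy with coefficients in $R$ if $$[t^{-1}]\ \big(\mathsf{B}(t)\tau\big)\otimes_{R((t^{-1}))}\big(\mathsf{B}^\perp(t^{-1})\tau\big)=0,$$ where $[t^{-1}]$ extracts the coefficient of $t^{-1}$ and $f\otimes g$ is interpreted as $f(x_1,x_2,\dots)g(y_1,y_2,\dots)$ in two disjoint sets of variables. (Equivalently, by a theorem of Sato, the coefficients $\Delta^\lambda$ of $\tau$ in the Schur basis satisfy all the Plücker relations.) *)

theory Defs
  imports
    Complex_Main
    "HOL-Library.Multiset"
    "HOL-Library.Poly_Mapping"
    "HOL-Combinatorics.Permutations"
    "HOL-Combinatorics.Perm"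
    "HOL-Computational_Algebra.Formal_Laurent_Series"
begin

text \<open>
  Conventions. The index set \<open>{1, 2, 3, \<dots>}\<close> is represented by \<^typ>\<open>nat\<close>, the number \<open>i\<close> standing
  for the index \<open>i + 1\<close>; this concerns the variables \<open>x\<^sub>i\<close>, the variables \<open>z\<^sub>i\<close> and the points moved
  by permutations. Partitions are weakly decreasing lists of positive numbers.
\<close>

section \<open>Unital complex algebras\<close>

text \<open>A (not necessarily commutative) unital complex algebra, given by its structure map.\<close>

class complex_algebra_1 = ring_1 +
  fixes of_complex :: "complex \<Rightarrow> 'a"
  assumes of_complex_1: "of_complex 1 = 1"
    and of_complex_add: "of_complex (a + b) = of_complex a + of_complex b"
    and of_complex_mult: "of_complex (a * b) = of_complex a * of_complex b"
    and of_complex_commute: "of_complex a * x = x * of_complex a"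

definition commutative_subalgebra :: "'a::complex_algebra_1 set \<Rightarrow> bool" where
  "commutative_subalgebra R \<longleftrightarrow>
     range of_complex \<subseteq> R \<and>
     (\<forall>a\<in>R. \<forall>b\<in>R. a + b \<in> R \<and> a * b \<in> R \<and> a * b = b * a)"

instantiation complex :: complex_algebra_1
begin

definition of_complex_complex :: "complex \<Rightarrow> complex" where
  "of_complex_complex c = c"

instance
  by standard (simp_all add: of_complex_complex_def)

end


section \<open>The group algebra of the finitary symmetric group\<close>

text \<open>
  \<^typ>\<open>nat perm\<close> is the group of finitely supported permutations, with composition as product. The
  convolution product of \<^typ>\<open>'g \<Rightarrow>\<^sub>0 'b\<close> takes the operation of the indexing monoid from the class
  \<open>monoid_add\<close>, so the group operation is made available under the name \<open>+\<close> as well (it is not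
  commutative). Then \<^typ>\<open>nat perm \<Rightarrow>\<^sub>0 complex\<close> is the group algebra.
\<close>

instantiation Perm.perm :: (type) monoid_add
begin

definition zero_perm :: "'a perm" where
  "zero_perm = 1"

definition plus_perm :: "'a perm \<Rightarrow> 'a perm \<Rightarrow> 'a perm" where
  "plus_perm \<sigma> \<rho> = \<sigma> * \<rho>"

instance
  by standard (simp_all add: zero_perm_def plus_perm_def mult.assoc)

end

lemma single_0_commute:
  fixes p :: "'g::monoid_add \<Rightarrow>\<^sub>0 'b::ring_1"
  assumes "\<And>x. a * x = x * a"
  shows "Poly_Mapping.single 0 a * p = p * Poly_Mapping.single 0 a"
proof (induction p rule: update_induct)
  case const
  show ?case by simp
next
  case (update f k v)
  then have "Poly_Mapping.update k v f = f + Poly_Mapping.single k v"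
    by (intro poly_mapping_eqI)
      (auto simp: lookup_update lookup_add lookup_single in_keys_iff when_def)
  with update show ?case
    by (simp add: algebra_simps mult_single assms)
qed

instantiation poly_mapping :: (monoid_add, complex_algebra_1) complex_algebra_1
begin

definition of_complex_poly_mapping :: "complex \<Rightarrow> 'a \<Rightarrow>\<^sub>0 'b" where
  "of_complex_poly_mapping c = Poly_Mapping.single 0 (of_complex c)"

instance
proof
  fix a b :: complex and x :: "'a \<Rightarrow>\<^sub>0 'b"
  show "(of_complex 1 :: 'a \<Rightarrow>\<^sub>0 'b) = 1"
    by (simp add: of_complex_poly_mapping_def of_complex_1)
  show "(of_complex (a + b) :: 'a \<Rightarrow>\<^sub>0 'b) = of_complex a + of_complex b"
    by (simp add: of_complex_poly_mapping_def of_complex_add single_add)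
  show "(of_complex (a * b) :: 'a \<Rightarrow>\<^sub>0 'b) = of_complex a * of_complex b"
    by (simp add: of_complex_poly_mapping_def of_complex_mult mult_single)
  show "of_complex a * x = x * of_complex a"
    by (simp add: of_complex_poly_mapping_def single_0_commute of_complex_commute)
qed

end


section \<open>Formal power series in countably many variables\<close>

text \<open>Every function from monomials to coefficients is allowed, so the degree may be unbounded and
  infinitely many variables may occur.\<close>

type_synonym monom = "nat \<Rightarrow>\<^sub>0 nat"

definition mdeg :: "monom \<Rightarrow> nat" where
  "mdeg \<alpha> = (\<Sum>i\<in>Poly_Mapping.keys \<alpha>. Poly_Mapping.lookup \<alpha> i)"

typedef 'a mps = "UNIV :: (monom \<Rightarrow> 'a) set"
  morphisms mcoeff Abs_mps ..

setup_lifting type_definition_mps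

lemma mcoeff_Abs_mps [simp]: "mcoeff (Abs_mps F) = F"
  by (simp add: Abs_mps_inverse)

lemma mps_eqI: "(\<And>\<alpha>. mcoeff f \<alpha> = mcoeff g \<alpha>) \<Longrightarrow> f = g"
  by (metis ext mcoeff_inject)

lemma finite_monom_splits: "finite {(\<beta>, \<gamma>). \<beta> + \<gamma> = (\<alpha> :: monom)}"
proof -
  let ?L = "\<lambda>(\<beta>, \<gamma>). (Poly_Mapping.lookup \<beta>, Poly_Mapping.lookup \<gamma>) :: (nat \<Rightarrow> nat) \<times> (nat \<Rightarrow> nat)"
  let ?K = "Poly_Mapping.keys \<alpha>"
  let ?F = "{f. (\<forall>i. (i \<in> ?K \<longrightarrow> f i \<in> {..mdeg \<alpha>}) \<and> (i \<notin> ?K \<longrightarrow> f i = 0))}"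
  have fin: "finite ?F"
    by (rule finite_set_of_finite_funs) simp_all
  have le: "Poly_Mapping.lookup \<alpha> i \<le> mdeg \<alpha>" if "i \<in> ?K" for i
    using that unfolding mdeg_def by (intro member_le_sum) simp_all
  have "?L ` {(\<beta>, \<gamma>). \<beta> + \<gamma> = \<alpha>} \<subseteq> ?F \<times> ?F"
  proof (clarsimp, intro conjI allI impI)
    fix \<beta> \<gamma> :: monom and i
    assume \<alpha>: "\<alpha> = \<beta> + \<gamma>"
    { assume "i \<in> Poly_Mapping.keys (\<beta> + \<gamma>)"
      then show "Poly_Mapping.lookup \<beta> i \<le> mdeg (\<beta> + \<gamma>)"
        "Poly_Mapping.lookup \<gamma> i \<le> mdeg (\<beta> + \<gamma>)"
        using le[of i] \<alpha> by (auto simp: lookup_add) }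
    { assume "i \<notin> Poly_Mapping.keys (\<beta> + \<gamma>)"
      then show "Poly_Mapping.lookup \<beta> i = 0" "Poly_Mapping.lookup \<gamma> i = 0"
        by (auto simp: in_keys_iff lookup_add) }
  qed
  then have "finite (?L ` {(\<beta>, \<gamma>). \<beta> + \<gamma> = \<alpha>})"
    by (rule finite_subset) (intro finite_cartesian_product fin)
  moreover have "inj ?L"
    by (auto simp: inj_def intro: poly_mapping_eqI)
  ultimately show ?thesis
    by (meson finite_imageD inj_on_subset subset_UNIV)
qed

instantiation mps :: (ring_1) ring_1
begin

lift_definition zero_mps :: "'a mps" is "\<lambda>_. 0" .
lift_definition one_mps :: "'a mps" is "\<lambda>\<alpha>. if \<alpha> = 0 then 1 else 0" .
lift_definition plus_mps :: "'a mps \<Rightarrow> 'a mps \<Rightarrow> 'a mps" is "\<lambda>f g \<alpha>. f \<alpha> + g \<alpha>" .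
lift_definition uminus_mps :: "'a mps \<Rightarrow> 'a mps" is "\<lambda>f \<alpha>. - f \<alpha>" .
lift_definition minus_mps :: "'a mps \<Rightarrow> 'a mps \<Rightarrow> 'a mps" is "\<lambda>f g \<alpha>. f \<alpha> - g \<alpha>" .
lift_definition times_mps :: "'a mps \<Rightarrow> 'a mps \<Rightarrow> 'a mps"
  is "\<lambda>f g \<alpha>. \<Sum>(\<beta>, \<gamma>) | \<beta> + \<gamma> = \<alpha>. f \<beta> * g \<gamma>" .

instance
proof
  fix f g h :: "'a mps"
  show "f * g * h = f * (g * h)"
  proof (transfer, rule ext)
    fix f g h :: "monom \<Rightarrow> 'a" and \<alpha> :: monom
    let ?S = "\<lambda>\<alpha>. {(\<beta>, \<gamma>). \<beta> + \<gamma> = (\<alpha> :: monom)}"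
    have "(\<Sum>(\<delta>, \<gamma>)\<in>?S \<alpha>. (\<Sum>(\<beta>, \<beta>')\<in>?S \<delta>. f \<beta> * g \<beta>') * h \<gamma>)
        = (\<Sum>p\<in>?S \<alpha>. \<Sum>q\<in>?S (fst p). f (fst q) * g (snd q) * h (snd p))"
      by (simp add: sum_distrib_right case_prod_unfold)
    also have "\<dots> = (\<Sum>(p, q)\<in>(SIGMA p:?S \<alpha>. ?S (fst p)). f (fst q) * g (snd q) * h (snd p))"
      by (subst sum.Sigma) (auto simp: finite_monom_splits split: if_splits)
    also have "\<dots> = (\<Sum>(p, q)\<in>(SIGMA p:?S \<alpha>. ?S (snd p)). f (fst p) * g (fst q) * h (snd q))"
      by (rule sum.reindex_bij_witness[where
            i = "\<lambda>((a, _), (b, c)). ((a + b, c), (a, b))" and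
            j = "\<lambda>((_, c), (a, b)). ((a, b + c), (b, c))"])
        (auto simp: add.assoc)
    also have "\<dots> = (\<Sum>p\<in>?S \<alpha>. \<Sum>q\<in>?S (snd p). f (fst p) * g (fst q) * h (snd q))"
      by (subst sum.Sigma) (auto simp: finite_monom_splits split: if_splits)
    also have "\<dots> = (\<Sum>(\<beta>, \<delta>)\<in>?S \<alpha>. f \<beta> * (\<Sum>(\<beta>', \<gamma>)\<in>?S \<delta>. g \<beta>' * h \<gamma>))"
      by (simp add: sum_distrib_left case_prod_unfold mult.assoc)
    finally show "(\<Sum>(\<delta>, \<gamma>)\<in>?S \<alpha>. (\<Sum>(\<beta>, \<beta>')\<in>?S \<delta>. f \<beta> * g \<beta>') * h \<gamma>)
        = (\<Sum>(\<beta>, \<delta>)\<in>?S \<alpha>. f \<beta> * (\<Sum>(\<beta>', \<gamma>)\<in>?S \<delta>. g \<beta>' * h \<gamma>))" .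
  qed
  show "1 * f = f"
  proof (transfer, rule ext)
    fix f :: "monom \<Rightarrow> 'a" and \<alpha>
    have "(\<Sum>(\<beta>, \<gamma>) | \<beta> + \<gamma> = \<alpha>. (if \<beta> = 0 then 1 else 0) * f \<gamma>)
        = (\<Sum>(\<beta>, \<gamma>) \<in> {(0 :: monom, \<alpha>)}. (if \<beta> = 0 then 1 else 0) * f \<gamma>)"
      by (rule sum.mono_neutral_right) (auto simp: finite_monom_splits split: if_splits)
    then show "(\<Sum>(\<beta>, \<gamma>) | \<beta> + \<gamma> = \<alpha>. (if \<beta> = 0 then 1 else 0) * f \<gamma>) = f \<alpha>"
      by simp
  qed
  show "f * 1 = f"
  proof (transfer, rule ext)
    fix f :: "monom \<Rightarrow> 'a" and \<alpha>
    have "(\<Sum>(\<beta>, \<gamma>) | \<beta> + \<gamma> = \<alpha>. f \<beta> * (if \<gamma> = 0 then 1 else 0))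
        = (\<Sum>(\<beta>, \<gamma>) \<in> {(\<alpha>, 0 :: monom)}. f \<beta> * (if \<gamma> = 0 then 1 else 0))"
      by (rule sum.mono_neutral_right) (auto simp: finite_monom_splits split: if_splits)
    then show "(\<Sum>(\<beta>, \<gamma>) | \<beta> + \<gamma> = \<alpha>. f \<beta> * (if \<gamma> = 0 then 1 else 0)) = f \<alpha>"
      by simp
  qed
  show "(f + g) * h = f * h + g * h"
    by transfer (simp add: distrib_right case_prod_unfold sum.distrib)
  show "f * (g + h) = f * g + f * h"
    by transfer (simp add: distrib_left case_prod_unfold sum.distrib)
  show "(0 :: 'a mps) \<noteq> 1"
    by transfer (metis zero_neq_one)
qed (transfer; simp add: algebra_simps fun_eq_iff)+

end

definition mmonom :: "monom \<Rightarrow> 'a \<Rightarrow> 'a::zero mps" where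
  "mmonom \<alpha> c = Abs_mps (\<lambda>\<beta>. if \<beta> = \<alpha> then c else 0)"

lemma mcoeff_mmonom_0_times:
  "mcoeff (mmonom 0 c * f) \<alpha> = c * mcoeff f \<alpha>" for f :: "'a::ring_1 mps"
proof -
  have "(\<Sum>(\<beta>, \<gamma>) | \<beta> + \<gamma> = \<alpha>. mcoeff (mmonom 0 c) \<beta> * mcoeff f \<gamma>)
      = (\<Sum>(\<beta>, \<gamma>) \<in> {(0, \<alpha>)}. mcoeff (mmonom 0 c) \<beta> * mcoeff f \<gamma>)"
    by (rule sum.mono_neutral_right) (auto simp: finite_monom_splits mmonom_def split: if_splits)
  then show ?thesis
    by (simp add: times_mps.rep_eq mmonom_def)
qed

lemma mcoeff_times_mmonom_0:
  "mcoeff (f * mmonom 0 c) \<alpha> = mcoeff f \<alpha> * c" for f :: "'a::ring_1 mps"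
proof -
  have "(\<Sum>(\<beta>, \<gamma>) | \<beta> + \<gamma> = \<alpha>. mcoeff f \<beta> * mcoeff (mmonom 0 c) \<gamma>)
      = (\<Sum>(\<beta>, \<gamma>) \<in> {(\<alpha>, 0)}. mcoeff f \<beta> * mcoeff (mmonom 0 c) \<gamma>)"
    by (rule sum.mono_neutral_right) (auto simp: finite_monom_splits mmonom_def split: if_splits)
  then show ?thesis
    by (simp add: times_mps.rep_eq mmonom_def)
qed

instantiation mps :: (complex_algebra_1) complex_algebra_1
begin

definition of_complex_mps :: "complex \<Rightarrow> 'a mps" where
  "of_complex_mps c = mmonom 0 (of_complex c)"

instance
proof
  fix a b :: complex and f :: "'a mps"
  show "(of_complex 1 :: 'a mps) = 1"
    by (rule mps_eqI) (simp add: of_complex_mps_def mmonom_def of_complex_1 one_mps.rep_eq)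
  show "(of_complex (a + b) :: 'a mps) = of_complex a + of_complex b"
    by (rule mps_eqI) (simp add: of_complex_mps_def mmonom_def of_complex_add plus_mps.rep_eq)
  show "(of_complex (a * b) :: 'a mps) = of_complex a * of_complex b"
    unfolding of_complex_mps_def
    by (rule mps_eqI) (simp add: mcoeff_mmonom_0_times, simp add: mmonom_def of_complex_mult)
  show "of_complex a * f = f * of_complex a"
    unfolding of_complex_mps_def
    by (rule mps_eqI) (simp add: mcoeff_mmonom_0_times mcoeff_times_mmonom_0 of_complex_commute)
qed

end


section \<open>Symmetric functions\<close>

definition symmetric_mps :: "'a mps \<Rightarrow> bool" where
  "symmetric_mps f \<longleftrightarrow> (\<forall>\<pi> \<alpha>. bij \<pi> \<longrightarrow> mcoeff f (Poly_Mapping.map_key \<pi> \<alpha>) = mcoeff f \<alpha>)"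

text \<open>\<open>Sym\<close> is the algebra \<open>\<Lambda>\<close> over the complex numbers; \<open>Sym_hat R\<close> is its completion with
  coefficients in \<open>R\<close>, i.e. the symmetric series of possibly unbounded degree.\<close>

definition Sym :: "complex mps set" where
  "Sym = {f. symmetric_mps f \<and> (\<exists>d. \<forall>\<alpha>. mcoeff f \<alpha> \<noteq> 0 \<longrightarrow> mdeg \<alpha> \<le> d)}"

definition Sym_hat :: "'a set \<Rightarrow> 'a mps set" where
  "Sym_hat R = {f. symmetric_mps f \<and> range (mcoeff f) \<subseteq> R}"

definition hsym :: "nat \<Rightarrow> 'a::ring_1 mps" where
  "hsym k = Abs_mps (\<lambda>\<alpha>. if mdeg \<alpha> = k then 1 else 0)"

definition esym :: "nat \<Rightarrow> 'a::ring_1 mps" where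
  "esym k = Abs_mps (\<lambda>\<alpha>. if mdeg \<alpha> = k \<and> (\<forall>i. Poly_Mapping.lookup \<alpha> i \<le> 1) then 1 else 0)"

text \<open>Only used for \<open>k > 0\<close>.\<close>

definition psum :: "nat \<Rightarrow> 'a::ring_1 mps" where
  "psum k = Abs_mps (\<lambda>\<alpha>. if \<exists>i. \<alpha> = Poly_Mapping.single i k then 1 else 0)"

definition psum_partition :: "nat list \<Rightarrow> 'a::ring_1 mps" where
  "psum_partition \<mu> = prod_list (map psum \<mu>)"

definition is_partition :: "nat list \<Rightarrow> bool" where
  "is_partition \<nu> \<longleftrightarrow> sorted_wrt (\<ge>) \<nu> \<and> 0 \<notin> set \<nu>"

definition cells :: "nat list \<Rightarrow> (nat \<times> nat) set" where
  "cells \<nu> = {(i, j). i < length \<nu> \<and> j < \<nu> ! i}"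

text \<open>Semistandard tableaux of shape \<open>\<nu>\<close> and content \<open>\<alpha>\<close>; fillings are \<open>0\<close> outside the diagram so
  that each tableau is counted once.\<close>

definition ssyt :: "nat list \<Rightarrow> monom \<Rightarrow> (nat \<times> nat \<Rightarrow> nat) set" where
  "ssyt \<nu> \<alpha> = {T.
     (\<forall>c. c \<notin> cells \<nu> \<longrightarrow> T c = 0) \<and>
     (\<forall>i j. (i, Suc j) \<in> cells \<nu> \<longrightarrow> T (i, j) \<le> T (i, Suc j)) \<and>
     (\<forall>i j. (Suc i, j) \<in> cells \<nu> \<longrightarrow> T (i, j) < T (Suc i, j)) \<and>
     (\<forall>v. card {c \<in> cells \<nu>. T c = v} = Poly_Mapping.lookup \<alpha> v)}"

definition schur :: "nat list \<Rightarrow> 'a::ring_1 mps" where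
  "schur \<nu> = Abs_mps (\<lambda>\<alpha>. of_nat (card (ssyt \<nu> \<alpha>)))"

text \<open>The coordinates of a symmetric series in the Schur basis. The sum is finite because \<open>schur \<nu>\<close>
  is homogeneous of degree \<open>sum_list \<nu>\<close>.\<close>

definition schur_coeff :: "'a::ring_1 mps \<Rightarrow> nat list \<Rightarrow> 'a" where
  "schur_coeff f = (THE c.
     (\<forall>\<nu>. \<not> is_partition \<nu> \<longrightarrow> c \<nu> = 0) \<and>
     (\<forall>\<alpha>. mcoeff f \<alpha> = (\<Sum>\<nu> | is_partition \<nu> \<and> sum_list \<nu> = mdeg \<alpha>. c \<nu> * mcoeff (schur \<nu>) \<alpha>)))"

text \<open>The bilinear form on \<^const>\<open>Sym\<close> for which the Schur functions are orthonormal.\<close>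

definition hall_inner :: "complex mps \<Rightarrow> complex mps \<Rightarrow> complex" where
  "hall_inner f g =
     (\<Sum>\<nu> | schur_coeff f \<nu> \<noteq> 0 \<and> schur_coeff g \<nu> \<noteq> 0. schur_coeff f \<nu> * schur_coeff g \<nu>)"

definition perp :: "complex mps \<Rightarrow> complex mps \<Rightarrow> complex mps" where
  "perp f g = (THE g'. g' \<in> Sym \<and> (\<forall>u\<in>Sym. hall_inner (f * u) g = hall_inner u g'))"

text \<open>
  The \<open>R\<close>-linear extension of an operator \<open>L\<close> on \<^const>\<open>Sym\<close> to the completion: the image of
  \<open>\<Sum>\<^sub>\<nu> c\<^sub>\<nu> s\<^sub>\<nu>\<close> is \<open>\<Sum>\<^sub>\<nu> c\<^sub>\<nu> L(s\<^sub>\<nu>)\<close>. For \<open>L = f\<^sup>\<bottom>\<close> with \<open>f\<close> of bounded degree, only finitely many terms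
  contribute to the coefficient of a given monomial.
\<close>

definition extend_scalars :: "(complex mps \<Rightarrow> complex mps) \<Rightarrow> 'a::complex_algebra_1 mps \<Rightarrow> 'a mps" where
  "extend_scalars L f = Abs_mps (\<lambda>\<alpha>.
     \<Sum>\<nu> | is_partition \<nu> \<and> mcoeff (L (schur \<nu>)) \<alpha> \<noteq> 0.
       schur_coeff f \<nu> * of_complex (mcoeff (L (schur \<nu>)) \<alpha>))"


section \<open>The KP hierarchy\<close>

text \<open>
  All Laurent series below are in \<open>s = t\<^sup>-\<^sup>1\<close>, so that \<open>R((t\<^sup>-\<^sup>1))\<close> consists of the \<open>fls\<close> with
  coefficients in \<open>R\<close>, and \<open>[t\<^sup>-\<^sup>1]\<close> extracts the coefficient of \<open>s\<^sup>1\<close>.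

  \<open>genfun F u\<close> is \<open>\<Sum>\<^sub>k F\<^sub>k u\<^sup>k\<close>, where \<open>F\<^sub>k\<close> is homogeneous of degree \<open>k\<close>, so that only \<open>k \<le> mdeg \<alpha>\<close>
  matters for the coefficient of \<open>\<alpha>\<close>. \<open>perp_genfun F \<epsilon> \<tau>\<close> is \<open>\<Sum>\<^sub>k (\<epsilon>s)\<^sup>k F\<^sub>k\<^sup>\<bottom> \<tau>\<close>.
\<close>

definition genfun :: "(nat \<Rightarrow> 'a mps) \<Rightarrow> 'a fls \<Rightarrow> 'a::ring_1 fls mps" where
  "genfun F u = Abs_mps (\<lambda>\<alpha>. \<Sum>k\<le>mdeg \<alpha>. fls_const (mcoeff (F k) \<alpha>) * u ^ k)"

definition perp_genfun :: "(nat \<Rightarrow> complex mps) \<Rightarrow> 'a \<Rightarrow> 'a::complex_algebra_1 mps \<Rightarrow> 'a fls mps" where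
  "perp_genfun F \<epsilon> \<tau> = Abs_mps (\<lambda>\<alpha>.
     fps_to_fls (Abs_fps (\<lambda>k. \<epsilon> ^ k * mcoeff (extend_scalars (perp (F k)) \<tau>) \<alpha>)))"

text \<open>\<open>B(t) \<tau> = H(t) E\<^sup>\<bottom>(-t\<^sup>-\<^sup>1) \<tau>\<close> with \<open>t = s\<^sup>-\<^sup>1\<close>.\<close>

definition KP_B :: "'a::complex_algebra_1 mps \<Rightarrow> 'a fls mps" where
  "KP_B \<tau> = genfun hsym fls_X_inv * perp_genfun esym (-1) \<tau>"

text \<open>\<open>B\<^sup>\<bottom>(s) \<tau> = E(-s\<^sup>-\<^sup>1) H\<^sup>\<bottom>(s) \<tau>\<close>, i.e. \<open>B\<^sup>\<bottom>(t\<^sup>-\<^sup>1) \<tau>\<close>.\<close>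

definition KP_B_perp :: "'a::complex_algebra_1 mps \<Rightarrow> 'a fls mps" where
  "KP_B_perp \<tau> = genfun esym (- fls_X_inv) * perp_genfun hsym 1 \<tau>"

text \<open>The coefficient of \<open>x\<^sup>\<alpha> y\<^sup>\<beta>\<close> in \<open>f(x) g(y)\<close>.\<close>

definition tensor_coeff :: "'b::ring_1 mps \<Rightarrow> 'b mps \<Rightarrow> monom \<Rightarrow> monom \<Rightarrow> 'b" where
  "tensor_coeff f g \<alpha> \<beta> = mcoeff f \<alpha> * mcoeff g \<beta>"

definition KP_tau_function :: "'a::complex_algebra_1 set \<Rightarrow> 'a mps \<Rightarrow> bool" where
  "KP_tau_function R \<tau> \<longleftrightarrow>
     commutative_subalgebra R \<and> \<tau> \<in> Sym_hat R \<and>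
     (\<forall>\<alpha> \<beta>. fls_nth (tensor_coeff (KP_B \<tau>) (KP_B_perp \<tau>) \<alpha> \<beta>) 1 = 0)"


section \<open>The series\<close>

definition supported_perms :: "(nat perm \<times> nat set) set" where
  "supported_perms = {(\<sigma>, X). finite X \<and> Perm.apply \<sigma> permutes X}"

definition cyc :: "nat perm \<times> nat set \<Rightarrow> nat list" where
  "cyc = (\<lambda>(\<sigma>, X). rev (sorted_list_of_multiset
     (image_mset card (mset_set ((\<lambda>i. Perm.orbit \<sigma> i) ` X)))))"

text \<open>Power series in \<open>z\<^sub>1\<^sup>-\<^sup>1, z\<^sub>2\<^sup>-\<^sup>1, \<dots>\<close>: the exponents are those of the inverses.\<close>

type_synonym perm_series = "(nat perm \<Rightarrow>\<^sub>0 complex) mps"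

definition z_inv :: "nat set \<Rightarrow> monom" where
  "z_inv X = (\<Sum>i\<in>X. Poly_Mapping.single i 1)"

definition tau_term :: "nat perm \<times> nat set \<Rightarrow> perm_series mps" where
  "tau_term = (\<lambda>(\<sigma>, X).
     mmonom 0 (mmonom (z_inv X) (Poly_Mapping.single \<sigma> 1)) * psum_partition (cyc (\<sigma>, X)))"

text \<open>The formal sum of all terms: for each monomial in the \<open>x\<^sub>i\<close> and each monomial \<open>m\<close> in the \<open>z\<^sub>i\<^sup>-\<^sup>1\<close>
  only terms with \<open>z_inv X = m\<close> contribute, and there are finitely many of these.\<close>

definition tau_infinity :: "perm_series mps" where
  "tau_infinity = Abs_mps (\<lambda>\<alpha>. Abs_mps (\<lambda>m.
     \<Sum>\<sigma>X | \<sigma>X \<in> supported_perms \<and> mcoeff (mcoeff (tau_term \<sigma>X) \<alpha>) m \<noteq> 0.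
       mcoeff (mcoeff (tau_term \<sigma>X) \<alpha>) m))"

end

theory Submission
  imports
    Defs
begin

text \<open>
 Write \<open>s = t\<^sup>-\<^sup>1\<close>. On a product of power sums the operators \<open>E\<^sup>\<bottom>(-s)\<close> and
 \<open>H\<^sup>\<bottom>(s)\<close> are the substitutions \<open>p\<^sub>k \<mapsto> p\<^sub>k - s\<^sup>k\<close> and \<open>p\<^sub>k \<mapsto> p\<^sub>k + s\<^sup>k\<close> (\<open>perp_power_sums\<close>). Therefore the
 coefficient of a permutation \<open>\<rho>\<close> and of a monomial \<open>m\<close> in the bilinear expression is
 \<open>L(\<Sum> \<Prod> a \<cdot> \<Prod> b)\<close>. The sum is over all \<open>\<sigma>\<close> on \<open>X\<close> and \<open>\<pi>\<close> on \<open>Y\<close> with \<open>\<sigma>\<pi> = \<rho>\<close> and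
 \<open>z\<^sub>X\<^sup>-\<^sup>1 z\<^sub>Y\<^sup>-\<^sup>1 = m\<close>; the products are over the cycles \<open>C\<close> of \<open>\<sigma>\<close> and of \<open>\<pi>\<close>, with weights \<open>a\<^sub>|\<^sub>C\<^sub>|\<close> and
 \<open>b\<^sub>|\<^sub>C\<^sub>|\<close>, where \<open>a\<^sub>k = p\<^sub>k(x) - s\<^sup>k\<close> and \<open>b\<^sub>k = p\<^sub>k(y) + s\<^sup>k\<close>; and \<open>L\<close> is linear over the power series in
 \<open>x\<close> and \<open>y\<close>, kills \<open>1\<close> and maps \<open>s\<^sup>n\<^sup>+\<^sup>1\<close> to \<open>\<eta>\<^sub>n = \<Sum> h\<^sub>i(x) (-1)\<^sup>j e\<^sub>j(y)\<close>, summed over \<open>i + j = n\<close>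
 (\<open>KP_coefficient_tau_zero\<close>, \<open>xy_coeff_resid\<close>). Let \<open>D\<close> and \<open>S\<close> be the sets of points of exponent two
 and one in \<open>m\<close>; then \<open>D = X \<inter> Y\<close> and every point of \<open>S\<close> lies in exactly one of \<open>X\<close> and \<open>Y\<close>.

 The points of \<open>S\<close> can be eliminated one at a time: contract the point out of its cycle and keep its
 length as a weight on a neighbour. This preserves the sum, except that a fixed point splits off a
 factor \<open>a\<^sub>k + b\<^sub>k\<close>, and this factor does not involve \<open>s\<close> (\<open>mixed_sum_reduction\<close>). What remains is a sum
 over pairs of permutations of \<open>D\<close> whose points carry exponents, to be distributed over the two factors in
 all possible ways (\<open>pair_sum\<close>).

 Let the points \<open>d\<close> of \<open>D\<close> carry generic numbers \<open>c\<^sub>d\<close>. The remaining sums are the coefficients of the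
 monomials in \<open>c\<close> of a product of two elements of the form \<open>\<Sum> \<sigma> \<Prod>\<^sub>C b[c\<^sub>C]\<close>, with \<open>b[c\<^sub>C]\<close> the divided difference
 of \<open>b(u) = \<Sum> b\<^sub>k u\<^sup>k\<^sup>-\<^sup>1\<close> at the numbers on the cycle \<open>C\<close> (\<open>lookup_series_product\<close>). Expanding each divided
 difference over its nodes writes such an element as \<open>\<Sum> f\<^sub>E \<Prod> b(c\<^sub>e)\<close>, a sum over subsets \<open>E\<close> of \<open>D\<close> with
 the product over \<open>e \<in> E\<close> (\<open>series_rooted_sum\<close>). The \<open>f\<^sub>E\<close> are polynomials in the Gaudin Hamiltonians
 \<open>-\<Sum> (d e) / (c\<^sub>d - c\<^sub>e)\<close>; the latter commute, so all the elements commute. This gives the commutativity of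
 the coefficients of \<open>\<tau>\<^sub>\<infinity>\<close>, and \<open>R\<close> can be taken to be their bicommutant.

 The terms \<open>\<mp>s\<^sup>k\<close> in the weights change the values \<open>b(c\<^sub>e)\<close> by \<open>y\<^sub>e = s / (1 - c\<^sub>e s)\<close>, up to a grading variable.
 As \<open>y\<^sub>d y\<^sub>e = (y\<^sub>d - y\<^sub>e) / (c\<^sub>d - c\<^sub>e)\<close>, the product becomes linear in the \<open>y\<^sub>e\<close> apart from the squares \<open>y\<^sub>d\<^sup>2\<close>.
 Newton's identities for \<open>\<eta>\<close> say exactly that \<open>L(y\<^sub>d\<^sup>2)\<close> is \<open>L(y\<^sub>d)\<close> times the difference of the power sum
 parts of \<open>a(c\<^sub>d)\<close> and \<open>b(c\<^sub>d)\<close>, and then the coefficient of every \<open>L(y\<^sub>d)\<close> vanishes by the recursion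
 for the \<open>f\<^sub>E\<close> (\<open>residue_theorem\<close>).

 The operators \<open>e\<^sub>k\<^sup>\<bottom>\<close> and \<open>h\<^sub>k\<^sup>\<bottom>\<close> are defined by the Hall inner product. They are computed on monomials
 with the Pieri rule: \<open>h\<^sub>k\<^sup>\<bottom>\<close> extracts the coefficient of the \<open>k\<close>-th power of a fresh variable
 (\<open>perp_hsym\<close>), and \<open>e\<^sub>k\<^sup>\<bottom>\<close> follows from \<open>E(-t) H(t) = 1\<close> (\<open>perp_esym\<close>).
\<close>

abbreviation lookup :: "('a \<Rightarrow>\<^sub>0 'b::zero) \<Rightarrow> 'a \<Rightarrow> 'b" where "lookup \<equiv> Poly_Mapping.lookup"
abbreviation single :: "'a \<Rightarrow> 'b \<Rightarrow> ('a \<Rightarrow>\<^sub>0 'b::zero)" where "single \<equiv> Poly_Mapping.single"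
abbreviation keys :: "('a \<Rightarrow>\<^sub>0 'b::zero) \<Rightarrow> 'a set" where "keys \<equiv> Poly_Mapping.keys"
abbreviation map_key :: "('a \<Rightarrow> 'b) \<Rightarrow> ('b \<Rightarrow>\<^sub>0 'c::zero) \<Rightarrow> ('a \<Rightarrow>\<^sub>0 'c)" where "map_key \<equiv> Poly_Mapping.map_key"
abbreviation act :: "'a perm \<Rightarrow> 'a \<Rightarrow> 'a" where "act \<equiv> Perm.apply"

section \<open>Partitions and horizontal strips\<close>

definition part :: "nat list \<Rightarrow> nat \<Rightarrow> nat" where
 "part \<nu> i = (if i < length \<nu> then \<nu> ! i else 0)"

text \<open>The interlacing form of the condition that the skew diagram \<open>\<nu>/\<kappa>\<close> has no two cells in a column.\<close>

definition horizontal_strip :: "nat list \<Rightarrow> nat list \<Rightarrow> bool" where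
 "horizontal_strip \<kappa> \<nu> \<longleftrightarrow> (\<forall>i. part \<nu> (Suc i) \<le> part \<kappa> i \<and> part \<kappa> i \<le> part \<nu> i)"

definition kostka :: "nat list \<Rightarrow> monom \<Rightarrow> nat" where
 "kostka \<nu> \<alpha> = card (ssyt \<nu> \<alpha>)"

lemma part_antimono: "is_partition \<nu> \<Longrightarrow> i \<le> j \<Longrightarrow> part \<nu> j \<le> part \<nu> i"
 unfolding part_def is_partition_def
 by (cases "i = j") (auto simp: sorted_wrt_iff_nth_less)

lemma part_pos: "is_partition \<nu> \<Longrightarrow> 0 < part \<nu> i \<longleftrightarrow> i < length \<nu>"
 unfolding part_def is_partition_def by (metis gr0I nth_mem not_less_zero)

lemma part_inj:
 assumes "is_partition \<mu>" "is_partition \<nu>" "\<And>i. part \<mu> i = part \<nu> i"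
 shows "\<mu> = \<nu>"
proof -
 have "i < length \<mu> \<longleftrightarrow> i < length \<nu>" for i
  using part_pos[OF assms(1)] part_pos[OF assms(2)] assms(3) by metis
 then have "length \<mu> = length \<nu>" by (metis linorder_neqE_nat less_irrefl)
 then show ?thesis
  using assms(3) by (intro nth_equalityI) (auto simp: part_def split: if_splits, metis)
qed

lemma part_exists:
 assumes "\<And>i j. i \<le> j \<Longrightarrow> f j \<le> f i" "\<And>i. M \<le> i \<Longrightarrow> f i = 0"
 shows "\<exists>\<nu>. is_partition \<nu> \<and> (\<forall>i. part \<nu> i = f i)"
proof -
 define m where "m = (LEAST m. f m = 0)"
 have m0: "f m = 0" unfolding m_def using assms(2)[of M] by (intro LeastI) auto
 have mpos: "f i > 0" if "i < m" for i
  using that not_less_Least[of i "\<lambda>m. f m = 0"] unfolding m_def by auto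
 have "is_partition (map f [0..<m])"
  unfolding is_partition_def using mpos assms(1)
  by (auto simp: sorted_wrt_iff_nth_less) (metis less_irrefl)
 moreover have "part (map f [0..<m]) i = f i" for i
  using m0 assms(1)[of m i] by (auto simp: part_def)
 ultimately show ?thesis by blast
qed

definition of_parts :: "(nat \<Rightarrow> nat) \<Rightarrow> nat list" where
 "of_parts f = (SOME \<nu>. is_partition \<nu> \<and> (\<forall>i. part \<nu> i = f i))"

lemma of_parts:
 assumes "\<And>i j. i \<le> j \<Longrightarrow> f j \<le> f i" "\<And>i. M \<le> i \<Longrightarrow> f i = 0"
 shows "is_partition (of_parts f)" "part (of_parts f) i = f i"
 using someI_ex[OF part_exists[of f M, OF assms]] unfolding of_parts_def by auto

lemma sum_list_part: "length \<nu> \<le> M \<Longrightarrow> sum_list \<nu> = (\<Sum>i<M. part \<nu> i)"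
proof -
 assume "length \<nu> \<le> M"
 have "sum_list \<nu> = (\<Sum>i<length \<nu>. part \<nu> i)"
  by (simp add: sum_list_sum_nth part_def atLeast0LessThan)
 also have "... = (\<Sum>i<M. part \<nu> i)"
  using \<open>length \<nu> \<le> M\<close> by (intro sum.mono_neutral_left) (auto simp: part_def)
 finally show ?thesis .
qed

lemma part_beyond: "length \<nu> \<le> i \<Longrightarrow> part \<nu> i = 0"
 by (simp add: part_def)

lemma part_Nil [simp]: "part [] i = 0"
 by (simp add: part_def)

lemma length_le_sum_list: "is_partition \<nu> \<Longrightarrow> length \<nu> \<le> sum_list \<nu>"
proof (induction \<nu>)
 case (Cons a \<nu>)
 then have "is_partition \<nu>" "a > 0" by (auto simp: is_partition_def)
 with Cons show ?case by auto
qed simp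

lemma finite_partitions: "finite {\<nu>. is_partition \<nu> \<and> sum_list \<nu> = n}"
proof (rule finite_subset)
 show "{\<nu>. is_partition \<nu> \<and> sum_list \<nu> = n} \<subseteq> {\<nu>. set \<nu> \<subseteq> {..n} \<and> length \<nu> \<le> n}"
  using length_le_sum_list by (auto dest: member_le_sum_list)
 show "finite {\<nu>. set \<nu> \<subseteq> {..n} \<and> length \<nu> \<le> n}"
  by (rule finite_lists_length_le) simp
qed

lemma finite_partitions_le: "finite {\<nu>. is_partition \<nu> \<and> sum_list \<nu> \<le> n}"
proof -
 have "{\<nu>. is_partition \<nu> \<and> sum_list \<nu> \<le> n} = (\<Union>m\<le>n. {\<nu>. is_partition \<nu> \<and> sum_list \<nu> = m})"
  by auto
 then show ?thesis by (simp add: finite_partitions)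
qed

lemma horizontal_strip_length:
 assumes "is_partition \<kappa>" "is_partition \<nu>" "horizontal_strip \<kappa> \<nu>"
 shows "length \<kappa> \<le> length \<nu>" "length \<nu> \<le> Suc (length \<kappa>)" "sum_list \<kappa> \<le> sum_list \<nu>"
proof -
 show l1: "length \<kappa> \<le> length \<nu>"
  using assms part_pos[of \<kappa> "length \<nu>"] part_beyond[of \<nu> "length \<nu>"]
  unfolding horizontal_strip_def by (metis le_zero_eq neq0_conv linorder_not_less order_refl)
 show "length \<nu> \<le> Suc (length \<kappa>)"
  using assms part_pos[of \<nu> "Suc (length \<kappa>)"] part_beyond[of \<kappa> "length \<kappa>"]
  unfolding horizontal_strip_def by (metis le_zero_eq neq0_conv linorder_not_less order_refl)
 show "sum_list \<kappa> \<le> sum_list \<nu>"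
  using assms(3) l1 unfolding sum_list_part[OF l1] sum_list_part[OF order_refl[of "length \<nu>"]]
  by (intro sum_mono) (auto simp: horizontal_strip_def)
qed

text \<open>Both conditions on \<open>\<xi>\<close> and on \<open>\<delta>\<close> say that parts lie in the intervals from
 \<open>max(\<mu>\<^sub>i\<^sub>+\<^sub>1, \<kappa>\<^sub>i\<^sub>+\<^sub>1)\<close> to \<open>min(\<mu>\<^sub>i, \<kappa>\<^sub>i)\<close>. Reflecting every part in its interval turns \<open>\<delta>\<^sub>i\<close> into \<open>\<xi>\<^sub>i\<^sub>+\<^sub>1\<close>, and
 the largest part of \<open>\<xi>\<close> is then determined by the size \<open>n\<close>. This is the commutation of adding and removing
 horizontal strips on which the Pieri rule rests.\<close>

lemma toggle_bij:
 assumes \<mu>: "is_partition \<mu>" and \<kappa>: "is_partition \<kappa>"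
 shows "card {\<xi>. is_partition \<xi> \<and> horizontal_strip \<mu> \<xi> \<and> horizontal_strip \<kappa> \<xi> \<and> sum_list \<xi> = n}
    = card {\<delta>. is_partition \<delta> \<and> horizontal_strip \<delta> \<mu> \<and> horizontal_strip \<delta> \<kappa> \<and> sum_list \<mu> + sum_list \<kappa> \<le> n + sum_list \<delta>}"
  (is "card ?A = card ?B")
proof -
 define mx where "mx i = max (part \<mu> i) (part \<kappa> i)" for i
 define mn where "mn i = min (part \<mu> i) (part \<kappa> i)" for i
 define M where "M = length \<mu> + length \<kappa>"
 have mx0: "mx i = 0" "mn i = 0" if "M \<le> i" for i
  using that by (auto simp: mx_def mn_def M_def part_beyond)
 have anti: "mx j \<le> mx i" "mn j \<le> mn i" if "i \<le> j" for i j
  using part_antimono[OF \<mu> that] part_antimono[OF \<kappa> that] by (auto simp: mx_def mn_def)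
 have mnmx: "mn i \<le> mx i" for i by (auto simp: mx_def mn_def)
 have tot: "(\<Sum>i<M. mx (Suc i) + mn i) + mx 0 = sum_list \<mu> + sum_list \<kappa>"
 proof -
  have "(\<Sum>i<M. mx (Suc i)) + mx 0 = (\<Sum>i<Suc M. mx i)"
   by (subst sum.lessThan_Suc_shift) simp
  also have "... = (\<Sum>i<M. mx i)" using mx0 by simp
  finally have "(\<Sum>i<M. mx (Suc i) + mn i) + mx 0 = (\<Sum>i<M. mx i + mn i)"
   by (simp add: sum.distrib)
  also have "... = (\<Sum>i<M. part \<mu> i + part \<kappa> i)"
   by (intro sum.cong) (auto simp: mx_def mn_def max_def min_def)
  finally show ?thesis
   by (simp add: sum.distrib sum_list_part[of \<mu> M] sum_list_part[of \<kappa> M] M_def)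
 qed
 have up: "(horizontal_strip \<mu> \<xi> \<and> horizontal_strip \<kappa> \<xi>) \<longleftrightarrow>
   (mx 0 \<le> part \<xi> 0 \<and> (\<forall>i. mx (Suc i) \<le> part \<xi> (Suc i) \<and> part \<xi> (Suc i) \<le> mn i))" for \<xi>
 proof -
  have "(\<forall>i. mx i \<le> part \<xi> i) \<longleftrightarrow> mx 0 \<le> part \<xi> 0 \<and> (\<forall>i. mx (Suc i) \<le> part \<xi> (Suc i))"
   by (metis not0_implies_Suc)
  then show ?thesis
   unfolding horizontal_strip_def mx_def mn_def by (auto simp del: max.bounded_iff) (metis max.bounded_iff)+
 qed
 have dn: "(horizontal_strip \<delta> \<mu> \<and> horizontal_strip \<delta> \<kappa>) \<longleftrightarrow>
   (\<forall>i. mx (Suc i) \<le> part \<delta> i \<and> part \<delta> i \<le> mn i)" for \<delta>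
  unfolding horizontal_strip_def mx_def mn_def by auto
 define F where "F \<delta> = of_parts (case_nat (mx 0 + (n + sum_list \<delta> - (sum_list \<mu> + sum_list \<kappa>)))
   (\<lambda>i. mx (Suc i) + mn i - part \<delta> i))" for \<delta>
 define G where "G \<xi> = of_parts (\<lambda>i. mx (Suc i) + mn i - part \<xi> (Suc i))" for \<xi>
 have F: "is_partition (F \<delta>)"
   "part (F \<delta>) i = case_nat (mx 0 + (n + sum_list \<delta> - (sum_list \<mu> + sum_list \<kappa>)))
   (\<lambda>i. mx (Suc i) + mn i - part \<delta> i) i"
  if "\<forall>i. mx (Suc i) \<le> part \<delta> i \<and> part \<delta> i \<le> mn i" for \<delta> i
 proof -
  let ?f = "case_nat (mx 0 + (n + sum_list \<delta> - (sum_list \<mu> + sum_list \<kappa>)))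
   (\<lambda>i. mx (Suc i) + mn i - part \<delta> i)"
  have step: "?f (Suc i) \<le> ?f i" for i
  proof (cases i)
   case 0
   have "mx (Suc 0) + mn 0 - part \<delta> 0 \<le> mx 0"
    using that[rule_format, of 0] mnmx[of 0] by arith
   with 0 show ?thesis by simp
  next
   case (Suc j)
   have "mx (Suc i) \<le> part \<delta> i" "part \<delta> j \<le> mn j" using that by auto
   then show ?thesis using Suc mnmx[of i] by simp
  qed
  have 1: "?f j \<le> ?f i" if "i \<le> j" for i j
   using lift_Suc_antimono_le[of ?f i j, OF step that] .
  have 2: "?f i = 0" if "Suc M \<le> i" for i
   using that mx0 by (cases i) auto
  show "is_partition (F \<delta>)" "part (F \<delta>) i = ?f i"
   unfolding F_def using of_parts[of ?f "Suc M", OF 1 2] by blast+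
 qed
 have G: "is_partition (G \<xi>)" "part (G \<xi>) i = mx (Suc i) + mn i - part \<xi> (Suc i)"
  if "\<forall>i. mx (Suc i) \<le> part \<xi> (Suc i) \<and> part \<xi> (Suc i) \<le> mn i" for \<xi> i
 proof -
  let ?f = "\<lambda>i. mx (Suc i) + mn i - part \<xi> (Suc i)"
  have step: "?f (Suc i) \<le> ?f i" for i
  proof -
   have "mx (Suc (Suc i)) \<le> part \<xi> (Suc (Suc i))" "part \<xi> (Suc i) \<le> mn i" using that by auto
   then show ?thesis using mnmx[of "Suc i"] by simp
  qed
  have 1: "?f j \<le> ?f i" if "i \<le> j" for i j
   using lift_Suc_antimono_le[of ?f i j, OF step that] .
  have 2: "?f i = 0" if "M \<le> i" for i
   using that mx0 by auto
  show "is_partition (G \<xi>)" "part (G \<xi>) i = ?f i"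
   unfolding G_def using of_parts[of ?f M, OF 1 2] by blast+
 qed
 have sF: "sum_list \<xi> = part \<xi> 0 + (\<Sum>i<M. part \<xi> (Suc i))"
  if "is_partition \<xi>" "\<forall>i. part \<xi> (Suc i) \<le> mn i" for \<xi>
 proof -
  have "length \<xi> \<le> Suc M"
   using that part_pos[of \<xi> "Suc M"] mx0(2)[of M]
   by (metis le_zero_eq neq0_conv linorder_not_less order_refl)
  then show ?thesis
   by (simp only: sum_list_part[of \<xi> "Suc M"] sum.lessThan_Suc_shift)
 qed
 have sG: "sum_list \<delta> = (\<Sum>i<M. part \<delta> i)"
  if "is_partition \<delta>" "\<forall>i. part \<delta> i \<le> mn i" for \<delta>
 proof -
  have "length \<delta> \<le> M"
   using that part_pos[of \<delta> "M"] mx0(2)[of M]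
   by (metis le_zero_eq neq0_conv linorder_not_less order_refl)
  then show ?thesis by (rule sum_list_part)
 qed
 have "bij_betw F ?B ?A"
 proof (rule bij_betw_byWitness[where f' = G])
  show "F ` ?B \<subseteq> ?A"
  proof (safe)
   fix \<delta> assume \<delta>: "is_partition \<delta>" and h: "horizontal_strip \<delta> \<mu>" "horizontal_strip \<delta> \<kappa>"
    and le: "sum_list \<mu> + sum_list \<kappa> \<le> n + sum_list \<delta>"
   have d: "\<forall>i. mx (Suc i) \<le> part \<delta> i \<and> part \<delta> i \<le> mn i" using h dn by blast
   have b: "mx (Suc i) \<le> part (F \<delta>) (Suc i)" "part (F \<delta>) (Suc i) \<le> mn i" for i
    using d[rule_format, of i] by (auto simp: F(2)[OF d])
   show "is_partition (F \<delta>)" using F(1)[OF d] .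
   have "horizontal_strip \<mu> (F \<delta>) \<and> horizontal_strip \<kappa> (F \<delta>)"
    unfolding up using b by (auto simp: F(2)[OF d])
   then show "horizontal_strip \<mu> (F \<delta>)" "horizontal_strip \<kappa> (F \<delta>)" by auto
   have s: "sum_list (F \<delta>) = part (F \<delta>) 0 + (\<Sum>i<M. part (F \<delta>) (Suc i))"
    using b by (intro sF F(1)[OF d]) auto
   have "(\<Sum>i<M. part (F \<delta>) (Suc i)) + (\<Sum>i<M. part \<delta> i) = (\<Sum>i<M. mx (Suc i) + mn i)"
    unfolding sum.distrib[symmetric]
   proof (intro sum.cong refl)
    fix i show "part (F \<delta>) (Suc i) + part \<delta> i = mx (Suc i) + mn i"
     using d[rule_format, of i] by (simp add: F(2)[OF d])
   qed
   moreover have "sum_list \<delta> = (\<Sum>i<M. part \<delta> i)" using d \<delta> by (intro sG) auto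
   ultimately show "sum_list (F \<delta>) = n"
    using tot le s by (simp add: F(2)[OF d])
  qed
  show "G ` ?A \<subseteq> ?B"
  proof (safe)
   fix \<xi> assume \<xi>: "is_partition \<xi>" and h: "horizontal_strip \<mu> \<xi>" "horizontal_strip \<kappa> \<xi>"
    and n: "n = sum_list \<xi>"
   have u: "mx 0 \<le> part \<xi> 0" "\<forall>i. mx (Suc i) \<le> part \<xi> (Suc i) \<and> part \<xi> (Suc i) \<le> mn i"
    using h up by blast+
   have b: "mx (Suc i) \<le> part (G \<xi>) i" "part (G \<xi>) i \<le> mn i" for i
    using u(2)[rule_format, of i] by (auto simp: G(2)[OF u(2)])
   show "is_partition (G \<xi>)" using G(1)[OF u(2)] .
   have "horizontal_strip (G \<xi>) \<mu> \<and> horizontal_strip (G \<xi>) \<kappa>"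
    unfolding dn using b by auto
   then show "horizontal_strip (G \<xi>) \<mu>" "horizontal_strip (G \<xi>) \<kappa>" by auto
   have s: "sum_list \<xi> = part \<xi> 0 + (\<Sum>i<M. part \<xi> (Suc i))"
    using u by (intro sF \<xi>) auto
   have "(\<Sum>i<M. part \<xi> (Suc i)) + (\<Sum>i<M. part (G \<xi>) i) = (\<Sum>i<M. mx (Suc i) + mn i)"
    unfolding sum.distrib[symmetric]
   proof (intro sum.cong refl)
    fix i show "part \<xi> (Suc i) + part (G \<xi>) i = mx (Suc i) + mn i"
     using u(2)[rule_format, of i] by (simp add: G(2)[OF u(2)])
   qed
   moreover have "sum_list (G \<xi>) = (\<Sum>i<M. part (G \<xi>) i)" using b G(1)[OF u(2)] by (intro sG) auto
   ultimately show "sum_list \<mu> + sum_list \<kappa> \<le> sum_list \<xi> + sum_list (G \<xi>)"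
    using tot s u(1) by simp
  qed
  show "\<forall>\<delta>\<in>?B. G (F \<delta>) = \<delta>"
  proof (safe)
   fix \<delta> assume \<delta>: "is_partition \<delta>" and h: "horizontal_strip \<delta> \<mu>" "horizontal_strip \<delta> \<kappa>"
   have d: "\<forall>i. mx (Suc i) \<le> part \<delta> i \<and> part \<delta> i \<le> mn i" using h dn by blast
   have d': "\<forall>i. mx (Suc i) \<le> part (F \<delta>) (Suc i) \<and> part (F \<delta>) (Suc i) \<le> mn i"
   proof
    fix i show "mx (Suc i) \<le> part (F \<delta>) (Suc i) \<and> part (F \<delta>) (Suc i) \<le> mn i"
     using d[rule_format, of i] by (auto simp: F(2)[OF d])
   qed
   show "G (F \<delta>) = \<delta>"
   proof (rule part_inj[OF G(1)[OF d'] \<delta>])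
    fix i show "part (G (F \<delta>)) i = part \<delta> i"
     using d[rule_format, of i] by (simp add: F(2)[OF d] G(2)[OF d'])
   qed
  qed
  show "\<forall>\<xi>\<in>?A. F (G \<xi>) = \<xi>"
  proof (safe)
   fix \<xi> assume \<xi>: "is_partition \<xi>" and h: "horizontal_strip \<mu> \<xi>" "horizontal_strip \<kappa> \<xi>"
    and n: "n = sum_list \<xi>"
   have u: "mx 0 \<le> part \<xi> 0" "\<forall>i. mx (Suc i) \<le> part \<xi> (Suc i) \<and> part \<xi> (Suc i) \<le> mn i"
    using h up by blast+
   have b: "\<forall>i. mx (Suc i) \<le> part (G \<xi>) i \<and> part (G \<xi>) i \<le> mn i"
   proof
    fix i show "mx (Suc i) \<le> part (G \<xi>) i \<and> part (G \<xi>) i \<le> mn i"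
     using u(2)[rule_format, of i] by (auto simp: G(2)[OF u(2)])
   qed
   have s: "sum_list \<xi> = part \<xi> 0 + (\<Sum>i<M. part \<xi> (Suc i))"
    using u by (intro sF \<xi>) auto
   have "(\<Sum>i<M. part \<xi> (Suc i)) + (\<Sum>i<M. part (G \<xi>) i) = (\<Sum>i<M. mx (Suc i) + mn i)"
    unfolding sum.distrib[symmetric]
   proof (intro sum.cong refl)
    fix i show "part \<xi> (Suc i) + part (G \<xi>) i = mx (Suc i) + mn i"
     using u(2)[rule_format, of i] by (simp add: G(2)[OF u(2)])
   qed
   moreover have "sum_list (G \<xi>) = (\<Sum>i<M. part (G \<xi>) i)" using b G(1)[OF u(2)] by (intro sG) auto
   ultimately have p0: "part \<xi> 0 = mx 0 + (n + sum_list (G \<xi>) - (sum_list \<mu> + sum_list \<kappa>))"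
    using tot s u(1) n by simp
   show "F (G \<xi>) = \<xi>"
   proof (rule part_inj[OF F(1)[OF b] \<xi>])
    fix i show "part (F (G \<xi>)) i = part \<xi> i"
     using u(2)[rule_format, of "i - 1"] p0 by (cases i) (simp_all add: F(2)[OF b] G(2)[OF u(2)])
   qed
  qed
 qed
 then show ?thesis by (simp add: bij_betw_same_card)
qed

section \<open>Semistandard tableaux\<close>

lemma cells_part: "cells \<nu> = {(i, j). j < part \<nu> i}"
 by (auto simp: cells_def part_def split: if_splits)

lemma cells_Sigma: "cells \<nu> = (SIGMA i:{..<length \<nu>}. {..<part \<nu> i})"
 by (auto simp: cells_def part_def split: if_splits)

lemma finite_cells [simp]: "finite (cells \<nu>)"
 by (simp add: cells_Sigma)

lemma card_cells: "card (cells \<nu>) = sum_list \<nu>"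
 by (simp add: cells_Sigma sum_list_part[OF order_refl])

lemma part_le_imp_cells: "(\<And>i. part \<kappa> i \<le> part \<nu> i) \<Longrightarrow> cells \<kappa> \<subseteq> cells \<nu>"
 by (auto simp: cells_part dest: less_le_trans)

lemma ssytD:
 assumes "T \<in> ssyt \<nu> \<alpha>"
 shows "c \<notin> cells \<nu> \<Longrightarrow> T c = 0"
  and "(i, Suc j) \<in> cells \<nu> \<Longrightarrow> T (i, j) \<le> T (i, Suc j)"
  and "(Suc i, j) \<in> cells \<nu> \<Longrightarrow> T (i, j) < T (Suc i, j)"
  and "card {c \<in> cells \<nu>. T c = v} = lookup \<alpha> v"
 using assms unfolding ssyt_def by blast+

lemma sum_over_tableau:
 fixes g :: "nat \<Rightarrow> nat"
 assumes "T \<in> ssyt \<nu> \<alpha>"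
 shows "(\<Sum>c\<in>cells \<nu>. g (T c)) = (\<Sum>v\<in>keys \<alpha>. lookup \<alpha> v * g v)"
proof -
 have card: "card {c \<in> cells \<nu>. T c = v} = lookup \<alpha> v" for v
  by (rule ssytD(4)[OF assms])
 have "T ` cells \<nu> \<subseteq> keys \<alpha>"
 proof safe
  fix i j assume "(i, j) \<in> cells \<nu>"
  then have "{c \<in> cells \<nu>. T c = T (i, j)} \<noteq> {}" by blast
  then have "card {c \<in> cells \<nu>. T c = T (i, j)} \<noteq> 0" using card_0_eq finite_cells by simp
  then show "T (i, j) \<in> keys \<alpha>" by (simp add: card in_keys_iff)
 qed
 then have "(\<Sum>c\<in>cells \<nu>. g (T c)) = (\<Sum>v\<in>keys \<alpha>. \<Sum>c | c \<in> cells \<nu> \<and> T c = v. g (T c))"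
  by (intro sum.group[symmetric]) simp_all
 also have "... = (\<Sum>v\<in>keys \<alpha>. lookup \<alpha> v * g v)"
  by (intro sum.cong refl) (simp add: card[symmetric])
 finally show ?thesis .
qed

lemma ssyt_values_in_keys:
 assumes "T \<in> ssyt \<nu> \<alpha>" "c \<in> cells \<nu>" shows "T c \<in> keys \<alpha>"
proof -
 have "{c' \<in> cells \<nu>. T c' = T c} \<noteq> {}" using assms by blast
 then have "card {c' \<in> cells \<nu>. T c' = T c} \<noteq> 0" using card_0_eq finite_cells by simp
 then show ?thesis using ssytD(4)[OF assms(1), of "T c"] by (simp add: in_keys_iff)
qed

lemma finite_ssyt [simp]: "finite (ssyt \<nu> \<alpha>)"
proof (rule finite_subset)
 show "ssyt \<nu> \<alpha> \<subseteq> {T. \<forall>c. (c \<in> cells \<nu> \<longrightarrow> T c \<in> keys \<alpha>) \<and> (c \<notin> cells \<nu> \<longrightarrow> T c = 0)}"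
  using ssyt_values_in_keys ssytD(1) by blast
 show "finite {T. \<forall>c. (c \<in> cells \<nu> \<longrightarrow> T c \<in> keys \<alpha>) \<and> (c \<notin> cells \<nu> \<longrightarrow> T c = (0::nat))}"
  by (rule finite_set_of_finite_funs) simp_all
qed

lemma kostka_degree: "kostka \<nu> \<alpha> \<noteq> 0 \<Longrightarrow> sum_list \<nu> = mdeg \<alpha>"
proof -
 assume "kostka \<nu> \<alpha> \<noteq> 0"
 then obtain T where "T \<in> ssyt \<nu> \<alpha>" unfolding kostka_def by fastforce
 from sum_over_tableau[OF this, of "\<lambda>_. 1"] show ?thesis
  by (simp add: card_cells mdeg_def)
qed

lemma down_closed_eq_lessThan:
 fixes S :: "nat set"
 assumes "finite S" "\<And>j. Suc j \<in> S \<Longrightarrow> j \<in> S"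
 shows "S = {..<card S}"
proof -
 have down: "i \<in> S" if "i \<le> j" "j \<in> S" for i j
  using that
 proof (induction j)
  case (Suc j)
  then show ?case using assms(2)[of j] by (cases "i = Suc j") (simp_all add: le_Suc_eq)
 qed simp
 show ?thesis
 proof (cases "S = {}")
  case False
  have "i \<in> S \<longleftrightarrow> i \<le> Max S" for i
   using Max_ge[OF assms(1), of i] Max_in[OF assms(1) False] down[of i "Max S"] by blast
  then have S: "S = {..Max S}" by auto
  then have "card S = Suc (Max S)" using card_atMost[of "Max S"] by (simp only:)
  with S show ?thesis by (simp only: lessThan_Suc_atMost)
 qed simp
qed

definition restrict_shape :: "nat \<Rightarrow> (nat \<times> nat \<Rightarrow> nat) \<Rightarrow> nat list \<Rightarrow> nat list" where
 "restrict_shape N T \<nu> = of_parts (\<lambda>i. card {j. j < part \<nu> i \<and> T (i, j) < N})"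

text \<open>The cells with the largest entry \<open>N\<close> form a horizontal strip; deleting them is a bijection.\<close>

lemma kostka_branching:
 assumes \<nu>: "is_partition \<nu>" and keys: "keys \<alpha> \<subseteq> {..<N}"
 shows "kostka \<nu> (\<alpha> + single N k)
    = (\<Sum>\<kappa> | is_partition \<kappa> \<and> horizontal_strip \<kappa> \<nu> \<and> sum_list \<kappa> + k = sum_list \<nu>. kostka \<kappa> \<alpha>)"
proof -
 let ?\<beta> = "\<alpha> + single N k"
 let ?I = "{\<kappa>. is_partition \<kappa> \<and> horizontal_strip \<kappa> \<nu> \<and> sum_list \<kappa> + k = sum_list \<nu>}"
 have finI: "finite ?I"
  by (rule finite_subset[OF _ finite_partitions_le[of "sum_list \<nu>"]]) auto
 have \<alpha>N: "lookup \<alpha> v = 0" if "N \<le> v" for v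
  using keys that by (meson in_keys_iff lessThan_iff linorder_not_less subsetD)
 have keys\<beta>: "keys ?\<beta> \<subseteq> {..N}"
 proof
  fix v assume "v \<in> keys ?\<beta>"
  then have "lookup \<alpha> v \<noteq> 0 \<or> v = N"
   by (auto simp: in_keys_iff lookup_add lookup_single when_def)
  with \<alpha>N[of v] show "v \<in> {..N}" by (cases "N \<le> v") auto
 qed
 define f where "f T = (restrict_shape N T \<nu>, \<lambda>c. if c \<in> cells \<nu> \<and> T c < N then T c else 0)" for T :: "nat \<times> nat \<Rightarrow> nat"
 define g where "g = (\<lambda>(\<kappa>, T'). \<lambda>c. if c \<in> cells \<kappa> then T' c else if c \<in> cells \<nu> then N else (0::nat))"
 have anti: "part \<nu> (Suc i) \<le> part \<nu> i" for i using part_antimono[OF \<nu>, of i "Suc i"] by simp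
 have shape: "is_partition (restrict_shape N T \<nu>)"
   "{j. j < part \<nu> i \<and> T (i, j) < N} = {..<part (restrict_shape N T \<nu>) i}"
   "horizontal_strip (restrict_shape N T \<nu>) \<nu>"
   if "T \<in> ssyt \<nu> ?\<beta>" for T i
 proof -
  let ?S = "\<lambda>i. {j. j < part \<nu> i \<and> T (i, j) < N}"
  have row: "T (i, j) \<le> T (i, Suc j)" if "Suc j < part \<nu> i" for i j
   using ssytD(2)[OF \<open>T \<in> ssyt \<nu> ?\<beta>\<close>, of i j] that by (simp add: cells_part)
  have col: "T (i, j) < T (Suc i, j)" if "j < part \<nu> (Suc i)" for i j
   using ssytD(3)[OF \<open>T \<in> ssyt \<nu> ?\<beta>\<close>, of i j] that by (simp add: cells_part)
  have leN: "T (i, j) \<le> N" if "j < part \<nu> i" for i j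
   using ssyt_values_in_keys[OF \<open>T \<in> ssyt \<nu> ?\<beta>\<close>, of "(i, j)"] that keys\<beta> by (auto simp: cells_part)
  have S: "?S i = {..<card (?S i)}" for i
   by (rule down_closed_eq_lessThan) (auto dest: row)
  have sub1: "?S i \<subseteq> {..<part \<nu> i}" for i by auto
  have le1: "card (?S i) \<le> part \<nu> i" for i
   using card_mono[OF _ sub1[of i]] by simp
  have sub2: "{..<part \<nu> (Suc i)} \<subseteq> ?S i" for i
  proof
   fix j assume "j \<in> {..<part \<nu> (Suc i)}"
   then have "j < part \<nu> (Suc i)" by simp
   with col[OF this] leN[of j "Suc i"] anti[of i] show "j \<in> ?S i" by auto
  qed
  have le2: "part \<nu> (Suc i) \<le> card (?S i)" for i
   using card_mono[OF _ sub2[of i]] by simp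
  have step: "card (?S (Suc i)) \<le> card (?S i)" for i
   using le1[of "Suc i"] le2[of i] by linarith
  have 1: "card (?S j) \<le> card (?S i)" if "i \<le> j" for i j
   using lift_Suc_antimono_le[of "\<lambda>i. card (?S i)", OF step that] .
  have 2: "card (?S i) = 0" if "length \<nu> \<le> i" for i
   using le1[of i] part_beyond[OF that] by simp
  note r = of_parts[of "\<lambda>i. card (?S i)" "length \<nu>", OF 1 2, folded restrict_shape_def]
  show "is_partition (restrict_shape N T \<nu>)" using r(1) by blast
  have p: "part (restrict_shape N T \<nu>) i = card (?S i)" for i using r(2) by blast
  show "?S i = {..<part (restrict_shape N T \<nu>) i}" unfolding p by (rule S)
  show "horizontal_strip (restrict_shape N T \<nu>) \<nu>"
   unfolding horizontal_strip_def p using le1 le2 by auto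
 qed
 have cells_shape: "cells (restrict_shape N T \<nu>) = {c \<in> cells \<nu>. T c < N}" if "T \<in> ssyt \<nu> ?\<beta>" for T
 proof -
  have "(i, j) \<in> cells (restrict_shape N T \<nu>) \<longleftrightarrow> (i, j) \<in> {c \<in> cells \<nu>. T c < N}" for i j
   using shape(2)[OF that, of i] by (auto simp: cells_part)
  then show ?thesis by auto
 qed
 have "bij_betw f (ssyt \<nu> ?\<beta>) (SIGMA \<kappa>:?I. ssyt \<kappa> \<alpha>)"
 proof (rule bij_betw_byWitness[where f' = g])
  show "\<forall>T\<in>ssyt \<nu> ?\<beta>. g (f T) = T"
  proof
   fix T assume T: "T \<in> ssyt \<nu> ?\<beta>"
   have "g (f T) c = T c" for c
   proof -
    have "T c \<le> N" if "c \<in> cells \<nu>" using ssyt_values_in_keys[OF T that] keys\<beta> by auto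
    moreover have "T c = 0" if "c \<notin> cells \<nu>" using ssytD(1)[OF T that] .
    ultimately show ?thesis unfolding f_def g_def by (cases "c \<in> cells \<nu>"; cases "T c < N") (simp_all add: cells_shape[OF T])
   qed
   then show "g (f T) = T" by blast
  qed
  show "f ` ssyt \<nu> ?\<beta> \<subseteq> (SIGMA \<kappa>:?I. ssyt \<kappa> \<alpha>)"
  proof
   fix z assume "z \<in> f ` ssyt \<nu> ?\<beta>"
   then obtain T where T: "T \<in> ssyt \<nu> ?\<beta>" and z: "z = f T" by blast
   let ?\<kappa> = "restrict_shape N T \<nu>"
   let ?T = "\<lambda>c. if c \<in> cells \<nu> \<and> T c < N then T c else 0"
   have card: "card {c \<in> cells \<nu>. T c = v} = lookup ?\<beta> v" for v
    by (rule ssytD(4)[OF T])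
   have card': "card {c \<in> cells ?\<kappa>. ?T c = v} = lookup \<alpha> v" for v
   proof (cases "v < N")
    case True
    then have "{c \<in> cells ?\<kappa>. ?T c = v} = {c \<in> cells \<nu>. T c = v}"
     by (auto simp: cells_shape[OF T])
    then show ?thesis using card[of v] True by (simp add: lookup_add lookup_single)
   next
    case False
    then have "{c \<in> cells ?\<kappa>. ?T c = v} = {}"
     by (auto simp: cells_shape[OF T])
    then show ?thesis using \<alpha>N[of v] False by (simp del: Collect_empty_eq)
   qed
   have tab: "?T \<in> ssyt ?\<kappa> \<alpha>"
    unfolding ssyt_def mem_Collect_eq
   proof (intro conjI allI impI card')
    fix c assume "c \<notin> cells ?\<kappa>"
    then show "?T c = 0" by (auto simp: cells_shape[OF T])
   next
    fix i j assume "(i, Suc j) \<in> cells ?\<kappa>"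
    then have a: "(i, Suc j) \<in> cells \<nu>" "T (i, Suc j) < N" by (auto simp: cells_shape[OF T])
    then have b: "T (i, j) \<le> T (i, Suc j)" using ssytD(2)[OF T] by blast
    have "(i, j) \<in> cells \<nu>" using a by (auto simp: cells_part)
    with a b show "?T (i, j) \<le> ?T (i, Suc j)" by auto
   next
    fix i j assume "(Suc i, j) \<in> cells ?\<kappa>"
    then have a: "(Suc i, j) \<in> cells \<nu>" "T (Suc i, j) < N" by (auto simp: cells_shape[OF T])
    then have b: "T (i, j) < T (Suc i, j)" using ssytD(3)[OF T] by blast
    have "(i, j) \<in> cells \<nu>" using a anti[of i] by (auto simp: cells_part)
    with a b show "?T (i, j) < ?T (Suc i, j)" by auto
   qed
   have "sum_list \<nu> = card (cells ?\<kappa>) + card {c \<in> cells \<nu>. T c = N}"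
   proof -
    have "cells \<nu> = cells ?\<kappa> \<union> {c \<in> cells \<nu>. T c = N}"
    proof -
     have "c \<in> cells \<nu> \<longleftrightarrow> c \<in> {c \<in> cells \<nu>. T c < N} \<union> {c \<in> cells \<nu>. T c = N}" for c
      using ssyt_values_in_keys[OF T, of c] keys\<beta> by (cases "c \<in> cells \<nu>") auto
     then show ?thesis unfolding cells_shape[OF T] by blast
    qed
    then have "card (cells \<nu>) = card (cells ?\<kappa> \<union> {c \<in> cells \<nu>. T c = N})" by simp
    also have "... = card (cells ?\<kappa>) + card {c \<in> cells \<nu>. T c = N}"
     by (rule card_Un_disjoint) (auto simp: cells_shape[OF T])
    finally show ?thesis by (simp add: card_cells)
   qed
   then have "sum_list ?\<kappa> + k = sum_list \<nu>"
    using card[of N] \<alpha>N[of N] by (simp add: card_cells lookup_add lookup_single)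
   then show "z \<in> (SIGMA \<kappa>:?I. ssyt \<kappa> \<alpha>)"
    unfolding z f_def using tab shape[OF T] by auto
  qed
  have inv: "g (\<kappa>, T') \<in> ssyt \<nu> ?\<beta>" "{c \<in> cells \<nu>. g (\<kappa>, T') c < N} = cells \<kappa>"
   if \<kappa>: "is_partition \<kappa>" "horizontal_strip \<kappa> \<nu>" "sum_list \<kappa> + k = sum_list \<nu>" and T': "T' \<in> ssyt \<kappa> \<alpha>" for \<kappa> T'
  proof -
   have sub: "cells \<kappa> \<subseteq> cells \<nu>"
    using \<kappa>(2) by (intro part_le_imp_cells) (auto simp: horizontal_strip_def)
   have lt: "T' c < N" if "c \<in> cells \<kappa>" for c
    using ssyt_values_in_keys[OF T' that] keys by auto
   show c1: "{c \<in> cells \<nu>. g (\<kappa>, T') c < N} = cells \<kappa>"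
    using sub lt by (auto simp: g_def)
   have up: "(i, j) \<in> cells \<kappa>" if "(Suc i, j) \<in> cells \<nu>" for i j
    using that \<kappa>(2) unfolding horizontal_strip_def cells_part by (auto dest: less_le_trans)
   show "g (\<kappa>, T') \<in> ssyt \<nu> ?\<beta>"
    unfolding ssyt_def mem_Collect_eq
   proof (intro conjI allI impI)
    fix c assume "c \<notin> cells \<nu>"
    then show "g (\<kappa>, T') c = 0" using sub by (auto simp: g_def)
   next
    fix i j assume a: "(i, Suc j) \<in> cells \<nu>"
    then have "(i, j) \<in> cells \<nu>" by (auto simp: cells_part)
    moreover have "(i, j) \<in> cells \<kappa>" if "(i, Suc j) \<in> cells \<kappa>" using that by (auto simp: cells_part)
    moreover have "T' (i, j) \<le> T' (i, Suc j)" if "(i, Suc j) \<in> cells \<kappa>" using ssytD(2)[OF T' that] .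
    ultimately show "g (\<kappa>, T') (i, j) \<le> g (\<kappa>, T') (i, Suc j)"
     using a lt[of "(i, j)"] by (auto simp: g_def)
   next
    fix i j assume a: "(Suc i, j) \<in> cells \<nu>"
    moreover have "T' (i, j) < T' (Suc i, j)" if "(Suc i, j) \<in> cells \<kappa>" using ssytD(3)[OF T' that] .
    ultimately show "g (\<kappa>, T') (i, j) < g (\<kappa>, T') (Suc i, j)"
     using up[OF a] lt[of "(i, j)"] by (auto simp: g_def)
   next
    fix v
    have card: "card {c \<in> cells \<kappa>. T' c = v} = lookup \<alpha> v"
     by (rule ssytD(4)[OF T'])
    show "card {c \<in> cells \<nu>. g (\<kappa>, T') c = v} = lookup ?\<beta> v"
    proof (cases "v = N")
     case False
     then have "{c \<in> cells \<nu>. g (\<kappa>, T') c = v} = {c \<in> cells \<kappa>. T' c = v}"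
      using sub by (auto simp: g_def)
     then show ?thesis using card False by (simp add: lookup_add lookup_single)
    next
     case True
     have "c \<in> cells \<nu> \<and> g (\<kappa>, T') c = v \<longleftrightarrow> c \<in> cells \<nu> - cells \<kappa>" for c
      using sub lt[of c] True by (auto simp: g_def)
     then have "{c \<in> cells \<nu>. g (\<kappa>, T') c = v} = cells \<nu> - cells \<kappa>" by blast
     moreover have "card (cells \<nu> - cells \<kappa>) = k"
      using sub \<kappa>(3) by (simp add: card_Diff_subset card_cells)
     ultimately show ?thesis using True \<alpha>N[of N] by (simp add: lookup_add lookup_single)
    qed
   qed
  qed
  show "g ` (SIGMA \<kappa>:?I. ssyt \<kappa> \<alpha>) \<subseteq> ssyt \<nu> ?\<beta>"
   using inv(1) by auto
  show "\<forall>z\<in>(SIGMA \<kappa>:?I. ssyt \<kappa> \<alpha>). f (g z) = z"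
  proof safe
   fix \<kappa> T' assume \<kappa>: "is_partition \<kappa>" "horizontal_strip \<kappa> \<nu>" "sum_list \<kappa> + k = sum_list \<nu>" and T': "T' \<in> ssyt \<kappa> \<alpha>"
   note i = inv[OF \<kappa> T']
   have "cells (restrict_shape N (g (\<kappa>, T')) \<nu>) = cells \<kappa>"
    using cells_shape[OF i(1)] i(2) by simp
   then have "j < part (restrict_shape N (g (\<kappa>, T')) \<nu>) i \<longleftrightarrow> j < part \<kappa> i" for i j
    unfolding cells_part by blast
   then have "part (restrict_shape N (g (\<kappa>, T')) \<nu>) i = part \<kappa> i" for i
    by (metis less_irrefl linorder_neqE_nat)
   then have 1: "restrict_shape N (g (\<kappa>, T')) \<nu> = \<kappa>"
    by (intro part_inj shape(1)[OF i(1)] \<kappa>)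
   have "(if c \<in> cells \<nu> \<and> g (\<kappa>, T') c < N then g (\<kappa>, T') c else 0) = T' c" for c
   proof (cases "c \<in> cells \<kappa>")
    case True
    then have "c \<in> cells \<nu> \<and> g (\<kappa>, T') c < N" using i(2) by blast
    then show ?thesis using True by (simp add: g_def)
   next
    case False
    then have "T' c = 0" by (rule ssytD(1)[OF T'])
    then show ?thesis using False i(2) by auto
   qed
   with 1 show "f (g (\<kappa>, T')) = (\<kappa>, T')" unfolding f_def by auto
  qed
 qed
 then have "kostka \<nu> ?\<beta> = card (SIGMA \<kappa>:?I. ssyt \<kappa> \<alpha>)"
  unfolding kostka_def by (rule bij_betw_same_card)
 also have "... = (\<Sum>\<kappa>\<in>?I. kostka \<kappa> \<alpha>)"
  unfolding kostka_def using finI by (subst card_SigmaI) auto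
 finally show ?thesis .
qed

lemma kostka_zero:
 assumes "is_partition \<nu>"
 shows "kostka \<nu> 0 = (if \<nu> = [] then 1 else 0)"
proof (cases "\<nu> = []")
 case True
 have "ssyt [] 0 = {\<lambda>_. 0}"
  by (auto simp: ssyt_def cells_def)
 then show ?thesis using True by (simp add: kostka_def)
next
 case False
 have "kostka \<nu> 0 = 0"
 proof (rule ccontr)
  assume "kostka \<nu> 0 \<noteq> 0"
  then have "sum_list \<nu> = 0" by (simp add: kostka_degree mdeg_def)
  with length_le_sum_list[OF assms] False show False by simp
 qed
 with False show ?thesis by simp
qed

section \<open>Products of series and the Pieri rule\<close>

lemma mdeg_eq_sum: "finite A \<Longrightarrow> keys \<alpha> \<subseteq> A \<Longrightarrow> mdeg \<alpha> = (\<Sum>i\<in>A. lookup \<alpha> i)"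
 unfolding mdeg_def by (rule sum.mono_neutral_left) (auto simp: in_keys_iff)

lemma mdeg_add [simp]: "mdeg (\<alpha> + \<beta>) = mdeg \<alpha> + mdeg \<beta>"
proof -
 let ?A = "keys \<alpha> \<union> keys \<beta>"
 have "keys (\<alpha> + \<beta>) \<subseteq> ?A" by (rule keys_add)
 then show ?thesis
  by (simp add: mdeg_eq_sum[of ?A] lookup_add sum.distrib)
qed

lemma mdeg_single [simp]: "mdeg (single i k) = k"
 by (simp add: mdeg_def)

lemma mdeg_zero [simp]: "mdeg 0 = 0"
 by (simp add: mdeg_def)

lemma mdeg_eq_0_iff [simp]: "mdeg \<alpha> = 0 \<longleftrightarrow> \<alpha> = 0"
 by (auto simp: mdeg_def in_keys_iff intro: poly_mapping_eqI)

definition splits :: "monom \<Rightarrow> (monom \<times> monom) set" where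
 "splits \<alpha> = {(\<beta>, \<gamma>). \<beta> + \<gamma> = \<alpha>}"

lemma finite_splits [simp]: "finite (splits \<alpha>)"
 unfolding splits_def by (rule finite_monom_splits)

lemma splits_zero: "splits 0 = {(0, 0)}"
proof -
 have "\<beta> = 0 \<and> \<gamma> = 0" if "\<beta> + \<gamma> = (0 :: monom)" for \<beta> \<gamma>
 proof -
  have "mdeg \<beta> + mdeg \<gamma> = 0" using arg_cong[OF that, of mdeg] by simp
  then show ?thesis by simp
 qed
 then have "(\<beta>, \<gamma>) \<in> splits 0 \<longleftrightarrow> (\<beta>, \<gamma>) \<in> {(0, 0)}" for \<beta> \<gamma>
  unfolding splits_def mem_Collect_eq case_prod_conv by (metis add_0 prod.inject singleton_iff)
 then show ?thesis by (intro subset_antisym subrelI) simp_all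
qed

lemma mcoeff_times: "mcoeff (f * g) \<alpha> = (\<Sum>p\<in>splits \<alpha>. mcoeff f (fst p) * mcoeff g (snd p))"
 by (simp add: times_mps.rep_eq splits_def case_prod_unfold)

lemma sum_splits_add_single:
 assumes "lookup \<alpha> N = 0"
 shows "(\<Sum>p\<in>splits (\<alpha> + single N j). F (fst p) (snd p))
    = (\<Sum>i\<le>j. \<Sum>q\<in>splits \<alpha>. F (fst q + single N (j - i)) (snd q + single N i))"
proof -
 have "(\<Sum>i\<le>j. \<Sum>q\<in>splits \<alpha>. F (fst q + single N (j - i)) (snd q + single N i))
   = (\<Sum>z\<in>{..j} \<times> splits \<alpha>. F (fst (snd z) + single N (j - fst z)) (snd (snd z) + single N (fst z)))"
  by (subst sum.cartesian_product) (simp add: case_prod_unfold)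
 also have "... = (\<Sum>p\<in>splits (\<alpha> + single N j). F (fst p) (snd p))"
 proof (rule sum.reindex_bij_witness[where
    j = "\<lambda>z. (fst (snd z) + single N (j - fst z), snd (snd z) + single N (fst z))" and
    i = "\<lambda>p. (lookup (snd p) N, fst p - single N (lookup (fst p) N),
         snd p - single N (lookup (snd p) N))"], goal_cases)
  case (1 z)
  then have "fst (snd z) + snd (snd z) = \<alpha>" "fst z \<le> j" by (auto simp: splits_def)
  then have "lookup (fst (snd z)) N = 0 \<and> lookup (snd (snd z)) N = 0"
   using assms by (metis add_is_0 lookup_add)
  then show ?case by (cases z) (simp add: lookup_add)
 next
  case (2 z)
  then have "fst (snd z) + snd (snd z) = \<alpha>" "fst z \<le> j" by (auto simp: splits_def)
  then show ?case
   by (auto simp: splits_def intro!: poly_mapping_eqI simp: lookup_add lookup_single when_def)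
 next
  case (3 p)
  then have p: "fst p + snd p = \<alpha> + single N j" by (auto simp: splits_def)
  have l: "lookup (fst p) i + lookup (snd p) i
    = lookup \<alpha> i + (if i = N then j else 0)" for i
   using arg_cong[OF p, of "\<lambda>m. lookup m i"]
   by (auto simp: lookup_add lookup_single when_def)
  have "j - lookup (snd p) N = lookup (fst p) N"
   using l[of N] assms by simp
  then show ?case
   by (intro prod_eqI poly_mapping_eqI) (auto simp: lookup_add lookup_minus lookup_single when_def)
 next
  case (4 p)
  then have p: "fst p + snd p = \<alpha> + single N j" by (auto simp: splits_def)
  have l: "lookup (fst p) i + lookup (snd p) i
    = lookup \<alpha> i + (if i = N then j else 0)" for i
   using arg_cong[OF p, of "\<lambda>m. lookup m i"]
   by (auto simp: lookup_add lookup_single when_def)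
  have "fst p - single N (lookup (fst p) N) +
   (snd p - single N (lookup (snd p) N)) = \<alpha>"
  proof (rule poly_mapping_eqI)
   fix i show "lookup (fst p - single N (lookup (fst p) N) +
    (snd p - single N (lookup (snd p) N))) i = lookup \<alpha> i"
    using l[of i] assms by (auto simp: lookup_add lookup_minus lookup_single when_def)
  qed
  then show ?case using l[of N] assms by (auto simp: splits_def)
 qed auto
 finally show ?thesis by simp
qed

lemma horizontal_strip_Nil: "is_partition \<mu> \<Longrightarrow> horizontal_strip \<mu> [] \<longleftrightarrow> \<mu> = []"
 using horizontal_strip_length(1)[of \<mu> "[]"] by (auto simp: is_partition_def horizontal_strip_def)

text \<open>Induction on the number of variables: splitting off the last variable on both sides by
 \<open>kostka_branching\<close> reduces the claim to exchanging the order of adding and removing horizontal strips, which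
 is \<open>toggle_bij\<close>.\<close>

lemma pieri_aux:
 assumes "is_partition \<mu>" "keys \<alpha> \<subseteq> {..<N}"
 shows "(\<Sum>\<xi> | is_partition \<xi> \<and> horizontal_strip \<mu> \<xi> \<and> sum_list \<xi> = n. kostka \<xi> \<alpha>)
    = (\<Sum>p\<in>splits \<alpha>. if sum_list \<mu> + mdeg (fst p) = n then kostka \<mu> (snd p) else 0)"
 using assms
proof (induction N arbitrary: \<mu> \<alpha> n)
 case 0
 then have \<alpha>: "\<alpha> = 0" by (auto intro: poly_mapping_eqI simp: in_keys_iff)
 let ?X = "{\<xi>. is_partition \<xi> \<and> horizontal_strip \<mu> \<xi> \<and> sum_list \<xi> = n}"
 have fin: "finite ?X" by (rule finite_subset[OF _ finite_partitions[of n]]) auto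
 have "(\<Sum>\<xi>\<in>?X. kostka \<xi> \<alpha>) = (\<Sum>\<xi>\<in>?X. if \<xi> = [] then 1 else 0)"
  by (intro sum.cong refl) (auto simp: \<alpha> kostka_zero)
 also have "... = (if [] \<in> ?X then 1 else 0)" using fin by (simp add: sum.delta)
 also have "... = (if \<mu> = [] \<and> n = 0 then 1 else 0)"
  using horizontal_strip_Nil[OF 0(1)] by (auto simp: is_partition_def)
 finally have "(\<Sum>\<xi>\<in>?X. kostka \<xi> \<alpha>) = (if \<mu> = [] \<and> n = 0 then 1 else 0)" .
 moreover have "kostka \<mu> 0 = (if \<mu> = [] then 1 else 0)" by (rule kostka_zero[OF 0(1)])
 moreover have "sum_list \<mu> = n \<longleftrightarrow> n = 0" if "\<mu> = []" using that by auto
 ultimately show ?case by (simp only: \<alpha> splits_zero) simp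
next
 case (Suc N)
 define j where "j = lookup \<alpha> N"
 define \<alpha>' where "\<alpha>' = \<alpha> - single N j"
 have \<alpha>: "\<alpha> = \<alpha>' + single N j"
  by (rule poly_mapping_eqI) (auto simp: \<alpha>'_def j_def lookup_add lookup_minus lookup_single when_def)
 have l0: "lookup \<alpha>' N = 0" by (simp add: \<alpha>'_def j_def lookup_minus)
 have keys: "keys \<alpha>' \<subseteq> {..<N}"
 proof
  fix i assume "i \<in> keys \<alpha>'"
  then have "i \<noteq> N" "i \<in> keys \<alpha>"
   using l0 by (auto simp: \<alpha>'_def in_keys_iff lookup_minus)
  with Suc.prems(2) show "i \<in> {..<N}" by auto
 qed
 let ?X = "{\<xi>. is_partition \<xi> \<and> horizontal_strip \<mu> \<xi> \<and> sum_list \<xi> = n}"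
 let ?K = "{\<kappa>. is_partition \<kappa> \<and> sum_list \<kappa> + j = n}"
 let ?D = "{\<delta>. is_partition \<delta> \<and> horizontal_strip \<delta> \<mu> \<and> sum_list \<mu> \<le> j + sum_list \<delta>}"
 have finX: "finite ?X" by (rule finite_subset[OF _ finite_partitions[of n]]) auto
 have finK: "finite ?K" by (rule finite_subset[OF _ finite_partitions_le[of n]]) auto
 have finD: "finite ?D"
  by (rule finite_subset[OF _ finite_partitions_le[of "sum_list \<mu>"]])
    (use horizontal_strip_length(3) Suc.prems(1) in auto)
 have "(\<Sum>\<xi>\<in>?X. kostka \<xi> \<alpha>) = (\<Sum>\<xi>\<in>?X. \<Sum>\<kappa>\<in>{\<kappa>\<in>?K. horizontal_strip \<kappa> \<xi>}. kostka \<kappa> \<alpha>')"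
 proof (intro sum.cong refl)
  fix \<xi> assume "\<xi> \<in> ?X"
  then show "kostka \<xi> \<alpha> = (\<Sum>\<kappa>\<in>{\<kappa>\<in>?K. horizontal_strip \<kappa> \<xi>}. kostka \<kappa> \<alpha>')"
   unfolding \<alpha> by (subst kostka_branching[OF _ keys]) (auto intro!: sum.cong)
 qed
 also have "... = (\<Sum>\<kappa>\<in>?K. \<Sum>\<xi>\<in>{\<xi>\<in>?X. horizontal_strip \<kappa> \<xi>}. kostka \<kappa> \<alpha>')"
  by (rule sum.swap_restrict[OF finX finK])
 also have "... = (\<Sum>\<kappa>\<in>?K. \<Sum>\<delta>\<in>{\<delta>\<in>?D. horizontal_strip \<delta> \<kappa>}. kostka \<kappa> \<alpha>')"
 proof (rule sum.cong[OF refl])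
  fix \<kappa> assume k: "\<kappa> \<in> ?K"
  have "{\<xi>\<in>?X. horizontal_strip \<kappa> \<xi>} = {\<xi>. is_partition \<xi> \<and> horizontal_strip \<mu> \<xi> \<and> horizontal_strip \<kappa> \<xi> \<and> sum_list \<xi> = n}"
   by auto
  moreover have "{\<delta>\<in>?D. horizontal_strip \<delta> \<kappa>} = {\<delta>. is_partition \<delta> \<and> horizontal_strip \<delta> \<mu> \<and> horizontal_strip \<delta> \<kappa> \<and> sum_list \<mu> + sum_list \<kappa> \<le> n + sum_list \<delta>}"
   using k by auto
  ultimately show "(\<Sum>\<xi>\<in>{\<xi>\<in>?X. horizontal_strip \<kappa> \<xi>}. kostka \<kappa> \<alpha>') = (\<Sum>\<delta>\<in>{\<delta>\<in>?D. horizontal_strip \<delta> \<kappa>}. kostka \<kappa> \<alpha>')"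
   using toggle_bij[OF Suc.prems(1), of \<kappa> n] k by simp
 qed
 also have "... = (\<Sum>\<delta>\<in>?D. \<Sum>\<kappa>\<in>{\<kappa>\<in>?K. horizontal_strip \<delta> \<kappa>}. kostka \<kappa> \<alpha>')"
  by (rule sum.swap_restrict[OF finK finD])
 also have "... = (\<Sum>\<delta>\<in>?D. \<Sum>q\<in>splits \<alpha>'. if sum_list \<delta> + mdeg (fst q) + j = n then kostka \<delta> (snd q) else 0)"
 proof (rule sum.cong[OF refl])
  fix \<delta> assume d: "\<delta> \<in> ?D"
  show "(\<Sum>\<kappa>\<in>{\<kappa>\<in>?K. horizontal_strip \<delta> \<kappa>}. kostka \<kappa> \<alpha>') =
    (\<Sum>q\<in>splits \<alpha>'. if sum_list \<delta> + mdeg (fst q) + j = n then kostka \<delta> (snd q) else 0)"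
  proof (cases "j \<le> n")
   case True
   have "{\<kappa>\<in>?K. horizontal_strip \<delta> \<kappa>} = {\<kappa>. is_partition \<kappa> \<and> horizontal_strip \<delta> \<kappa> \<and> sum_list \<kappa> = n - j}"
    using True by auto
   then have "(\<Sum>\<kappa>\<in>{\<kappa>\<in>?K. horizontal_strip \<delta> \<kappa>}. kostka \<kappa> \<alpha>') =
     (\<Sum>q\<in>splits \<alpha>'. if sum_list \<delta> + mdeg (fst q) = n - j then kostka \<delta> (snd q) else 0)"
    using Suc.IH[of \<delta> \<alpha>' "n - j"] keys d by simp
   also have "... = (\<Sum>q\<in>splits \<alpha>'. if sum_list \<delta> + mdeg (fst q) + j = n then kostka \<delta> (snd q) else 0)"
    using True by (intro sum.cong refl if_cong) auto
   finally show ?thesis .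
  next
   case False
   then have "{\<kappa>\<in>?K. horizontal_strip \<delta> \<kappa>} = {}" by auto
   then show ?thesis using False by (simp del: Collect_empty_eq)
  qed
 qed
 also have "... = (\<Sum>q\<in>splits \<alpha>'. \<Sum>\<delta>\<in>?D. if sum_list \<delta> + mdeg (fst q) + j = n then kostka \<delta> (snd q) else 0)"
  by (rule sum.swap)
 also have "... = (\<Sum>q\<in>splits \<alpha>'. \<Sum>i\<le>j. \<Sum>\<delta>\<in>{\<delta>\<in>?D. sum_list \<delta> + i = sum_list \<mu>}. if sum_list \<mu> + mdeg (fst q) + (j - i) = n then kostka \<delta> (snd q) else 0)"
 proof (rule sum.cong[OF refl])
  fix q
  have "(\<Sum>i\<le>j. \<Sum>\<delta>\<in>{\<delta>\<in>?D. sum_list \<delta> + i = sum_list \<mu>}. if sum_list \<mu> + mdeg (fst q) + (j - i) = n then kostka \<delta> (snd q) else 0)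
    = (\<Sum>i\<le>j. \<Sum>\<delta>\<in>{\<delta>\<in>?D. sum_list \<mu> - sum_list \<delta> = i}. if sum_list \<delta> + mdeg (fst q) + j = n then kostka \<delta> (snd q) else 0)"
  proof (intro sum.cong refl)
   fix i assume "i \<in> {..j}"
   show "{\<delta> \<in> ?D. sum_list \<delta> + i = sum_list \<mu>} = {\<delta> \<in> ?D. sum_list \<mu> - sum_list \<delta> = i}"
    using horizontal_strip_length(3)[OF _ Suc.prems(1)] by fastforce
  next
   fix i \<delta> assume "i \<in> {..j}" "\<delta> \<in> {\<delta> \<in> ?D. sum_list \<mu> - sum_list \<delta> = i}"
   then have "sum_list \<delta> + i = sum_list \<mu>" "i \<le> j"
    using horizontal_strip_length(3)[OF _ Suc.prems(1), of \<delta>] by auto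
   then have "(sum_list \<mu> + mdeg (fst q) + (j - i) = n) = (sum_list \<delta> + mdeg (fst q) + j = n)" by arith
   then show "(if sum_list \<mu> + mdeg (fst q) + (j - i) = n then kostka \<delta> (snd q) else 0)
     = (if sum_list \<delta> + mdeg (fst q) + j = n then kostka \<delta> (snd q) else 0)" by simp
  qed
  also have "... = (\<Sum>\<delta>\<in>?D. if sum_list \<delta> + mdeg (fst q) + j = n then kostka \<delta> (snd q) else 0)"
   by (rule sum.group[OF finD]) auto
  finally show "(\<Sum>\<delta>\<in>?D. if sum_list \<delta> + mdeg (fst q) + j = n then kostka \<delta> (snd q) else 0) =
    (\<Sum>i\<le>j. \<Sum>\<delta>\<in>{\<delta>\<in>?D. sum_list \<delta> + i = sum_list \<mu>}. if sum_list \<mu> + mdeg (fst q) + (j - i) = n then kostka \<delta> (snd q) else 0)" ..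
 qed
 also have "... = (\<Sum>q\<in>splits \<alpha>'. \<Sum>i\<le>j. if sum_list \<mu> + mdeg (fst q + single N (j - i)) = n then kostka \<mu> (snd q + single N i) else 0)"
 proof (intro sum.cong refl)
  fix q i assume q: "q \<in> splits \<alpha>'" and i: "i \<in> {..j}"
  have k: "keys (snd q) \<subseteq> {..<N}"
  proof
   fix v assume "v \<in> keys (snd q)"
   moreover have "\<alpha>' = fst q + snd q" using q by (auto simp: splits_def)
   ultimately have "v \<in> keys \<alpha>'" by (simp add: in_keys_iff lookup_add)
   with keys show "v \<in> {..<N}" by blast
  qed
  have "{\<delta>\<in>?D. sum_list \<delta> + i = sum_list \<mu>} = {\<kappa>. is_partition \<kappa> \<and> horizontal_strip \<kappa> \<mu> \<and> sum_list \<kappa> + i = sum_list \<mu>}"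
   using i by auto
  then show "(\<Sum>\<delta>\<in>{\<delta>\<in>?D. sum_list \<delta> + i = sum_list \<mu>}. if sum_list \<mu> + mdeg (fst q) + (j - i) = n then kostka \<delta> (snd q) else 0)
   = (if sum_list \<mu> + mdeg (fst q + single N (j - i)) = n then kostka \<mu> (snd q + single N i) else 0)"
   by (simp add: kostka_branching[OF Suc.prems(1) k] add.assoc)
 qed
 also have "... = (\<Sum>p\<in>splits \<alpha>. if sum_list \<mu> + mdeg (fst p) = n then kostka \<mu> (snd p) else 0)"
  unfolding \<alpha> sum_splits_add_single[OF l0, where F = "\<lambda>a b. if sum_list \<mu> + mdeg a = n then kostka \<mu> b else 0"]
  by (rule sum.swap)
 finally show ?case .
qed

lemma pieri:
 assumes "is_partition \<mu>"
 shows "(\<Sum>\<xi> | is_partition \<xi> \<and> horizontal_strip \<mu> \<xi> \<and> sum_list \<xi> = sum_list \<mu> + k. kostka \<xi> \<alpha>)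
    = (\<Sum>p\<in>splits \<alpha>. if mdeg (fst p) = k then kostka \<mu> (snd p) else 0)"
proof -
 obtain N where "keys \<alpha> \<subseteq> {..<N}"
  using finite_nat_iff_bounded[of "keys \<alpha>"] by auto
 from pieri_aux[OF assms this] show ?thesis by simp
qed

section \<open>Kostka numbers: triangularity and symmetry\<close>

text \<open>A statistic that strictly decreases along the dominance order. It serves as a linear refinement of that
 order, both for triangularity and as an induction measure.\<close>

definition row_weight :: "nat list \<Rightarrow> nat" where
 "row_weight \<nu> = (\<Sum>c\<in>cells \<nu>. fst c)"

definition part_monom :: "nat list \<Rightarrow> monom" where
 "part_monom \<nu> = Abs_poly_mapping (part \<nu>)"

lemma lookup_part_monom [simp]: "lookup (part_monom \<nu>) i = part \<nu> i"
proof -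
 have "finite {i. part \<nu> i \<noteq> 0}"
  by (rule finite_subset[of _ "{..<length \<nu>}"]) (auto simp: part_def split: if_splits)
 then show ?thesis by (simp add: part_monom_def)
qed

lemma keys_part_monom: "keys (part_monom \<nu>) \<subseteq> {..<length \<nu>}"
 by (auto simp: in_keys_iff part_def split: if_splits)

lemma mdeg_part_monom [simp]: "mdeg (part_monom \<nu>) = sum_list \<nu>"
 using mdeg_eq_sum[OF _ keys_part_monom] by (simp add: sum_list_part[OF order_refl])

lemma row_weight_eq_sum: "length \<nu> \<le> M \<Longrightarrow> row_weight \<nu> = (\<Sum>i<M. i * part \<nu> i)"
proof -
 assume "length \<nu> \<le> M"
 have "row_weight \<nu> = (\<Sum>i<length \<nu>. \<Sum>j<part \<nu> i. i)"
  unfolding row_weight_def cells_Sigma by (subst sum.Sigma) (auto intro!: sum.cong)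
 also have "... = (\<Sum>i<length \<nu>. i * part \<nu> i)" by (simp add: mult.commute)
 also have "... = (\<Sum>i<M. i * part \<nu> i)"
  using \<open>length \<nu> \<le> M\<close> by (intro sum.mono_neutral_left) (auto simp: part_def)
 finally show ?thesis .
qed

lemma tableau_entry_ge_row:
 assumes "is_partition \<nu>" "T \<in> ssyt \<nu> \<alpha>" "(i, j) \<in> cells \<nu>"
 shows "i \<le> T (i, j)"
 using assms(3)
proof (induction i)
 case (Suc i)
 have "part \<nu> (Suc i) \<le> part \<nu> i" using part_antimono[OF assms(1)] by simp
 then have "(i, j) \<in> cells \<nu>" using Suc.prems by (auto simp: cells_part)
 then show ?case using Suc.IH ssytD(3)[OF assms(2) Suc.prems] by simp
qed simp

lemma tableau_weight:
 assumes "T \<in> ssyt \<nu> (part_monom \<mu>)"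
 shows "(\<Sum>c\<in>cells \<nu>. T c) = row_weight \<mu>"
proof -
 have "(\<Sum>c\<in>cells \<nu>. T c) = (\<Sum>v\<in>keys (part_monom \<mu>). part \<mu> v * v)"
  using sum_over_tableau[OF assms, of "\<lambda>v. v"] by simp
 also have "... = (\<Sum>v<length \<mu>. part \<mu> v * v)"
  using keys_part_monom by (intro sum.mono_neutral_left) (auto simp: in_keys_iff)
 finally show ?thesis by (simp add: row_weight_eq_sum[OF order_refl] mult.commute)
qed

text \<open>Entries of a semistandard tableau are at least their row index, so the sum of the entries is at least
 \<open>row_weight \<nu>\<close>; equality forces every entry to be its row index.\<close>

lemma tableau_eq_rows:
 assumes "is_partition \<nu>" "is_partition \<mu>" "T \<in> ssyt \<nu> (part_monom \<mu>)" "row_weight \<mu> \<le> row_weight \<nu>"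
 shows "\<nu> = \<mu>" "T = (\<lambda>c. if c \<in> cells \<nu> then fst c else 0)"
proof -
 have ge: "fst c \<le> T c" if "c \<in> cells \<nu>" for c
  using tableau_entry_ge_row[OF assms(1,3), of "fst c" "snd c"] that by simp
 have T: "T c = fst c" if "c \<in> cells \<nu>" for c
 proof (rule ccontr)
  assume "T c \<noteq> fst c"
  then have "fst c < T c" using ge[OF that] by simp
  then have "row_weight \<nu> < (\<Sum>c\<in>cells \<nu>. T c)"
   unfolding row_weight_def using that ge by (intro sum_strict_mono_ex1) auto
  with assms(4) tableau_weight[OF assms(3)] show False by simp
 qed
 have "part \<nu> v = part \<mu> v" for v
 proof -
  have "part \<mu> v = card {c \<in> cells \<nu>. T c = v}" using ssytD(4)[OF assms(3), of v] by simp
  also have "{c \<in> cells \<nu>. T c = v} = Pair v ` {..<part \<nu> v}"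
  proof -
   have "c \<in> cells \<nu> \<and> T c = v \<longleftrightarrow> c \<in> Pair v ` {..<part \<nu> v}" for c
    using T[of c] by (cases c) (auto simp: cells_part image_iff)
   then show ?thesis by blast
  qed
  also have "card ... = part \<nu> v" by (subst card_image) (auto simp: inj_on_def)
  finally show ?thesis ..
 qed
 then show "\<nu> = \<mu>" by (intro part_inj assms)
 show "T = (\<lambda>c. if c \<in> cells \<nu> then fst c else 0)"
 proof
  fix c show "T c = (if c \<in> cells \<nu> then fst c else 0)"
   using T[of c] ssytD(1)[OF assms(3), of c] by simp
 qed
qed

lemma kostka_triangular:
 assumes "is_partition \<nu>" "is_partition \<mu>" "\<nu> \<noteq> \<mu>" "row_weight \<mu> \<le> row_weight \<nu>"
 shows "kostka \<nu> (part_monom \<mu>) = 0"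
proof (rule ccontr)
 assume "kostka \<nu> (part_monom \<mu>) \<noteq> 0"
 then obtain T where "T \<in> ssyt \<nu> (part_monom \<mu>)" unfolding kostka_def by fastforce
 from tableau_eq_rows(1)[OF assms(1,2) this assms(4)] assms(3) show False by simp
qed

lemma kostka_diagonal:
 assumes "is_partition \<nu>"
 shows "kostka \<nu> (part_monom \<nu>) = 1"
proof -
 let ?T = "\<lambda>c. if c \<in> cells \<nu> then fst c else (0::nat)"
 have "?T \<in> ssyt \<nu> (part_monom \<nu>)"
  unfolding ssyt_def mem_Collect_eq
 proof (intro conjI allI impI)
  fix i j assume "(Suc i, j) \<in> cells \<nu>"
  moreover have "part \<nu> (Suc i) \<le> part \<nu> i" using part_antimono[OF assms] by simp
  ultimately show "?T (i, j) < ?T (Suc i, j)" by (auto simp: cells_part)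
 next
  fix v
  have "c \<in> cells \<nu> \<and> ?T c = v \<longleftrightarrow> c \<in> Pair v ` {..<part \<nu> v}" for c
   by (cases c) (auto simp: cells_part image_iff)
  then have "{c \<in> cells \<nu>. ?T c = v} = Pair v ` {..<part \<nu> v}" by blast
  then show "card {c \<in> cells \<nu>. ?T c = v} = lookup (part_monom \<nu>) v"
   by (simp add: card_image inj_on_def)
 qed (auto simp: cells_part)
 then have "ssyt \<nu> (part_monom \<nu>) = {?T}"
  using tableau_eq_rows(2)[OF assms assms _ order_refl] by blast
 then show ?thesis by (simp add: kostka_def)
qed

lemma row_weight_decreasing:
 assumes \<nu>: "is_partition \<nu>" "\<nu> \<noteq> []" and \<xi>: "is_partition \<xi>" "horizontal_strip (butlast \<nu>) \<xi>"
  and size: "sum_list \<xi> = sum_list \<nu>" and ne: "\<xi> \<noteq> \<nu>"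
 shows "row_weight \<xi> < row_weight \<nu>"
proof -
 define m where "m = length \<nu> - 1"
 have len: "length \<nu> = Suc m" using \<nu>(2) by (simp add: m_def)
 have pb: "part (butlast \<nu>) i = (if i < m then part \<nu> i else 0)" for i
  using len by (auto simp: part_def nth_butlast)
 have \<nu>': "is_partition (butlast \<nu>)"
  using \<nu>(1) unfolding is_partition_def by (auto simp: sorted_wrt_iff_nth_less nth_butlast dest: in_set_butlastD)
 have len\<xi>: "length \<xi> \<le> Suc m"
  using horizontal_strip_length(2)[OF \<nu>' \<xi>] len by simp
 have ge: "part \<nu> i \<le> part \<xi> i" if "i < m" for i
  using \<xi>(2) that unfolding horizontal_strip_def by (metis pb)
 have s: "(\<Sum>i<Suc m. part \<xi> i) = (\<Sum>i<Suc m. part \<nu> i)"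
  using size sum_list_part[OF len\<xi>] sum_list_part[of \<nu> "Suc m"] len by simp
 have conv: "(\<Sum>i<Suc m. (m - i) * part \<eta> i) + (\<Sum>i<Suc m. i * part \<eta> i) = m * (\<Sum>i<Suc m. part \<eta> i)" for \<eta>
  unfolding sum.distrib[symmetric] sum_distrib_left
 proof (intro sum.cong refl)
  fix i assume "i \<in> {..<Suc m}"
  then have "(m - i) + i = m" by simp
  then show "(m - i) * part \<eta> i + i * part \<eta> i = m * part \<eta> i" by (metis distrib_right)
 qed
 have "\<exists>i<m. part \<nu> i \<noteq> part \<xi> i"
 proof (rule ccontr)
  assume "\<not> (\<exists>i<m. part \<nu> i \<noteq> part \<xi> i)"
  then have eq: "part \<nu> i = part \<xi> i" if "i < m" for i using that by blast
  then have "(\<Sum>i<m. part \<nu> i) = (\<Sum>i<m. part \<xi> i)" by (intro sum.cong) auto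
  with s have "part \<nu> m = part \<xi> m" by simp
  then have "part \<nu> i = part \<xi> i" for i
   using eq[of i] part_beyond[of \<nu> i] part_beyond[of \<xi> i] len len\<xi> by (cases i m rule: linorder_cases) auto
  then have "\<nu> = \<xi>" by (intro part_inj \<nu> \<xi>)
  with ne show False by simp
 qed
 then obtain i0 where i0: "i0 < m" "part \<nu> i0 < part \<xi> i0" using ge by (metis le_neq_implies_less)
 have "(\<Sum>i<Suc m. (m - i) * part \<nu> i) < (\<Sum>i<Suc m. (m - i) * part \<xi> i)"
 proof (rule sum_strict_mono_ex1)
  show "\<forall>i\<in>{..<Suc m}. (m - i) * part \<nu> i \<le> (m - i) * part \<xi> i"
  proof
   fix i assume "i \<in> {..<Suc m}"
   then show "(m - i) * part \<nu> i \<le> (m - i) * part \<xi> i" using ge[of i] by (cases "i < m") auto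
  qed
  show "\<exists>i\<in>{..<Suc m}. (m - i) * part \<nu> i < (m - i) * part \<xi> i"
   using i0 by (intro bexI[of _ i0]) auto
 qed simp
 then have lt: "(\<Sum>i<Suc m. (m - i) * part \<nu> i) < (\<Sum>i<Suc m. (m - i) * part \<xi> i)" .
 have aux: "a < b \<Longrightarrow> a + x = c \<Longrightarrow> b + y = c \<Longrightarrow> y < x" for a b c x y :: nat by linarith
 have "(\<Sum>i<Suc m. i * part \<xi> i) < (\<Sum>i<Suc m. i * part \<nu> i)"
  by (rule aux[OF lt conv[of \<nu>] conv[of \<xi>, unfolded s]])
 then show ?thesis
  using row_weight_eq_sum[OF len\<xi>] row_weight_eq_sum[of \<nu> "Suc m"] len by simp
qed

lemma lookup_map_key_bij: "bij \<pi> \<Longrightarrow> lookup (map_key \<pi> \<alpha>) i = lookup \<alpha> (\<pi> i)"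
 by (simp add: map_key.rep_eq bij_is_inj)

lemma map_key_inverse:
 assumes "bij \<pi>"
 shows "map_key \<pi> (map_key (inv \<pi>) \<alpha>) = (\<alpha> :: monom)"
  "map_key (inv \<pi>) (map_key \<pi> \<alpha>) = \<alpha>"
 using assms by (auto intro!: poly_mapping_eqI simp: lookup_map_key_bij bij_imp_bij_inv
   bij_is_inj bij_is_surj surj_f_inv_f inv_f_f)

lemma map_key_add: "bij \<pi> \<Longrightarrow> map_key \<pi> (\<alpha> + \<beta>) = map_key \<pi> \<alpha> + (map_key \<pi> \<beta> :: monom)"
 by (rule poly_mapping_eqI) (simp add: lookup_map_key_bij lookup_add)

lemma mdeg_map_key [simp]:
 assumes "bij \<pi>" shows "mdeg (map_key \<pi> \<alpha>) = mdeg \<alpha>"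
proof -
 have "bij_betw \<pi> (keys (map_key \<pi> \<alpha>)) (keys \<alpha>)"
 proof (rule bij_betw_byWitness[where f' = "inv \<pi>"])
  show "\<forall>a\<in>keys (map_key \<pi> \<alpha>). inv \<pi> (\<pi> a) = a"
   using assms by (simp add: bij_is_inj)
  show "\<forall>a'\<in>keys \<alpha>. \<pi> (inv \<pi> a') = a'"
   using assms by (simp add: bij_is_surj surj_f_inv_f)
  then show "inv \<pi> ` keys \<alpha> \<subseteq> keys (map_key \<pi> \<alpha>)"
   using assms by (auto simp: in_keys_iff lookup_map_key_bij)
  show "\<pi> ` keys (map_key \<pi> \<alpha>) \<subseteq> keys \<alpha>"
   using assms by (auto simp: in_keys_iff lookup_map_key_bij)
 qed
 from sum.reindex_bij_betw[OF this, of "lookup \<alpha>"] show ?thesis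
  unfolding mdeg_def by (simp add: lookup_map_key_bij[OF assms])
qed

lemma sum_splits_map_key:
 assumes "bij \<pi>"
 shows "(\<Sum>p\<in>splits (map_key \<pi> \<alpha>). F (fst p) (snd p))
    = (\<Sum>p\<in>splits \<alpha>. F (map_key \<pi> (fst p)) (map_key \<pi> (snd p)))"
 by (rule sum.reindex_bij_witness[where
    i = "\<lambda>p. (map_key \<pi> (fst p), map_key \<pi> (snd p))" and
    j = "\<lambda>p. (map_key (inv \<pi>) (fst p), map_key (inv \<pi>) (snd p))"])
   (use assms in \<open>auto simp: splits_def map_key_inverse map_key_add[symmetric] bij_imp_bij_inv\<close>)

text \<open>The Pieri rule expresses a sum of Kostka numbers through the shape with its last row \<open>k\<close> removed, times
 \<open>h\<^sub>k\<close>, which is visibly symmetric. Among the shapes in that sum the given one has the largest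
 \<open>row_weight\<close>, so induction handles all the others.\<close>

lemma kostka_symmetric:
 assumes "is_partition \<nu>" "bij \<pi>"
 shows "kostka \<nu> (map_key \<pi> \<alpha>) = kostka \<nu> \<alpha>"
 using assms(1)
proof (induction "(sum_list \<nu>, row_weight \<nu>)" arbitrary: \<nu> \<alpha> rule: wf_induct_rule[OF wf_lex_prod[OF wf_less_than wf_less_than]])
 case (1 \<nu>)
 show ?case
 proof (cases "\<nu> = []")
  case True
  have "kostka [] \<beta> = (if \<beta> = 0 then 1 else 0)" for \<beta>
  proof (cases "\<beta> = 0")
   case True
   then show ?thesis by (simp add: kostka_zero is_partition_def)
  next
   case False
   then show ?thesis using kostka_degree[of "[]" \<beta>] by force
  qed
  moreover have "map_key \<pi> \<alpha> = 0 \<longleftrightarrow> \<alpha> = 0"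
   by (metis mdeg_map_key[OF assms(2)] mdeg_eq_0_iff)
  ultimately show ?thesis using True by simp
 next
  case False
  define \<nu>' where "\<nu>' = butlast \<nu>"
  define k where "k = last \<nu>"
  have \<nu>: "\<nu> = \<nu>' @ [k]" using False by (simp add: \<nu>'_def k_def)
  have p': "is_partition \<nu>'" and k: "k > 0"
   using 1(2) unfolding \<nu> is_partition_def by (auto simp: sorted_wrt_append)
  have small: "sum_list \<nu>' < sum_list \<nu>" using k by (simp add: \<nu>)
  let ?X = "{\<xi>. is_partition \<xi> \<and> horizontal_strip \<nu>' \<xi> \<and> sum_list \<xi> = sum_list \<nu>' + k}"
  have finX: "finite ?X" by (rule finite_subset[OF _ finite_partitions[of "sum_list \<nu>' + k"]]) auto
  have "horizontal_strip \<nu>' \<nu>"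
   unfolding horizontal_strip_def
  proof (intro allI conjI)
   fix i
   have pb: "part \<nu>' i = (if i < length \<nu>' then part \<nu> i else 0)" by (auto simp: part_def \<nu> nth_append)
   show "part \<nu>' i \<le> part \<nu> i" using pb by auto
   show "part \<nu> (Suc i) \<le> part \<nu>' i"
    using pb part_antimono[OF 1(2), of i "Suc i"] part_beyond[of \<nu> "Suc i"] by (auto simp: \<nu>)
  qed
  then have mem: "\<nu> \<in> ?X" using 1(2) by (simp add: \<nu>)
  have others: "kostka \<xi> (map_key \<pi> \<alpha>) = kostka \<xi> \<alpha>" if "\<xi> \<in> ?X - {\<nu>}" for \<xi>
  proof -
   have "row_weight \<xi> < row_weight \<nu>"
    using that by (intro row_weight_decreasing 1(2) False) (auto simp: \<nu>)
   then show ?thesis using that by (intro 1(1)) (auto simp: \<nu>)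
  qed
  have "(\<Sum>\<xi>\<in>?X. kostka \<xi> (map_key \<pi> \<alpha>)) =
    (\<Sum>p\<in>splits \<alpha>. if mdeg (fst p) = k then kostka \<nu>' (map_key \<pi> (snd p)) else 0)"
   unfolding pieri[OF p'] sum_splits_map_key[OF assms(2), where F = "\<lambda>a b. if mdeg a = k then kostka \<nu>' b else 0"]
   by (simp add: assms(2))
  also have "... = (\<Sum>p\<in>splits \<alpha>. if mdeg (fst p) = k then kostka \<nu>' (snd p) else 0)"
   using 1(1)[of \<nu>'] small p' by (intro sum.cong refl if_cong) auto
  also have "... = (\<Sum>\<xi>\<in>?X. kostka \<xi> \<alpha>)" by (rule pieri[OF p', symmetric])
  finally have "(\<Sum>\<xi>\<in>?X. kostka \<xi> (map_key \<pi> \<alpha>)) = (\<Sum>\<xi>\<in>?X. kostka \<xi> \<alpha>)" .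
  moreover have "(\<Sum>\<xi>\<in>?X. kostka \<xi> \<beta>) = kostka \<nu> \<beta> + (\<Sum>\<xi>\<in>?X - {\<nu>}. kostka \<xi> \<beta>)" for \<beta>
   by (rule sum.remove[OF finX mem])
  moreover have "(\<Sum>\<xi>\<in>?X - {\<nu>}. kostka \<xi> (map_key \<pi> \<alpha>)) = (\<Sum>\<xi>\<in>?X - {\<nu>}. kostka \<xi> \<alpha>)"
   using others by (intro sum.cong) auto
  ultimately show ?thesis by simp
 qed
qed

lemma exists_sorting:
 fixes \<alpha> :: monom
 obtains \<pi> \<mu> where "bij \<pi>" "is_partition \<mu>" "map_key \<pi> \<alpha> = part_monom \<mu>"
proof -
 let ?K = "keys \<alpha>"
 define xs where "xs = rev (sort_key (lookup \<alpha>) (sorted_list_of_set ?K))"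
 have xs: "distinct xs" "set xs = ?K" by (auto simp: xs_def)
 have len: "length xs = card ?K" using xs distinct_card[of xs] by simp
 have b1: "bij_betw (\<lambda>i. xs ! i) {..<card ?K} ?K"
  using bij_betw_nth[OF xs(1) _ xs(2)[symmetric], of "{..<card ?K}"] len by (simp add: xs)
 let ?U = "?K \<union> {..<card ?K}"
 have "card (?U - {..<card ?K}) = card (?U - ?K)"
  by (simp add: card_Diff_subset)
 then obtain g where g: "bij_betw g (?U - {..<card ?K}) (?U - ?K)"
  using finite_same_card_bij[of "?U - {..<card ?K}" "?U - ?K"] by auto
 define \<pi> where "\<pi> i = (if i < card ?K then xs ! i else if i \<in> ?U then g i else i)" for i
 have c1: "bij_betw \<pi> {..<card ?K} ?K"
  using b1 by (rule bij_betw_cong[THEN iffD1, rotated]) (auto simp: \<pi>_def)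
 have c2: "bij_betw \<pi> (?U - {..<card ?K}) (?U - ?K)"
  using g by (rule bij_betw_cong[THEN iffD1, rotated]) (auto simp: \<pi>_def)
 have c3: "bij_betw \<pi> (- ?U) (- ?U)"
  using bij_betw_id by (rule bij_betw_cong[THEN iffD1, rotated]) (auto simp: \<pi>_def id_def)
 have "bij_betw \<pi> ({..<card ?K} \<union> (?U - {..<card ?K})) (?K \<union> (?U - ?K))"
  using c1 c2 by (rule bij_betw_combine) auto
 then have "bij_betw \<pi> (({..<card ?K} \<union> (?U - {..<card ?K})) \<union> - ?U) ((?K \<union> (?U - ?K)) \<union> - ?U)"
  using c3 by (rule bij_betw_combine) auto
 moreover have "({..<card ?K} \<union> (?U - {..<card ?K})) \<union> - ?U = UNIV" "(?K \<union> (?U - ?K)) \<union> - ?U = UNIV" by auto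
 ultimately have bij: "bij \<pi>" by simp
 define \<mu> where "\<mu> = map (lookup \<alpha>) xs"
 have sorted: "sorted (map (lookup \<alpha>) (rev xs))" by (simp add: xs_def)
 have "sorted (rev \<mu>)" using sorted by (simp add: \<mu>_def rev_map)
 then have "sorted_wrt (\<ge>) \<mu>" by (simp only: sorted_wrt_rev)
 moreover have "0 \<notin> set \<mu>" by (auto simp: \<mu>_def xs in_keys_iff)
 ultimately have part: "is_partition \<mu>" by (simp add: is_partition_def)
 have "map_key \<pi> \<alpha> = part_monom \<mu>"
 proof (rule poly_mapping_eqI)
  fix i
  show "lookup (map_key \<pi> \<alpha>) i = lookup (part_monom \<mu>) i"
  proof (cases "i < card ?K")
   case True
   then show ?thesis by (simp add: lookup_map_key_bij[OF bij] \<pi>_def part_def \<mu>_def len)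
  next
   case False
   have "\<pi> i \<notin> ?K"
   proof (cases "i \<in> ?U")
    case True
    then show ?thesis using False bij_betwE[OF c2] by blast
   next
    case i: False
    then show ?thesis using False by (simp add: \<pi>_def)
   qed
   then show ?thesis using False by (simp add: lookup_map_key_bij[OF bij] part_def \<mu>_def len in_keys_iff)
  qed
 qed
 with bij part show ?thesis using that by blast
qed

section \<open>Schur expansions and the Hall inner product\<close>

definition partitions_of :: "nat \<Rightarrow> nat list set" where
 "partitions_of n = {\<nu>. is_partition \<nu> \<and> sum_list \<nu> = n}"

lemma finite_partitions_of [simp]: "finite (partitions_of n)"
 unfolding partitions_of_def by (rule finite_partitions)

lemma mcoeff_schur: "mcoeff (schur \<nu>) \<alpha> = of_nat (kostka \<nu> \<alpha>)"
 by (simp add: schur_def kostka_def)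

definition schur_expansion :: "'a::ring_1 mps \<Rightarrow> (nat list \<Rightarrow> 'a) \<Rightarrow> bool" where
 "schur_expansion f c \<longleftrightarrow>
   (\<forall>\<nu>. \<not> is_partition \<nu> \<longrightarrow> c \<nu> = 0) \<and>
   (\<forall>\<alpha>. mcoeff f \<alpha> = (\<Sum>\<nu>\<in>partitions_of (mdeg \<alpha>). c \<nu> * of_nat (kostka \<nu> \<alpha>)))"

lemma schur_expansion_unique:
 assumes "schur_expansion f c" "schur_expansion f d"
 shows "c = d"
proof
 fix \<mu>
 show "c \<mu> = d \<mu>"
 proof (induction "row_weight \<mu>" arbitrary: \<mu> rule: less_induct)
  case less
  show ?case
  proof (cases "is_partition \<mu>")
   case True
   let ?P = "partitions_of (sum_list \<mu>)"
   have mem: "\<mu> \<in> ?P" using True by (simp add: partitions_of_def)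
   have ex: "mcoeff f (part_monom \<mu>) = e \<mu> + (\<Sum>\<nu>\<in>?P - {\<mu>}. e \<nu> * of_nat (kostka \<nu> (part_monom \<mu>)))"
    if "schur_expansion f e" for e
   proof -
    have "mcoeff f (part_monom \<mu>) = (\<Sum>\<nu>\<in>?P. e \<nu> * of_nat (kostka \<nu> (part_monom \<mu>)))"
     using that by (simp add: schur_expansion_def)
    also have "... = e \<mu> * of_nat (kostka \<mu> (part_monom \<mu>)) + (\<Sum>\<nu>\<in>?P - {\<mu>}. e \<nu> * of_nat (kostka \<nu> (part_monom \<mu>)))"
     by (rule sum.remove[OF _ mem]) simp
    finally show ?thesis using True by (simp add: kostka_diagonal)
   qed
   have "(\<Sum>\<nu>\<in>?P - {\<mu>}. c \<nu> * of_nat (kostka \<nu> (part_monom \<mu>))) = (\<Sum>\<nu>\<in>?P - {\<mu>}. d \<nu> * of_nat (kostka \<nu> (part_monom \<mu>)))"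
   proof (rule sum.cong[OF refl])
    fix \<nu> assume "\<nu> \<in> ?P - {\<mu>}"
    then have "kostka \<nu> (part_monom \<mu>) = 0" if "\<not> row_weight \<nu> < row_weight \<mu>"
     using that True by (intro kostka_triangular) (auto simp: partitions_of_def)
    then show "c \<nu> * of_nat (kostka \<nu> (part_monom \<mu>)) = d \<nu> * of_nat (kostka \<nu> (part_monom \<mu>))"
     using less[of \<nu>] by (cases "row_weight \<nu> < row_weight \<mu>") simp_all
   qed
   with ex[OF assms(1)] ex[OF assms(2)] show ?thesis by simp
  qed (use assms in \<open>simp add: schur_expansion_def\<close>)
 qed
qed

text \<open>The Kostka matrix is unitriangular for \<open>row_weight\<close>, hence invertible over any ring.\<close>

lemma triangular_solve:
 fixes F :: "nat list \<Rightarrow> 'a::ring_1"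
 shows "\<exists>c. \<forall>\<mu>\<in>partitions_of n. F \<mu> = (\<Sum>\<nu>\<in>partitions_of n. c \<nu> * of_nat (kostka \<nu> (part_monom \<mu>)))"
proof -
 let ?P = "partitions_of n"
 have "\<exists>c. (\<forall>\<nu>. t \<le> row_weight \<nu> \<longrightarrow> c \<nu> = 0) \<and>
   (\<forall>\<mu>\<in>?P. row_weight \<mu> < t \<longrightarrow> F \<mu> = (\<Sum>\<nu>\<in>?P. c \<nu> * of_nat (kostka \<nu> (part_monom \<mu>))))" for t
 proof (induction t)
  case 0
  show ?case by (intro exI[of _ "\<lambda>_. 0"]) simp
 next
  case (Suc t)
  then obtain c where c0: "\<And>\<nu>. t \<le> row_weight \<nu> \<Longrightarrow> c \<nu> = 0"
   and c: "\<And>\<mu>. \<mu> \<in> ?P \<Longrightarrow> row_weight \<mu> < t \<Longrightarrow> F \<mu> = (\<Sum>\<nu>\<in>?P. c \<nu> * of_nat (kostka \<nu> (part_monom \<mu>)))"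
   by blast
  define d where "d \<nu> = F \<nu> - (\<Sum>\<xi>\<in>?P. c \<xi> * of_nat (kostka \<xi> (part_monom \<nu>)))" for \<nu>
  define c' where "c' \<nu> = c \<nu> + (if row_weight \<nu> = t then d \<nu> else 0)" for \<nu>
  have "F \<mu> = (\<Sum>\<nu>\<in>?P. c' \<nu> * of_nat (kostka \<nu> (part_monom \<mu>)))"
   if \<mu>: "\<mu> \<in> ?P" "row_weight \<mu> < Suc t" for \<mu>
  proof -
   have "(\<Sum>\<nu>\<in>?P. c' \<nu> * of_nat (kostka \<nu> (part_monom \<mu>)))
     = (\<Sum>\<nu>\<in>?P. c \<nu> * of_nat (kostka \<nu> (part_monom \<mu>)))
     + (\<Sum>\<nu>\<in>?P. (if row_weight \<nu> = t then d \<nu> else 0) * of_nat (kostka \<nu> (part_monom \<mu>)))"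
    unfolding c'_def by (simp add: distrib_right sum.distrib)
   also have "(\<Sum>\<nu>\<in>?P. (if row_weight \<nu> = t then d \<nu> else 0) * of_nat (kostka \<nu> (part_monom \<mu>)))
     = (\<Sum>\<nu>\<in>?P. if \<nu> = \<mu> then (if row_weight \<mu> = t then d \<mu> else 0) else 0)"
   proof (rule sum.cong[OF refl])
    fix \<nu> assume \<nu>: "\<nu> \<in> ?P"
    show "(if row_weight \<nu> = t then d \<nu> else 0) * of_nat (kostka \<nu> (part_monom \<mu>))
     = (if \<nu> = \<mu> then (if row_weight \<mu> = t then d \<mu> else 0) else 0)"
    proof (cases "\<nu> = \<mu>")
     case True
     then show ?thesis using \<mu>(1) by (simp add: kostka_diagonal partitions_of_def)
    next
     case False
     have "kostka \<nu> (part_monom \<mu>) = 0" if "row_weight \<nu> = t"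
      using \<nu> \<mu> False that by (intro kostka_triangular) (auto simp: partitions_of_def)
     then show ?thesis using False by simp
    qed
   qed
   also have "... = (if row_weight \<mu> = t then d \<mu> else 0)"
    using \<mu>(1) by (simp add: sum.delta)
   finally show ?thesis
    using c[OF \<mu>(1)] \<mu>(2) by (cases "row_weight \<mu> = t") (simp_all add: d_def)
  qed
  moreover have "c' \<nu> = 0" if "Suc t \<le> row_weight \<nu>" for \<nu>
   using that c0[of \<nu>] by (simp add: c'_def)
  ultimately show ?case by (intro exI[of _ c']) blast
 qed
 from this[of "Suc (Max (row_weight ` ?P))"] obtain c where c: "\<And>\<mu>. \<mu> \<in> ?P \<Longrightarrow>
   row_weight \<mu> < Suc (Max (row_weight ` ?P)) \<Longrightarrow> F \<mu> = (\<Sum>\<nu>\<in>?P. c \<nu> * of_nat (kostka \<nu> (part_monom \<mu>)))"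
  by blast
 have "row_weight \<mu> < Suc (Max (row_weight ` ?P))" if "\<mu> \<in> ?P" for \<mu>
  using that Max_ge[of "row_weight ` ?P" "row_weight \<mu>"] by (simp add: less_Suc_eq_le)
 with c show ?thesis by blast
qed

lemma symmetric_determined:
 assumes "symmetric_mps f" "symmetric_mps g"
  "\<And>\<mu>. is_partition \<mu> \<Longrightarrow> mcoeff f (part_monom \<mu>) = mcoeff g (part_monom \<mu>)"
 shows "f = g"
proof (rule mps_eqI)
 fix \<alpha> :: monom
 obtain \<pi> \<mu> where "bij \<pi>" "is_partition \<mu>" "map_key \<pi> \<alpha> = part_monom \<mu>"
  using exists_sorting[of \<alpha>] by blast
 then show "mcoeff f \<alpha> = mcoeff g \<alpha>"
  using assms unfolding symmetric_mps_def by metis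
qed

definition schur_series :: "(nat list \<Rightarrow> 'a::ring_1) \<Rightarrow> 'a mps" where
 "schur_series c = Abs_mps (\<lambda>\<alpha>. \<Sum>\<nu>\<in>partitions_of (mdeg \<alpha>). c \<nu> * of_nat (kostka \<nu> \<alpha>))"

lemma symmetric_schur_series: "symmetric_mps (schur_series c)"
 unfolding symmetric_mps_def schur_series_def
 by (auto intro!: sum.cong simp: kostka_symmetric partitions_of_def)

lemma schur_expansion_symmetric: "schur_expansion f c \<Longrightarrow> symmetric_mps f"
proof -
 assume "schur_expansion f c"
 then have "f = schur_series c"
  by (intro mps_eqI) (simp add: schur_expansion_def schur_series_def)
 then show ?thesis using symmetric_schur_series by simp
qed

lemma schur_expansion_exists:
 fixes f :: "'a::ring_1 mps"
 assumes "symmetric_mps f"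
 shows "\<exists>c. schur_expansion f c"
proof -
 from triangular_solve[where F = "\<lambda>\<mu>. mcoeff f (part_monom \<mu>)"]
 obtain c where c: "\<And>n \<mu>. \<mu> \<in> partitions_of n \<Longrightarrow>
   mcoeff f (part_monom \<mu>) = (\<Sum>\<nu>\<in>partitions_of n. c n \<nu> * of_nat (kostka \<nu> (part_monom \<mu>)))"
  by metis
 define d where "d \<nu> = (if is_partition \<nu> then c (sum_list \<nu>) \<nu> else 0)" for \<nu>
 have "f = schur_series d"
 proof (rule symmetric_determined[OF assms symmetric_schur_series])
  fix \<mu> assume "is_partition \<mu>"
  then have "mcoeff f (part_monom \<mu>) = (\<Sum>\<nu>\<in>partitions_of (sum_list \<mu>). c (sum_list \<mu>) \<nu> * of_nat (kostka \<nu> (part_monom \<mu>)))"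
   by (intro c) (simp add: partitions_of_def)
  also have "... = (\<Sum>\<nu>\<in>partitions_of (sum_list \<mu>). d \<nu> * of_nat (kostka \<nu> (part_monom \<mu>)))"
   by (intro sum.cong) (auto simp: d_def partitions_of_def)
  finally show "mcoeff f (part_monom \<mu>) = mcoeff (schur_series d) (part_monom \<mu>)"
   by (simp add: schur_series_def)
 qed
 then have "schur_expansion f d"
  by (simp add: schur_expansion_def schur_series_def d_def)
 then show ?thesis by blast
qed

lemma schur_coeff_eqI:
 assumes "schur_expansion f c"
 shows "schur_coeff f = c"
proof -
 have "schur_coeff f = (THE c. schur_expansion f c)"
  unfolding schur_coeff_def schur_expansion_def mcoeff_schur partitions_of_def ..
 also have "... = c"
  using assms schur_expansion_unique by blast
 finally show ?thesis .
qed

lemma schur_expansion_schur_coeff: "symmetric_mps f \<Longrightarrow> schur_expansion f (schur_coeff f)"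
 using schur_expansion_exists[of f] schur_coeff_eqI[of f] by blast

lemma schur_coeff_nonpartition: "symmetric_mps f \<Longrightarrow> \<not> is_partition \<nu> \<Longrightarrow> schur_coeff f \<nu> = 0"
 using schur_expansion_schur_coeff unfolding schur_expansion_def by blast

lemma mcoeff_schur_coeff:
 "symmetric_mps f \<Longrightarrow> mcoeff f \<alpha> = (\<Sum>\<nu>\<in>partitions_of (mdeg \<alpha>). schur_coeff f \<nu> * of_nat (kostka \<nu> \<alpha>))"
 using schur_expansion_schur_coeff unfolding schur_expansion_def by blast

lemma symmetric_eqI_schur_coeff:
 assumes "symmetric_mps f" "symmetric_mps g" "\<And>\<nu>. is_partition \<nu> \<Longrightarrow> schur_coeff f \<nu> = schur_coeff g \<nu>"
 shows "f = g"
 by (rule mps_eqI) (use assms in \<open>auto simp: mcoeff_schur_coeff partitions_of_def intro!: sum.cong\<close>)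

lemma schur_expansion_schur:
 assumes "is_partition \<nu>"
 shows "schur_expansion (schur \<nu>) (\<lambda>\<mu>. if \<mu> = \<nu> then 1 else 0)"
 unfolding schur_expansion_def mcoeff_schur
proof (intro conjI allI impI)
 fix \<alpha>
 have "(\<Sum>\<mu>\<in>partitions_of (mdeg \<alpha>). (if \<mu> = \<nu> then 1 else 0) * of_nat (kostka \<mu> \<alpha>) :: 'a)
  = (\<Sum>\<mu>\<in>partitions_of (mdeg \<alpha>). if \<mu> = \<nu> then of_nat (kostka \<nu> \<alpha>) else 0)"
  by (intro sum.cong) auto
 also have "... = (if \<nu> \<in> partitions_of (mdeg \<alpha>) then of_nat (kostka \<nu> \<alpha>) else 0)"
  by (rule sum.delta) simp
 also have "... = of_nat (kostka \<nu> \<alpha>)"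
  using kostka_degree[of \<nu> \<alpha>] assms by (cases "kostka \<nu> \<alpha> = 0") (auto simp: partitions_of_def)
 finally show "of_nat (kostka \<nu> \<alpha>) = (\<Sum>\<mu>\<in>partitions_of (mdeg \<alpha>). (if \<mu> = \<nu> then 1 else 0) * of_nat (kostka \<mu> \<alpha>) :: 'a)" ..
qed (use assms in auto)

lemma schur_coeff_schur: "is_partition \<nu> \<Longrightarrow> schur_coeff (schur \<nu>) = (\<lambda>\<mu>. if \<mu> = \<nu> then 1 else 0)"
 by (rule schur_coeff_eqI) (rule schur_expansion_schur)

lemma schur_in_Sym: "is_partition \<nu> \<Longrightarrow> schur \<nu> \<in> Sym"
 unfolding Sym_def using schur_expansion_symmetric[OF schur_expansion_schur[of \<nu>]] kostka_degree[of \<nu>]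
 by (auto simp: mcoeff_schur intro!: exI[of _ "sum_list \<nu>"])

lemma symmetric_times:
 assumes "symmetric_mps f" "symmetric_mps g"
 shows "symmetric_mps (f * g)"
 unfolding symmetric_mps_def
proof (intro allI impI)
 fix \<pi> :: "nat \<Rightarrow> nat" and \<alpha> :: monom assume "bij \<pi>"
 with assms show "mcoeff (f * g) (map_key \<pi> \<alpha>) = mcoeff (f * g) \<alpha>"
  unfolding mcoeff_times sum_splits_map_key[OF \<open>bij \<pi>\<close>, where F = "\<lambda>a b. mcoeff f a * mcoeff g b"]
  by (simp add: symmetric_mps_def)
qed

lemma symmetric_hsym: "symmetric_mps (hsym k)"
 by (auto simp: symmetric_mps_def hsym_def)

lemma symmetric_esym: "symmetric_mps (esym k)"
 unfolding symmetric_mps_def esym_def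
proof (intro allI impI)
 fix \<pi> :: "nat \<Rightarrow> nat" and \<alpha> :: monom assume b: "bij \<pi>"
 have "(\<forall>i. lookup \<alpha> (\<pi> i) \<le> 1) \<longleftrightarrow> (\<forall>i. lookup \<alpha> i \<le> 1)"
  using b by (metis bij_pointE)
 then show "mcoeff (Abs_mps (\<lambda>\<alpha>. if mdeg \<alpha> = k \<and> (\<forall>i. lookup \<alpha> i \<le> 1) then 1 else 0)) (map_key \<pi> \<alpha>)
  = mcoeff (Abs_mps (\<lambda>\<alpha>. if mdeg \<alpha> = k \<and> (\<forall>i. lookup \<alpha> i \<le> 1) then 1 else 0)) \<alpha>"
  using b by (simp add: lookup_map_key_bij)
qed

lemma mcoeff_sum: "mcoeff (\<Sum>i\<in>I. f i) \<alpha> = (\<Sum>i\<in>I. mcoeff (f i) \<alpha>)"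
 by (induction I rule: infinite_finite_induct) (simp_all add: zero_mps.rep_eq plus_mps.rep_eq)

lemma SymI: "symmetric_mps f \<Longrightarrow> (\<And>\<alpha>. mcoeff f \<alpha> \<noteq> 0 \<Longrightarrow> mdeg \<alpha> \<le> d) \<Longrightarrow> f \<in> Sym"
 by (auto simp: Sym_def)

lemma SymD: "f \<in> Sym \<Longrightarrow> symmetric_mps f"
 by (auto simp: Sym_def)

lemma hsym_in_Sym: "hsym k \<in> Sym"
 by (rule SymI[OF symmetric_hsym, of _ k]) (auto simp: hsym_def split: if_splits)

lemma esym_in_Sym: "esym k \<in> Sym"
 by (rule SymI[OF symmetric_esym, of _ k]) (auto simp: esym_def split: if_splits)

lemma times_in_Sym:
 assumes "f \<in> Sym" "g \<in> Sym"
 shows "f * g \<in> Sym"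
proof -
 obtain a b where a: "\<And>\<alpha>. mcoeff f \<alpha> \<noteq> 0 \<Longrightarrow> mdeg \<alpha> \<le> a" and b: "\<And>\<alpha>. mcoeff g \<alpha> \<noteq> 0 \<Longrightarrow> mdeg \<alpha> \<le> b"
  using assms unfolding Sym_def by blast
 show ?thesis
 proof (rule SymI)
  show "symmetric_mps (f * g)" using assms by (intro symmetric_times SymD)
  fix \<alpha> assume "mcoeff (f * g) \<alpha> \<noteq> 0"
  then obtain p where p: "p \<in> splits \<alpha>" "mcoeff f (fst p) * mcoeff g (snd p) \<noteq> 0"
   unfolding mcoeff_times by (meson sum.neutral)
  have "mdeg \<alpha> = mdeg (fst p) + mdeg (snd p)" using p(1) by (auto simp: splits_def)
  moreover have "mdeg (fst p) \<le> a" "mdeg (snd p) \<le> b" using p(2) a b by auto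
  ultimately show "mdeg \<alpha> \<le> a + b" by simp
 qed
qed

lemma schur_coeff_bounded:
 assumes "symmetric_mps f" "\<And>\<alpha>. mcoeff f \<alpha> \<noteq> 0 \<Longrightarrow> mdeg \<alpha> \<le> d" "d < sum_list \<nu>"
 shows "schur_coeff f \<nu> = 0"
proof -
 let ?c = "\<lambda>\<nu>. if sum_list \<nu> \<le> d then schur_coeff f \<nu> else 0"
 have "schur_expansion f ?c"
  unfolding schur_expansion_def
 proof (intro conjI allI impI)
  fix \<alpha>
  show "mcoeff f \<alpha> = (\<Sum>\<nu>\<in>partitions_of (mdeg \<alpha>). ?c \<nu> * of_nat (kostka \<nu> \<alpha>))"
  proof (cases "mdeg \<alpha> \<le> d")
   case True
   then show ?thesis unfolding mcoeff_schur_coeff[OF assms(1), of \<alpha>]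
    by (intro sum.cong) (auto simp: partitions_of_def)
  next
   case False
   then have "mcoeff f \<alpha> = 0" using assms(2) by blast
   moreover have "(\<Sum>\<nu>\<in>partitions_of (mdeg \<alpha>). ?c \<nu> * of_nat (kostka \<nu> \<alpha>)) = 0"
    using False by (intro sum.neutral) (auto simp: partitions_of_def)
   ultimately show ?thesis by simp
  qed
 qed (use schur_coeff_nonpartition[OF assms(1)] in auto)
 from fun_cong[OF schur_coeff_eqI[OF this], of \<nu>] assms(3) show ?thesis by simp
qed

definition partitions_le :: "nat \<Rightarrow> nat list set" where
 "partitions_le d = {\<nu>. is_partition \<nu> \<and> sum_list \<nu> \<le> d}"

lemma finite_partitions_le' [simp]: "finite (partitions_le d)"
 unfolding partitions_le_def by (rule finite_partitions_le)

lemma schur_coeff_Sym: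
 assumes "f \<in> Sym"
 obtains d where "\<And>\<nu>. \<nu> \<notin> partitions_le d \<Longrightarrow> schur_coeff f \<nu> = 0"
proof -
 obtain d where d: "\<And>\<alpha>. mcoeff f \<alpha> \<noteq> 0 \<Longrightarrow> mdeg \<alpha> \<le> d"
  using assms unfolding Sym_def by blast
 show ?thesis
 proof (rule that[of d])
  fix \<nu> assume "\<nu> \<notin> partitions_le d"
  then consider "\<not> is_partition \<nu>" | "d < sum_list \<nu>" by (force simp: partitions_le_def)
  then show "schur_coeff f \<nu> = 0"
   using schur_coeff_nonpartition[OF SymD[OF assms]] schur_coeff_bounded[OF SymD[OF assms] d] by cases auto
 qed
qed

lemma hall_inner_eq_sum:
 assumes "finite A" "\<And>\<nu>. \<nu> \<notin> A \<Longrightarrow> schur_coeff f \<nu> = 0 \<or> schur_coeff g \<nu> = 0"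
 shows "hall_inner f g = (\<Sum>\<nu>\<in>A. schur_coeff f \<nu> * schur_coeff g \<nu>)"
 unfolding hall_inner_def using assms by (intro sum.mono_neutral_left) auto

section \<open>The adjoint of a complete homogeneous function\<close>

definition fresh :: "monom \<Rightarrow> nat" where
 "fresh \<alpha> = (LEAST N. keys \<alpha> \<subseteq> {..<N})"

lemma keys_fresh: "keys \<alpha> \<subseteq> {..<fresh \<alpha>}"
proof -
 obtain N where "keys \<alpha> \<subseteq> {..<N}"
  using finite_nat_iff_bounded[of "keys \<alpha>"] by auto
 then show ?thesis unfolding fresh_def by (rule LeastI)
qed

text \<open>For symmetric \<open>f\<close> any variable absent from the monomial gives the same value (\<open>hperp_any_fresh\<close>); the
 operator is \<open>h\<^sub>k\<^sup>\<bottom>\<close> (\<open>perp_hsym\<close>).\<close>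

definition hperp :: "nat \<Rightarrow> 'a mps \<Rightarrow> 'a mps" where
 "hperp k f = Abs_mps (\<lambda>\<alpha>. mcoeff f (\<alpha> + single (fresh \<alpha>) k))"

lemma mcoeff_hperp: "mcoeff (hperp k f) \<alpha> = mcoeff f (\<alpha> + single (fresh \<alpha>) k)"
 by (simp add: hperp_def)

text \<open>The actions of \<open>h\<^sub>k\<^sup>\<bottom>\<close> and of multiplication by \<open>h\<^sub>k\<close> on Schur coefficients. They are transposes of each
 other, which is why \<open>hperp\<close> is the adjoint.\<close>

definition skew_h :: "nat \<Rightarrow> (nat list \<Rightarrow> 'a::comm_monoid_add) \<Rightarrow> nat list \<Rightarrow> 'a" where
 "skew_h k c \<kappa> = (if is_partition \<kappa> then \<Sum>\<nu>\<in>{\<nu> \<in> partitions_of (sum_list \<kappa> + k). horizontal_strip \<kappa> \<nu>}. c \<nu> else 0)"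

lemma mcoeff_add_single:
 fixes f :: "'a::ring_1 mps"
 assumes "symmetric_mps f" "keys \<alpha> \<subseteq> {..<N}"
 shows "mcoeff f (\<alpha> + single N k)
   = (\<Sum>\<kappa>\<in>partitions_of (mdeg \<alpha>). skew_h k (schur_coeff f) \<kappa> * of_nat (kostka \<kappa> \<alpha>))"
proof -
 let ?P = "partitions_of (mdeg \<alpha> + k)" and ?Q = "partitions_of (mdeg \<alpha>)"
 have "mcoeff f (\<alpha> + single N k)
   = (\<Sum>\<nu>\<in>?P. schur_coeff f \<nu> * of_nat (kostka \<nu> (\<alpha> + single N k)))"
  by (simp add: mcoeff_schur_coeff[OF assms(1)])
 also have "... = (\<Sum>\<nu>\<in>?P. \<Sum>\<kappa>\<in>{\<kappa>\<in>?Q. horizontal_strip \<kappa> \<nu>}. schur_coeff f \<nu> * of_nat (kostka \<kappa> \<alpha>))"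
 proof (rule sum.cong[OF refl])
  fix \<nu> assume \<nu>: "\<nu> \<in> ?P"
  then have "{\<kappa>. is_partition \<kappa> \<and> horizontal_strip \<kappa> \<nu> \<and> sum_list \<kappa> + k = sum_list \<nu>} = {\<kappa>\<in>?Q. horizontal_strip \<kappa> \<nu>}"
   by (auto simp: partitions_of_def)
  then show "schur_coeff f \<nu> * of_nat (kostka \<nu> (\<alpha> + single N k)) =
    (\<Sum>\<kappa>\<in>{\<kappa>\<in>?Q. horizontal_strip \<kappa> \<nu>}. schur_coeff f \<nu> * of_nat (kostka \<kappa> \<alpha>))"
   using \<nu> by (simp add: kostka_branching[OF _ assms(2)] partitions_of_def sum_distrib_left)
 qed
 also have "... = (\<Sum>\<kappa>\<in>?Q. \<Sum>\<nu>\<in>{\<nu>\<in>?P. horizontal_strip \<kappa> \<nu>}. schur_coeff f \<nu> * of_nat (kostka \<kappa> \<alpha>))"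
  by (rule sum.swap_restrict) simp_all
 also have "... = (\<Sum>\<kappa>\<in>?Q. skew_h k (schur_coeff f) \<kappa> * of_nat (kostka \<kappa> \<alpha>))"
  by (intro sum.cong refl) (simp add: skew_h_def partitions_of_def sum_distrib_right)
 finally show ?thesis .
qed

lemma hperp_any_fresh:
 fixes f :: "'a::ring_1 mps"
 assumes "symmetric_mps f" "keys \<alpha> \<subseteq> {..<N}"
 shows "mcoeff (hperp k f) \<alpha> = mcoeff f (\<alpha> + single N k)"
 unfolding mcoeff_hperp mcoeff_add_single[OF assms] mcoeff_add_single[OF assms(1) keys_fresh] ..

lemma schur_expansion_hperp:
 fixes f :: "'a::ring_1 mps"
 assumes "symmetric_mps f"
 shows "schur_expansion (hperp k f) (skew_h k (schur_coeff f))"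
 unfolding schur_expansion_def mcoeff_hperp mcoeff_add_single[OF assms keys_fresh]
 by (simp add: skew_h_def)

lemmas symmetric_hperp = schur_expansion_hperp[THEN schur_expansion_symmetric]

lemma hperp_in_Sym: "f \<in> Sym \<Longrightarrow> hperp k f \<in> Sym"
proof -
 assume f: "f \<in> Sym"
 then obtain d where d: "\<And>\<alpha>. mcoeff f \<alpha> \<noteq> 0 \<Longrightarrow> mdeg \<alpha> \<le> d" unfolding Sym_def by blast
 show ?thesis
 proof (rule SymI)
  show "symmetric_mps (hperp k f)" by (rule symmetric_hperp[OF SymD[OF f]])
  fix \<alpha> assume "mcoeff (hperp k f) \<alpha> \<noteq> 0"
  then show "mdeg \<alpha> \<le> d"
   using d[of "\<alpha> + single (fresh \<alpha>) k"] by (simp add: mcoeff_hperp)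
 qed
qed

definition add_h :: "nat \<Rightarrow> (nat list \<Rightarrow> 'a::comm_monoid_add) \<Rightarrow> nat list \<Rightarrow> 'a" where
 "add_h k c \<xi> = (if is_partition \<xi> then \<Sum>\<mu> | is_partition \<mu> \<and> horizontal_strip \<mu> \<xi> \<and> sum_list \<mu> + k = sum_list \<xi>. c \<mu> else 0)"

lemma schur_expansion_hsym_times:
 fixes u :: "'a::ring_1 mps"
 assumes "symmetric_mps u"
 shows "schur_expansion (hsym k * u) (add_h k (schur_coeff u))"
 unfolding schur_expansion_def
proof (intro conjI allI impI)
 fix \<alpha>
 have split: "mdeg (fst p) + mdeg (snd p) = mdeg \<alpha>" if "p \<in> splits \<alpha>" for p
  using that by (auto simp: splits_def)
 show "mcoeff (hsym k * u) \<alpha> = (\<Sum>\<nu>\<in>partitions_of (mdeg \<alpha>). add_h k (schur_coeff u) \<nu> * of_nat (kostka \<nu> \<alpha>))"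
 proof (cases "k \<le> mdeg \<alpha>")
  case True
  let ?Q = "partitions_of (mdeg \<alpha> - k)" and ?P = "partitions_of (mdeg \<alpha>)"
  have "mcoeff (hsym k * u) \<alpha> = (\<Sum>p\<in>splits \<alpha>. if mdeg (fst p) = k then mcoeff u (snd p) else 0)"
   unfolding mcoeff_times by (intro sum.cong) (auto simp: hsym_def)
  also have "... = (\<Sum>p\<in>splits \<alpha>. \<Sum>\<mu>\<in>?Q. schur_coeff u \<mu> * of_nat (if mdeg (fst p) = k then kostka \<mu> (snd p) else 0))"
  proof (rule sum.cong[OF refl])
   fix p assume "p \<in> splits \<alpha>"
   from split[OF this] have "mdeg (snd p) = mdeg \<alpha> - k" if "mdeg (fst p) = k" using that by simp
   then show "(if mdeg (fst p) = k then mcoeff u (snd p) else 0) =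
    (\<Sum>\<mu>\<in>?Q. schur_coeff u \<mu> * of_nat (if mdeg (fst p) = k then kostka \<mu> (snd p) else 0))"
    by (simp add: mcoeff_schur_coeff[OF assms])
  qed
  also have "... = (\<Sum>\<mu>\<in>?Q. \<Sum>p\<in>splits \<alpha>. schur_coeff u \<mu> * of_nat (if mdeg (fst p) = k then kostka \<mu> (snd p) else 0))"
   by (rule sum.swap)
  also have "... = (\<Sum>\<mu>\<in>?Q. \<Sum>\<xi>\<in>{\<xi>\<in>?P. horizontal_strip \<mu> \<xi>}. schur_coeff u \<mu> * of_nat (kostka \<xi> \<alpha>))"
  proof (rule sum.cong[OF refl])
   fix \<mu> assume \<mu>: "\<mu> \<in> ?Q"
   have "(\<Sum>p\<in>splits \<alpha>. schur_coeff u \<mu> * of_nat (if mdeg (fst p) = k then kostka \<mu> (snd p) else 0))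
    = schur_coeff u \<mu> * of_nat (\<Sum>p\<in>splits \<alpha>. if mdeg (fst p) = k then kostka \<mu> (snd p) else 0)"
    by (simp only: sum_distrib_left of_nat_sum)
   also have "(\<Sum>p\<in>splits \<alpha>. if mdeg (fst p) = k then kostka \<mu> (snd p) else 0) = (\<Sum>\<xi>\<in>{\<xi>\<in>?P. horizontal_strip \<mu> \<xi>}. kostka \<xi> \<alpha>)"
    using \<mu> True by (subst pieri[symmetric]) (auto simp: partitions_of_def intro!: sum.cong)
   finally show "(\<Sum>p\<in>splits \<alpha>. schur_coeff u \<mu> * of_nat (if mdeg (fst p) = k then kostka \<mu> (snd p) else 0)) =
    (\<Sum>\<xi>\<in>{\<xi>\<in>?P. horizontal_strip \<mu> \<xi>}. schur_coeff u \<mu> * of_nat (kostka \<xi> \<alpha>))"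
    by (simp only: sum_distrib_left of_nat_sum)
  qed
  also have "... = (\<Sum>\<xi>\<in>?P. \<Sum>\<mu>\<in>{\<mu>\<in>?Q. horizontal_strip \<mu> \<xi>}. schur_coeff u \<mu> * of_nat (kostka \<xi> \<alpha>))"
   by (rule sum.swap_restrict) simp_all
  also have "... = (\<Sum>\<nu>\<in>?P. add_h k (schur_coeff u) \<nu> * of_nat (kostka \<nu> \<alpha>))"
  proof (rule sum.cong[OF refl])
   fix \<xi> assume \<xi>: "\<xi> \<in> ?P"
   then have "{\<mu>\<in>?Q. horizontal_strip \<mu> \<xi>} = {\<mu>. is_partition \<mu> \<and> horizontal_strip \<mu> \<xi> \<and> sum_list \<mu> + k = sum_list \<xi>}"
    using True by (auto simp: partitions_of_def)
   then show "(\<Sum>\<mu>\<in>{\<mu>\<in>?Q. horizontal_strip \<mu> \<xi>}. schur_coeff u \<mu> * of_nat (kostka \<xi> \<alpha>)) = add_h k (schur_coeff u) \<xi> * of_nat (kostka \<xi> \<alpha>)"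
    using \<xi> by (simp add: add_h_def partitions_of_def sum_distrib_right)
  qed
  finally show ?thesis .
 next
  case False
  have "mcoeff (hsym k * u) \<alpha> = 0"
   unfolding mcoeff_times using split False by (intro sum.neutral) (fastforce simp: hsym_def)
  moreover have "add_h k (schur_coeff u) \<nu> = 0" if "\<nu> \<in> partitions_of (mdeg \<alpha>)" for \<nu>
  proof -
   have "{\<mu>. is_partition \<mu> \<and> horizontal_strip \<mu> \<nu> \<and> sum_list \<mu> + k = sum_list \<nu>} = {}"
    using that False by (auto simp: partitions_of_def)
   then show ?thesis unfolding add_h_def by (simp del: Collect_empty_eq)
  qed
  ultimately show ?thesis by simp
 qed
qed (simp add: add_h_def)

lemma hall_inner_hsym_times:
 assumes u: "u \<in> Sym" and g: "g \<in> Sym"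
 shows "hall_inner (hsym k * u) g = hall_inner u (hperp k g)"
proof -
 obtain d where d: "\<And>\<nu>. \<nu> \<notin> partitions_le d \<Longrightarrow> schur_coeff g \<nu> = 0"
  using schur_coeff_Sym[OF g] by blast
 let ?A = "partitions_le d"
 let ?u = "schur_coeff u" and ?g = "schur_coeff g"
 note su = schur_coeff_eqI[OF schur_expansion_hsym_times[OF SymD[OF u]], of k]
 note sg = schur_coeff_eqI[OF schur_expansion_hperp[OF SymD[OF g]], of k]
 have le: "\<mu> \<in> ?A" if "is_partition \<mu>" "sum_list \<mu> + k = sum_list \<xi>" "\<xi> \<in> ?A" for \<mu> \<xi>
  using that by (auto simp: partitions_le_def)
 have "hall_inner (hsym k * u) g = (\<Sum>\<xi>\<in>?A. add_h k ?u \<xi> * ?g \<xi>)"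
  unfolding su[symmetric] using d by (intro hall_inner_eq_sum) auto
 also have "... = (\<Sum>\<xi>\<in>?A. \<Sum>\<mu>\<in>{\<mu>\<in>?A. horizontal_strip \<mu> \<xi> \<and> sum_list \<mu> + k = sum_list \<xi>}. ?u \<mu> * ?g \<xi>)"
 proof (rule sum.cong[OF refl])
  fix \<xi> assume \<xi>: "\<xi> \<in> ?A"
  have "{\<mu>\<in>?A. horizontal_strip \<mu> \<xi> \<and> sum_list \<mu> + k = sum_list \<xi>} = {\<mu>. is_partition \<mu> \<and> horizontal_strip \<mu> \<xi> \<and> sum_list \<mu> + k = sum_list \<xi>}"
   using \<xi> le by (auto simp: partitions_le_def)
  then show "add_h k ?u \<xi> * ?g \<xi> = (\<Sum>\<mu>\<in>{\<mu>\<in>?A. horizontal_strip \<mu> \<xi> \<and> sum_list \<mu> + k = sum_list \<xi>}. ?u \<mu> * ?g \<xi>)"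
   using \<xi> by (simp add: add_h_def sum_distrib_right partitions_le_def)
 qed
 also have "... = (\<Sum>\<mu>\<in>?A. \<Sum>\<xi>\<in>{\<xi>\<in>?A. horizontal_strip \<mu> \<xi> \<and> sum_list \<mu> + k = sum_list \<xi>}. ?u \<mu> * ?g \<xi>)"
  by (rule sum.swap_restrict) simp_all
 also have "... = (\<Sum>\<mu>\<in>?A. ?u \<mu> * skew_h k ?g \<mu>)"
 proof (rule sum.cong[OF refl])
  fix \<mu> assume \<mu>: "\<mu> \<in> ?A"
  have "(\<Sum>\<xi>\<in>{\<xi>\<in>?A. horizontal_strip \<mu> \<xi> \<and> sum_list \<mu> + k = sum_list \<xi>}. ?u \<mu> * ?g \<xi>)
    = (\<Sum>\<xi>\<in>{\<xi> \<in> partitions_of (sum_list \<mu> + k). horizontal_strip \<mu> \<xi>}. ?u \<mu> * ?g \<xi>)"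
  proof (rule sum.mono_neutral_left)
   show "\<forall>\<xi>\<in>{\<xi> \<in> partitions_of (sum_list \<mu> + k). horizontal_strip \<mu> \<xi>} -
     {\<xi>\<in>?A. horizontal_strip \<mu> \<xi> \<and> sum_list \<mu> + k = sum_list \<xi>}. ?u \<mu> * ?g \<xi> = 0"
    using d by (auto simp: partitions_of_def)
   show "finite {\<xi> \<in> partitions_of (sum_list \<mu> + k). horizontal_strip \<mu> \<xi>}" by simp
  qed (auto simp: partitions_le_def partitions_of_def)
  then show "(\<Sum>\<xi>\<in>{\<xi>\<in>?A. horizontal_strip \<mu> \<xi> \<and> sum_list \<mu> + k = sum_list \<xi>}. ?u \<mu> * ?g \<xi>) = ?u \<mu> * skew_h k ?g \<mu>"
   using \<mu> by (simp add: skew_h_def sum_distrib_left partitions_le_def)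
 qed
 also have "... = hall_inner u (hperp k g)"
 proof -
  have z: "skew_h k ?g \<mu> = 0" if "\<mu> \<notin> ?A" for \<mu>
  proof (cases "is_partition \<mu>")
   case True
   then have "?g \<xi> = 0" if "\<xi> \<in> partitions_of (sum_list \<mu> + k)" for \<xi>
    using that \<open>\<mu> \<notin> ?A\<close> by (intro d) (auto simp: partitions_le_def partitions_of_def)
   then show ?thesis by (simp add: skew_h_def)
  qed (simp add: skew_h_def)
  show ?thesis unfolding sg[symmetric] by (rule hall_inner_eq_sum[symmetric]) (use z sg in auto)
 qed
 finally show ?thesis .
qed

lemma hall_inner_schur:
 assumes "is_partition \<nu>"
 shows "hall_inner (schur \<nu>) g = schur_coeff g \<nu>"
proof -
 have "hall_inner (schur \<nu>) g = (\<Sum>\<mu>\<in>{\<nu>}. schur_coeff (schur \<nu>) \<mu> * schur_coeff g \<mu>)"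
  by (rule hall_inner_eq_sum) (simp_all add: schur_coeff_schur[OF assms])
 then show ?thesis by (simp add: schur_coeff_schur[OF assms])
qed

lemma perp_eqI:
 assumes "g' \<in> Sym" "\<And>u. u \<in> Sym \<Longrightarrow> hall_inner (f * u) g = hall_inner u g'"
 shows "perp f g = g'"
 unfolding perp_def
proof (rule the_equality)
 fix g'' assume g'': "g'' \<in> Sym \<and> (\<forall>u\<in>Sym. hall_inner (f * u) g = hall_inner u g'')"
 show "g'' = g'"
 proof (rule symmetric_eqI_schur_coeff)
  fix \<nu> assume \<nu>: "is_partition \<nu>"
  have "hall_inner (f * schur \<nu>) g = hall_inner (schur \<nu>) g''"
   using g'' schur_in_Sym[OF \<nu>] by blast
  then have "hall_inner (schur \<nu>) g'' = hall_inner (schur \<nu>) g'"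
   using assms(2)[OF schur_in_Sym[OF \<nu>]] by simp
  then show "schur_coeff g'' \<nu> = schur_coeff g' \<nu>" by (simp add: hall_inner_schur[OF \<nu>])
 qed (use g'' assms SymD in auto)
qed (use assms in auto)

lemma perp_hsym: "g \<in> Sym \<Longrightarrow> perp (hsym k) g = hperp k g"
 by (rule perp_eqI) (simp_all add: hperp_in_Sym hall_inner_hsym_times)

section \<open>The adjoint of an elementary symmetric function\<close>

text \<open>The recursion is the adjoint of \<open>e\<^sub>k\<^sub>+\<^sub>1 = \<Sum> (-1)\<^sup>i h\<^sub>i\<^sub>+\<^sub>1 e\<^sub>k\<^sub>-\<^sub>i\<close> (\<open>esym_Suc\<close>).\<close>

fun eperp :: "nat \<Rightarrow> 'a::ring_1 mps \<Rightarrow> 'a mps" where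
 "eperp 0 f = f"
| "eperp (Suc k) f = Abs_mps (\<lambda>\<alpha>. \<Sum>i\<le>k. (-1) ^ i * mcoeff (eperp (k - i) (hperp (Suc i) f)) \<alpha>)"

lemma schur_expansion_linear:
 assumes "finite I" "\<And>i. i \<in> I \<Longrightarrow> symmetric_mps (f i)" "\<And>\<alpha>. mcoeff g \<alpha> = (\<Sum>i\<in>I. c i * mcoeff (f i) \<alpha>)"
 shows "schur_expansion g (\<lambda>\<nu>. \<Sum>i\<in>I. c i * schur_coeff (f i) \<nu>)"
 unfolding schur_expansion_def
proof (intro conjI allI impI)
 fix \<nu> assume "\<not> is_partition \<nu>"
 then show "(\<Sum>i\<in>I. c i * schur_coeff (f i) \<nu>) = 0"
  using assms(2) by (intro sum.neutral) (simp add: schur_coeff_nonpartition)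
next
 fix \<alpha>
 have "mcoeff g \<alpha> = (\<Sum>i\<in>I. \<Sum>\<nu>\<in>partitions_of (mdeg \<alpha>). c i * schur_coeff (f i) \<nu> * of_nat (kostka \<nu> \<alpha>))"
  unfolding assms(3)
  by (intro sum.cong refl) (simp add: mcoeff_schur_coeff[OF assms(2)] sum_distrib_left mult.assoc)
 also have "... = (\<Sum>\<nu>\<in>partitions_of (mdeg \<alpha>). (\<Sum>i\<in>I. c i * schur_coeff (f i) \<nu>) * of_nat (kostka \<nu> \<alpha>))"
  by (subst sum.swap) (simp add: sum_distrib_right)
 finally show "mcoeff g \<alpha> = (\<Sum>\<nu>\<in>partitions_of (mdeg \<alpha>). (\<Sum>i\<in>I. c i * schur_coeff (f i) \<nu>) * of_nat (kostka \<nu> \<alpha>))" .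
qed

lemma symmetric_eperp: "symmetric_mps f \<Longrightarrow> symmetric_mps (eperp k f)"
proof (induction k arbitrary: f rule: less_induct)
 case (less k)
 show ?case
 proof (cases k)
  case (Suc k')
  have "schur_expansion (eperp k f) (\<lambda>\<nu>. \<Sum>i\<le>k'. (-1) ^ i * schur_coeff (eperp (k' - i) (hperp (Suc i) f)) \<nu>)"
   using Suc by (intro schur_expansion_linear less.IH symmetric_hperp less.prems) auto
  then show ?thesis by (rule schur_expansion_symmetric)
 qed (use less.prems in simp)
qed

lemma eperp_in_Sym: "f \<in> Sym \<Longrightarrow> eperp k f \<in> Sym"
proof (induction k arbitrary: f rule: less_induct)
 case (less k)
 show ?case
 proof (cases k)
  case (Suc k')
  have "\<forall>i\<in>{..k'}. \<exists>d. \<forall>\<alpha>. mcoeff (eperp (k' - i) (hperp (Suc i) f)) \<alpha> \<noteq> 0 \<longrightarrow> mdeg \<alpha> \<le> d"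
   using less.IH[OF _ hperp_in_Sym[OF less.prems]] Suc unfolding Sym_def by fastforce
  then obtain d where d: "\<And>i \<alpha>. i \<le> k' \<Longrightarrow> mcoeff (eperp (k' - i) (hperp (Suc i) f)) \<alpha> \<noteq> 0 \<Longrightarrow> mdeg \<alpha> \<le> d i"
   by (metis atMost_iff)
  show ?thesis
  proof (rule SymI[of _ "\<Sum>i\<le>k'. d i"])
   show "symmetric_mps (eperp k f)" by (intro symmetric_eperp SymD less.prems)
   fix \<alpha> assume "mcoeff (eperp k f) \<alpha> \<noteq> 0"
   then obtain i where "i \<le> k'" "mcoeff (eperp (k' - i) (hperp (Suc i) f)) \<alpha> \<noteq> 0"
    unfolding Suc by (auto elim: sum.not_neutral_contains_not_neutral)
   then have "mdeg \<alpha> \<le> d i" by (rule d)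
   also have "... \<le> (\<Sum>i\<le>k'. d i)" using \<open>i \<le> k'\<close> by (intro member_le_sum) auto
   finally show "mdeg \<alpha> \<le> (\<Sum>i\<le>k'. d i)" .
  qed
 qed (use less.prems in simp)
qed

text \<open>Moving one copy of a fixed variable of \<open>\<alpha>\<close> between the two factors is a sign-reversing involution.\<close>

lemma alternating_splits:
 assumes "\<alpha> \<noteq> 0"
 shows "(\<Sum>p\<in>splits \<alpha>. if \<forall>i. lookup (snd p) i \<le> 1 then (-1) ^ mdeg (fst p) else 0 :: 'a::ring_1) = 0"
proof -
 obtain N where N: "lookup \<alpha> N \<noteq> 0"
  using assms by (metis lookup_zero poly_mapping_eqI)
 define j where "j = lookup \<alpha> N"
 define \<alpha>' where "\<alpha>' = \<alpha> - single N j"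
 have \<alpha>: "\<alpha> = \<alpha>' + single N j"
  by (rule poly_mapping_eqI) (auto simp: \<alpha>'_def j_def lookup_add lookup_minus lookup_single when_def)
 have l0: "lookup \<alpha>' N = 0" by (simp add: \<alpha>'_def j_def lookup_minus)
 have j: "1 \<le> j" using N by (simp add: j_def)
 let ?P = "\<lambda>m :: monom. \<forall>i. lookup m i \<le> 1"
 have P: "?P (snd q + single N i) \<longleftrightarrow> ?P (snd q) \<and> i \<le> 1" if "q \<in> splits \<alpha>'" for q i
 proof -
  have "lookup (snd q) N = 0"
   using that l0 by (auto simp: splits_def lookup_add)
  then have "lookup (snd q + single N i) v = (if v = N then i else lookup (snd q) v)" for v
   by (simp add: lookup_add lookup_single when_def)
  then show ?thesis using \<open>lookup (snd q) N = 0\<close> by (auto split: if_splits)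
 qed
 have "(\<Sum>p\<in>splits \<alpha>. if ?P (snd p) then (-1) ^ mdeg (fst p) else 0 :: 'a)
   = (\<Sum>i\<le>j. \<Sum>q\<in>splits \<alpha>'. if ?P (snd q + single N i) then (-1) ^ mdeg (fst q + single N (j - i)) else 0)"
  unfolding \<alpha> by (rule sum_splits_add_single[OF l0, where F = "\<lambda>a b. if ?P b then (-1) ^ mdeg a else 0"])
 also have "... = (\<Sum>q\<in>splits \<alpha>'. \<Sum>i\<le>j. if ?P (snd q) then (if i \<le> 1 then (-1) ^ (mdeg (fst q) + (j - i)) else 0) else 0)"
 proof (subst sum.swap, intro sum.cong refl)
  fix q i assume q: "q \<in> splits \<alpha>'"
  show "(if ?P (snd q + single N i) then (-1) ^ mdeg (fst q + single N (j - i)) else 0 :: 'a)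
   = (if ?P (snd q) then (if i \<le> 1 then (-1) ^ (mdeg (fst q) + (j - i)) else 0) else 0)"
   by (cases "?P (snd q)"; cases "i \<le> 1"; simp only: P[OF q] mdeg_add mdeg_single if_True if_False simp_thms)
 qed
 also have "... = 0"
 proof (rule sum.neutral, rule ballI)
  fix q :: "monom \<times> monom"
  have "(\<Sum>i\<le>j. if i \<le> 1 then (-1) ^ (mdeg (fst q) + (j - i)) else 0 :: 'a) = (\<Sum>i\<in>{0, 1}. (-1) ^ (mdeg (fst q) + (j - i)))"
   using j by (intro sum.mono_neutral_cong_right) auto
  also have "... = 0" using j by (cases j) (simp_all add: power_add)
  finally have "(\<Sum>i\<le>j. if i \<le> 1 then (-1) ^ (mdeg (fst q) + (j - i)) else 0 :: 'a) = 0" .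
  then show "(\<Sum>i\<le>j. if ?P (snd q) then (if i \<le> 1 then (-1) ^ (mdeg (fst q) + (j - i)) else 0) else 0 :: 'a) = 0"
   by (cases "?P (snd q)") (simp_all only: if_True if_False sum.neutral_const simp_thms)
 qed
 finally show ?thesis .
qed

lemma mcoeff_esym: "mcoeff (esym k) \<alpha> = (if mdeg \<alpha> = k \<and> (\<forall>i. lookup \<alpha> i \<le> 1) then 1 else 0)"
 by (simp add: esym_def)

lemma mcoeff_hsym: "mcoeff (hsym k) \<alpha> = (if mdeg \<alpha> = k then 1 else 0)"
 by (simp add: hsym_def)

lemma esym_0: "esym 0 = 1"
 by (rule mps_eqI) (auto simp: mcoeff_esym one_mps.rep_eq)

lemma hsym_0: "hsym 0 = 1"
 by (rule mps_eqI) (auto simp: mcoeff_hsym one_mps.rep_eq)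

lemma mcoeff_hsym_esym:
 "mcoeff (hsym a * esym b :: 'a::ring_1 mps) \<alpha> = (\<Sum>p\<in>splits \<alpha>.
   if mdeg (fst p) = a \<and> mdeg (snd p) = b \<and> (\<forall>i. lookup (snd p) i \<le> 1) then 1 else 0)"
 unfolding mcoeff_times by (intro sum.cong) (auto simp: mcoeff_hsym mcoeff_esym)

lemma hsym_esym_convolution:
 assumes "n > 0"
 shows "(\<Sum>i\<le>n. (-1) ^ i * mcoeff (hsym i * esym (n - i) :: 'a::ring_1 mps) \<alpha>) = 0"
proof -
 let ?P = "\<lambda>m :: monom. \<forall>i. lookup m i \<le> 1"
 have "(\<Sum>i\<le>n. (-1) ^ i * mcoeff (hsym i * esym (n - i) :: 'a mps) \<alpha>)
   = (\<Sum>p\<in>splits \<alpha>. \<Sum>i\<le>n. if i = mdeg (fst p) then (if mdeg \<alpha> = n \<and> ?P (snd p) then (-1) ^ mdeg (fst p) else 0) else 0)"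
  unfolding mcoeff_hsym_esym sum_distrib_left
 proof (subst sum.swap, intro sum.cong refl)
  fix p i assume p: "p \<in> splits \<alpha>" "i \<in> {..n}"
  have "mdeg \<alpha> = mdeg (fst p) + mdeg (snd p)" using p(1) by (auto simp: splits_def)
  then have "(mdeg (fst p) = i \<and> mdeg (snd p) = n - i \<and> ?P (snd p)) \<longleftrightarrow> (i = mdeg (fst p) \<and> mdeg \<alpha> = n \<and> ?P (snd p))"
   using p(2) by auto
  then show "(-1) ^ i * (if mdeg (fst p) = i \<and> mdeg (snd p) = n - i \<and> ?P (snd p) then 1 else 0)
   = (if i = mdeg (fst p) then (if mdeg \<alpha> = n \<and> ?P (snd p) then (-1) ^ mdeg (fst p) else 0) else 0 :: 'a)"
   by (cases "i = mdeg (fst p)"; cases "mdeg \<alpha> = n \<and> ?P (snd p)") (simp_all only: if_True if_False simp_thms mult_1_right mult_zero_right)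
 qed
 also have "... = (\<Sum>p\<in>splits \<alpha>. if mdeg \<alpha> = n \<and> ?P (snd p) then (-1) ^ mdeg (fst p) else 0)"
 proof (rule sum.cong[OF refl])
  fix p assume "p \<in> splits \<alpha>"
  then have "mdeg (fst p) \<le> mdeg \<alpha>" by (auto simp: splits_def)
  then show "(\<Sum>i\<le>n. if i = mdeg (fst p) then (if mdeg \<alpha> = n \<and> ?P (snd p) then (-1) ^ mdeg (fst p) else 0) else 0)
   = (if mdeg \<alpha> = n \<and> ?P (snd p) then (-1) ^ mdeg (fst p) else 0 :: 'a)"
   by (simp only: sum.delta[OF finite_atMost]) auto
 qed
 also have "... = (if mdeg \<alpha> = n then (\<Sum>p\<in>splits \<alpha>. if ?P (snd p) then (-1) ^ mdeg (fst p) else 0) else 0)"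
  by simp
 also have "... = 0"
  using alternating_splits[of \<alpha>, where 'a = 'a] assms by (cases "\<alpha> = 0") auto
 finally show ?thesis .
qed

lemma mcoeff_minus: "mcoeff (- f) \<alpha> = - mcoeff f \<alpha>"
 by (simp add: uminus_mps.rep_eq)

lemma mcoeff_signed: "mcoeff ((-1) ^ i * f) \<alpha> = (-1) ^ i * mcoeff (f :: 'a::ring_1 mps) \<alpha>"
 by (cases "even i") (simp_all add: mcoeff_minus)

lemma mcoeff_esym_Suc:
 "mcoeff (esym (Suc k) :: 'a::ring_1 mps) \<alpha> = (\<Sum>i\<le>k. (-1) ^ i * mcoeff (hsym (Suc i) * esym (k - i)) \<alpha>)"
proof -
 have "0 = (\<Sum>i\<le>Suc k. (-1) ^ i * mcoeff (hsym i * esym (Suc k - i) :: 'a mps) \<alpha>)"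
  by (rule hsym_esym_convolution[symmetric]) simp
 also have "... = mcoeff (esym (Suc k)) \<alpha> + (\<Sum>i\<le>k. (-1) ^ Suc i * mcoeff (hsym (Suc i) * esym (k - i) :: 'a mps) \<alpha>)"
  by (subst sum.atMost_Suc_shift) (simp add: hsym_0)
 also have "(\<Sum>i\<le>k. (-1) ^ Suc i * mcoeff (hsym (Suc i) * esym (k - i) :: 'a mps) \<alpha>) =
   - (\<Sum>i\<le>k. (-1) ^ i * mcoeff (hsym (Suc i) * esym (k - i) :: 'a mps) \<alpha>)"
  by (simp add: sum_negf)
 finally show ?thesis by simp
qed

lemma esym_Suc:
 "(esym (Suc k) :: 'a::ring_1 mps) = (\<Sum>i\<le>k. (-1) ^ i * (hsym (Suc i) * esym (k - i)))"
 by (rule mps_eqI) (simp only: mcoeff_sum mcoeff_signed mcoeff_esym_Suc)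

lemma hall_inner_linear_left:
 assumes "finite I" "\<And>i. i \<in> I \<Longrightarrow> f i \<in> Sym" "g \<in> Sym" "\<And>\<alpha>. mcoeff h \<alpha> = (\<Sum>i\<in>I. c i * mcoeff (f i) \<alpha>)"
 shows "hall_inner h g = (\<Sum>i\<in>I. c i * hall_inner (f i) g)"
proof -
 obtain d where d: "\<And>\<nu>. \<nu> \<notin> partitions_le d \<Longrightarrow> schur_coeff g \<nu> = 0"
  using schur_coeff_Sym[OF assms(3)] by blast
 have "schur_expansion h (\<lambda>\<nu>. \<Sum>i\<in>I. c i * schur_coeff (f i) \<nu>)"
  using assms by (intro schur_expansion_linear) (auto dest: SymD)
 then have s: "schur_coeff h \<nu> = (\<Sum>i\<in>I. c i * schur_coeff (f i) \<nu>)" for \<nu>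
  by (simp add: schur_coeff_eqI)
 have "hall_inner h g = (\<Sum>\<nu>\<in>partitions_le d. (\<Sum>i\<in>I. c i * schur_coeff (f i) \<nu>) * schur_coeff g \<nu>)"
  unfolding s[symmetric] using d by (intro hall_inner_eq_sum) auto
 also have "... = (\<Sum>i\<in>I. c i * (\<Sum>\<nu>\<in>partitions_le d. schur_coeff (f i) \<nu> * schur_coeff g \<nu>))"
  unfolding sum_distrib_right sum_distrib_left by (subst sum.swap) (simp add: mult.assoc)
 also have "... = (\<Sum>i\<in>I. c i * hall_inner (f i) g)"
  using d by (intro sum.cong refl arg_cong2[where f = "(*)"] hall_inner_eq_sum[symmetric]) auto
 finally show ?thesis .
qed

lemma hall_inner_linear_right:
 assumes "finite I" "\<And>i. i \<in> I \<Longrightarrow> f i \<in> Sym" "g \<in> Sym" "\<And>\<alpha>. mcoeff h \<alpha> = (\<Sum>i\<in>I. c i * mcoeff (f i) \<alpha>)"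
 shows "hall_inner g h = (\<Sum>i\<in>I. c i * hall_inner g (f i))"
proof -
 have "hall_inner g h = hall_inner h g" for g h :: "complex mps"
  unfolding hall_inner_def by (intro sum.cong) (auto simp: mult.commute)
 then show ?thesis using hall_inner_linear_left[OF assms] by simp
qed

lemma hall_inner_esym_times:
 assumes "u \<in> Sym" "g \<in> Sym"
 shows "hall_inner (esym k * u) g = hall_inner u (eperp k g)"
 using assms
proof (induction k arbitrary: u g rule: less_induct)
 case (less k)
 show ?case
 proof (cases k)
  case 0
  then show ?thesis by (simp add: esym_0)
 next
  case (Suc k')
  have "hall_inner (esym k * u) g = (\<Sum>i\<le>k'. (-1) ^ i * hall_inner (hsym (Suc i) * (esym (k' - i) * u)) g)"
  proof (rule hall_inner_linear_left)
   fix \<alpha>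
   have "esym k * u = (\<Sum>i\<le>k'. (-1) ^ i * (hsym (Suc i) * (esym (k' - i) * u)))"
    unfolding Suc esym_Suc sum_distrib_right by (simp add: mult.assoc)
   then show "mcoeff (esym k * u) \<alpha> = (\<Sum>i\<le>k'. (-1) ^ i * mcoeff (hsym (Suc i) * (esym (k' - i) * u)) \<alpha>)"
    by (simp only: mcoeff_sum mcoeff_signed)
  qed (use less.prems in \<open>auto intro!: times_in_Sym hsym_in_Sym esym_in_Sym\<close>)
  also have "... = (\<Sum>i\<le>k'. (-1) ^ i * hall_inner u (eperp (k' - i) (hperp (Suc i) g)))"
  proof (intro sum.cong refl arg_cong2[where f = "(*)"])
   fix i
   have "hall_inner (hsym (Suc i) * (esym (k' - i) * u)) g = hall_inner (esym (k' - i) * u) (hperp (Suc i) g)"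
    using less.prems by (intro hall_inner_hsym_times times_in_Sym esym_in_Sym)
   also have "... = hall_inner u (eperp (k' - i) (hperp (Suc i) g))"
    using less.prems Suc by (intro less.IH hperp_in_Sym) auto
   finally show "hall_inner (hsym (Suc i) * (esym (k' - i) * u)) g = hall_inner u (eperp (k' - i) (hperp (Suc i) g))" .
  qed
  also have "... = hall_inner u (eperp k g)"
   using less.prems Suc
   by (intro hall_inner_linear_right[symmetric]) (auto intro: eperp_in_Sym hperp_in_Sym)
  finally show ?thesis .
 qed
qed

lemma perp_esym: "g \<in> Sym \<Longrightarrow> perp (esym k) g = eperp k g"
 by (rule perp_eqI) (simp_all add: eperp_in_Sym hall_inner_esym_times)

section \<open>Extending the adjoints to other coefficients\<close>

lemma of_complex_0 [simp]: "of_complex 0 = 0"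
 using of_complex_add[of 0 0] by simp

lemma of_complex_minus: "of_complex (- x) = - of_complex x"
 using of_complex_add[of x "- x"] by (simp add: eq_neg_iff_add_eq_0 add.commute)

lemma of_complex_sum: "of_complex (\<Sum>i\<in>I. f i) = (\<Sum>i\<in>I. of_complex (f i))"
 by (induction I rule: infinite_finite_induct) (simp_all add: of_complex_add)

lemma of_complex_of_nat: "of_complex (of_nat n) = of_nat n"
 by (induction n) (simp_all add: of_complex_add of_complex_1)

lemma of_complex_power: "of_complex (x ^ n) = of_complex x ^ n"
 by (induction n) (simp_all add: of_complex_mult of_complex_1)

lemma signed_commute: "(-1) ^ i * (x :: 'a::ring_1) = x * (-1) ^ i"
 by (cases "even i") simp_all

lemma eperp_linear:
 fixes f :: "'a::complex_algebra_1 mps" and g :: "'i \<Rightarrow> complex mps"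
 assumes "\<And>\<gamma>. mdeg \<gamma> = mdeg \<alpha> + k \<Longrightarrow> mcoeff f \<gamma> = (\<Sum>i\<in>I. c i * of_complex (mcoeff (g i) \<gamma>))"
 shows "mcoeff (eperp k f) \<alpha> = (\<Sum>i\<in>I. c i * of_complex (mcoeff (eperp k (g i)) \<alpha>))"
 using assms
proof (induction k arbitrary: f g \<alpha> rule: less_induct)
 case (less k)
 show ?case
 proof (cases k)
  case 0
  then show ?thesis using less.prems[of \<alpha>] by simp
 next
  case (Suc k')
  have IH: "mcoeff (eperp (k' - j) (hperp (Suc j) f)) \<alpha> = (\<Sum>i\<in>I. c i * of_complex (mcoeff (eperp (k' - j) (hperp (Suc j) (g i))) \<alpha>))"
   if "j \<le> k'" for j
   using that Suc by (intro less.IH) (auto simp: mcoeff_hperp less.prems)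
  have "mcoeff (eperp k f) \<alpha> = (\<Sum>j\<le>k'. \<Sum>i\<in>I. (-1) ^ j * (c i * of_complex (mcoeff (eperp (k' - j) (hperp (Suc j) (g i))) \<alpha>)))"
   unfolding Suc by (simp add: IH sum_distrib_left)
  also have "... = (\<Sum>i\<in>I. \<Sum>j\<le>k'. (-1) ^ j * (c i * of_complex (mcoeff (eperp (k' - j) (hperp (Suc j) (g i))) \<alpha>)))"
   by (rule sum.swap)
  also have "... = (\<Sum>i\<in>I. c i * of_complex (mcoeff (eperp k (g i)) \<alpha>))"
  proof (intro sum.cong refl)
   fix i
   have "(\<Sum>j\<le>k'. (-1) ^ j * (c i * of_complex (mcoeff (eperp (k' - j) (hperp (Suc j) (g i))) \<alpha>)))
    = (\<Sum>j\<le>k'. c i * of_complex ((-1) ^ j * mcoeff (eperp (k' - j) (hperp (Suc j) (g i))) \<alpha>))"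
    by (intro sum.cong refl)
      (simp only: of_complex_mult of_complex_power of_complex_minus of_complex_1 signed_commute[of _ "c i * _"]
       signed_commute[of _ "of_complex _"] mult.assoc)
   also have "... = c i * of_complex (mcoeff (eperp k (g i)) \<alpha>)"
    unfolding Suc by (simp add: sum_distrib_left of_complex_sum)
   finally show "(\<Sum>j\<le>k'. (-1) ^ j * (c i * of_complex (mcoeff (eperp (k' - j) (hperp (Suc j) (g i))) \<alpha>)))
    = c i * of_complex (mcoeff (eperp k (g i)) \<alpha>)" .
  qed
  finally show ?thesis .
 qed
qed

lemma mcoeff_schur_expansion_complex:
 "symmetric_mps f \<Longrightarrow> mcoeff f \<gamma> = (\<Sum>\<nu>\<in>partitions_of (mdeg \<gamma>). schur_coeff f \<nu> * of_complex (mcoeff (schur \<nu>) \<gamma>))"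
 by (simp add: mcoeff_schur_coeff mcoeff_schur of_complex_of_nat)

lemma extend_scalars_eqI:
 fixes f :: "'a::complex_algebra_1 mps"
 assumes "\<And>\<nu>. is_partition \<nu> \<Longrightarrow> mcoeff (L (schur \<nu>)) \<alpha> \<noteq> 0 \<Longrightarrow> sum_list \<nu> = n"
  "x = (\<Sum>\<nu>\<in>partitions_of n. schur_coeff f \<nu> * of_complex (mcoeff (L (schur \<nu>)) \<alpha>))"
 shows "mcoeff (extend_scalars L f) \<alpha> = x"
 unfolding extend_scalars_def mcoeff_Abs_mps assms(2)
proof (rule sum.mono_neutral_left)
 show "{\<nu>. is_partition \<nu> \<and> mcoeff (L (schur \<nu>)) \<alpha> \<noteq> 0} \<subseteq> partitions_of n"
  using assms(1) by (auto simp: partitions_of_def)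
qed (auto simp: partitions_of_def finite_partitions)

text \<open>Both sides are linear in the Schur coefficients of \<open>f\<close>, and only those of degree \<open>|\<alpha>| + k\<close>
 contribute to the coefficient of \<open>\<alpha>\<close>.\<close>

lemma extend_scalars_perp_esym:
 fixes f :: "'a::complex_algebra_1 mps"
 assumes "symmetric_mps f"
 shows "mcoeff (extend_scalars (perp (esym k)) f) \<alpha> = mcoeff (eperp k f) \<alpha>"
proof (rule extend_scalars_eqI[where n = "mdeg \<alpha> + k"])
 fix \<nu> assume \<nu>: "is_partition \<nu>" and nz: "mcoeff (perp (esym k) (schur \<nu>)) \<alpha> \<noteq> 0"
 show "sum_list \<nu> = mdeg \<alpha> + k"
 proof (rule ccontr)
  assume ne: "sum_list \<nu> \<noteq> mdeg \<alpha> + k"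
  have "mcoeff (eperp k (schur \<nu>)) \<alpha> = (\<Sum>i\<in>({} :: nat set). 0 * of_complex (mcoeff (eperp k (0 :: complex mps)) \<alpha>) :: complex)"
   using ne kostka_degree[of \<nu>] by (intro eperp_linear) (force simp: mcoeff_schur)
  with nz show False by (simp add: perp_esym schur_in_Sym \<nu>)
 qed
next
 have "mcoeff (eperp k f) \<alpha> = (\<Sum>\<nu>\<in>partitions_of (mdeg \<alpha> + k). schur_coeff f \<nu> * of_complex (mcoeff (eperp k (schur \<nu>)) \<alpha>))"
  by (rule eperp_linear) (simp add: mcoeff_schur_expansion_complex[OF assms])
 also have "... = (\<Sum>\<nu>\<in>partitions_of (mdeg \<alpha> + k). schur_coeff f \<nu> * of_complex (mcoeff (perp (esym k) (schur \<nu>)) \<alpha>))"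
  by (intro sum.cong refl) (simp add: perp_esym schur_in_Sym partitions_of_def)
 finally show "mcoeff (eperp k f) \<alpha> = (\<Sum>\<nu>\<in>partitions_of (mdeg \<alpha> + k). schur_coeff f \<nu> * of_complex (mcoeff (perp (esym k) (schur \<nu>)) \<alpha>))" .
qed

lemma extend_scalars_perp_hsym:
 fixes f :: "'a::complex_algebra_1 mps"
 assumes "symmetric_mps f"
 shows "mcoeff (extend_scalars (perp (hsym k)) f) \<alpha> = mcoeff (hperp k f) \<alpha>"
proof (rule extend_scalars_eqI[where n = "mdeg \<alpha> + k"])
 fix \<nu> assume \<nu>: "is_partition \<nu>" and nz: "mcoeff (perp (hsym k) (schur \<nu>)) \<alpha> \<noteq> 0"
 then show "sum_list \<nu> = mdeg \<alpha> + k"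
  using kostka_degree[of \<nu> "\<alpha> + single (fresh \<alpha>) k"]
  by (simp add: perp_hsym schur_in_Sym mcoeff_hperp mcoeff_schur)
next
 show "mcoeff (hperp k f) \<alpha> = (\<Sum>\<nu>\<in>partitions_of (mdeg \<alpha> + k). schur_coeff f \<nu> * of_complex (mcoeff (perp (hsym k) (schur \<nu>)) \<alpha>))"
  unfolding mcoeff_hperp mcoeff_schur_expansion_complex[OF assms]
  by (intro sum.cong) (simp_all add: perp_hsym schur_in_Sym partitions_of_def mcoeff_hperp)
qed

section \<open>Partial fractions\<close>

text \<open>With \<open>r d e = 1 / (c\<^sub>d - c\<^sub>e)\<close> the hypotheses are the partial fraction relations. They make a product of
 distinct \<open>y\<^sub>e\<close> a linear combination of the \<open>y\<^sub>e\<close>. The coefficient of \<open>y\<^sub>d\<close> arises by replacing every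
 other \<open>y\<^sub>e\<close> by \<open>r d e\<close>, its value at the pole of \<open>y\<^sub>d\<close>.\<close>

lemma prod_add_expand:
 fixes b y :: "'i \<Rightarrow> 'a::comm_ring_1"
 assumes "finite A"
  and anti: "\<And>d e. d \<in> A \<Longrightarrow> e \<in> A \<Longrightarrow> d \<noteq> e \<Longrightarrow> r e d = - r d e"
  and rr: "\<And>x d e. x \<in> A \<Longrightarrow> d \<in> A \<Longrightarrow> e \<in> A \<Longrightarrow> x \<noteq> d \<Longrightarrow> x \<noteq> e \<Longrightarrow> d \<noteq> e \<Longrightarrow> r x d * r x e = r d e * (r x d - r x e)"
  and yy: "\<And>d e. d \<in> A \<Longrightarrow> e \<in> A \<Longrightarrow> d \<noteq> e \<Longrightarrow> y d * y e = r d e * (y d - y e)"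
 shows "(\<Prod>e\<in>A. b e + y e) = (\<Prod>e\<in>A. b e) + (\<Sum>d\<in>A. y d * (\<Prod>e\<in>A - {d}. b e + r d e))"
 using assms
proof (induction A arbitrary: y rule: finite_induct)
 case (insert x A)
 let ?P = "\<lambda>d. \<Prod>e\<in>A - {d}. b e + r d e"
 have IHy: "(\<Prod>e\<in>A. b e + y e) = (\<Prod>e\<in>A. b e) + (\<Sum>d\<in>A. y d * ?P d)"
  by (intro insert.IH insert.prems) auto
 have IHr: "(\<Prod>e\<in>A. b e + r x e) = (\<Prod>e\<in>A. b e) + (\<Sum>d\<in>A. r x d * ?P d)"
  using insert.hyps by (intro insert.IH insert.prems) auto
 have P: "(\<Prod>e\<in>insert x A - {d}. b e + r d e) = (b x + r d x) * ?P d" if "d \<in> A" for d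
 proof -
  have "insert x A - {d} = insert x (A - {d})" using that insert.hyps by auto
  then show ?thesis using insert.hyps by simp
 qed
 have step: "(b x + y x) * (y d * ?P d) = y d * ((b x + r d x) * ?P d) + y x * (r x d * ?P d)" if "d \<in> A" for d
 proof -
  have "y d * y x = r d x * (y d - y x)" "r x d = - r d x"
   using that insert.hyps by (intro insert.prems; blast)+
  then have "(b x + y x) * y d = y d * (b x + r d x) + y x * r x d" by (simp add: algebra_simps)
  then have "((b x + y x) * y d) * ?P d = (y d * (b x + r d x) + y x * r x d) * ?P d" by simp
  then show ?thesis by (simp only: distrib_right mult.assoc)
 qed
 have "(\<Prod>e\<in>insert x A. b e + y e) = (b x + y x) * (\<Prod>e\<in>A. b e) + (\<Sum>d\<in>A. (b x + y x) * (y d * ?P d))"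
  using insert.hyps IHy by (simp add: distrib_left sum_distrib_left)
 also have "(\<Sum>d\<in>A. (b x + y x) * (y d * ?P d)) = (\<Sum>d\<in>A. y d * ((b x + r d x) * ?P d)) + y x * (\<Sum>d\<in>A. r x d * ?P d)"
  by (simp add: step sum.distrib sum_distrib_left)
 also have "(\<Sum>d\<in>A. r x d * ?P d) = (\<Prod>e\<in>A. b e + r x e) - (\<Prod>e\<in>A. b e)"
  using IHr by simp
 also have "(b x + y x) * (\<Prod>e\<in>A. b e) + ((\<Sum>d\<in>A. y d * ((b x + r d x) * ?P d)) + y x * ((\<Prod>e\<in>A. b e + r x e) - (\<Prod>e\<in>A. b e)))
  = b x * (\<Prod>e\<in>A. b e) + (y x * (\<Prod>e\<in>A. b e + r x e) + (\<Sum>d\<in>A. y d * ((b x + r d x) * ?P d)))"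
  by (simp add: algebra_simps)
 also have "... = (\<Prod>e\<in>insert x A. b e) + (\<Sum>d\<in>insert x A. y d * (\<Prod>e\<in>insert x A - {d}. b e + r d e))"
 proof -
  have "(\<Sum>d\<in>A. y d * ((b x + r d x) * ?P d)) = (\<Sum>d\<in>A. y d * (\<Prod>e\<in>insert x A - {d}. b e + r d e))"
   by (intro sum.cong refl arg_cong2[where f = "(*)"] P[symmetric])
  moreover have "insert x A - {x} = A" using insert.hyps by auto
  ultimately show ?thesis using insert.hyps by simp
 qed
 finally show ?case .
qed simp

lemma sum_squares_prod_shift:
 fixes b y :: "'i \<Rightarrow> 'a::comm_ring_1"
 assumes "finite A"
  and anti: "\<And>d e. d \<in> A \<Longrightarrow> e \<in> A \<Longrightarrow> d \<noteq> e \<Longrightarrow> r e d = - r d e"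
  and rr: "\<And>x d e. x \<in> A \<Longrightarrow> d \<in> A \<Longrightarrow> e \<in> A \<Longrightarrow> x \<noteq> d \<Longrightarrow> x \<noteq> e \<Longrightarrow> d \<noteq> e \<Longrightarrow> r x d * r x e = r d e * (r x d - r x e)"
  and yy: "\<And>d e. d \<in> A \<Longrightarrow> e \<in> A \<Longrightarrow> d \<noteq> e \<Longrightarrow> y d * y e = r d e * (y d - y e)"
 shows "(\<Sum>e\<in>A. y e * y e * (\<Prod>g\<in>A - {e}. b g + r e g)) = (\<Sum>e\<in>A. y e * y e * (\<Prod>g\<in>A - {e}. b g + y g))"
 using assms
proof (induction A rule: finite_induct)
 case (insert x A)
 let ?P = "\<lambda>d. \<Prod>e\<in>A - {d}. b e + r d e"
 let ?Q = "\<lambda>d. \<Prod>e\<in>A - {d}. b e + y e"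
 have IH: "(\<Sum>e\<in>A. y e * y e * ?P e) = (\<Sum>e\<in>A. y e * y e * ?Q e)"
  by (intro insert.IH insert.prems) auto
 have ey: "(\<Prod>e\<in>A. b e + y e) = (\<Prod>e\<in>A. b e) + (\<Sum>d\<in>A. y d * ?P d)"
  using insert.hyps by (intro prod_add_expand insert.prems) auto
 have er: "(\<Prod>e\<in>A. b e + r x e) = (\<Prod>e\<in>A. b e) + (\<Sum>d\<in>A. r x d * ?P d)"
  using insert.hyps by (intro prod_add_expand insert.prems) auto
 have ins: "insert x A - {d} = insert x (A - {d})" if "d \<in> A" for d
  using that insert.hyps by auto
 have step: "y d * y d * (\<Prod>e\<in>insert x A - {d}. b e + r d e)
   = (b x + y x) * (y d * y d * ?P d) + y x * y x * (y d * ?P d - r x d * ?P d)" if "d \<in> A" for d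
 proof -
  have 1: "y d * y x = r d x * (y d - y x)" "r x d = - r d x"
   using that insert.hyps by (intro insert.prems; blast)+
  have "y d * r d x = y x * y d + y x * r d x" using 1(1) by (simp add: algebra_simps)
  note A = this
  have "y d * y d * r d x = y d * (y d * r d x)" by (simp only: mult.assoc)
  also have "... = y d * (y x * y d + y x * r d x)" by (simp only: A)
  also have "... = y x * y d * y d + y x * (y d * r d x)" by (simp add: distrib_left mult_ac)
  also have "... = y x * y d * y d + y x * (y x * y d + y x * r d x)" by (simp only: A)
  also have "... = y x * y d * y d + y x * y x * (y d - r x d)" unfolding 1(2) by (simp add: algebra_simps)
  finally have 2: "y d * y d * r d x = y x * y d * y d + y x * y x * (y d - r x d)" .
  have "(\<Prod>e\<in>insert x A - {d}. b e + r d e) = (b x + r d x) * ?P d"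
   using insert.hyps by (simp add: ins[OF that])
  then have "y d * y d * (\<Prod>e\<in>insert x A - {d}. b e + r d e) = (b x * (y d * y d) + y d * y d * r d x) * ?P d"
   by (simp add: algebra_simps)
  also have "... = (b x + y x) * (y d * y d * ?P d) + y x * y x * (y d * ?P d - r x d * ?P d)"
   unfolding 2 by (simp add: algebra_simps)
  finally show ?thesis .
 qed
 have "(\<Sum>e\<in>insert x A. y e * y e * (\<Prod>g\<in>insert x A - {e}. b g + r e g))
   = y x * y x * (\<Prod>e\<in>A. b e + r x e) + ((b x + y x) * (\<Sum>e\<in>A. y e * y e * ?P e)
    + y x * y x * ((\<Sum>d\<in>A. y d * ?P d) - (\<Sum>d\<in>A. r x d * ?P d)))"
 proof -
  have ix: "insert x A - {x} = A" using insert.hyps by auto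
  have s: "(\<Sum>e\<in>A. y e * y e * (\<Prod>g\<in>insert x A - {e}. b g + r e g))
   = (\<Sum>d\<in>A. (b x + y x) * (y d * y d * ?P d) + y x * y x * (y d * ?P d - r x d * ?P d))"
   by (intro sum.cong refl step)
  show ?thesis
   unfolding sum.insert[OF insert.hyps] s ix
   by (simp only: sum.distrib sum_distrib_left sum_subtractf right_diff_distrib)
 qed
 also have "... = y x * y x * (\<Prod>e\<in>A. b e + y e) + (b x + y x) * (\<Sum>e\<in>A. y e * y e * ?Q e)"
  unfolding IH ey er by (simp add: algebra_simps)
 also have "... = (\<Sum>e\<in>insert x A. y e * y e * (\<Prod>g\<in>insert x A - {e}. b g + y g))"
 proof -
  have "(b x + y x) * (y d * y d * ?Q d) = y d * y d * (\<Prod>e\<in>insert x A - {d}. b e + y e)" if "d \<in> A" for d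
   using insert.hyps by (simp add: ins[OF that] algebra_simps)
  then have s: "(\<Sum>d\<in>A. (b x + y x) * (y d * y d * ?Q d)) = (\<Sum>d\<in>A. y d * y d * (\<Prod>e\<in>insert x A - {d}. b e + y e))"
   by (intro sum.cong refl)
  have ix: "insert x A - {x} = A" using insert.hyps by auto
  show ?thesis unfolding sum.insert[OF insert.hyps] ix sum_distrib_left s ..
 qed
 finally show ?case .
qed simp

section \<open>Families satisfying the Gaudin recursion\<close>

text \<open>The abstract situation: \<open>r d e\<close> plays the role of \<open>1 / (c\<^sub>d - c\<^sub>e)\<close>, \<open>G d\<close> that of the Gaudin
 Hamiltonian at \<open>d\<close>, and the two recursions determine \<open>f E\<close> from \<open>f D = 1\<close>. Having the recursion on both
 sides is what makes everything commute.\<close>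

locale gaudin_family =
 fixes sc :: "'w::comm_ring_1 \<Rightarrow> 'r::ring_1"
  and D :: "'i set" and r :: "'i \<Rightarrow> 'i \<Rightarrow> 'w" and f :: "'i set \<Rightarrow> 'r" and G :: "'i \<Rightarrow> 'r"
 assumes sc_add: "sc (a + b) = sc a + sc b" and sc_mult: "sc (a * b) = sc a * sc b" and sc_1: "sc 1 = 1"
  and sc_central: "sc a * z = z * sc a"
  and finite_D: "finite D"
  and r_anti: "d \<in> D \<Longrightarrow> e \<in> D \<Longrightarrow> d \<noteq> e \<Longrightarrow> r e d = - r d e"
  and r_mult: "x \<in> D \<Longrightarrow> d \<in> D \<Longrightarrow> e \<in> D \<Longrightarrow> x \<noteq> d \<Longrightarrow> x \<noteq> e \<Longrightarrow> d \<noteq> e \<Longrightarrow> r x d * r x e = r d e * (r x d - r x e)"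
  and f_full: "f D = 1"
  and rec_left: "E \<subseteq> D \<Longrightarrow> d \<in> D - E \<Longrightarrow>
   f E = G d * f (insert d E) + (\<Sum>e\<in>D - insert d E. sc (r d e * r d e) * f (insert e (insert d E)))"
  and rec_right: "E \<subseteq> D \<Longrightarrow> d \<in> D - E \<Longrightarrow>
   f E = f (insert d E) * G d + (\<Sum>e\<in>D - insert d E. sc (r d e * r d e) * f (insert e (insert d E)))"
begin

lemma sc_0 [simp]: "sc 0 = 0"
 using sc_add[of 0 0] by simp

lemma sc_minus: "sc (- a) = - sc a"
 using sc_add[of a "- a"] by (simp add: eq_neg_iff_add_eq_0 add.commute)

lemma sc_diff: "sc (a - b) = sc a - sc b"
 using sc_add[of a "- b"] by (simp add: sc_minus)

lemma sc_sum: "sc (\<Sum>i\<in>I. g i) = (\<Sum>i\<in>I. sc (g i))"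
 by (induction I rule: infinite_finite_induct) (simp_all add: sc_add)

lemma sc_left_commute: "z * (sc a * w) = sc a * (z * w)"
 by (metis mult.assoc sc_central)

text \<open>\<open>f (D - {e}) = G e\<close>, so the two recursions for \<open>f (D - {d, e})\<close> compare \<open>G d * G e\<close> with \<open>G e * G d\<close>.\<close>

lemma G_commutes_G:
 assumes "d \<in> D" "e \<in> D"
 shows "G d * G e = G e * G d"
proof (cases "d = e")
 case False
 have fe: "f (D - {e}) = G e"
 proof -
  have "insert e (D - {e}) = D" using assms by auto
  then show ?thesis using rec_left[of "D - {e}" e] assms by (simp add: f_full)
 qed
 let ?E = "D - {d, e}"
 have "insert d ?E = D - {e}" using assms False by auto
 then show ?thesis
  using rec_left[of ?E d] rec_right[of ?E d] assms by (simp add: fe)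
qed simp

text \<open>The recursion expresses \<open>f E\<close> through \<open>G\<close>, so induction from \<open>E = D\<close> downwards applies.\<close>

lemma commutes_with_f:
 assumes "\<And>d. d \<in> D \<Longrightarrow> z * G d = G d * z" "E \<subseteq> D"
 shows "z * f E = f E * z"
 using assms(2)
proof (induction "card (D - E)" arbitrary: E rule: less_induct)
 case less
 show ?case
 proof (cases "E = D")
  case True
  then show ?thesis by (simp add: f_full)
 next
  case False
  then obtain x where x: "x \<in> D - E" using less.prems by blast
  have sm: "card (D - insert x E) < card (D - E)"
   using x finite_D by (intro psubset_card_mono) auto
  have i1: "z * f (insert x E) = f (insert x E) * z"
   using sm x less.prems by (intro less.hyps) auto
  have i2: "z * f (insert e (insert x E)) = f (insert e (insert x E)) * z" if "e \<in> D - insert x E" for e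
  proof (rule less.hyps)
   have "card (D - insert e (insert x E)) \<le> card (D - insert x E)"
    using finite_D by (intro card_mono) auto
   with sm show "card (D - insert e (insert x E)) < card (D - E)" by simp
  qed (use that x less.prems in auto)
  have "z * (G x * f (insert x E)) = G x * (z * f (insert x E))"
   using assms(1)[of x] x by (simp add: mult.assoc[symmetric])
  then have "z * f E = G x * (z * f (insert x E)) + (\<Sum>e\<in>D - insert x E. sc (r x e * r x e) * (z * f (insert e (insert x E))))"
   unfolding rec_left[OF less.prems x] distrib_left sum_distrib_left
   by (simp add: sc_left_commute)
  also have "... = G x * (f (insert x E) * z) + (\<Sum>e\<in>D - insert x E. sc (r x e * r x e) * (f (insert e (insert x E)) * z))"
   by (simp add: i1 i2)
  also have "... = f E * z"
   unfolding rec_left[OF less.prems x] distrib_right sum_distrib_right by (simp add: mult.assoc)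
  finally show ?thesis .
 qed
qed

lemma G_commutes_f:
 assumes "E \<subseteq> D" "d \<in> D"
 shows "G d * f E = f E * G d"
proof (rule commutes_with_f)
 show "G d * G e = G e * G d" if "e \<in> D" for e by (rule G_commutes_G[OF assms(2) that])
qed (rule assms(1))

lemma f_commutes_f:
 assumes "E \<subseteq> D" "F \<subseteq> D"
 shows "f F * f E = f E * f F"
proof (rule commutes_with_f)
 show "f F * G d = G d * f F" if "d \<in> D" for d by (rule G_commutes_f[OF assms(2) that, symmetric])
qed (rule assms(1))

definition series :: "('i \<Rightarrow> 'w) \<Rightarrow> 'r" where
 "series b = (\<Sum>E\<in>Pow D. sc (\<Prod>e\<in>E. b e) * f E)"

text \<open>The coefficient of \<open>y\<^sub>d\<close> in the series with \<open>b\<close> shifted by \<open>y\<close> (\<open>series_add\<close>).\<close>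

definition residue :: "('i \<Rightarrow> 'i \<Rightarrow> 'w) \<Rightarrow> ('i \<Rightarrow> 'w) \<Rightarrow> 'i \<Rightarrow> 'r" where
 "residue q b d = (\<Sum>E\<in>Pow D. if d \<in> E then sc (\<Prod>e\<in>E - {d}. b e + q d e) * f E else 0)"

lemma series_commute: "series a * series b = series b * series a"
proof -
 have "series a * series b = (\<Sum>E\<in>Pow D. \<Sum>F\<in>Pow D. (sc (prod a E) * f E) * (sc (prod b F) * f F))"
  unfolding series_def by (rule sum_product)
 also have "... = (\<Sum>E\<in>Pow D. \<Sum>F\<in>Pow D. (sc (prod b F) * f F) * (sc (prod a E) * f E))"
 proof (intro sum.cong refl)
  fix E F assume "E \<in> Pow D" "F \<in> Pow D"
  then have ff: "f E * f F = f F * f E" using f_commutes_f by blast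
  have "(sc (prod a E) * f E) * (sc (prod b F) * f F) = sc (prod a E) * (sc (prod b F) * (f E * f F))"
   by (simp add: mult.assoc sc_left_commute[of "f E"])
  also have "... = (sc (prod b F) * f F) * (sc (prod a E) * f E)"
   unfolding ff by (simp add: mult.assoc sc_left_commute[of "f F"] sc_left_commute[of "sc (prod b F)"])
  finally show "(sc (prod a E) * f E) * (sc (prod b F) * f F) = (sc (prod b F) * f F) * (sc (prod a E) * f E)" .
 qed
 also have "... = (\<Sum>F\<in>Pow D. \<Sum>E\<in>Pow D. (sc (prod b F) * f F) * (sc (prod a E) * f E))"
  by (rule sum.swap)
 also have "... = series b * series a"
  unfolding series_def by (rule sum_product[symmetric])
 finally show ?thesis .
qed

lemma G_commutes_residue: "d \<in> D \<Longrightarrow> G d * residue q b e = residue q b e * G d"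
 unfolding residue_def sum_distrib_left sum_distrib_right
 by (intro sum.cong refl) (auto simp: sc_left_commute G_commutes_f mult.assoc)

lemma series_add:
 assumes q: "q = r \<or> q = (\<lambda>d e. - r d e)"
  and yy: "\<And>d e. d \<in> D \<Longrightarrow> e \<in> D \<Longrightarrow> d \<noteq> e \<Longrightarrow> y d * y e = q d e * (y d - y e)"
 shows "series (\<lambda>e. b e + y e) = series b + (\<Sum>d\<in>D. sc (y d) * residue q b d)"
proof -
 have ex: "(\<Prod>e\<in>E. b e + y e) = (\<Prod>e\<in>E. b e) + (\<Sum>d\<in>E. y d * (\<Prod>e\<in>E - {d}. b e + q d e))" if "E \<subseteq> D" for E
 proof (rule prod_add_expand)
  show "finite E" using that finite_D by (rule finite_subset)
  show "q e d = - q d e" if "d \<in> E" "e \<in> E" "d \<noteq> e" for d e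
   using q r_anti[OF subsetD[OF \<open>E \<subseteq> D\<close> that(1)] subsetD[OF \<open>E \<subseteq> D\<close> that(2)] that(3)] by auto
  show "q x d * q x e = q d e * (q x d - q x e)" if "x \<in> E" "d \<in> E" "e \<in> E" "x \<noteq> d" "x \<noteq> e" "d \<noteq> e" for x d e
  proof -
   have "x \<in> D" "d \<in> D" "e \<in> D" using that \<open>E \<subseteq> D\<close> by auto
   from r_mult[OF this that(4-6)] q show ?thesis by (auto simp: algebra_simps)
  qed
  show "y d * y e = q d e * (y d - y e)" if "d \<in> E" "e \<in> E" "d \<noteq> e" for d e
   using yy[of d e] that \<open>E \<subseteq> D\<close> by auto
 qed
 have "series (\<lambda>e. b e + y e) = series b + (\<Sum>E\<in>Pow D. \<Sum>d\<in>E. sc (y d) * (sc (\<Prod>e\<in>E - {d}. b e + q d e) * f E))"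
  unfolding series_def
  by (subst sum.distrib[symmetric], intro sum.cong refl)
    (simp add: ex sc_add sc_sum sc_mult distrib_right sum_distrib_right mult.assoc)
 also have "(\<Sum>E\<in>Pow D. \<Sum>d\<in>E. sc (y d) * (sc (\<Prod>e\<in>E - {d}. b e + q d e) * f E))
   = (\<Sum>E\<in>Pow D. \<Sum>d\<in>D. sc (y d) * (if d \<in> E then sc (\<Prod>e\<in>E - {d}. b e + q d e) * f E else 0))"
  by (intro sum.cong refl sum.mono_neutral_cong_left) (auto simp: finite_D)
 also have "... = (\<Sum>d\<in>D. sc (y d) * residue q b d)"
  unfolding residue_def sum_distrib_left by (rule sum.swap)
 finally show ?thesis .
qed

lemma sum_Pow_split:
 assumes "d \<in> D"
 shows "(\<Sum>E\<in>Pow D. h E) = (\<Sum>F\<in>Pow (D - {d}). h F) + (\<Sum>F\<in>Pow (D - {d}). h (insert d F) :: 'r)"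
proof -
 have "Pow D = Pow (D - {d}) \<union> insert d ` Pow (D - {d})"
  using Pow_insert[of d "D - {d}"] assms by (simp add: insert_absorb)
 moreover have "inj_on (insert d) (Pow (D - {d}))" by (auto simp: inj_on_def)
 moreover have "sum h (Pow (D - {d}) \<union> insert d ` Pow (D - {d})) = sum h (Pow (D - {d})) + sum h (insert d ` Pow (D - {d}))"
  using finite_D by (intro sum.union_disjoint) auto
 ultimately show ?thesis by (simp add: sum.reindex)
qed

text \<open>The recursion for \<open>f\<close>, multiplied by the products over \<open>E\<close> and summed: the shift of \<open>b\<close> inside the
 residues produces the quadratic terms of the recursion.\<close>

lemma series_residue:
 assumes q: "q = r \<or> q = (\<lambda>d e. - r d e)" and d: "d \<in> D"
 shows "series b + (\<Sum>e\<in>D - {d}. sc (q d e) * residue q b e) = sc (b d) * residue q b d + G d * residue q b d"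
proof -
 let ?D = "D - {d}"
 have qq: "q d e * q d e = r d e * r d e" for e using q by auto
 have anti: "q e x = - q x e" if "x \<in> D" "e \<in> D" "x \<noteq> e" for x e
  using q r_anti[of x e] that by auto
 have qr: "q x u * q x e = q u e * (q x u - q x e)" if "x \<in> D" "u \<in> D" "e \<in> D" "x \<noteq> u" "x \<noteq> e" "u \<noteq> e" for x u e
  using q r_mult[of x u e] that by (auto simp: algebra_simps)
 have finF: "finite F" if "F \<in> Pow ?D" for F using that finite_D by (auto intro: finite_subset)
 define B where "B F = (\<Prod>g\<in>F. b g + q d g)" for F
 have e1: "B F = (\<Prod>e\<in>F. b e) + (\<Sum>e\<in>F. q d e * (\<Prod>g\<in>F - {e}. b g + q e g))" if "F \<in> Pow ?D" for F
  unfolding B_def using that d by (intro prod_add_expand finF anti qr) auto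
 have e2: "(\<Sum>e\<in>F. q d e * q d e * (\<Prod>g\<in>F - {e}. b g + q e g)) = (\<Sum>e\<in>F. q d e * q d e * B (F - {e}))" if "F \<in> Pow ?D" for F
  unfolding B_def using that d by (intro sum_squares_prod_shift finF anti qr) auto
 have res: "residue q b d = (\<Sum>F\<in>Pow ?D. sc (B F) * f (insert d F))"
 proof -
  have "residue q b d = (\<Sum>F\<in>Pow ?D. 0) + (\<Sum>F\<in>Pow ?D. sc (\<Prod>e\<in>insert d F - {d}. b e + q d e) * f (insert d F))"
   unfolding residue_def sum_Pow_split[OF d] by (intro arg_cong2[where f = "(+)"] sum.cong refl) auto
  also have "(\<Sum>F\<in>Pow ?D. sc (\<Prod>e\<in>insert d F - {d}. b e + q d e) * f (insert d F)) = (\<Sum>F\<in>Pow ?D. sc (B F) * f (insert d F))"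
  proof (rule sum.cong[OF refl])
   fix F assume "F \<in> Pow ?D"
   then have "insert d F - {d} = F" by auto
   then show "sc (\<Prod>e\<in>insert d F - {d}. b e + q d e) * f (insert d F) = sc (B F) * f (insert d F)"
    by (simp add: B_def)
  qed
  finally show ?thesis by simp
 qed
 let ?c = "\<lambda>E. (\<Prod>e\<in>E. b e) + (\<Sum>e\<in>E - {d}. q d e * (\<Prod>g\<in>E - {e}. b g + q e g))"
 have "(\<Sum>e\<in>?D. sc (q d e) * residue q b e) = (\<Sum>E\<in>Pow D. \<Sum>e\<in>?D. sc (q d e) * (if e \<in> E then sc (\<Prod>g\<in>E - {e}. b g + q e g) * f E else 0))"
  unfolding residue_def sum_distrib_left by (rule sum.swap)
 also have "... = (\<Sum>E\<in>Pow D. \<Sum>e\<in>E - {d}. sc (q d e) * (sc (\<Prod>g\<in>E - {e}. b g + q e g) * f E))"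
  by (intro sum.cong refl sum.mono_neutral_cong_right) (auto simp: finite_D)
 finally have "series b + (\<Sum>e\<in>?D. sc (q d e) * residue q b e) = (\<Sum>E\<in>Pow D. sc (?c E) * f E)"
  unfolding series_def by (simp add: sc_add sc_sum sc_mult distrib_right sum_distrib_right mult.assoc sum.distrib)
 also have "... = (\<Sum>F\<in>Pow ?D. sc (?c F) * f F) + (\<Sum>F\<in>Pow ?D. sc (?c (insert d F)) * f (insert d F))"
  by (rule sum_Pow_split[OF d])
 also have "(\<Sum>F\<in>Pow ?D. sc (?c F) * f F) = (\<Sum>F\<in>Pow ?D. sc (B F) * f F)"
 proof (rule sum.cong[OF refl])
  fix F assume F: "F \<in> Pow ?D"
  then have "F - {d} = F" by auto
  then show "sc (?c F) * f F = sc (B F) * f F" by (simp add: e1[OF F])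
 qed
 also have "(\<Sum>F\<in>Pow ?D. sc (?c (insert d F)) * f (insert d F))
   = (\<Sum>F\<in>Pow ?D. sc (b d * B F) * f (insert d F)) - (\<Sum>F\<in>Pow ?D. sc (\<Sum>e\<in>F. q d e * q d e * B (F - {e})) * f (insert d F))"
  unfolding sum_subtractf[symmetric]
 proof (rule sum.cong[OF refl])
  fix F assume F: "F \<in> Pow ?D"
  then have Fd: "insert d F - {d} = F" "d \<notin> F" by auto
  have pr: "(\<Prod>g\<in>insert d F - {e}. b g + q e g) = (b d + q e d) * (\<Prod>g\<in>F - {e}. b g + q e g)" if "e \<in> F" for e
  proof -
   have "insert d F - {e} = insert d (F - {e})" using that Fd by auto
   then show ?thesis using Fd finF[OF F] by simp
  qed
  have "?c (insert d F) = b d * (\<Prod>e\<in>F. b e) + (\<Sum>e\<in>F. q d e * ((b d + q e d) * (\<Prod>g\<in>F - {e}. b g + q e g)))"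
   using Fd finF[OF F] by (simp add: pr cong: sum.cong)
  also have "(\<Sum>e\<in>F. q d e * ((b d + q e d) * (\<Prod>g\<in>F - {e}. b g + q e g)))
   = (\<Sum>e\<in>F. b d * (q d e * (\<Prod>g\<in>F - {e}. b g + q e g)) - q d e * q d e * (\<Prod>g\<in>F - {e}. b g + q e g))"
  proof (rule sum.cong[OF refl])
   fix e assume "e \<in> F"
   then have "q e d = - q d e" using F d by (intro anti) auto
   then show "q d e * ((b d + q e d) * (\<Prod>g\<in>F - {e}. b g + q e g)) = b d * (q d e * (\<Prod>g\<in>F - {e}. b g + q e g)) - q d e * q d e * (\<Prod>g\<in>F - {e}. b g + q e g)"
    by (simp add: algebra_simps)
  qed
  also have "... = b d * (\<Sum>e\<in>F. q d e * (\<Prod>g\<in>F - {e}. b g + q e g)) - (\<Sum>e\<in>F. q d e * q d e * B (F - {e}))"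
   unfolding sum_subtractf e2[OF F] by (simp add: sum_distrib_left)
  finally have "?c (insert d F) = b d * B F - (\<Sum>e\<in>F. q d e * q d e * B (F - {e}))"
   unfolding e1[OF F] by (simp add: algebra_simps)
  then show "sc (?c (insert d F)) * f (insert d F) = sc (b d * B F) * f (insert d F) - sc (\<Sum>e\<in>F. q d e * q d e * B (F - {e})) * f (insert d F)"
   by (simp only: sc_diff left_diff_distrib)
 qed
 finally have A: "series b + (\<Sum>e\<in>?D. sc (q d e) * residue q b e) =
   (\<Sum>F\<in>Pow ?D. sc (B F) * f F) + ((\<Sum>F\<in>Pow ?D. sc (b d * B F) * f (insert d F)) - (\<Sum>F\<in>Pow ?D. sc (\<Sum>e\<in>F. q d e * q d e * B (F - {e})) * f (insert d F)))" .
 have C1: "(\<Sum>F\<in>Pow ?D. sc (b d * B F) * f (insert d F)) = sc (b d) * residue q b d"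
  unfolding res by (simp add: sum_distrib_left sc_mult mult.assoc)
 have "G d * residue q b d = (\<Sum>F\<in>Pow ?D. sc (B F) * (G d * f (insert d F)))"
  unfolding res by (simp add: sum_distrib_left sc_left_commute)
 also have "... = (\<Sum>F\<in>Pow ?D. sc (B F) * f F - (\<Sum>e\<in>?D - F. sc (q d e * q d e * B F) * f (insert d (insert e F))))"
 proof (rule sum.cong[OF refl])
  fix F assume F: "F \<in> Pow ?D"
  have "D - insert d F = ?D - F" by auto
  then have "G d * f (insert d F) = f F - (\<Sum>e\<in>?D - F. sc (q d e * q d e) * f (insert d (insert e F)))"
  proof -
   have "F \<subseteq> D" "d \<in> D - F" using F d by auto
   note rec_left[OF this]
   then show ?thesis using \<open>D - insert d F = ?D - F\<close> by (simp add: qq insert_commute)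
  qed
  moreover have "sc (B F) * (sc k * z) = sc (k * B F) * z" for k z
   by (metis mult.assoc mult.commute sc_mult)
  ultimately show "sc (B F) * (G d * f (insert d F)) = sc (B F) * f F - (\<Sum>e\<in>?D - F. sc (q d e * q d e * B F) * f (insert d (insert e F)))"
   by (simp only: right_diff_distrib sum_distrib_left)
 qed
 also have "... = (\<Sum>F\<in>Pow ?D. sc (B F) * f F) - (\<Sum>F\<in>Pow ?D. \<Sum>e\<in>?D - F. sc (q d e * q d e * B F) * f (insert d (insert e F)))"
  by (rule sum_subtractf)
 also have "(\<Sum>F\<in>Pow ?D. \<Sum>e\<in>?D - F. sc (q d e * q d e * B F) * f (insert d (insert e F)))
   = (\<Sum>F\<in>Pow ?D. \<Sum>e\<in>F. sc (q d e * q d e * B (F - {e})) * f (insert d F))"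
 proof -
  have "(\<Sum>F\<in>Pow ?D. \<Sum>e\<in>?D - F. sc (q d e * q d e * B F) * f (insert d (insert e F)))
   = (\<Sum>z\<in>Sigma (Pow ?D) (\<lambda>F. ?D - F). sc (q d (snd z) * q d (snd z) * B (fst z)) * f (insert d (insert (snd z) (fst z))))"
   using finite_D by (subst sum.Sigma) (auto simp: case_prod_unfold)
  also have "... = (\<Sum>z\<in>Sigma (Pow ?D) (\<lambda>F. F). sc (q d (snd z) * q d (snd z) * B (fst z - {snd z})) * f (insert d (fst z)))"
   by (rule sum.reindex_bij_witness[where i = "\<lambda>z. (fst z - {snd z}, snd z)" and j = "\<lambda>z. (insert (snd z) (fst z), snd z)"])
     (auto simp: insert_absorb)
  also have "... = (\<Sum>F\<in>Pow ?D. \<Sum>e\<in>F. sc (q d e * q d e * B (F - {e})) * f (insert d F))"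
   using finite_D finF by (subst sum.Sigma) (auto simp: case_prod_unfold)
  finally show ?thesis .
 qed
 also have "... = (\<Sum>F\<in>Pow ?D. sc (\<Sum>e\<in>F. q d e * q d e * B (F - {e})) * f (insert d F))"
  by (simp add: sc_sum sum_distrib_right)
 finally show ?thesis unfolding A C1 by (simp add: algebra_simps)
qed

end

context gaudin_family begin

definition linear_scalars :: "('w \<Rightarrow> 'w) \<Rightarrow> 'w set" where
 "linear_scalars L = {k. \<forall>w. L (k * w) = k * L w}"

lemma scalars_add: "additive L \<Longrightarrow> k \<in> linear_scalars L \<Longrightarrow> l \<in> linear_scalars L \<Longrightarrow> k + l \<in> linear_scalars L"
 by (simp add: linear_scalars_def distrib_right additive.add)

lemma scalars_mult: "k \<in> linear_scalars L \<Longrightarrow> l \<in> linear_scalars L \<Longrightarrow> k * l \<in> linear_scalars L"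
 by (simp add: linear_scalars_def mult.assoc)

lemma scalars_0: "additive L \<Longrightarrow> 0 \<in> linear_scalars L"
 by (simp add: linear_scalars_def additive.zero)

lemma scalars_1: "1 \<in> linear_scalars L"
 by (simp add: linear_scalars_def)

lemma scalars_minus: "additive L \<Longrightarrow> k \<in> linear_scalars L \<Longrightarrow> - k \<in> linear_scalars L"
 by (simp add: linear_scalars_def additive.minus)

lemma scalars_sum: "additive L \<Longrightarrow> (\<And>i. i \<in> I \<Longrightarrow> k i \<in> linear_scalars L) \<Longrightarrow> (\<Sum>i\<in>I. k i) \<in> linear_scalars L"
 by (induction I rule: infinite_finite_induct) (simp_all add: scalars_0 scalars_add)

lemma scalars_prod: "(\<And>i. i \<in> I \<Longrightarrow> k i \<in> linear_scalars L) \<Longrightarrow> (\<Prod>i\<in>I. k i) \<in> linear_scalars L"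
 by (induction I rule: infinite_finite_induct) (simp_all add: scalars_1 scalars_mult)

text \<open>Let \<open>M\<close> and \<open>N\<close> be the series of \<open>b\<close> and \<open>a\<close>, and \<open>M\<^sub>d\<close>, \<open>N\<^sub>d\<close> their residues. After expanding the product
 and linearising \<open>y\<^sub>d y\<^sub>e\<close>, the coefficient of \<open>L(y\<^sub>d)\<close> is
 \<open>M\<^sub>d N - M N\<^sub>d - (a\<^sub>d - b\<^sub>d) M\<^sub>d N\<^sub>d - \<Sum> r\<^sub>d\<^sub>e (M\<^sub>d N\<^sub>e + M\<^sub>e N\<^sub>d)\<close>, summed over \<open>e \<noteq> d\<close>. Substituting \<open>series_residue\<close> for \<open>M\<close> and \<open>N\<close> leaves
 \<open>M\<^sub>d G\<^sub>d N\<^sub>d - G\<^sub>d M\<^sub>d N\<^sub>d = 0\<close>. The map \<open>l\<close> allows the product to be tested one coefficient at a time, so that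
 the scalars form a commutative ring.\<close>

lemma residue_theorem:
 fixes L :: "'w \<Rightarrow> 'w" and l :: "'r \<Rightarrow> 'w"
 assumes L: "additive L" and l: "additive l" and l_sc: "\<And>k z. l (sc k * z) = k * l z"
  and l_ff: "\<And>E F. E \<subseteq> D \<Longrightarrow> F \<subseteq> D \<Longrightarrow> l (f E * f F) \<in> linear_scalars L"
  and r_sc: "\<And>d e. d \<in> D \<Longrightarrow> e \<in> D \<Longrightarrow> r d e \<in> linear_scalars L"
  and b_sc: "\<And>d. d \<in> D \<Longrightarrow> b d \<in> linear_scalars L"
  and a_sc: "\<And>d. d \<in> D \<Longrightarrow> a d \<in> linear_scalars L"
  and yy: "\<And>d e. d \<in> D \<Longrightarrow> e \<in> D \<Longrightarrow> d \<noteq> e \<Longrightarrow> y d * y e = r d e * (y d - y e)"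
  and L1: "L 1 = 0" and Lyy: "\<And>d. d \<in> D \<Longrightarrow> L (y d * y d) = (a d - b d) * L (y d)"
 shows "L (l (series (\<lambda>e. b e + y e) * series (\<lambda>e. a e - y e))) = 0"
proof -
 let ?M = "residue r b" and ?N = "residue (\<lambda>d e. - r d e) a"
 let ?MM = "series b" and ?NN = "series a"
 note l_add = additive.add[OF l] and l_diff = additive.diff[OF l] and l_sum = additive.sum[OF l]
 note L_add = additive.add[OF L] and L_diff = additive.diff[OF L] and L_sum = additive.sum[OF L] and L_minus = additive.minus[OF L]
 have EM: "series (\<lambda>e. b e + y e) = ?MM + (\<Sum>d\<in>D. sc (y d) * ?M d)"
  using yy by (intro series_add) auto
 have EN: "series (\<lambda>e. a e - y e) = ?NN - (\<Sum>d\<in>D. sc (y d) * ?N d)"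
 proof -
  have "series (\<lambda>e. a e + (- y e)) = ?NN + (\<Sum>d\<in>D. sc (- y d) * ?N d)"
   using yy by (intro series_add) (auto simp: algebra_simps)
  then show ?thesis by (simp add: sc_minus sum_negf)
 qed
 have lin: "l ((\<Sum>E\<in>Pow D. sc (u E) * f E) * (\<Sum>F\<in>Pow D. sc (v F) * f F)) \<in> linear_scalars L"
  if "\<And>E. E \<subseteq> D \<Longrightarrow> u E \<in> linear_scalars L" "\<And>E. E \<subseteq> D \<Longrightarrow> v E \<in> linear_scalars L" for u v
 proof -
  have "l ((\<Sum>E\<in>Pow D. sc (u E) * f E) * (\<Sum>F\<in>Pow D. sc (v F) * f F))
   = (\<Sum>E\<in>Pow D. \<Sum>F\<in>Pow D. l ((sc (u E) * f E) * (sc (v F) * f F)))"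
   unfolding sum_product by (simp add: l_sum)
  also have "... = (\<Sum>E\<in>Pow D. \<Sum>F\<in>Pow D. u E * (v F * l (f E * f F)))"
   by (intro sum.cong refl) (simp add: mult.assoc sc_left_commute[of "f _"] l_sc)
  also have "... \<in> linear_scalars L"
   using that l_ff by (intro scalars_sum[OF L] scalars_mult) auto
  finally show ?thesis .
 qed
 have serform: "residue q c d = (\<Sum>E\<in>Pow D. sc (if d \<in> E then \<Prod>e\<in>E - {d}. c e + q d e else 0) * f E)" for q c d
  unfolding residue_def by (intro sum.cong refl) auto
 have c_res: "(if d \<in> E then \<Prod>e\<in>E - {d}. c e + q d e else 0) \<in> linear_scalars L"
  if "\<And>d. d \<in> D \<Longrightarrow> c d \<in> linear_scalars L" "\<And>e. e \<in> D \<Longrightarrow> q d e \<in> linear_scalars L" "E \<subseteq> D" for q c d E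
 proof (cases "d \<in> E")
  case True
  have "(\<Prod>e\<in>E - {d}. c e + q d e) \<in> linear_scalars L"
   by (rule scalars_prod, rule scalars_add[OF L]) (use that in blast)+
  with True show ?thesis by simp
 qed (simp add: scalars_0[OF L])
 have c_ser: "(\<Prod>e\<in>E. c e) \<in> linear_scalars L"
  if "\<And>d. d \<in> D \<Longrightarrow> c d \<in> linear_scalars L" "E \<subseteq> D" for c E
  by (rule scalars_prod) (use that in blast)
 have nr: "- r d e \<in> linear_scalars L" if "d \<in> D" "e \<in> D" for d e
  using r_sc[OF that] by (rule scalars_minus[OF L])
 have c_M: "(if d \<in> E then \<Prod>e\<in>E - {d}. b e + r d e else 0) \<in> linear_scalars L" if "d \<in> D" "E \<subseteq> D" for d E
  by (rule c_res[where c = b and q = r]) (use that b_sc r_sc in blast)+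
 have c_N: "(if d \<in> E then \<Prod>e\<in>E - {d}. a e + (- r d e) else 0) \<in> linear_scalars L" if "d \<in> D" "E \<subseteq> D" for d E
  by (rule c_res[where c = a and q = "\<lambda>d e. - r d e"]) (use that a_sc nr in blast)+
 have m00: "l (?MM * ?NN) \<in> linear_scalars L"
  unfolding series_def by (rule lin; rule c_ser) (use b_sc a_sc in blast)+
 have md0: "l (?M d * ?NN) \<in> linear_scalars L" if "d \<in> D" for d
  unfolding series_def serform by (rule lin, erule c_M[OF that], rule c_ser) (use a_sc in blast)+
 have m0d: "l (?MM * ?N d) \<in> linear_scalars L" if "d \<in> D" for d
  unfolding series_def serform by (rule lin, rule c_ser, use b_sc in blast, assumption, erule c_N[OF that])
 have mde: "l (?M d * ?N e) \<in> linear_scalars L" if "d \<in> D" "e \<in> D" for d e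
  unfolding serform by (rule lin, erule c_M[OF that(1)], erule c_N[OF that(2)])
 have Lk: "L (k * w) = k * L w" if "k \<in> linear_scalars L" for k w
  using that by (simp add: linear_scalars_def)
 have "series (\<lambda>e. b e + y e) * series (\<lambda>e. a e - y e) =
   ?MM * ?NN + (\<Sum>d\<in>D. sc (y d) * (?M d * ?NN)) - (\<Sum>d\<in>D. sc (y d) * (?MM * ?N d))
   - (\<Sum>d\<in>D. \<Sum>e\<in>D. sc (y d * y e) * (?M d * ?N e))"
 proof -
  have 1: "(\<Sum>d\<in>D. sc (y d) * ?M d) * (\<Sum>d\<in>D. sc (y d) * ?N d) = (\<Sum>d\<in>D. \<Sum>e\<in>D. sc (y d * y e) * (?M d * ?N e))"
   unfolding sum_product by (intro sum.cong refl) (simp add: sc_mult mult.assoc sc_left_commute[of "residue r b _"])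
  have 2: "(\<Sum>d\<in>D. sc (y d) * ?M d) * ?NN = (\<Sum>d\<in>D. sc (y d) * (?M d * ?NN))"
   by (simp add: sum_distrib_right mult.assoc)
  have 3: "?MM * (\<Sum>d\<in>D. sc (y d) * ?N d) = (\<Sum>d\<in>D. sc (y d) * (?MM * ?N d))"
   by (simp add: sum_distrib_left sc_left_commute[of "series b"])
  show ?thesis unfolding EM EN distrib_right right_diff_distrib distrib_left 1 2 3
   by (simp add: algebra_simps)
 qed
 then have "l (series (\<lambda>e. b e + y e) * series (\<lambda>e. a e - y e)) =
   l (?MM * ?NN) * 1 + (\<Sum>d\<in>D. l (?M d * ?NN) * y d) - (\<Sum>d\<in>D. l (?MM * ?N d) * y d)
   - (\<Sum>d\<in>D. \<Sum>e\<in>D. l (?M d * ?N e) * (y d * y e))"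
  by (simp add: l_add l_diff l_sum l_sc mult.commute)
 then have "L (l (series (\<lambda>e. b e + y e) * series (\<lambda>e. a e - y e))) =
   (\<Sum>d\<in>D. l (?M d * ?NN) * L (y d)) - (\<Sum>d\<in>D. l (?MM * ?N d) * L (y d))
   - (\<Sum>d\<in>D. \<Sum>e\<in>D. l (?M d * ?N e) * L (y d * y e))"
  by (simp only: L_add L_diff L_sum Lk[OF m00] L1) (simp add: Lk md0 m0d mde)
 also have "(\<Sum>d\<in>D. \<Sum>e\<in>D. l (?M d * ?N e) * L (y d * y e))
   = (\<Sum>d\<in>D. L (y d) * ((a d - b d) * l (?M d * ?N d) + (\<Sum>e\<in>D - {d}. r d e * (l (?M d * ?N e) + l (?M e * ?N d)))))"
 proof -
  have "(\<Sum>d\<in>D. \<Sum>e\<in>D. l (?M d * ?N e) * L (y d * y e))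
   = (\<Sum>d\<in>D. l (?M d * ?N d) * L (y d * y d) + (\<Sum>e\<in>D - {d}. l (?M d * ?N e) * L (y d * y e)))"
   by (intro sum.cong refl) (rule sum.remove[OF finite_D])
  also have "... = (\<Sum>d\<in>D. L (y d) * ((a d - b d) * l (?M d * ?N d))
    + ((\<Sum>e\<in>D - {d}. L (y d) * (r d e * l (?M d * ?N e))) - (\<Sum>e\<in>D - {d}. L (y e) * (r d e * l (?M d * ?N e)))))"
  proof (rule sum.cong[OF refl])
   fix d assume d: "d \<in> D"
   have "l (?M d * ?N e) * L (y d * y e) = L (y d) * (r d e * l (?M d * ?N e)) - L (y e) * (r d e * l (?M d * ?N e))"
    if e: "e \<in> D - {d}" for e
   proof -
    have "y d * y e = r d e * (y d - y e)" using yy[of d e] d e by auto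
    then have "L (y d * y e) = r d e * (L (y d) - L (y e))"
     using Lk[OF r_sc[of d e]] d e by (simp add: L_diff)
    then show ?thesis by (simp only:) (simp add: algebra_simps)
   qed
   then show "l (?M d * ?N d) * L (y d * y d) + (\<Sum>e\<in>D - {d}. l (?M d * ?N e) * L (y d * y e))
     = L (y d) * ((a d - b d) * l (?M d * ?N d))
    + ((\<Sum>e\<in>D - {d}. L (y d) * (r d e * l (?M d * ?N e))) - (\<Sum>e\<in>D - {d}. L (y e) * (r d e * l (?M d * ?N e))))"
    by (simp add: Lyy[OF d] sum_subtractf mult_ac)
  qed
  also have "... = (\<Sum>d\<in>D. L (y d) * ((a d - b d) * l (?M d * ?N d)))
    + ((\<Sum>d\<in>D. \<Sum>e\<in>D - {d}. L (y d) * (r d e * l (?M d * ?N e))) - (\<Sum>d\<in>D. \<Sum>e\<in>D - {d}. L (y e) * (r d e * l (?M d * ?N e))))"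
   by (simp add: sum.distrib sum_subtractf)
  also have "(\<Sum>d\<in>D. \<Sum>e\<in>D - {d}. L (y e) * (r d e * l (?M d * ?N e))) = (\<Sum>d\<in>D. \<Sum>e\<in>D - {d}. L (y d) * (- r d e * l (?M e * ?N d)))"
  proof -
   have "(\<Sum>d\<in>D. \<Sum>e\<in>D - {d}. L (y e) * (r d e * l (?M d * ?N e))) = (\<Sum>d\<in>D. \<Sum>e\<in>{e \<in> D. e \<noteq> d}. L (y e) * (r d e * l (?M d * ?N e)))"
    by (intro sum.cong refl) auto
   also have "... = (\<Sum>e\<in>D. \<Sum>d\<in>{d \<in> D. e \<noteq> d}. L (y e) * (r d e * l (?M d * ?N e)))"
    by (rule sum.swap_restrict[OF finite_D finite_D])
   also have "... = (\<Sum>e\<in>D. \<Sum>d\<in>D - {e}. L (y e) * (- r e d * l (?M d * ?N e)))"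
   proof (intro sum.cong refl)
    fix e d assume "e \<in> D" "d \<in> D - {e}"
    then show "L (y e) * (r d e * l (?M d * ?N e)) = L (y e) * (- r e d * l (?M d * ?N e))"
     using r_anti[of e d] by auto
   qed auto
   finally show ?thesis .
  qed
  finally show ?thesis
   by (simp add: distrib_left sum_distrib_left sum.distrib sum_negf)
 qed
 also have "(\<Sum>d\<in>D. l (?M d * ?NN) * L (y d)) - (\<Sum>d\<in>D. l (?MM * ?N d) * L (y d))
   - (\<Sum>d\<in>D. L (y d) * ((a d - b d) * l (?M d * ?N d) + (\<Sum>e\<in>D - {d}. r d e * (l (?M d * ?N e) + l (?M e * ?N d)))))
   = (\<Sum>d\<in>D. L (y d) * l (?M d * ?NN - ?MM * ?N d - (sc (a d - b d) * (?M d * ?N d)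
     + (\<Sum>e\<in>D - {d}. sc (r d e) * (?M d * ?N e + ?M e * ?N d)))))"
  unfolding sum_subtractf[symmetric]
  by (intro sum.cong refl) (simp add: l_add l_diff l_sum l_sc algebra_simps)
 also have "... = 0"
 proof (rule sum.neutral, rule ballI)
  fix d assume d: "d \<in> D"
  have N0: "?NN = sc (a d) * ?N d + G d * ?N d + (\<Sum>e\<in>D - {d}. sc (r d e) * ?N e)"
   using series_residue[of "\<lambda>d e. - r d e" d a] d by (simp add: sc_minus sum_negf algebra_simps)
  have M0: "?MM = sc (b d) * ?M d + G d * ?M d - (\<Sum>e\<in>D - {d}. sc (r d e) * ?M e)"
   using series_residue[of r d b] d by (simp add: algebra_simps)
  have gm: "?M d * (G d * z) = G d * (?M d * z)" for z
   by (simp only: mult.assoc[symmetric] G_commutes_residue[OF d])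
  have 1: "?M d * ?NN = sc (a d) * (?M d * ?N d) + G d * (?M d * ?N d) + (\<Sum>e\<in>D - {d}. sc (r d e) * (?M d * ?N e))"
   unfolding N0 distrib_left sum_distrib_left
   by (simp only: sc_left_commute[of "residue r b _"] gm)
  have 2: "?MM * ?N d = sc (b d) * (?M d * ?N d) + G d * (?M d * ?N d) - (\<Sum>e\<in>D - {d}. sc (r d e) * (?M e * ?N d))"
   unfolding M0 distrib_right left_diff_distrib sum_distrib_right by (simp add: mult.assoc)
  have "?M d * ?NN - ?MM * ?N d - (sc (a d - b d) * (?M d * ?N d)
     + (\<Sum>e\<in>D - {d}. sc (r d e) * (?M d * ?N e + ?M e * ?N d))) = 0"
   unfolding 1 2 by (simp add: sc_diff left_diff_distrib distrib_left sum.distrib)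
  then show "L (y d) * l (?M d * ?NN - ?MM * ?N d - (sc (a d - b d) * (?M d * ?N d)
     + (\<Sum>e\<in>D - {d}. sc (r d e) * (?M d * ?N e + ?M e * ?N d)))) = 0"
   by (simp only: additive.zero[OF l] mult_zero_right)
 qed
 finally show ?thesis .
qed

end

section \<open>Contracting a point of a permutation\<close>

lemma orbit_subset:
 assumes "a \<in> S" "\<And>x. x \<in> S \<Longrightarrow> act \<sigma> x \<in> S"
 shows "orbit \<sigma> a \<subseteq> S"
proof -
 have "act (\<sigma> ^ n) a \<in> S" for n
  by (induction n) (simp_all add: assms apply_times)
 then show ?thesis by (auto simp: orbit_def)
qed

lemma orbit_closed: "x \<in> orbit \<sigma> a \<Longrightarrow> act \<sigma> x \<in> orbit \<sigma> a"
 using orbit_equiv[of x \<sigma> a] apply_self_in_orbit[of \<sigma> x] by blast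

lemma orbit_eq_iff: "orbit \<sigma> a = orbit \<sigma> b \<longleftrightarrow> a \<in> orbit \<sigma> b"
 by (metis in_orbit_self orbit_equiv)

lemma apply_mem_iff: "affected \<sigma> \<subseteq> X \<Longrightarrow> act \<sigma> x \<in> X \<longleftrightarrow> x \<in> X"
 using apply_affected[of \<sigma> x] in_affected[of x \<sigma>] by (cases "x \<in> affected \<sigma>") auto

lemma orbit_subset_support: "affected \<sigma> \<subseteq> X \<Longrightarrow> a \<in> X \<Longrightarrow> orbit \<sigma> a \<subseteq> X"
 by (rule orbit_subset) (simp_all add: apply_mem_iff)

lemma affected_mult_subset: "affected \<sigma> \<subseteq> X \<Longrightarrow> affected \<tau> \<subseteq> X \<Longrightarrow> affected (\<sigma> * \<tau>) \<subseteq> X"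
 using affected_times[of \<sigma> \<tau>] by blast

lemma affected_swap_subset: "a \<in> X \<Longrightarrow> b \<in> X \<Longrightarrow> affected (swap a b) \<subseteq> X"
 by (cases "a = b") (simp_all add: affected_swap)

lemma fixed_outside: "affected \<sigma> \<subseteq> X \<Longrightarrow> x \<notin> X \<Longrightarrow> act \<sigma> x = x"
 by (auto simp: in_affected)

lemma apply_inverse_cancel [simp]:
 "act \<sigma> (act (inverse \<sigma>) x) = x" "act (inverse \<sigma>) (act \<sigma> x) = x"
 by (simp_all add: apply_sequence)

lemma apply_swap: "act (swap a b) x = (if x = a then b else if x = b then a else x)"
 by (cases "x = a"; cases "x = b") simp_all

lemma perm_mult_swap: "\<sigma> * swap a b = swap (act \<sigma> a) (act \<sigma> b) * \<sigma>"
 by (rule perm_eqI) (auto simp: apply_times apply_swap apply_inj)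

text \<open>Multiplying by the transposition of \<open>w\<close> and its image \<open>x\<close> makes \<open>x\<close> a fixed point and cuts it out of
 its cycle.\<close>

lemma orbit_contract:
 assumes w: "act \<sigma> w = x" and ne: "w \<noteq> x" and i: "i \<noteq> x"
 shows "orbit (\<sigma> * swap w x) i = orbit \<sigma> i - {x}"
proof
 let ?\<tau> = "\<sigma> * swap w x"
 have \<tau>: "act ?\<tau> j = (if j = w then act \<sigma> x else if j = x then x else act \<sigma> j)" for j
  using w by (auto simp: apply_times apply_swap)
 have nx: "act \<sigma> x \<noteq> x" using w ne apply_inj[of \<sigma> x w] by auto
 have nw: "act \<sigma> j \<noteq> x" if "j \<noteq> w" for j using w that apply_inj[of \<sigma> j w] by auto
 show "orbit ?\<tau> i \<subseteq> orbit \<sigma> i - {x}"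
 proof (rule orbit_subset)
  show "i \<in> orbit \<sigma> i - {x}" using i by simp
  fix j assume j: "j \<in> orbit \<sigma> i - {x}"
  show "act ?\<tau> j \<in> orbit \<sigma> i - {x}"
  proof (cases "j = w")
   case True
   then have "act \<sigma> (act \<sigma> w) \<in> orbit \<sigma> i" using j by (intro orbit_closed) auto
   then show ?thesis using True w nx by (simp add: \<tau>)
  next
   case False
   then show ?thesis using j nw[OF False] by (simp add: \<tau> orbit_closed)
  qed
 qed
 have "orbit \<sigma> i \<subseteq> {j. (j \<noteq> x \<and> j \<in> orbit ?\<tau> i) \<or> (j = x \<and> w \<in> orbit ?\<tau> i)}"
 proof (rule orbit_subset)
  show "i \<in> {j. (j \<noteq> x \<and> j \<in> orbit ?\<tau> i) \<or> (j = x \<and> w \<in> orbit ?\<tau> i)}" using i by simp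
  fix j assume j: "j \<in> {j. (j \<noteq> x \<and> j \<in> orbit ?\<tau> i) \<or> (j = x \<and> w \<in> orbit ?\<tau> i)}"
  show "act \<sigma> j \<in> {j. (j \<noteq> x \<and> j \<in> orbit ?\<tau> i) \<or> (j = x \<and> w \<in> orbit ?\<tau> i)}"
  proof (cases "j = x")
   case True
   then have "w \<in> orbit ?\<tau> i" using j by auto
   from orbit_closed[OF this] True nx show ?thesis by (simp add: \<tau>)
  next
   case False
   then have jo: "j \<in> orbit ?\<tau> i" using j by auto
   show ?thesis
   proof (cases "j = w")
    case True
    then show ?thesis using jo w by simp
   next
    case jw: False
    from orbit_closed[OF jo] jw False nw[OF jw] show ?thesis by (simp add: \<tau>)
   qed
  qed
 qed
 then show "orbit \<sigma> i - {x} \<subseteq> orbit ?\<tau> i" by blast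
qed

lemma contract_orbits:
 assumes X: "affected \<sigma> \<subseteq> X" and w: "act \<sigma> w = x" "w \<noteq> x"
 defines "B \<equiv> orbit \<sigma> w" and "Os \<equiv> orbit \<sigma> ` X - {orbit \<sigma> w}"
 shows "w \<in> X" "x \<in> X" "w \<in> B" "x \<in> B" "B \<in> orbit \<sigma> ` X"
  "affected (\<sigma> * swap w x) \<subseteq> X - {x}"
  "orbit (\<sigma> * swap w x) ` (X - {x}) = insert (B - {x}) Os"
  "B - {x} \<notin> Os" "\<And>C. C \<in> Os \<Longrightarrow> C \<inter> B = {}"
proof -
 show wX: "w \<in> X" using fixed_outside[OF X, of w] w by (cases "w \<in> X") auto
 show xX: "x \<in> X" using apply_mem_iff[OF X, of w] w wX by simp
 show "w \<in> B" by (simp add: B_def)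
 show xB: "x \<in> B" using apply_self_in_orbit[of \<sigma> w] w by (simp add: B_def)
 show "B \<in> orbit \<sigma> ` X" using wX by (simp add: B_def)
 show dis: "C \<inter> B = {}" if "C \<in> Os" for C
  using that orbit_disjoint[of \<sigma> _ w] unfolding Os_def B_def by blast
 then show "B - {x} \<notin> Os" using \<open>w \<in> B\<close> w by blast
 show "affected (\<sigma> * swap w x) \<subseteq> X - {x}"
 proof
  fix j assume "j \<in> affected (\<sigma> * swap w x)"
  moreover have "affected (\<sigma> * swap w x) \<subseteq> X"
   by (intro affected_mult_subset X affected_swap_subset wX xX)
  moreover have "act (\<sigma> * swap w x) x = x" using w by (simp add: apply_times)
  ultimately show "j \<in> X - {x}" by (auto simp: in_affected)
 qed
 have "orbit (\<sigma> * swap w x) ` (X - {x}) = (\<lambda>i. orbit \<sigma> i - {x}) ` (X - {x})"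
  using w by (intro image_cong refl) (auto simp: orbit_contract)
 also have "... = insert (B - {x}) Os"
 proof (intro equalityI subsetI)
  fix C assume "C \<in> (\<lambda>i. orbit \<sigma> i - {x}) ` (X - {x})"
  then obtain i where i: "i \<in> X" "i \<noteq> x" "C = orbit \<sigma> i - {x}" by blast
  show "C \<in> insert (B - {x}) Os"
  proof (cases "orbit \<sigma> i = B")
   case False
   then have O: "orbit \<sigma> i \<in> Os" using i(1) by (auto simp: Os_def B_def)
   then have "x \<notin> orbit \<sigma> i" using dis xB by blast
   then show ?thesis using i O by simp
  qed (use i in simp)
 next
  fix C assume C: "C \<in> insert (B - {x}) Os"
  show "C \<in> (\<lambda>i. orbit \<sigma> i - {x}) ` (X - {x})"
  proof (cases "C = B - {x}")
   case True
   then show ?thesis using wX w by (auto simp: B_def)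
  next
   case False
   then obtain i where i: "i \<in> X" "C = orbit \<sigma> i" "C \<in> Os" using C by (auto simp: Os_def)
   then have "x \<notin> C" using dis xB by blast
   then have "i \<noteq> x" "C = orbit \<sigma> i - {x}" using i by auto
   then show ?thesis using i(1) by blast
  qed
 qed
 finally show "orbit (\<sigma> * swap w x) ` (X - {x}) = insert (B - {x}) Os" .
qed

lemma prod_orbits_remove:
 assumes "finite X" "B \<in> orbit \<sigma> ` X"
 shows "(\<Prod>C\<in>orbit \<sigma> ` X. g C) = g B * (\<Prod>C\<in>orbit \<sigma> ` X - {B}. g C)"
 using assms by (intro prod.remove) auto

lemma prod_orbits_contract:
 assumes "finite X" "affected \<sigma> \<subseteq> X" "act \<sigma> w = x" "w \<noteq> x"
 shows "(\<Prod>C\<in>orbit (\<sigma> * swap w x) ` (X - {x}). h C)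
   = h (orbit \<sigma> w - {x}) * (\<Prod>C\<in>orbit \<sigma> ` X - {orbit \<sigma> w}. h C)"
 using contract_orbits(7,8)[OF assms(2-4)] assms(1) by simp

section \<open>Weights of rooted cycles\<close>

text \<open>The term of the divided difference over the nodes of \<open>C\<close> that belongs to the only node in \<open>E\<close>, and \<open>0\<close> if
 \<open>C\<close> does not meet \<open>E\<close> in exactly one point.\<close>

definition root_weight :: "(nat \<Rightarrow> complex) \<Rightarrow> nat set \<Rightarrow> nat set \<Rightarrow> complex" where
 "root_weight c E C = (\<Sum>e\<in>C. if C \<inter> E = {e} then \<Prod>j\<in>C - {e}. 1 / (c e - c j) else 0)"

definition rooted_weight :: "(nat \<Rightarrow> complex) \<Rightarrow> nat set \<Rightarrow> nat set \<Rightarrow> nat perm \<Rightarrow> complex" where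
 "rooted_weight c E D \<sigma> = (\<Prod>C\<in>orbit \<sigma> ` D. root_weight c E C)"

lemma root_weight_unique:
 assumes "finite C" "C \<inter> E = {e}"
 shows "root_weight c E C = (\<Prod>j\<in>C - {e}. 1 / (c e - c j))"
proof -
 have "root_weight c E C = (\<Sum>e'\<in>C. if e' = e then \<Prod>j\<in>C - {e}. 1 / (c e - c j) else 0)"
  unfolding root_weight_def by (intro sum.cong) (use assms in auto)
 also have "... = (\<Prod>j\<in>C - {e}. 1 / (c e - c j))" using assms by (auto simp: sum.delta)
 finally show ?thesis .
qed

lemma root_weight_none: "(\<And>e. C \<inter> E \<noteq> {e}) \<Longrightarrow> root_weight c E C = 0"
 unfolding root_weight_def by (intro sum.neutral) auto

lemma root_weight_two: "d \<in> C \<inter> E \<Longrightarrow> e \<in> C \<inter> E \<Longrightarrow> d \<noteq> e \<Longrightarrow> root_weight c E C = 0"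
 by (rule root_weight_none) (metis singletonD)

lemma root_weight_cong: "C \<inter> E = C \<inter> E' \<Longrightarrow> root_weight c E C = root_weight c E' C"
 unfolding root_weight_def by simp

lemma root_weight_contract:
 assumes "finite C" "d \<in> C" "d \<in> E" "x \<in> C" "x \<notin> E"
 shows "root_weight c E C = 1 / (c d - c x) * root_weight c E (C - {x})"
proof (cases "C \<inter> E = {d}")
 case True
 then have 2: "(C - {x}) \<inter> E = {d}" using assms by auto
 have "C - {d} = insert x (C - {x} - {d})" using assms by auto
 moreover have "x \<notin> C - {x} - {d}" "finite (C - {x} - {d})" using assms by auto
 ultimately have "(\<Prod>j\<in>C - {d}. 1 / (c d - c j)) = 1 / (c d - c x) * (\<Prod>j\<in>C - {x} - {d}. 1 / (c d - c j))"
  by (simp only: prod.insert not_False_eq_True)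
 then show ?thesis
  using root_weight_unique[OF assms(1) True, of c] root_weight_unique[OF _ 2, of c] assms(1) by simp
next
 case False
 then obtain e where e: "e \<in> C \<inter> E" "e \<noteq> d" using assms by blast
 have "root_weight c E C = 0" using e assms by (intro root_weight_two[of d _ _ e]) auto
 moreover have "root_weight c E (C - {x}) = 0" using e assms by (intro root_weight_two[of d _ _ e]) auto
 ultimately show ?thesis by simp
qed

lemma inverse_diff_relation:
 fixes a b x :: complex
 assumes "x \<noteq> a" "x \<noteq> b" "a \<noteq> b"
 shows "1 / (x - a) * (1 / (x - b)) = 1 / (a - b) * (1 / (x - a) - 1 / (x - b))"
 using assms by (simp add: divide_simps)

lemma root_weight_exchange:
 assumes "finite C" "d \<in> C" "x \<in> C" "d \<noteq> x" "d \<notin> E" "x \<notin> E" "inj_on c C"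
 shows "root_weight c E C = 1 / (c d - c x) * (root_weight c E (C - {x}) - root_weight c E (C - {d}))"
proof (cases "\<exists>e. C \<inter> E = {e}")
 case True
 then obtain e where e: "C \<inter> E = {e}" by blast
 then have ed: "e \<in> C" "e \<noteq> d" "e \<noteq> x" using assms by auto
 have 2: "(C - {x}) \<inter> E = {e}" "(C - {d}) \<inter> E = {e}" using e assms by auto
 let ?P = "\<Prod>j\<in>C - {e, d, x}. 1 / (c e - c j)"
 have s: "C - {e} = insert d (insert x (C - {e, d, x}))" "C - {x} - {e} = insert d (C - {e, d, x})"
  "C - {d} - {e} = insert x (C - {e, d, x})" using assms ed by auto
 have w: "root_weight c E C = 1 / (c e - c d) * (1 / (c e - c x)) * ?P"
  "root_weight c E (C - {x}) = 1 / (c e - c d) * ?P"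
  "root_weight c E (C - {d}) = 1 / (c e - c x) * ?P"
  using root_weight_unique[OF assms(1) e, of c] root_weight_unique[OF _ 2(1), of c] root_weight_unique[OF _ 2(2), of c] assms(1,4)
  unfolding s by simp_all
 have "c e \<noteq> c d" "c e \<noteq> c x" "c d \<noteq> c x" using ed assms by (auto dest: inj_onD)
 from inverse_diff_relation[OF this]
 have "1 / (c e - c d) * (1 / (c e - c x)) * ?P = 1 / (c d - c x) * (1 / (c e - c d) - 1 / (c e - c x)) * ?P"
  by (simp only:)
 then show ?thesis unfolding w by (simp only: left_diff_distrib mult.assoc)
next
 case False
 then have "root_weight c E C = 0" by (intro root_weight_none) blast
 moreover have "(C - {x}) \<inter> E = C \<inter> E" "(C - {d}) \<inter> E = C \<inter> E" using assms by auto
 then have "root_weight c E (C - {x}) = 0" "root_weight c E (C - {d}) = 0"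
  using False by (auto intro!: root_weight_none)
 ultimately show ?thesis by simp
qed

lemma orbits_disjoint:
 assumes "A \<in> orbit \<sigma> ` X" "B \<in> orbit \<sigma> ` Y" "A \<noteq> B"
 shows "A \<inter> B = {}"
proof -
 obtain a b where "A = orbit \<sigma> a" "B = orbit \<sigma> b" using assms by blast
 with assms(3) show ?thesis by (simp add: orbit_disjoint)
qed

lemma disjoint_orbits_sum:
 assumes "finite X" "affected \<sigma> \<subseteq> X"
 shows "(\<Sum>x\<in>X. g x) = (\<Sum>C\<in>orbit \<sigma> ` X. \<Sum>x\<in>C. g x)"
proof -
 have "X = \<Union>(orbit \<sigma> ` X)" using orbit_subset_support[OF assms(2)] by fastforce
 then have "(\<Sum>x\<in>X. g x) = sum g (\<Union>(orbit \<sigma> ` X))" by simp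
 also have "... = (\<Sum>C\<in>orbit \<sigma> ` X. \<Sum>x\<in>C. g x)"
  by (rule sum.Union_disjoint[unfolded comp_def]; intro ballI impI; (rule orbits_disjoint; assumption)?) auto
 finally show ?thesis .
qed

lemma insert_fixed_point:
 assumes D: "finite D" "affected \<rho> \<subseteq> D" "d \<in> D" "act \<rho> d = d" and e: "e \<in> D - {d}"
 shows "orbit (swap d e * \<rho>) ` D = insert (insert d (orbit \<rho> e)) (orbit \<rho> ` (D - {d}) - {orbit \<rho> e})"
  "insert d (orbit \<rho> e) \<notin> orbit \<rho> ` (D - {d}) - {orbit \<rho> e}"
  "\<And>i. i \<in> D - {d} \<Longrightarrow> d \<notin> orbit \<rho> i"
proof -
 let ?\<tau> = "swap d e * \<rho>"
 define u where "u = act (inverse \<rho>) e"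
 have \<rho>u: "act \<rho> u = e" by (simp add: u_def)
 have ud: "u \<noteq> d" using \<rho>u D(4) e by auto
 have \<tau>u: "act ?\<tau> u = d" by (simp add: apply_times \<rho>u)
 have "act (swap d e) e = d" by simp
 have \<rho>: "?\<tau> * swap u d = \<rho>"
 proof (rule perm_eqI)
  fix a show "act (?\<tau> * swap u d) a = act \<rho> a"
  proof (cases "a = u \<or> a = d")
   case True
   then show ?thesis using D(4) \<rho>u ud by (auto simp: apply_times apply_swap)
  next
   case False
   then have "act \<rho> a \<noteq> e" "act \<rho> a \<noteq> d"
    using \<rho>u D(4) apply_inj[of \<rho> a u] apply_inj[of \<rho> a d] by auto
   then show ?thesis using False by (simp add: apply_times apply_swap)
  qed
 qed
 have aff: "affected ?\<tau> \<subseteq> D" using D e by (intro affected_mult_subset affected_swap_subset) auto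
 note c = contract_orbits[OF aff \<tau>u ud, unfolded \<rho>]
 have fx: "orbit \<rho> i \<subseteq> D - {d}" if "i \<in> D - {d}" for i
 proof (rule orbit_subset_support[OF _ that])
  show "affected \<rho> \<subseteq> D - {d}" using D by (auto simp: in_affected)
 qed
 then show nd: "d \<notin> orbit \<rho> i" if "i \<in> D - {d}" for i using that by blast
 have "orbit \<rho> u = orbit ?\<tau> u - {d}" using orbit_contract[OF \<tau>u ud ud] by (simp add: \<rho>)
 moreover have "orbit \<rho> u = orbit \<rho> e" using orbit_apply[of \<rho> u] \<rho>u by simp
 ultimately have B: "orbit ?\<tau> u = insert d (orbit \<rho> e)" "orbit ?\<tau> u - {d} = orbit \<rho> e" using c(4) by auto
 let ?Os = "orbit ?\<tau> ` D - {orbit ?\<tau> u}"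
 have "orbit \<rho> ` (D - {d}) = insert (orbit \<rho> e) ?Os" "orbit \<rho> e \<notin> ?Os"
  using c(7,8) by (simp_all add: B(2))
 then have Os: "?Os = orbit \<rho> ` (D - {d}) - {orbit \<rho> e}" by blast
 have "orbit ?\<tau> ` D = insert (orbit ?\<tau> u) ?Os" using c(1) by blast
 then show "orbit ?\<tau> ` D = insert (insert d (orbit \<rho> e)) (orbit \<rho> ` (D - {d}) - {orbit \<rho> e})"
  unfolding Os unfolding B(1) .
 show "insert d (orbit \<rho> e) \<notin> orbit \<rho> ` (D - {d}) - {orbit \<rho> e}"
  using nd by blast
qed

lemma rooted_weight_contract:
 assumes D: "finite D" "affected \<tau> \<subseteq> D" and dx: "act \<tau> d = x" "d \<noteq> x" and E: "d \<in> E" "x \<notin> E"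
 shows "rooted_weight c E D \<tau> = 1 / (c d - c x) * rooted_weight c E (D - {x}) (\<tau> * swap d x)"
proof -
 note co = contract_orbits[OF D(2) dx]
 have "finite (orbit \<tau> d)" by simp
 then have "root_weight c E (orbit \<tau> d) = 1 / (c d - c x) * root_weight c E (orbit \<tau> d - {x})"
  using co(3,4) E by (intro root_weight_contract) auto
 then show ?thesis
  unfolding rooted_weight_def prod_orbits_contract[OF D dx] prod_orbits_remove[OF D(1) co(5)]
  by (simp only: mult.assoc)
qed

lemma rooted_weight_two:
 assumes D: "finite D" "affected \<tau> \<subseteq> D" and dx: "act \<tau> d = x" "d \<noteq> x" and E: "d \<in> E" "x \<in> E"
 shows "rooted_weight c E D \<tau> = 0"
proof -
 note co = contract_orbits[OF D(2) dx]
 have "root_weight c E (orbit \<tau> d) = 0"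
  using co(3,4) E dx(2) by (intro root_weight_two[of d _ _ x]) auto
 then show ?thesis unfolding rooted_weight_def prod_orbits_remove[OF D(1) co(5)] by simp
qed

lemma rooted_recursion_fixed:
 assumes D: "finite D" "affected \<rho> \<subseteq> D" "d \<in> D" "act \<rho> d = d" and c: "inj_on c D"
  and E: "E \<subseteq> D" "d \<notin> E"
 shows "rooted_weight c E D \<rho> + (\<Sum>e\<in>D - {d}. 1 / (c d - c e) * rooted_weight c (insert d E) D (swap d e * \<rho>))
  = (\<Sum>e\<in>D - insert d E. (1 / (c d - c e) * (1 / (c d - c e))) * rooted_weight c (insert e (insert d E)) D \<rho>)"
proof -
 let ?q = "\<lambda>d e. 1 / (c d - c e)"
 let ?O = "orbit \<rho> ` (D - {d})"
 let ?P = "\<lambda>C. \<Prod>C'\<in>?O - {C}. root_weight c E C'"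
 have aff': "affected \<rho> \<subseteq> D - {d}" using D by (auto simp: in_affected)
 have od: "orbit \<rho> d = {d}" using D(4) by (simp add: not_in_affected_iff_orbit_eq_singleton[symmetric] in_affected)
 have nd: "d \<notin> C" "C \<subseteq> D - {d}" "finite C" if "C \<in> ?O" for C
  using that orbit_subset_support[OF aff'] by auto
 have OD: "orbit \<rho> ` D = insert {d} ?O" "{d} \<notin> ?O" using D(3) od nd(1) by auto
 have dis: "C \<inter> C' = {}" if "C \<in> ?O" "C' \<in> ?O" "C \<noteq> C'" for C C'
  using that by (rule orbits_disjoint)
 have z: "rooted_weight c E D \<rho> = 0"
 proof -
  have "root_weight c E {d} = 0" using E by (intro root_weight_none) auto
  then show ?thesis unfolding rooted_weight_def OD(1) using OD(2) D(1) by simp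
 qed
 have A: "rooted_weight c (insert d E) D (swap d e * \<rho>) = root_weight c (insert d E) (insert d C) * ?P C"
  if "C \<in> ?O" "e \<in> C" for C e
 proof -
  have e: "e \<in> D - {d}" using nd[OF that(1)] that(2) by auto
  have Ce: "orbit \<rho> e = C"
  proof -
   note mem = that
   obtain i where i: "C = orbit \<rho> i" using mem(1) by blast
   show ?thesis unfolding i by (rule orbit_equiv) (use mem(2) i in simp)
  qed
  note i = insert_fixed_point[OF D e, unfolded Ce]
  have "rooted_weight c (insert d E) D (swap d e * \<rho>) = root_weight c (insert d E) (insert d C) * (\<Prod>C'\<in>?O - {C}. root_weight c (insert d E) C')"
   unfolding rooted_weight_def i(1) using i(2) D(1) by (intro prod.insert) auto
  also have "(\<Prod>C'\<in>?O - {C}. root_weight c (insert d E) C') = ?P C"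
   using nd(1) by (intro prod.cong refl root_weight_cong) auto
  finally show ?thesis .
 qed
 have B: "rooted_weight c (insert e (insert d E)) D \<rho> = root_weight c (insert e E) C * ?P C"
  if "C \<in> ?O" "e \<in> C" for C e
 proof -
  have 0: "rooted_weight c (insert e (insert d E)) D \<rho> = root_weight c (insert e (insert d E)) {d} * (\<Prod>C'\<in>?O. root_weight c (insert e (insert d E)) C')"
   unfolding rooted_weight_def OD(1) using OD(2) D(1) by (intro prod.insert) auto
  have "{d} \<inter> insert e (insert d E) = {d}" by blast
  from root_weight_unique[OF _ this, of c] have 1: "root_weight c (insert e (insert d E)) {d} = 1" by simp
  have "finite ?O" using D(1) by simp
  from prod.remove[OF this that(1)] have 2: "(\<Prod>C'\<in>?O. root_weight c (insert e (insert d E)) C')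
   = root_weight c (insert e (insert d E)) C * (\<Prod>C'\<in>?O - {C}. root_weight c (insert e (insert d E)) C')" .
  have "C \<inter> insert e (insert d E) = C \<inter> insert e E" using nd(1)[OF that(1)] by blast
  then have 3: "root_weight c (insert e (insert d E)) C = root_weight c (insert e E) C" by (rule root_weight_cong)
  have 4: "(\<Prod>C'\<in>?O - {C}. root_weight c (insert e (insert d E)) C') = ?P C"
  proof (rule prod.cong[OF refl])
   fix C' assume C': "C' \<in> ?O - {C}"
   have "d \<notin> C'" using C' nd(1)[of C'] by blast
   moreover have "e \<notin> C'" using dis[OF that(1), of C'] C' that(2) by blast
   ultimately have "C' \<inter> insert e (insert d E) = C' \<inter> E" by blast
   then show "root_weight c (insert e (insert d E)) C' = root_weight c E C'" by (rule root_weight_cong)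
  qed
  show ?thesis unfolding 0 1 2 3 4 by simp
 qed
 have key: "(\<Sum>e\<in>C. ?q d e * rooted_weight c (insert d E) D (swap d e * \<rho>))
   = (\<Sum>e\<in>C. if e \<in> E then 0 else (?q d e * ?q d e) * rooted_weight c (insert e (insert d E)) D \<rho>)" if C: "C \<in> ?O" for C
 proof (cases "C \<inter> E = {}")
  case False
  then obtain g where g: "g \<in> C" "g \<in> E" by blast
  have 1: "root_weight c (insert d E) (insert d C) = 0"
   using g E(2) by (intro root_weight_two[of d _ _ g]) auto
  have 2: "root_weight c (insert e E) C = 0" if "e \<in> C" "e \<notin> E" for e
   using g that by (intro root_weight_two[of e _ _ g]) auto
  have "(\<Sum>e\<in>C. ?q d e * rooted_weight c (insert d E) D (swap d e * \<rho>)) = 0"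
   by (intro sum.neutral ballI) (simp add: A[OF C] 1)
  moreover have "(\<Sum>e\<in>C. if e \<in> E then 0 else (?q d e * ?q d e) * rooted_weight c (insert e (insert d E)) D \<rho>) = 0"
   by (intro sum.neutral ballI) (simp add: B[OF C] 2)
  ultimately show ?thesis by simp
 next
  case True
  have 1: "root_weight c (insert d E) (insert d C) = (\<Prod>j\<in>C. ?q d j)"
  proof -
   have "insert d C \<inter> insert d E = {d}" "insert d C - {d} = C" using True nd(1)[OF C] by auto
   then show ?thesis using nd(3)[OF C] by (subst root_weight_unique[of _ _ d]) auto
  qed
  have 2: "root_weight c (insert e E) C = (\<Prod>j\<in>C - {e}. ?q e j)" if "e \<in> C" for e
   using True that nd(3)[OF C] by (intro root_weight_unique) auto
  have ne: "c u \<noteq> c v" if "u \<in> insert d C" "v \<in> insert d C" "u \<noteq> v" for u v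
   using c that D(3) nd(2)[OF C] unfolding inj_on_def by blast
  have "(\<Sum>e\<in>C. ?q d e * ?q d e * (\<Prod>g\<in>C - {e}. 0 + ?q e g)) = (\<Sum>e\<in>C. ?q d e * ?q d e * (\<Prod>g\<in>C - {e}. 0 + ?q d g))"
  proof (rule sum_squares_prod_shift)
   show "?q e u = - ?q u e" if "u \<in> C" "e \<in> C" "u \<noteq> e" for u e
    using ne[of u e] that by (simp add: divide_simps)
   show "?q x u * ?q x e = ?q u e * (?q x u - ?q x e)" if "x \<in> C" "u \<in> C" "e \<in> C" "x \<noteq> u" "x \<noteq> e" "u \<noteq> e" for x u e
    using that ne by (intro inverse_diff_relation) auto
   show "?q d u * ?q d e = ?q u e * (?q d u - ?q d e)" if "u \<in> C" "e \<in> C" "u \<noteq> e" for u e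
    using that ne nd(1)[OF C] by (intro inverse_diff_relation) auto
  qed (rule nd(3)[OF C])
  also have "... = (\<Sum>e\<in>C. ?q d e * (\<Prod>g\<in>C. ?q d g))"
  proof (rule sum.cong[OF refl])
   fix e assume "e \<in> C"
   then show "?q d e * ?q d e * (\<Prod>g\<in>C - {e}. 0 + ?q d g) = ?q d e * (\<Prod>g\<in>C. ?q d g)"
    using prod.remove[OF nd(3)[OF C], of e "?q d"] by simp
  qed
  finally have pf: "(\<Sum>e\<in>C. ?q d e * ?q d e * (\<Prod>g\<in>C - {e}. ?q e g)) = (\<Sum>e\<in>C. ?q d e * (\<Prod>g\<in>C. ?q d g))"
   by (simp only: add_0_left)
  have "(\<Sum>e\<in>C. ?q d e * rooted_weight c (insert d E) D (swap d e * \<rho>)) = (\<Sum>e\<in>C. ?q d e * (\<Prod>g\<in>C. ?q d g)) * ?P C"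
   unfolding sum_distrib_right by (intro sum.cong refl) (simp only: A[OF C] 1 mult.assoc)
  also have "... = (\<Sum>e\<in>C. (?q d e * ?q d e) * rooted_weight c (insert e (insert d E)) D \<rho>)"
   unfolding pf[symmetric] sum_distrib_right by (intro sum.cong refl) (simp only: B[OF C] 2 mult.assoc)
  also have "... = (\<Sum>e\<in>C. if e \<in> E then 0 else (?q d e * ?q d e) * rooted_weight c (insert e (insert d E)) D \<rho>)"
   using True by (intro sum.cong refl) auto
  finally show ?thesis .
 qed
 have "(\<Sum>e\<in>D - {d}. ?q d e * rooted_weight c (insert d E) D (swap d e * \<rho>))
   = (\<Sum>C\<in>?O. \<Sum>e\<in>C. ?q d e * rooted_weight c (insert d E) D (swap d e * \<rho>))"
  using D(1) by (intro disjoint_orbits_sum aff') auto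
 also have "... = (\<Sum>C\<in>?O. \<Sum>e\<in>C. if e \<in> E then 0 else (?q d e * ?q d e) * rooted_weight c (insert e (insert d E)) D \<rho>)"
  by (intro sum.cong refl key)
 also have "... = (\<Sum>e\<in>D - {d}. if e \<in> E then 0 else (?q d e * ?q d e) * rooted_weight c (insert e (insert d E)) D \<rho>)"
  using D(1) by (intro disjoint_orbits_sum[symmetric] aff') auto
 also have "... = (\<Sum>e\<in>D - insert d E. (?q d e * ?q d e) * rooted_weight c (insert e (insert d E)) D \<rho>)"
  using D(1) by (intro sum.mono_neutral_cong_right) auto
 finally show ?thesis using z by simp
qed

text \<open>The recursion of \<open>gaudin_family\<close>, one permutation at a time. If \<open>\<rho>\<close> moves \<open>d\<close> to \<open>x\<close>, the weights on both
 sides can be rewritten through permutations with \<open>x\<close> contracted, and induction on \<open>|D|\<close> applies; the case of a fixed point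
 \<open>d\<close> is a direct computation.\<close>

lemma rooted_recursion:
 assumes D: "finite D" "affected \<rho> \<subseteq> D" "d \<in> D" and c: "inj_on c D" and E: "E \<subseteq> D" "d \<notin> E"
 shows "rooted_weight c E D \<rho> + (\<Sum>e\<in>D - {d}. 1 / (c d - c e) * rooted_weight c (insert d E) D (swap d e * \<rho>))
  = (\<Sum>e\<in>D - insert d E. (1 / (c d - c e) * (1 / (c d - c e))) * rooted_weight c (insert e (insert d E)) D \<rho>)"
 using D c E
proof (induction "card D" arbitrary: D \<rho> rule: less_induct)
 case less
 note D = less.prems(1-3) and c = less.prems(4) and E = less.prems(5,6)
 let ?q = "\<lambda>d e. 1 / (c d - c e)"
 define x where "x = act \<rho> d"
 show ?case
 proof (cases "x = d")
  case True
  then show ?thesis using D c E by (intro rooted_recursion_fixed) (auto simp: x_def)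
 next
  case xd: False
  then have dx: "act \<rho> d = x" "d \<noteq> x" by (auto simp: x_def)
  note co = contract_orbits[OF D(2) dx]
  let ?B = "orbit \<rho> d" and ?\<rho>' = "\<rho> * swap d x"
  let ?PE = "\<Prod>C\<in>orbit \<rho> ` D - {?B}. root_weight c E C"
  have wE: "rooted_weight c E D \<rho> = root_weight c E ?B * ?PE"
   unfolding rooted_weight_def by (rule prod_orbits_remove[OF D(1) co(5)])
  have aff: "affected (swap d e * \<rho>) \<subseteq> D" if "e \<in> D" for e
   using D that by (intro affected_mult_subset affected_swap_subset) auto
  have ap: "act (swap d e * \<rho>) d = x" if "e \<noteq> x" for e
   using that dx by (auto simp: apply_times apply_swap)
  have wx: "rooted_weight c (insert d E) D (swap d x * \<rho>) = root_weight c E (?B - {d}) * ?PE"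
  proof -
   define w where "w = act (inverse \<rho>) d"
   have w: "act \<rho> w = d" by (simp add: w_def)
   have wd: "w \<noteq> d" using w dx by auto
   have sw: "swap d x * \<rho> = \<rho> * swap w d"
    unfolding perm_mult_swap using w dx by (simp add: swap_sym)
   note cw = contract_orbits[OF D(2) w wd]
   have Bw: "orbit \<rho> w = ?B" using orbit_apply[of \<rho> w] w by simp
   let ?\<tau> = "swap d x * \<rho>"
   have od: "orbit ?\<tau> d = {d}"
    using dx by (simp add: not_in_affected_iff_orbit_eq_singleton[symmetric] in_affected apply_times)
   have i: "orbit ?\<tau> ` (D - {d}) = insert (?B - {d}) (orbit \<rho> ` D - {?B})" "?B - {d} \<notin> orbit \<rho> ` D - {?B}"
    using cw(7,8) unfolding sw Bw by auto
   have nd: "d \<notin> C" if "C \<in> orbit \<rho> ` D - {?B}" for C using co(9)[OF that] by auto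
   have "orbit ?\<tau> ` D = insert {d} (orbit ?\<tau> ` (D - {d}))" using D(3) od by blast
   moreover have "{d} \<notin> orbit ?\<tau> ` (D - {d})" unfolding i(1) using nd by blast
   ultimately have "rooted_weight c (insert d E) D ?\<tau>
    = root_weight c (insert d E) {d} * (\<Prod>C\<in>orbit ?\<tau> ` (D - {d}). root_weight c (insert d E) C)"
    unfolding rooted_weight_def using D(1) by (simp only:) (rule prod.insert, auto)
   also have "root_weight c (insert d E) {d} = 1"
   proof -
    have "{d} \<inter> insert d E = {d}" by blast
    from root_weight_unique[OF _ this, of c] show ?thesis by simp
   qed
   also have "(\<Prod>C\<in>orbit ?\<tau> ` (D - {d}). root_weight c (insert d E) C) = (\<Prod>C\<in>orbit ?\<tau> ` (D - {d}). root_weight c E C)"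
    using nd unfolding i(1) by (intro prod.cong refl root_weight_cong) auto
   also have "... = root_weight c E (?B - {d}) * ?PE"
    unfolding i(1) using i(2) D(1) by (intro prod.insert) auto
   finally show ?thesis by simp
  qed
  have split1: "(\<Sum>e\<in>D - {d}. ?q d e * rooted_weight c (insert d E) D (swap d e * \<rho>))
   = ?q d x * rooted_weight c (insert d E) D (swap d x * \<rho>)
    + (\<Sum>e\<in>D - {x} - {d}. ?q d e * rooted_weight c (insert d E) D (swap d e * \<rho>))"
  proof -
   have "D - {d} - {x} = D - {x} - {d}" by auto
   then show ?thesis using D(1) co(2) xd by (subst sum.remove[of _ x]) auto
  qed
  show ?thesis
  proof (cases "x \<in> E")
   case True
   have "rooted_weight c (insert d E) D (swap d e * \<rho>) = 0" if "e \<in> D - {x} - {d}" for e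
    using that True ap[of e] by (intro rooted_weight_two[OF D(1) aff _ dx(2)]) auto
   moreover have "rooted_weight c (insert e (insert d E)) D \<rho> = 0" for e
    using True by (intro rooted_weight_two[OF D(1,2) dx]) auto
   moreover have "root_weight c E ?B + ?q d x * root_weight c E (?B - {d}) = 0"
   proof -
    have "c d \<noteq> c x" using inj_onD[OF c] D(3) co(2) dx(2) by blast
    then have "?q x d = - ?q d x" by (simp add: divide_simps)
    moreover have "root_weight c E ?B = ?q x d * root_weight c E (?B - {d})"
     using co(3,4) True E(2) by (intro root_weight_contract) auto
    ultimately show ?thesis by simp
   qed
   then have "(root_weight c E ?B + ?q d x * root_weight c E (?B - {d})) * ?PE = 0" by (simp only: mult_zero_left)
   then have "root_weight c E ?B * ?PE + ?q d x * (root_weight c E (?B - {d}) * ?PE) = 0"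
    by (simp only: distrib_right mult.assoc)
   ultimately show ?thesis unfolding split1 wE wx by simp
  next
   case False
   have IH: "rooted_weight c E (D - {x}) ?\<rho>' + (\<Sum>e\<in>D - {x} - {d}. ?q d e * rooted_weight c (insert d E) (D - {x}) (swap d e * ?\<rho>'))
    = (\<Sum>e\<in>D - {x} - insert d E. (?q d e * ?q d e) * rooted_weight c (insert e (insert d E)) (D - {x}) ?\<rho>')"
   proof (rule less.hyps)
    show "card (D - {x}) < card D" using D(1) co(2) by (rule card_Diff1_less)
    show "affected ?\<rho>' \<subseteq> D - {x}" by (rule co(6))
    show "inj_on c (D - {x})" using c by (rule inj_on_subset) auto
   qed (use D E dx False in auto)
   have t1: "rooted_weight c (insert d E) D (swap d e * \<rho>) = ?q d x * rooted_weight c (insert d E) (D - {x}) (swap d e * ?\<rho>')"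
    if "e \<in> D - {x} - {d}" for e
    using rooted_weight_contract[OF D(1) aff ap dx(2), of e "insert d E" c] that False dx(2)
    by (simp add: mult.assoc)
   have t2: "rooted_weight c (insert e (insert d E)) D \<rho> = ?q d x * rooted_weight c (insert e (insert d E)) (D - {x}) ?\<rho>'"
    if "e \<in> D - {x} - insert d E" for e
    using that False dx(2) by (intro rooted_weight_contract[OF D(1,2) dx]) auto
   have t3: "rooted_weight c (insert x (insert d E)) D \<rho> = 0"
    by (intro rooted_weight_two[OF D(1,2) dx]) auto
   have w': "rooted_weight c E (D - {x}) ?\<rho>' = root_weight c E (?B - {x}) * ?PE"
    unfolding rooted_weight_def by (rule prod_orbits_contract[OF D(1,2) dx])
   have ex: "root_weight c E ?B = ?q d x * (root_weight c E (?B - {x}) - root_weight c E (?B - {d}))"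
   proof (rule root_weight_exchange)
    show "inj_on c ?B" using c orbit_subset_support[OF D(2,3)] by (rule inj_on_subset)
   qed (use co(3,4) dx E False in auto)
   have "(\<Sum>e\<in>D - {x} - {d}. ?q d e * rooted_weight c (insert d E) D (swap d e * \<rho>))
    = ?q d x * (\<Sum>e\<in>D - {x} - {d}. ?q d e * rooted_weight c (insert d E) (D - {x}) (swap d e * ?\<rho>'))"
    unfolding sum_distrib_left by (intro sum.cong refl) (simp only: t1 mult_ac)
   also have "(\<Sum>e\<in>D - {x} - {d}. ?q d e * rooted_weight c (insert d E) (D - {x}) (swap d e * ?\<rho>'))
     = (\<Sum>e\<in>D - {x} - insert d E. (?q d e * ?q d e) * rooted_weight c (insert e (insert d E)) (D - {x}) ?\<rho>') - root_weight c E (?B - {x}) * ?PE"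
    using IH unfolding w' by (simp only: eq_diff_eq add.commute)
   also have "?q d x * ... = (\<Sum>e\<in>D - {x} - insert d E. (?q d e * ?q d e) * rooted_weight c (insert e (insert d E)) D \<rho>) - ?q d x * (root_weight c E (?B - {x}) * ?PE)"
    unfolding right_diff_distrib sum_distrib_left
    by (intro arg_cong2[where f = "(-)"] sum.cong refl) (simp only: t2 mult_ac)
   also have "(\<Sum>e\<in>D - {x} - insert d E. (?q d e * ?q d e) * rooted_weight c (insert e (insert d E)) D \<rho>)
     = (\<Sum>e\<in>D - insert d E. (?q d e * ?q d e) * rooted_weight c (insert e (insert d E)) D \<rho>)"
    using D(1) t3 by (intro sum.mono_neutral_left) auto
   finally have S: "(\<Sum>e\<in>D - {x} - {d}. ?q d e * rooted_weight c (insert d E) D (swap d e * \<rho>)) =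
     (\<Sum>e\<in>D - insert d E. (?q d e * ?q d e) * rooted_weight c (insert e (insert d E)) D \<rho>) - ?q d x * (root_weight c E (?B - {x}) * ?PE)" .
   have "root_weight c E ?B * ?PE = ?q d x * (root_weight c E (?B - {x}) * ?PE) - ?q d x * (root_weight c E (?B - {d}) * ?PE)"
    unfolding ex by (simp only: left_diff_distrib right_diff_distrib mult.assoc)
   then show ?thesis unfolding split1 wE wx S by simp
  qed
 qed
qed

lemma rooted_weight_inverse: "rooted_weight c E D (inverse \<rho>) = rooted_weight c E D \<rho>"
 by (simp add: rooted_weight_def)

text \<open>Inversion preserves the weights and exchanges left and right multiplication.\<close>

lemma rooted_recursion_right:
 assumes "finite D" "affected \<rho> \<subseteq> D" "d \<in> D" "inj_on c D" "E \<subseteq> D" "d \<notin> E"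
 shows "rooted_weight c E D \<rho> + (\<Sum>e\<in>D - {d}. 1 / (c d - c e) * rooted_weight c (insert d E) D (\<rho> * swap d e))
  = (\<Sum>e\<in>D - insert d E. (1 / (c d - c e) * (1 / (c d - c e))) * rooted_weight c (insert e (insert d E)) D \<rho>)"
proof -
 have "rooted_weight c (insert d E) D (swap d e * inverse \<rho>) = rooted_weight c (insert d E) D (\<rho> * swap d e)" for e
  using rooted_weight_inverse[of c "insert d E" D "\<rho> * swap d e"] by simp
 with rooted_recursion[of D "inverse \<rho>" d c E] assms show ?thesis
  by (simp add: rooted_weight_inverse)
qed

section \<open>The Gaudin family in the group algebra\<close>

definition perms_on :: "nat set \<Rightarrow> nat perm set" where
 "perms_on D = {\<sigma>. affected \<sigma> \<subseteq> D}"

lemma finite_perms_on [simp]: "finite D \<Longrightarrow> finite (perms_on D)"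
proof -
 assume "finite D"
 have "act ` perms_on D \<subseteq> {p. p permutes D}"
  by (auto simp: perms_on_def permutes_def in_affected bij_pointE intro: bij_pointE)
    (metis bij_apply bij_pointE)+
 then have "finite (act ` perms_on D)"
  by (rule finite_subset) (rule finite_permutations[OF \<open>finite D\<close>])
 moreover have "inj_on act (perms_on D)" by (simp add: inj_on_def apply_inject)
 ultimately show ?thesis by (rule finite_imageD)
qed

lemma perms_on_mult: "\<sigma> \<in> perms_on D \<Longrightarrow> \<tau> \<in> perms_on D \<Longrightarrow> \<sigma> * \<tau> \<in> perms_on D"
 unfolding perms_on_def using affected_mult_subset by blast

definition on_perms :: "nat set \<Rightarrow> (nat perm \<Rightarrow> 'w) \<Rightarrow> nat perm \<Rightarrow>\<^sub>0 'w::comm_ring_1" where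
 "on_perms D g = (\<Sum>\<sigma>\<in>perms_on D. single \<sigma> (g \<sigma>))"

abbreviation scal :: "'w::comm_ring_1 \<Rightarrow> nat perm \<Rightarrow>\<^sub>0 'w" where
 "scal k \<equiv> single 0 k"

lemma lookup_sum': "lookup (\<Sum>i\<in>I. f i) k = (\<Sum>i\<in>I. lookup (f i) k)"
 by (induction I rule: infinite_finite_induct) (simp_all add: lookup_add)

lemma lookup_on_perms: "finite D \<Longrightarrow> lookup (on_perms D g) \<rho> = (if \<rho> \<in> perms_on D then g \<rho> else 0)"
 unfolding on_perms_def lookup_sum' lookup_single when_def by (simp add: sum.delta)

lemma on_perms_eqI:
 assumes "finite D" "\<And>\<sigma>. \<sigma> \<in> perms_on D \<Longrightarrow> g \<sigma> = lookup z \<sigma>" "\<And>\<sigma>. \<sigma> \<notin> perms_on D \<Longrightarrow> lookup z \<sigma> = 0"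
 shows "on_perms D g = z"
 by (rule poly_mapping_eqI) (simp add: lookup_on_perms assms)

lemma scal_mult_on_perms: "scal k * on_perms D g = on_perms D (\<lambda>\<sigma>. k * g \<sigma>)"
 by (simp add: on_perms_def sum_distrib_left mult_single)

lemma on_perms_add: "on_perms D g + on_perms D h = on_perms D (\<lambda>\<sigma>. g \<sigma> + h \<sigma>)"
 by (simp add: on_perms_def sum.distrib single_add)

lemma on_perms_sum: "finite I \<Longrightarrow> (\<Sum>i\<in>I. on_perms D (g i)) = on_perms D (\<lambda>\<sigma>. \<Sum>i\<in>I. g i \<sigma>)"
 by (induction I rule: finite_induct) (simp_all add: on_perms_add, simp add: on_perms_def)

lemma lookup_scal_mult: "lookup (scal k * z) \<rho> = k * lookup z \<rho>"
proof (induction z rule: update_induct)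
 case const
 show ?case by simp
next
 case (update f k' v)
 then have "Poly_Mapping.update k' v f = f + single k' v"
  by (intro poly_mapping_eqI)
   (auto simp: lookup_update lookup_add lookup_single in_keys_iff when_def)
 with update show ?case
  by (simp add: distrib_left lookup_add mult_single lookup_single when_def)
qed

lemma scal_central: "scal k * z = z * (scal k :: nat perm \<Rightarrow>\<^sub>0 'w::comm_ring_1)"
 by (rule single_0_commute) (rule mult.commute)

lemma swap_mult_on_perms:
 assumes "d \<in> D" "e \<in> D"
 shows "single (swap d e) k * on_perms D g = on_perms D (\<lambda>\<sigma>. k * g (swap d e * \<sigma>))"
proof -
 have p: "swap d e \<in> perms_on D" using affected_swap_subset[OF assms] by (simp add: perms_on_def)
 have "single (swap d e) k * on_perms D g = (\<Sum>\<sigma>\<in>perms_on D. single (swap d e * \<sigma>) (k * g \<sigma>))"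
  by (simp add: on_perms_def sum_distrib_left mult_single plus_perm_def)
 also have "... = (\<Sum>\<sigma>\<in>perms_on D. single \<sigma> (k * g (swap d e * \<sigma>)))"
  by (rule sum.reindex_bij_witness[where i = "\<lambda>\<sigma>. swap d e * \<sigma>" and j = "\<lambda>\<sigma>. swap d e * \<sigma>"])
    (use p in \<open>auto simp: mult.assoc[symmetric] perms_on_mult\<close>)
 finally show ?thesis by (simp add: on_perms_def)
qed

lemma on_perms_mult_swap:
 assumes "d \<in> D" "e \<in> D"
 shows "on_perms D g * single (swap d e) k = on_perms D (\<lambda>\<sigma>. k * g (\<sigma> * swap d e))"
proof -
 have p: "swap d e \<in> perms_on D" using affected_swap_subset[OF assms] by (simp add: perms_on_def)
 have "on_perms D g * single (swap d e) k = (\<Sum>\<sigma>\<in>perms_on D. single (\<sigma> * swap d e) (k * g \<sigma>))"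
  by (simp add: on_perms_def sum_distrib_right mult_single plus_perm_def mult.commute)
 also have "... = (\<Sum>\<sigma>\<in>perms_on D. single \<sigma> (k * g (\<sigma> * swap d e)))"
  by (rule sum.reindex_bij_witness[where i = "\<lambda>\<sigma>. \<sigma> * swap d e" and j = "\<lambda>\<sigma>. \<sigma> * swap d e"])
    (use p in \<open>auto simp: mult.assoc perms_on_mult\<close>)
 finally show ?thesis by (simp add: on_perms_def)
qed

lemma lookup_on_perms_product:
 assumes "finite X" "finite Y"
 shows "lookup (on_perms X g * on_perms Y h) \<rho> = (\<Sum>(\<sigma>, \<tau>) | \<sigma> \<in> perms_on X \<and> \<tau> \<in> perms_on Y \<and> \<sigma> * \<tau> = \<rho>. g \<sigma> * h \<tau>)"
proof -
 have "on_perms X g * on_perms Y h = (\<Sum>p\<in>perms_on X \<times> perms_on Y. single (fst p * snd p) (g (fst p) * h (snd p)))"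
  unfolding on_perms_def sum_product
  by (subst sum.cartesian_product) (simp add: mult_single plus_perm_def case_prod_unfold)
 then have "lookup (on_perms X g * on_perms Y h) \<rho> = (\<Sum>p\<in>perms_on X \<times> perms_on Y. if fst p * snd p = \<rho> then g (fst p) * h (snd p) else 0)"
  by (simp add: lookup_sum' lookup_single when_def)
 also have "... = (\<Sum>p\<in>{p \<in> perms_on X \<times> perms_on Y. fst p * snd p = \<rho>}. g (fst p) * h (snd p))"
  using assms by (subst sum.inter_filter) auto
 also have "... = (\<Sum>(\<sigma>, \<tau>) | \<sigma> \<in> perms_on X \<and> \<tau> \<in> perms_on Y \<and> \<sigma> * \<tau> = \<rho>. g \<sigma> * h \<tau>)"
  by (intro sum.cong) auto
 finally show ?thesis .
qed

locale complex_hom =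
 fixes \<iota> :: "complex \<Rightarrow> 'w::comm_ring_1"
 assumes hom_add: "\<iota> (a + b) = \<iota> a + \<iota> b" and hom_mult: "\<iota> (a * b) = \<iota> a * \<iota> b" and hom_1: "\<iota> 1 = 1"
begin

lemma hom_0 [simp]: "\<iota> 0 = 0"
 using hom_add[of 0 0] by simp

lemma hom_minus: "\<iota> (- a) = - \<iota> a"
 using hom_add[of a "- a"] by (simp add: eq_neg_iff_add_eq_0 add.commute)

lemma hom_diff: "\<iota> (a - b) = \<iota> a - \<iota> b"
 using hom_add[of a "- b"] by (simp add: hom_minus)

lemma hom_sum: "\<iota> (\<Sum>i\<in>I. g i) = (\<Sum>i\<in>I. \<iota> (g i))"
 by (induction I rule: infinite_finite_induct) (simp_all add: hom_add)

lemma hom_prod: "\<iota> (\<Prod>i\<in>I. g i) = (\<Prod>i\<in>I. \<iota> (g i))"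
 by (induction I rule: infinite_finite_induct) (simp_all add: hom_mult hom_1)

definition rooted_sum :: "(nat \<Rightarrow> complex) \<Rightarrow> nat set \<Rightarrow> nat set \<Rightarrow> nat perm \<Rightarrow>\<^sub>0 'w" where
 "rooted_sum c D E = on_perms D (\<lambda>\<sigma>. \<iota> (rooted_weight c E D \<sigma>))"

definition gaudin :: "(nat \<Rightarrow> complex) \<Rightarrow> nat set \<Rightarrow> nat \<Rightarrow> nat perm \<Rightarrow>\<^sub>0 'w" where
 "gaudin c D d = - (\<Sum>e\<in>D - {d}. single (swap d e) (\<iota> (1 / (c d - c e))))"

lemma rooted_weight_full:
 assumes "finite D" "\<sigma> \<in> perms_on D"
 shows "rooted_weight c D D \<sigma> = (if \<sigma> = 1 then 1 else 0)"
proof (cases "\<sigma> = 1")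
 case True
 have "root_weight c D {i} = 1" if "i \<in> D" for i
  using that by (subst root_weight_unique[of _ _ i]) auto
 then show ?thesis using True by (auto simp: rooted_weight_def intro!: prod.neutral)
next
 case False
 then obtain d where d: "d \<in> affected \<sigma>" using affected_empty_iff[of \<sigma>] by blast
 define x where "x = act \<sigma> d"
 have "d \<noteq> x" using d by (auto simp: x_def in_affected)
 moreover have "d \<in> D" using d assms(2) by (auto simp: perms_on_def)
 moreover have "x \<in> D" using apply_mem_iff[of \<sigma> D d] \<open>d \<in> D\<close> assms(2) by (simp add: x_def perms_on_def)
 ultimately have "rooted_weight c D D \<sigma> = 0"
  using assms by (intro rooted_weight_two[of D \<sigma> d x]) (auto simp: x_def perms_on_def)
 then show ?thesis using False by simp
qed

lemma gaudin_family_rooted_sum: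
 assumes D: "finite D" and c: "inj_on c D"
 shows "gaudin_family scal D (\<lambda>d e. \<iota> (1 / (c d - c e))) (rooted_sum c D) (gaudin c D)"
proof
 let ?r = "\<lambda>d e. \<iota> (1 / (c d - c e))"
 have ne: "c u \<noteq> c v" if "u \<in> D" "v \<in> D" "u \<noteq> v" for u v
  using c that unfolding inj_on_def by blast
 show "scal (a + b) = scal a + (scal b :: nat perm \<Rightarrow>\<^sub>0 'w)" for a b by (rule single_add)
 show "scal (a * b) = scal a * (scal b :: nat perm \<Rightarrow>\<^sub>0 'w)" for a b by (simp add: mult_single)
 show "scal 1 = (1 :: nat perm \<Rightarrow>\<^sub>0 'w)" by (rule single_one)
 show "scal a * z = z * (scal a :: nat perm \<Rightarrow>\<^sub>0 'w)" for a z by (rule scal_central)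
 show "finite D" by (rule D)
 show "?r e d = - ?r d e" if "d \<in> D" "e \<in> D" "d \<noteq> e" for d e
  using ne[OF that] unfolding hom_minus[symmetric] by (intro arg_cong[where f = \<iota>]) (simp add: divide_simps)
 show "?r x d * ?r x e = ?r d e * (?r x d - ?r x e)"
  if "x \<in> D" "d \<in> D" "e \<in> D" "x \<noteq> d" "x \<noteq> e" "d \<noteq> e" for x d e
  unfolding hom_mult[symmetric] hom_diff[symmetric]
  by (intro arg_cong[where f = \<iota>] inverse_diff_relation ne that)
 show "rooted_sum c D D = 1"
  unfolding rooted_sum_def
  by (rule on_perms_eqI[OF D])
    (auto simp: rooted_weight_full[OF D] hom_1 lookup_one when_def zero_perm_def perms_on_def)
 fix E d assume E: "E \<subseteq> D" and d: "d \<in> D - E"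
 have R: "(\<Sum>e\<in>D - insert d E. scal (?r d e * ?r d e) * rooted_sum c D (insert e (insert d E)))
   = on_perms D (\<lambda>\<sigma>. \<iota> (\<Sum>e\<in>D - insert d E. (1 / (c d - c e) * (1 / (c d - c e))) * rooted_weight c (insert e (insert d E)) D \<sigma>))"
  unfolding rooted_sum_def scal_mult_on_perms hom_sum hom_mult using D by (intro on_perms_sum) auto
 have L: "gaudin c D d * rooted_sum c D (insert d E)
   = on_perms D (\<lambda>\<sigma>. - \<iota> (\<Sum>e\<in>D - {d}. 1 / (c d - c e) * rooted_weight c (insert d E) D (swap d e * \<sigma>)))"
 proof -
  have "(\<Sum>e\<in>D - {d}. single (swap d e) (?r d e)) * rooted_sum c D (insert d E)
   = (\<Sum>e\<in>D - {d}. on_perms D (\<lambda>\<sigma>. ?r d e * \<iota> (rooted_weight c (insert d E) D (swap d e * \<sigma>))))"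
   unfolding sum_distrib_right rooted_sum_def using d by (intro sum.cong refl swap_mult_on_perms) auto
  also have "... = on_perms D (\<lambda>\<sigma>. \<iota> (\<Sum>e\<in>D - {d}. 1 / (c d - c e) * rooted_weight c (insert d E) D (swap d e * \<sigma>)))"
   unfolding hom_sum hom_mult using D by (intro on_perms_sum) auto
  finally show ?thesis
   unfolding gaudin_def by (simp add: on_perms_def single_uminus sum_negf)
 qed
 have L': "rooted_sum c D (insert d E) * gaudin c D d
   = on_perms D (\<lambda>\<sigma>. - \<iota> (\<Sum>e\<in>D - {d}. 1 / (c d - c e) * rooted_weight c (insert d E) D (\<sigma> * swap d e)))"
 proof -
  have "rooted_sum c D (insert d E) * (\<Sum>e\<in>D - {d}. single (swap d e) (?r d e))
   = (\<Sum>e\<in>D - {d}. on_perms D (\<lambda>\<sigma>. ?r d e * \<iota> (rooted_weight c (insert d E) D (\<sigma> * swap d e))))"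
   unfolding sum_distrib_left rooted_sum_def using d by (intro sum.cong refl on_perms_mult_swap) auto
  also have "... = on_perms D (\<lambda>\<sigma>. \<iota> (\<Sum>e\<in>D - {d}. 1 / (c d - c e) * rooted_weight c (insert d E) D (\<sigma> * swap d e)))"
   unfolding hom_sum hom_mult using D by (intro on_perms_sum) auto
  finally show ?thesis
   unfolding gaudin_def by (simp add: on_perms_def single_uminus sum_negf)
 qed
 show "rooted_sum c D E = gaudin c D d * rooted_sum c D (insert d E)
   + (\<Sum>e\<in>D - insert d E. scal (?r d e * ?r d e) * rooted_sum c D (insert e (insert d E)))"
  unfolding R L on_perms_add unfolding rooted_sum_def on_perms_def
 proof (intro sum.cong refl arg_cong2[where f = single])
  fix \<sigma> assume "\<sigma> \<in> perms_on D"
  then have "rooted_weight c E D \<sigma> = - (\<Sum>e\<in>D - {d}. 1 / (c d - c e) * rooted_weight c (insert d E) D (swap d e * \<sigma>))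
   + (\<Sum>e\<in>D - insert d E. (1 / (c d - c e) * (1 / (c d - c e))) * rooted_weight c (insert e (insert d E)) D \<sigma>)"
   using rooted_recursion[OF D _ _ c E, of \<sigma> d] d by (simp add: perms_on_def eq_diff_eq)
  then show "\<iota> (rooted_weight c E D \<sigma>) = - \<iota> (\<Sum>e\<in>D - {d}. 1 / (c d - c e) * rooted_weight c (insert d E) D (swap d e * \<sigma>))
   + \<iota> (\<Sum>e\<in>D - insert d E. (1 / (c d - c e) * (1 / (c d - c e))) * rooted_weight c (insert e (insert d E)) D \<sigma>)"
   by (simp only: hom_add hom_minus)
 qed
 show "rooted_sum c D E = rooted_sum c D (insert d E) * gaudin c D d
   + (\<Sum>e\<in>D - insert d E. scal (?r d e * ?r d e) * rooted_sum c D (insert e (insert d E)))"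
  unfolding R L' on_perms_add unfolding rooted_sum_def on_perms_def
 proof (intro sum.cong refl arg_cong2[where f = single])
  fix \<sigma> assume "\<sigma> \<in> perms_on D"
  then have "rooted_weight c E D \<sigma> = - (\<Sum>e\<in>D - {d}. 1 / (c d - c e) * rooted_weight c (insert d E) D (\<sigma> * swap d e))
   + (\<Sum>e\<in>D - insert d E. (1 / (c d - c e) * (1 / (c d - c e))) * rooted_weight c (insert e (insert d E)) D \<sigma>)"
   using rooted_recursion_right[OF D _ _ c E, of \<sigma> d] d by (simp add: perms_on_def eq_diff_eq)
  then show "\<iota> (rooted_weight c E D \<sigma>) = - \<iota> (\<Sum>e\<in>D - {d}. 1 / (c d - c e) * rooted_weight c (insert d E) D (\<sigma> * swap d e))
   + \<iota> (\<Sum>e\<in>D - insert d E. (1 / (c d - c e) * (1 / (c d - c e))) * rooted_weight c (insert e (insert d E)) D \<sigma>)"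
   by (simp only: hom_add hom_minus)
 qed
qed

text \<open>Lagrange's formula for the divided difference at the nodes \<open>c\<^sub>e\<close> of a function with values \<open>b\<^sub>e\<close>.\<close>

definition cycle_value :: "(nat \<Rightarrow> complex) \<Rightarrow> (nat \<Rightarrow> 'w) \<Rightarrow> nat set \<Rightarrow> 'w" where
 "cycle_value c b C = (\<Sum>e\<in>C. b e * \<iota> (\<Prod>j\<in>C - {e}. 1 / (c e - c j)))"

lemma prod_blocks_sum_subsets:
 fixes h :: "nat set \<Rightarrow> nat set \<Rightarrow> 'w"
 assumes "finite Os" "\<And>C. C \<in> Os \<Longrightarrow> finite C" "\<And>C C'. C \<in> Os \<Longrightarrow> C' \<in> Os \<Longrightarrow> C \<noteq> C' \<Longrightarrow> C \<inter> C' = {}"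
 shows "(\<Prod>C\<in>Os. \<Sum>F\<in>Pow C. h C F) = (\<Sum>E\<in>Pow (\<Union>Os). \<Prod>C\<in>Os. h C (C \<inter> E))"
 using assms
proof (induction Os rule: finite_induct)
 case (insert B Os)
 have IH: "(\<Prod>C\<in>Os. \<Sum>F\<in>Pow C. h C F) = (\<Sum>E\<in>Pow (\<Union>Os). \<Prod>C\<in>Os. h C (C \<inter> E))"
  using insert.prems by (intro insert.IH) auto
 have dis: "C \<inter> B = {}" if "C \<in> Os" for C using insert.prems(2)[of C B] that insert.hyps(2) by auto
 have "(\<Prod>C\<in>insert B Os. \<Sum>F\<in>Pow C. h C F) = (\<Sum>F\<in>Pow B. \<Sum>E\<in>Pow (\<Union>Os). h B F * (\<Prod>C\<in>Os. h C (C \<inter> E)))"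
  using insert.hyps by (simp add: IH sum_product)
 also have "... = (\<Sum>z\<in>Pow B \<times> Pow (\<Union>Os). h B (fst z) * (\<Prod>C\<in>Os. h C (C \<inter> snd z)))"
  by (simp add: sum.cartesian_product case_prod_unfold)
 also have "... = (\<Sum>E\<in>Pow (\<Union>(insert B Os)). \<Prod>C\<in>insert B Os. h C (C \<inter> E))"
 proof (rule sum.reindex_bij_witness[where i = "\<lambda>E. (B \<inter> E, \<Union>Os \<inter> E)" and j = "\<lambda>z. fst z \<union> snd z"])
  fix z assume z: "z \<in> Pow B \<times> Pow (\<Union>Os)"
  have 1: "B \<inter> (fst z \<union> snd z) = fst z" using z dis by fastforce
  have 2: "C \<inter> (fst z \<union> snd z) = C \<inter> snd z" if "C \<in> Os" for C using z dis[OF that] by fastforce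
  have 3: "\<Union>Os \<inter> (fst z \<union> snd z) = snd z" using z dis by fastforce
  show "(B \<inter> (fst z \<union> snd z), \<Union>Os \<inter> (fst z \<union> snd z)) = z" using 1 3 by simp
  show "fst z \<union> snd z \<in> Pow (\<Union>(insert B Os))" using z by auto
  show "(\<Prod>C\<in>insert B Os. h C (C \<inter> (fst z \<union> snd z))) = h B (fst z) * (\<Prod>C\<in>Os. h C (C \<inter> snd z))"
   using insert.hyps 1 2 by simp
 qed auto
 finally show ?case .
qed simp

text \<open>Choosing a root in every cycle of \<open>\<sigma>\<close> amounts to choosing a set \<open>E\<close> that meets every cycle exactly once,
 so the sum over \<open>E\<close> factors over the cycles.\<close>

lemma series_rooted_sum:
 assumes D: "finite D" and c: "inj_on c D"
 shows "gaudin_family.series scal D (rooted_sum c D) b = on_perms D (\<lambda>\<sigma>. \<Prod>C\<in>orbit \<sigma> ` D. cycle_value c b C)"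
proof -
 interpret gaudin_family scal D "\<lambda>d e. \<iota> (1 / (c d - c e))" "rooted_sum c D" "gaudin c D"
  by (rule gaudin_family_rooted_sum[OF D c])
 have "series b = on_perms D (\<lambda>\<sigma>. \<Sum>E\<in>Pow D. (\<Prod>e\<in>E. b e) * \<iota> (rooted_weight c E D \<sigma>))"
  unfolding series_def rooted_sum_def scal_mult_on_perms using D by (intro on_perms_sum) auto
 also have "... = on_perms D (\<lambda>\<sigma>. \<Prod>C\<in>orbit \<sigma> ` D. cycle_value c b C)"
  unfolding on_perms_def
 proof (intro sum.cong refl arg_cong2[where f = single])
  fix \<sigma> assume s: "\<sigma> \<in> perms_on D"
  let ?O = "orbit \<sigma> ` D"
  have U: "\<Union>?O = D" using orbit_subset_support[of \<sigma> D] s by (fastforce simp: perms_on_def)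
  have dj: "C \<inter> C' = {}" if "C \<in> ?O" "C' \<in> ?O" "C \<noteq> C'" for C C'
   using that by (rule orbits_disjoint)
  define h where "h C F = (\<Prod>e\<in>F. b e) * \<iota> (root_weight c F C)" for C F
  have cv: "(\<Sum>F\<in>Pow C. h C F) = cycle_value c b C" if "C \<in> ?O" for C
  proof -
   have fin: "finite C" using that by auto
   have "(\<Sum>F\<in>Pow C. h C F) = (\<Sum>F\<in>(\<lambda>e. {e}) ` C. h C F)"
   proof (rule sum.mono_neutral_right)
    show "\<forall>F\<in>Pow C - (\<lambda>e. {e}) ` C. h C F = 0"
    proof
     fix F assume "F \<in> Pow C - (\<lambda>e. {e}) ` C"
     then have "root_weight c F C = 0" by (intro root_weight_none) blast
     then show "h C F = 0" by (simp add: h_def)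
    qed
   qed (use fin in auto)
   also have "... = (\<Sum>e\<in>C. h C {e})" by (subst sum.reindex) auto
   also have "... = cycle_value c b C"
    unfolding cycle_value_def h_def
    by (intro sum.cong refl) (subst root_weight_unique, auto simp: fin)
   finally show ?thesis .
  qed
  have "(\<Sum>E\<in>Pow D. (\<Prod>e\<in>E. b e) * \<iota> (rooted_weight c E D \<sigma>)) = (\<Sum>E\<in>Pow (\<Union>?O). \<Prod>C\<in>?O. h C (C \<inter> E))"
   unfolding U
  proof (rule sum.cong[OF refl])
   fix E assume E: "E \<in> Pow D"
   have rw: "root_weight c (C \<inter> E) C = root_weight c E C" for C
    by (rule root_weight_cong) auto
   have "(\<Prod>e\<in>E. b e) = (\<Prod>e\<in>\<Union>((\<lambda>C. C \<inter> E) ` ?O). b e)"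
    using U E by (intro prod.cong refl) blast
   also have "... = (\<Prod>C\<in>?O. \<Prod>e\<in>C \<inter> E. b e)"
   proof (rule prod.UNION_disjoint)
    show "\<forall>C\<in>?O. \<forall>C'\<in>?O. C \<noteq> C' \<longrightarrow> C \<inter> E \<inter> (C' \<inter> E) = {}" using dj by blast
   qed (use D in auto)
   finally show "(\<Prod>e\<in>E. b e) * \<iota> (rooted_weight c E D \<sigma>) = (\<Prod>C\<in>?O. h C (C \<inter> E))"
    unfolding h_def rooted_weight_def prod.distrib hom_prod rw by simp
  qed
  also have "... = (\<Prod>C\<in>?O. \<Sum>F\<in>Pow C. h C F)"
  proof (rule prod_blocks_sum_subsets[symmetric])
   show "C \<inter> C' = {}" if "C \<in> ?O" "C' \<in> ?O" "C \<noteq> C'" for C C' using dj that by blast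
  qed (use D in auto)
  also have "... = (\<Prod>C\<in>?O. cycle_value c b C)" by (intro prod.cong refl cv)
  finally show "(\<Sum>E\<in>Pow D. (\<Prod>e\<in>E. b e) * \<iota> (rooted_weight c E D \<sigma>)) = (\<Prod>C\<in>?O. cycle_value c b C)" .
 qed
 finally show ?thesis .
qed

end

section \<open>Sums over exponent vectors\<close>

definition exponents :: "nat set \<Rightarrow> nat \<Rightarrow> (nat \<Rightarrow> nat) set" where
 "exponents D n = {l. (\<forall>i. i \<notin> D \<longrightarrow> l i = 0) \<and> (\<Sum>i\<in>D. l i) = n}"

lemma finite_exponents [simp]: "finite D \<Longrightarrow> finite (exponents D n)"
proof -
 assume D: "finite D"
 have "l i \<le> n" if "l \<in> exponents D n" "i \<in> D" for l i
  using that D member_le_sum[of i D l] by (auto simp: exponents_def)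
 then have "exponents D n \<subseteq> {l. \<forall>i. (i \<in> D \<longrightarrow> l i \<in> {..n}) \<and> (i \<notin> D \<longrightarrow> l i = 0)}"
  by (auto simp: exponents_def)
 then show ?thesis
  by (rule finite_subset) (rule finite_set_of_finite_funs[OF D], simp)
qed

lemma sum_exponents_union:
 fixes \<phi> \<psi> :: "(nat \<Rightarrow> nat) \<Rightarrow> 'w::comm_ring_1"
 assumes fin: "finite A" "finite B" "A \<inter> B = {}"
  and \<phi>: "\<And>l l'. (\<And>i. i \<in> A \<Longrightarrow> l i = l' i) \<Longrightarrow> \<phi> l = \<phi> l'"
  and \<psi>: "\<And>l l'. (\<And>i. i \<in> B \<Longrightarrow> l i = l' i) \<Longrightarrow> \<psi> l = \<psi> l'"
 shows "(\<Sum>l\<in>exponents (A \<union> B) n. \<phi> l * \<psi> l) = (\<Sum>i\<le>n. (\<Sum>l\<in>exponents A i. \<phi> l) * (\<Sum>l\<in>exponents B (n - i). \<psi> l))"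
proof -
 have "(\<Sum>i\<le>n. (\<Sum>l\<in>exponents A i. \<phi> l) * (\<Sum>l\<in>exponents B (n - i). \<psi> l))
  = (\<Sum>i\<le>n. \<Sum>p\<in>exponents A i \<times> exponents B (n - i). \<phi> (fst p) * \<psi> (snd p))"
  by (simp add: sum_product sum.cartesian_product case_prod_unfold)
 also have "... = (\<Sum>z\<in>(SIGMA i:{..n}. exponents A i \<times> exponents B (n - i)). \<phi> (fst (snd z)) * \<psi> (snd (snd z)))"
  using fin by (subst sum.Sigma) (auto simp: case_prod_unfold)
 also have "... = (\<Sum>l\<in>exponents (A \<union> B) n. \<phi> l * \<psi> l)"
 proof (rule sum.reindex_bij_witness[where
   j = "\<lambda>z i. fst (snd z) i + snd (snd z) i" and
   i = "\<lambda>l. (\<Sum>i\<in>A. l i, (\<lambda>i. if i \<in> A then l i else 0, \<lambda>i. if i \<in> B then l i else 0))"], goal_cases)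
  case (1 z)
  then obtain i l k where z: "z = (i, l, k)" "i \<le> n" "l \<in> exponents A i" "k \<in> exponents B (n - i)" by auto
  have l0: "l j = 0" if "j \<notin> A" for j using z that by (auto simp: exponents_def)
  have k0: "k j = 0" if "j \<notin> B" for j using z that by (auto simp: exponents_def)
  have s: "(\<Sum>j\<in>A. l j + k j) = (\<Sum>j\<in>A. l j)" using fin(3) k0 by (intro sum.cong) auto
  show ?case using z fin(3) l0 k0 by (auto simp: s fun_eq_iff) (auto simp: exponents_def)
 next
  case (2 z)
  then obtain i l k where z: "z = (i, l, k)" "i \<le> n" "l \<in> exponents A i" "k \<in> exponents B (n - i)" by auto
  have l0: "l j = 0" if "j \<notin> A" for j using z that by (auto simp: exponents_def)
  have k0: "k j = 0" if "j \<notin> B" for j using z that by (auto simp: exponents_def)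
  have sA: "(\<Sum>j\<in>A. l j + k j) = (\<Sum>j\<in>A. l j)" using fin(3) k0 by (intro sum.cong) auto
  have sB: "(\<Sum>j\<in>B. l j + k j) = (\<Sum>j\<in>B. k j)" using fin(3) l0 by (intro sum.cong) auto
  have "(\<Sum>j\<in>A \<union> B. l j + k j) = n"
   using z(2-4) by (subst sum.union_disjoint[OF fin]) (auto simp: sA sB exponents_def)
  then show ?case using z(1) l0 k0 by (simp add: exponents_def)
 next
  case (3 l)
  then show ?case using fin(3) by (auto simp: exponents_def fun_eq_iff)
 next
  case (4 l)
  have l: "(\<Sum>j\<in>A. l j) + (\<Sum>j\<in>B. l j) = n"
   using 4 sum.union_disjoint[OF fin, of l] by (simp add: exponents_def)
  then have "(\<Sum>j\<in>B. l j) = n - (\<Sum>j\<in>A. l j)" "(\<Sum>j\<in>A. l j) \<le> n" by auto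
  then show ?case by (auto simp: exponents_def)
 next
  case (5 z)
  then obtain i l k where z: "z = (i, l, k)" "i \<le> n" "l \<in> exponents A i" "k \<in> exponents B (n - i)" by auto
  have l0: "l j = 0" if "j \<notin> A" for j using z that by (auto simp: exponents_def)
  have k0: "k j = 0" if "j \<notin> B" for j using z that by (auto simp: exponents_def)
  have "\<phi> (\<lambda>i. l i + k i) = \<phi> l" using fin(3) k0 by (intro \<phi>) auto
  moreover have "\<psi> (\<lambda>i. l i + k i) = \<psi> k" using fin(3) l0 by (intro \<psi>) auto
  ultimately show ?case using z(1) by simp
 qed
 finally show ?thesis by simp
qed

lemma prod_blocks_fps:
 fixes \<phi> :: "nat set \<Rightarrow> (nat \<Rightarrow> nat) \<Rightarrow> 'w::comm_ring_1"
 assumes "finite Os" "\<And>C. C \<in> Os \<Longrightarrow> finite C" "\<And>C C'. C \<in> Os \<Longrightarrow> C' \<in> Os \<Longrightarrow> C \<noteq> C' \<Longrightarrow> C \<inter> C' = {}"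
  and \<phi>: "\<And>C l l'. (\<And>i. i \<in> C \<Longrightarrow> l i = l' i) \<Longrightarrow> \<phi> C l = \<phi> C l'"
 shows "(\<Prod>C\<in>Os. Abs_fps (\<lambda>n. \<Sum>l\<in>exponents C n. \<phi> C l)) = Abs_fps (\<lambda>n. \<Sum>l\<in>exponents (\<Union>Os) n. \<Prod>C\<in>Os. \<phi> C l)"
 using assms(1-3)
proof (induction Os rule: finite_induct)
 case empty
 have "exponents {} n = (if n = 0 then {\<lambda>_. 0} else {})" for n
  by (auto simp: exponents_def)
 then show ?case by (intro fps_ext) simp
next
 case (insert B Os)
 have IH: "(\<Prod>C\<in>Os. Abs_fps (\<lambda>n. \<Sum>l\<in>exponents C n. \<phi> C l)) = Abs_fps (\<lambda>n. \<Sum>l\<in>exponents (\<Union>Os) n. \<Prod>C\<in>Os. \<phi> C l)"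
  using insert.prems by (intro insert.IH) auto
 have dis: "B \<inter> \<Union>Os = {}" using insert.prems(2)[of B] insert.hyps(2) by blast
 have finU: "finite (\<Union>Os)" using insert.hyps insert.prems by auto
 show ?case
 proof (rule fps_ext)
  fix n
  have "fps_nth (\<Prod>C\<in>insert B Os. Abs_fps (\<lambda>n. \<Sum>l\<in>exponents C n. \<phi> C l)) n
   = (\<Sum>i\<le>n. (\<Sum>l\<in>exponents B i. \<phi> B l) * (\<Sum>l\<in>exponents (\<Union>Os) (n - i). \<Prod>C\<in>Os. \<phi> C l))"
   using insert.hyps by (simp add: IH fps_mult_nth atLeast0AtMost)
  also have "... = (\<Sum>l\<in>exponents (B \<union> \<Union>Os) n. \<phi> B l * (\<Prod>C\<in>Os. \<phi> C l))"
  proof (rule sum_exponents_union[symmetric])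
   show "\<phi> B l = \<phi> B l'" if "\<And>i. i \<in> B \<Longrightarrow> l i = l' i" for l l' by (rule \<phi>) (rule that)
   show "(\<Prod>C\<in>Os. \<phi> C l) = (\<Prod>C\<in>Os. \<phi> C l')" if "\<And>i. i \<in> \<Union>Os \<Longrightarrow> l i = l' i" for l l'
    by (intro prod.cong refl \<phi> that) blast
  qed (use insert.prems finU dis in auto)
  finally show "fps_nth (\<Prod>C\<in>insert B Os. Abs_fps (\<lambda>n. \<Sum>l\<in>exponents C n. \<phi> C l)) n
   = fps_nth (Abs_fps (\<lambda>n. \<Sum>l\<in>exponents (\<Union>(insert B Os)) n. \<Prod>C\<in>insert B Os. \<phi> C l)) n"
   using insert.hyps by simp
 qed
qed

text \<open>A homogeneous polynomial in the \<open>c\<^sub>i\<close> that vanishes whenever these are distinct has zero coefficients: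
 with the other variables fixed it vanishes at all but finitely many values of one variable. This is what allows
 the identities proved for distinct \<open>c\<close> to be read off coefficientwise.\<close>

lemma poly_vanishing:
 fixes Z :: "(nat \<Rightarrow> nat) \<Rightarrow> complex"
 assumes "finite D" "\<And>c :: nat \<Rightarrow> complex. inj_on c D \<Longrightarrow> (\<Sum>m\<in>exponents D n. (\<Prod>i\<in>D. c i ^ m i) * Z m) = 0"
  "m \<in> exponents D n"
 shows "Z m = 0"
 using assms
proof (induction D arbitrary: Z n m rule: finite_induct)
 case empty
 then have "m = (\<lambda>_. 0)" "n = 0" "exponents {} n = {\<lambda>_. 0}" by (auto simp: exponents_def)
 then show ?case using empty(1)[of "\<lambda>_. 0"] by simp
next
 case (insert x A)
 have split: "(\<Sum>m\<in>exponents (insert x A) n. (\<Prod>i\<in>insert x A. c i ^ m i) * Z m)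
   = (\<Sum>j\<le>n. c x ^ j * (\<Sum>m\<in>exponents A (n - j). (\<Prod>i\<in>A. c i ^ m i) * Z (m(x := j))))" for c :: "nat \<Rightarrow> complex"
 proof -
  have "(\<Sum>j\<le>n. c x ^ j * (\<Sum>m\<in>exponents A (n - j). (\<Prod>i\<in>A. c i ^ m i) * Z (m(x := j))))
   = (\<Sum>z\<in>(SIGMA j:{..n}. exponents A (n - j)). c x ^ fst z * ((\<Prod>i\<in>A. c i ^ snd z i) * Z ((snd z)(x := fst z))))"
   unfolding sum_distrib_left using insert.hyps by (subst sum.Sigma) (auto simp: case_prod_unfold)
  also have "... = (\<Sum>m\<in>exponents (insert x A) n. (\<Prod>i\<in>insert x A. c i ^ m i) * Z m)"
  proof (rule sum.reindex_bij_witness[where j = "\<lambda>z. (snd z)(x := fst z)" and i = "\<lambda>m. (m x, m(x := 0))"], goal_cases)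
   case (1 z)
   then show ?case using insert.hyps(2) by (cases z) (auto simp: exponents_def fun_eq_iff)
  next
   case (2 z)
   have s: "(\<Sum>i\<in>A. ((snd z)(x := fst z)) i) = (\<Sum>i\<in>A. snd z i)" using insert.hyps by (intro sum.cong) auto
   show ?case using 2 insert.hyps s by (auto simp: exponents_def)
  next
   case (4 m)
   have s: "(\<Sum>i\<in>A. (m(x := 0)) i) = (\<Sum>i\<in>A. m i)" using insert.hyps by (intro sum.cong) auto
   show ?case using 4 insert.hyps s by (auto simp: exponents_def)
  next
   case (5 z)
   have s: "(\<Prod>i\<in>A. c i ^ ((snd z)(x := fst z)) i) = (\<Prod>i\<in>A. c i ^ snd z i)" using insert.hyps by (intro prod.cong) auto
   show ?case using insert.hyps s by (simp add: mult.assoc)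
  qed auto
  finally show ?thesis by simp
 qed
 have "(\<Sum>m\<in>exponents A (n - j). (\<Prod>i\<in>A. c i ^ m i) * Z (m(x := j))) = 0" if c: "inj_on c A" and j: "j \<le> n" for c :: "nat \<Rightarrow> complex" and j
 proof -
  define u where "u j = (\<Sum>m\<in>exponents A (n - j). (\<Prod>i\<in>A. c i ^ m i) * Z (m(x := j)))" for j
  define p where "p = (\<Sum>j\<le>n. monom (u j) j)"
  have "poly p z = 0" if "z \<notin> c ` A" for z
  proof -
   let ?c = "c(x := z)"
   have "inj_on ?c (insert x A)" using c that insert.hyps(2) by (auto simp: inj_on_def)
   then have "(\<Sum>m\<in>exponents (insert x A) n. (\<Prod>i\<in>insert x A. ?c i ^ m i) * Z m) = 0" by (rule insert.prems)
   moreover have "(\<Prod>i\<in>A. ?c i ^ m i) = (\<Prod>i\<in>A. c i ^ m i)" for m using insert.hyps by (intro prod.cong) auto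
   ultimately have "(\<Sum>j\<le>n. z ^ j * u j) = 0" unfolding split u_def by simp
   then show ?thesis by (simp add: p_def poly_sum poly_monom mult.commute)
  qed
  then have "- (c ` A) \<subseteq> {z. poly p z = 0}" by auto
  moreover have "infinite (- (c ` A))"
   using Diff_infinite_finite[of "c ` A" "UNIV :: complex set"] insert.hyps(1)
   by (simp add: Compl_eq_Diff_UNIV infinite_UNIV_char_0)
  ultimately have "p = 0" using poly_roots_finite[of p] finite_subset by blast
  moreover have "coeff p j = u j"
   using j by (simp add: p_def coeff_sum when_def sum.delta)
  ultimately show ?thesis by (simp add: u_def)
 qed
 note red = this
 have mx: "m x \<le> n" using insert.prems(2) insert.hyps by (auto simp: exponents_def)
 have "Z ((m(x := 0))(x := m x)) = 0"
 proof (rule insert.IH[where Z = "\<lambda>m'. Z (m'(x := m x))" and n = "n - m x" and m = "m(x := 0)"])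
  show "(\<Sum>m'\<in>exponents A (n - m x). (\<Prod>i\<in>A. c i ^ m' i) * Z (m'(x := m x))) = 0" if "inj_on c A" for c
   using red[OF that mx] .
  have s: "(\<Sum>i\<in>A. (m(x := 0)) i) = (\<Sum>i\<in>A. m i)" using insert.hyps by (intro sum.cong) auto
  show "m(x := 0) \<in> exponents A (n - m x)" using insert.prems(2) insert.hyps s by (auto simp: exponents_def)
 qed
 then show ?case by simp
qed

definition geom :: "complex \<Rightarrow> complex fps" where
 "geom z = Abs_fps (\<lambda>k. if k = 0 then 0 else z ^ (k - 1))"

lemma geom_eq: "(1 - fps_const z * fps_X) * geom z = fps_X"
proof (rule fps_ext)
 fix n
 have "(1 - fps_const z * fps_X) * geom z = geom z - fps_const z * (fps_X * geom z)"
  by (simp add: algebra_simps)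
 then have e: "fps_nth ((1 - fps_const z * fps_X) * geom z) n = fps_nth (geom z) n - z * (if n = 0 then 0 else fps_nth (geom z) (n - 1))"
  by simp
 show "fps_nth ((1 - fps_const z * fps_X) * geom z) n = fps_nth fps_X n"
 proof (cases n)
  case 0
  then show ?thesis unfolding e by (simp add: geom_def)
 next
  case (Suc m)
  then show ?thesis unfolding e by (cases m) (simp_all add: geom_def)
 qed
qed

lemma geom_mult:
 assumes "x \<noteq> y"
 shows "geom x * geom y = fps_const (1 / (x - y)) * (geom x - geom y)"
proof -
 let ?u = "\<lambda>z. 1 - fps_const z * fps_X :: complex fps"
 have nz: "?u z \<noteq> 0" for z
  using geom_eq[of z] by (metis fps_X_neq_zero mult_zero_left)
 have "(?u x * ?u y) * (geom x * geom y) = (?u x * geom x) * (?u y * geom y)" by (simp add: mult_ac)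
 also have "... = fps_X * fps_X" by (simp only: geom_eq)
 also have "... = fps_const (1 / (x - y)) * (fps_const (x - y) * (fps_X * fps_X))"
  using assms by (simp add: mult.assoc[symmetric] del: mult.assoc)
 also have "fps_const (x - y) * (fps_X * fps_X) = ?u y * fps_X - ?u x * fps_X"
  by (simp add: algebra_simps fps_const_sub[symmetric] del: fps_const_sub)
 also have "... = ?u y * (?u x * geom x) - ?u x * (?u y * geom y)" by (simp only: geom_eq)
 also have "fps_const (1 / (x - y)) * ... = (?u x * ?u y) * (fps_const (1 / (x - y)) * (geom x - geom y))"
 proof -
  have "K * (uy * (ux * gx) - ux * (uy * gy)) = (ux * uy) * (K * (gx - gy))" for K ux uy gx gy :: "complex fps"
   by (simp add: algebra_simps)
  then show ?thesis .
 qed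
 finally show ?thesis using nz by simp
qed

definition complete_hom :: "(nat \<Rightarrow> complex) \<Rightarrow> nat set \<Rightarrow> nat \<Rightarrow> complex" where
 "complete_hom c C n = (\<Sum>l\<in>exponents C n. \<Prod>i\<in>C. c i ^ l i)"

lemma prod_geom:
 assumes "finite C"
 shows "(\<Prod>i\<in>C. geom (c i)) = fps_X ^ card C * Abs_fps (complete_hom c C)"
proof -
 have e: "exponents {i} n = {\<lambda>j. if j = i then n else 0}" for i n
  by (auto simp: exponents_def)
 have g: "geom z = fps_X * Abs_fps (\<lambda>n. z ^ n)" for z
  by (rule fps_ext) (auto simp: geom_def)
 have "(\<Prod>i\<in>C. Abs_fps (\<lambda>n. c i ^ n)) = (\<Prod>B\<in>(\<lambda>i. {i}) ` C. Abs_fps (\<lambda>n. \<Sum>l\<in>exponents B n. \<Prod>i\<in>B. c i ^ l i))"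
  by (subst prod.reindex) (auto simp: e)
 also have "... = Abs_fps (\<lambda>n. \<Sum>l\<in>exponents (\<Union>((\<lambda>i. {i}) ` C)) n. \<Prod>B\<in>(\<lambda>i. {i}) ` C. \<Prod>i\<in>B. c i ^ l i)"
  using assms by (intro prod_blocks_fps) (auto intro!: prod.cong)
 also have "... = Abs_fps (complete_hom c C)"
  unfolding complete_hom_def by (intro arg_cong[where f = Abs_fps] ext sum.cong) (auto simp: prod.reindex)
 finally show ?thesis by (simp add: g prod.distrib)
qed

text \<open>The divided difference of \<open>u\<^sup>k\<^sup>-\<^sup>1\<close> is a complete homogeneous polynomial: expand the product of the
 geometric series by \<open>prod_add_expand\<close> with \<open>b = 0\<close>.\<close>

lemma lagrange_complete_hom:
 assumes C: "finite C" "C \<noteq> {}" "inj_on c C" and k: "0 < k"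
 shows "(\<Sum>e\<in>C. c e ^ (k - 1) * (\<Prod>j\<in>C - {e}. 1 / (c e - c j))) = (if k < card C then 0 else complete_hom c C (k - card C))"
proof -
 have ne: "c u \<noteq> c v" if "u \<in> C" "v \<in> C" "u \<noteq> v" for u v using C(3) that unfolding inj_on_def by blast
 let ?r = "\<lambda>d e. fps_const (1 / (c d - c e))"
 have "(\<Prod>e\<in>C. 0 + geom (c e)) = (\<Prod>e\<in>C. 0) + (\<Sum>d\<in>C. geom (c d) * (\<Prod>e\<in>C - {d}. 0 + ?r d e))"
 proof (rule prod_add_expand)
  show "?r e d = - ?r d e" if "d \<in> C" "e \<in> C" "d \<noteq> e" for d e
   using ne[OF that] by (simp add: divide_simps)
  show "?r x d * ?r x e = ?r d e * (?r x d - ?r x e)"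
   if "x \<in> C" "d \<in> C" "e \<in> C" "x \<noteq> d" "x \<noteq> e" "d \<noteq> e" for x d e
   unfolding fps_const_mult fps_const_sub
   by (intro arg_cong[where f = fps_const] inverse_diff_relation ne that)
  show "geom (c d) * geom (c e) = ?r d e * (geom (c d) - geom (c e))" if "d \<in> C" "e \<in> C" "d \<noteq> e" for d e
   by (intro geom_mult ne that)
 qed (rule C(1))
 moreover have "(\<Prod>e\<in>C. 0 :: complex fps) = 0" using C(1,2) by (simp add: card_gt_0_iff)
 ultimately have "fps_X ^ card C * Abs_fps (complete_hom c C) = (\<Sum>d\<in>C. geom (c d) * (\<Prod>e\<in>C - {d}. ?r d e))"
  using prod_geom[OF C(1), of c] by simp
 also have "... = (\<Sum>d\<in>C. geom (c d) * fps_const (\<Prod>e\<in>C - {d}. 1 / (c d - c e)))"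
 proof -
  have "(\<Prod>e\<in>I. fps_const (g e :: complex)) = fps_const (\<Prod>e\<in>I. g e)" for I :: "nat set" and g
   by (induction I rule: infinite_finite_induct) auto
  then show ?thesis by simp
 qed
 finally have "fps_nth (fps_X ^ card C * Abs_fps (complete_hom c C)) k = fps_nth (\<Sum>d\<in>C. geom (c d) * fps_const (\<Prod>e\<in>C - {d}. 1 / (c d - c e))) k"
  by simp
 then have "(if k < card C then 0 else complete_hom c C (k - card C)) = (\<Sum>e\<in>C. c e ^ (k - 1) * (\<Prod>j\<in>C - {e}. 1 / (c e - c j)))"
  using k by (cases "k < card C") (simp_all add: fps_sum_nth geom_def fps_X_power_mult_nth)
 then show ?thesis by (simp only:)
qed

section \<open>Pairs of permutations with prescribed product\<close>

definition cycle_product :: "(nat \<Rightarrow> 'v) \<Rightarrow> nat set \<Rightarrow> nat perm \<Rightarrow> (nat \<Rightarrow> nat) \<Rightarrow> 'v::comm_ring_1" where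
 "cycle_product b D \<sigma> l = (\<Prod>C\<in>orbit \<sigma> ` D. b (\<Sum>i\<in>C. Suc (l i)))"

definition pair_sum :: "(nat \<Rightarrow> 'v) \<Rightarrow> (nat \<Rightarrow> 'v) \<Rightarrow> nat perm \<Rightarrow> nat set \<Rightarrow> (nat \<Rightarrow> nat) \<Rightarrow> 'v::comm_ring_1" where
 "pair_sum b a \<rho> D m = (\<Sum>l | \<forall>i. l i \<le> m i. \<Sum>(\<pi>, \<sigma>) | \<pi> \<in> perms_on D \<and> \<sigma> \<in> perms_on D \<and> \<pi> * \<sigma> = \<rho>.
   cycle_product b D \<pi> l * cycle_product a D \<sigma> (\<lambda>i. m i - l i))"

locale scalar_embedding =
 fixes \<kappa> :: "complex \<Rightarrow> 'k::comm_ring_1"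
 assumes emb_add: "\<kappa> (a + b) = \<kappa> a + \<kappa> b" and emb_mult: "\<kappa> (a * b) = \<kappa> a * \<kappa> b" and emb_1: "\<kappa> 1 = 1"
begin

interpretation emb: complex_hom \<kappa>
 by unfold_locales (rule emb_add emb_mult emb_1)+

definition pconst :: "complex \<Rightarrow> 'k poly" where "pconst z = [:\<kappa> z:]"
definition wconst :: "complex \<Rightarrow> 'k poly fps" where "wconst z = fps_const (pconst z)"

lemma pconst_hom: "pconst (a + b) = pconst a + pconst b" "pconst (a * b) = pconst a * pconst b" "pconst 1 = 1"
 by (simp_all add: pconst_def emb_add emb_mult emb_1)

interpretation p: complex_hom pconst
 by unfold_locales (rule pconst_hom)+

interpretation w: complex_hom wconst
 by unfold_locales (simp_all add: wconst_def pconst_hom)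

text \<open>The values at \<open>c\<^sub>e\<close> of the function \<open>\<Sum> b\<^sub>k u\<^sup>k\<^sup>-\<^sup>1\<close>. The variable of the power series records the
 index \<open>k\<close>; it separates the contributions of different total degree in \<open>c\<close>.\<close>

definition node_series :: "(nat \<Rightarrow> complex) \<Rightarrow> (nat \<Rightarrow> 'k poly) \<Rightarrow> nat \<Rightarrow> 'k poly fps" where
 "node_series c b e = Abs_fps (\<lambda>k. if k = 0 then 0 else b k * pconst (c e ^ (k - 1)))"

lemma cycle_value_node_series:
 assumes C: "finite C" "C \<noteq> {}" "inj_on c C"
 shows "w.cycle_value c (node_series c b) C = fps_X ^ card C * Abs_fps (\<lambda>n. b (card C + n) * pconst (complete_hom c C n))"
proof (rule fps_ext)
 fix k
 have "fps_nth (w.cycle_value c (node_series c b) C) k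
  = (if k = 0 then 0 else b k * pconst (\<Sum>e\<in>C. c e ^ (k - 1) * (\<Prod>j\<in>C - {e}. 1 / (c e - c j))))"
  unfolding w.cycle_value_def wconst_def fps_sum_nth
  by (simp add: node_series_def p.hom_sum pconst_hom sum_distrib_left mult.assoc)
 also have "... = fps_nth (fps_X ^ card C * Abs_fps (\<lambda>n. b (card C + n) * pconst (complete_hom c C n))) k"
 proof (cases "k = 0")
  case True
  then show ?thesis using C by (simp add: fps_X_power_mult_nth card_gt_0_iff)
 next
  case False
  then show ?thesis using lagrange_complete_hom[OF C, of k]
   by (simp add: fps_X_power_mult_nth)
 qed
 finally show "fps_nth (w.cycle_value c (node_series c b) C) k = fps_nth (fps_X ^ card C * Abs_fps (\<lambda>n. b (card C + n) * pconst (complete_hom c C n))) k" .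
qed

lemma prod_cycle_value:
 assumes D: "finite D" "\<sigma> \<in> perms_on D" "inj_on c D"
 shows "(\<Prod>C\<in>orbit \<sigma> ` D. w.cycle_value c (node_series c b) C)
  = fps_X ^ card D * Abs_fps (\<lambda>n. \<Sum>l\<in>exponents D n. pconst (\<Prod>i\<in>D. c i ^ l i) * cycle_product b D \<sigma> l)"
proof -
 let ?O = "orbit \<sigma> ` D"
 have s: "affected \<sigma> \<subseteq> D" using D(2) by (simp add: perms_on_def)
 have U: "\<Union>?O = D" using orbit_subset_support[OF s] by fastforce
 have dj: "C \<inter> C' = {}" if "C \<in> ?O" "C' \<in> ?O" "C \<noteq> C'" for C C'
  using that by (rule orbits_disjoint)
 have fC: "finite C" "C \<noteq> {}" "C \<subseteq> D" if "C \<in> ?O" for C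
  using that orbit_subset_support[OF s] by auto
 define \<phi> where "\<phi> C l = pconst (\<Prod>i\<in>C. c i ^ l i) * b (\<Sum>i\<in>C. Suc (l i))" for C and l :: "nat \<Rightarrow> nat"
 have cardD: "(\<Sum>C\<in>?O. card C) = card D"
 proof -
  have "(\<Sum>C\<in>?O. card C) = (\<Sum>C\<in>?O. \<Sum>x\<in>C. 1)" by (intro sum.cong refl) simp
  also have "... = (\<Sum>x\<in>D. 1)" by (rule disjoint_orbits_sum[OF D(1) s, symmetric])
  finally show ?thesis by simp
 qed
 have "(\<Prod>C\<in>?O. w.cycle_value c (node_series c b) C) = (\<Prod>C\<in>?O. fps_X ^ card C * Abs_fps (\<lambda>n. \<Sum>l\<in>exponents C n. \<phi> C l))"
 proof (rule prod.cong[OF refl])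
  fix C assume C: "C \<in> ?O"
  have "b (card C + n) * pconst (complete_hom c C n) = (\<Sum>l\<in>exponents C n. \<phi> C l)" for n
   unfolding complete_hom_def p.hom_sum sum_distrib_left
  proof (rule sum.cong[OF refl])
   fix l assume "l \<in> exponents C n"
   then have "(\<Sum>i\<in>C. Suc (l i)) = card C + n" by (simp add: exponents_def sum_Suc add.commute)
   then show "b (card C + n) * pconst (\<Prod>i\<in>C. c i ^ l i) = \<phi> C l" by (simp add: \<phi>_def mult.commute)
  qed
  then show "w.cycle_value c (node_series c b) C = fps_X ^ card C * Abs_fps (\<lambda>n. \<Sum>l\<in>exponents C n. \<phi> C l)"
   using fC[OF C] D(3) by (subst cycle_value_node_series) (auto intro: inj_on_subset)
 qed
 also have "... = fps_X ^ card D * (\<Prod>C\<in>?O. Abs_fps (\<lambda>n. \<Sum>l\<in>exponents C n. \<phi> C l))"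
  unfolding prod.distrib cardD[symmetric] by (simp add: power_sum)
 also have "(\<Prod>C\<in>?O. Abs_fps (\<lambda>n. \<Sum>l\<in>exponents C n. \<phi> C l)) = Abs_fps (\<lambda>n. \<Sum>l\<in>exponents (\<Union>?O) n. \<Prod>C\<in>?O. \<phi> C l)"
 proof (rule prod_blocks_fps)
  show "\<phi> C l = \<phi> C l'" if "\<And>i. i \<in> C \<Longrightarrow> l i = l' i" for C l l'
   unfolding \<phi>_def using that by (intro arg_cong2[where f = "(*)"] arg_cong[where f = pconst] arg_cong[where f = b] prod.cong sum.cong) auto
 qed (use D fC dj in auto)
 also have "... = Abs_fps (\<lambda>n. \<Sum>l\<in>exponents D n. pconst (\<Prod>i\<in>D. c i ^ l i) * cycle_product b D \<sigma> l)"
  unfolding U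
 proof (intro arg_cong[where f = Abs_fps] ext sum.cong refl)
  fix l
  have "(\<Prod>i\<in>D. c i ^ l i) = (\<Prod>i\<in>\<Union>?O. c i ^ l i)" by (simp only: U)
  also have "... = (\<Prod>C\<in>?O. \<Prod>i\<in>C. c i ^ l i)"
  proof (rule prod.Union_disjoint[unfolded comp_def]; intro ballI impI)
   show "A \<inter> B = {}" if "A \<in> ?O" "B \<in> ?O" "A \<noteq> B" for A B using that by (rule dj)
  qed auto
  finally show "(\<Prod>C\<in>?O. \<phi> C l) = pconst (\<Prod>i\<in>D. c i ^ l i) * cycle_product b D \<sigma> l"
   by (simp only: \<phi>_def prod.distrib p.hom_prod cycle_product_def)
 qed
 finally show ?thesis .
qed

lemma sum_exponents_convolution:
 assumes D: "finite D"
 shows "(\<Sum>m\<in>exponents D n. \<Sum>l | \<forall>i. l i \<le> m i. g l (\<lambda>i. m i - l i)) = (\<Sum>i\<le>n. \<Sum>l\<in>exponents D i. \<Sum>k\<in>exponents D (n - i). g l k)"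
proof -
 have fin: "finite {l. \<forall>i. l i \<le> m i}" if "m \<in> exponents D n" for m
 proof (rule finite_subset)
  show "{l. \<forall>i. l i \<le> m i} \<subseteq> {l. \<forall>i. (i \<in> D \<longrightarrow> l i \<in> {..n}) \<and> (i \<notin> D \<longrightarrow> l i = 0)}"
  proof (rule subsetI, rule CollectI, rule allI, intro conjI impI)
   fix l i assume "l \<in> {l. \<forall>i. l i \<le> m i}"
   then have l: "l i \<le> m i" by simp
   show "l i \<in> {..n}" if "i \<in> D"
    using l \<open>m \<in> exponents D n\<close> D member_le_sum[of i D m] that by (auto simp: exponents_def)
   show "l i = 0" if "i \<notin> D"
    using l \<open>m \<in> exponents D n\<close> that by (auto simp: exponents_def)
  qed
  show "finite {l. \<forall>i. (i \<in> D \<longrightarrow> l i \<in> {..n}) \<and> (i \<notin> D \<longrightarrow> l i = 0)}"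
   by (rule finite_set_of_finite_funs[OF D]) simp
 qed
 have "(\<Sum>m\<in>exponents D n. \<Sum>l | \<forall>i. l i \<le> m i. g l (\<lambda>i. m i - l i))
  = (\<Sum>z\<in>(SIGMA m:exponents D n. {l. \<forall>i. l i \<le> m i}). g (snd z) (\<lambda>i. fst z i - snd z i))"
  using D fin by (subst sum.Sigma) (auto simp: case_prod_unfold)
 also have "... = (\<Sum>z\<in>(SIGMA i:{..n}. exponents D i \<times> exponents D (n - i)). g (fst (snd z)) (snd (snd z)))"
 proof (rule sum.reindex_bij_witness[where i = "\<lambda>z. (\<lambda>i. fst (snd z) i + snd (snd z) i, fst (snd z))" and
    j = "\<lambda>z. (\<Sum>i\<in>D. snd z i, (snd z, \<lambda>i. fst z i - snd z i))"], goal_cases)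
  case (2 z)
  then obtain m l where z: "z = (m, l)" "m \<in> exponents D n" "\<And>i. l i \<le> m i" by auto
  have 1: "(\<Sum>i\<in>D. l i) \<le> (\<Sum>i\<in>D. m i)" using z(3) by (intro sum_mono)
  have 2: "(\<Sum>i\<in>D. m i - l i) = (\<Sum>i\<in>D. m i) - (\<Sum>i\<in>D. l i)" using z(3) by (intro sum_subtractf_nat)
  have 3: "l i = 0" "m i = 0" if "i \<notin> D" for i using z(2) z(3)[of i] that by (auto simp: exponents_def)
  show ?case using z(1,2) 1 2 3 by (auto simp: exponents_def)
 qed (auto simp: exponents_def sum.distrib)
 also have "... = (\<Sum>i\<le>n. \<Sum>l\<in>exponents D i. \<Sum>k\<in>exponents D (n - i). g l k)"
 proof -
  have "(\<Sum>i\<le>n. \<Sum>l\<in>exponents D i. \<Sum>k\<in>exponents D (n - i). g l k)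
   = (\<Sum>i\<le>n. \<Sum>p\<in>exponents D i \<times> exponents D (n - i). g (fst p) (snd p))"
   by (simp add: sum.cartesian_product case_prod_unfold)
  also have "... = (\<Sum>z\<in>(SIGMA i:{..n}. exponents D i \<times> exponents D (n - i)). g (fst (snd z)) (snd (snd z)))"
   using D by (subst sum.Sigma) (auto simp: case_prod_unfold)
  finally show ?thesis by simp
 qed
 finally show ?thesis .
qed

text \<open>By \<open>lagrange_complete_hom\<close> the value of a cycle \<open>C\<close> is
 \<open>\<Sum> b\<^sub>|\<^sub>C\<^sub>|\<^sub>+\<^sub>n h\<^sub>n(c\<^sub>C)\<close>, summed over \<open>n\<close>; expanding \<open>h\<^sub>n\<close> into monomials attaches an exponent to each point of \<open>C\<close>.\<close>

lemma lookup_series_product: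
 assumes D: "finite D" "inj_on c D"
 shows "fps_nth (lookup (gaudin_family.series scal D (w.rooted_sum c D) (node_series c b)
   * gaudin_family.series scal D (w.rooted_sum c D) (node_series c a)) \<rho>) (card D + card D + n)
  = (\<Sum>m\<in>exponents D n. pconst (\<Prod>i\<in>D. c i ^ m i) * pair_sum b a \<rho> D m)"
proof -
 let ?P = "{(\<pi>, \<sigma>). \<pi> \<in> perms_on D \<and> \<sigma> \<in> perms_on D \<and> \<pi> * \<sigma> = \<rho>}"
 let ?F = "\<lambda>b \<pi>. Abs_fps (\<lambda>n. \<Sum>l\<in>exponents D n. pconst (\<Prod>i\<in>D. c i ^ l i) * cycle_product b D \<pi> l)"
 have "lookup (gaudin_family.series scal D (w.rooted_sum c D) (node_series c b)
   * gaudin_family.series scal D (w.rooted_sum c D) (node_series c a)) \<rho>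
  = (\<Sum>(\<pi>, \<sigma>)\<in>?P. (fps_X ^ card D * ?F b \<pi>) * (fps_X ^ card D * ?F a \<sigma>))"
  unfolding w.series_rooted_sum[OF D] lookup_on_perms_product[OF D(1) D(1)]
  by (intro sum.cong refl) (auto simp: prod_cycle_value D)
 also have "... = fps_X ^ (card D + card D) * (\<Sum>(\<pi>, \<sigma>)\<in>?P. ?F b \<pi> * ?F a \<sigma>)"
  by (simp add: sum_distrib_left case_prod_unfold power_add mult_ac)
 finally have "fps_nth (lookup (gaudin_family.series scal D (w.rooted_sum c D) (node_series c b)
   * gaudin_family.series scal D (w.rooted_sum c D) (node_series c a)) \<rho>) (card D + card D + n)
  = (\<Sum>(\<pi>, \<sigma>)\<in>?P. fps_nth (?F b \<pi> * ?F a \<sigma>) n)"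
  by (simp add: fps_X_power_mult_nth fps_sum_nth case_prod_unfold)
 also have "... = (\<Sum>(\<pi>, \<sigma>)\<in>?P. \<Sum>m\<in>exponents D n. \<Sum>l | \<forall>i. l i \<le> m i.
   pconst (\<Prod>i\<in>D. c i ^ m i) * (cycle_product b D \<pi> l * cycle_product a D \<sigma> (\<lambda>i. m i - l i)))"
 proof (intro sum.cong refl, clarify)
  fix \<pi> \<sigma>
  have "fps_nth (?F b \<pi> * ?F a \<sigma>) n = (\<Sum>i\<le>n. \<Sum>l\<in>exponents D i. \<Sum>k\<in>exponents D (n - i).
    pconst (\<Prod>i\<in>D. c i ^ (l i + k i)) * (cycle_product b D \<pi> l * cycle_product a D \<sigma> k))"
   unfolding fps_mult_nth atLeast0AtMost
   by (simp add: sum_product) (intro sum.cong refl, simp add: power_add prod.distrib pconst_hom mult_ac)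
  also have "... = (\<Sum>m\<in>exponents D n. \<Sum>l | \<forall>i. l i \<le> m i.
    pconst (\<Prod>i\<in>D. c i ^ (l i + (m i - l i))) * (cycle_product b D \<pi> l * cycle_product a D \<sigma> (\<lambda>i. m i - l i)))"
   by (rule sum_exponents_convolution[OF D(1), symmetric])
  also have "... = (\<Sum>m\<in>exponents D n. \<Sum>l | \<forall>i. l i \<le> m i.
    pconst (\<Prod>i\<in>D. c i ^ m i) * (cycle_product b D \<pi> l * cycle_product a D \<sigma> (\<lambda>i. m i - l i)))"
   by (intro sum.cong refl) simp
  finally show "fps_nth (?F b \<pi> * ?F a \<sigma>) n = (\<Sum>m\<in>exponents D n. \<Sum>l | \<forall>i. l i \<le> m i.
    pconst (\<Prod>i\<in>D. c i ^ m i) * (cycle_product b D \<pi> l * cycle_product a D \<sigma> (\<lambda>i. m i - l i)))" .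
 qed
 also have "... = (\<Sum>m\<in>exponents D n. \<Sum>l | \<forall>i. l i \<le> m i. \<Sum>(\<pi>, \<sigma>)\<in>?P.
   pconst (\<Prod>i\<in>D. c i ^ m i) * (cycle_product b D \<pi> l * cycle_product a D \<sigma> (\<lambda>i. m i - l i)))"
  unfolding case_prod_unfold by (subst sum.swap, intro sum.cong refl, rule sum.swap)
 also have "... = (\<Sum>m\<in>exponents D n. pconst (\<Prod>i\<in>D. c i ^ m i) * pair_sum b a \<rho> D m)"
  unfolding pair_sum_def sum_distrib_left case_prod_unfold by simp
 finally show ?thesis .
qed

text \<open>For distinct \<open>c\<close> both sides are coefficients of products of two commuting series. The functional \<open>\<psi>\<close> only
 reduces the claim to complex numbers, where \<open>poly_vanishing\<close> is available.\<close>

lemma pair_sum_commute: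
 fixes \<psi> :: "'k poly \<Rightarrow> complex"
 assumes D: "finite D" and m: "m \<in> exponents D n"
  and \<psi>: "additive \<psi>" "\<And>z g. \<psi> (pconst z * g) = z * \<psi> g"
 shows "\<psi> (pair_sum b a \<rho> D m) = \<psi> (pair_sum a b \<rho> D m)"
proof -
 have "\<psi> (pair_sum b a \<rho> D m) - \<psi> (pair_sum a b \<rho> D m) = 0"
 proof (rule poly_vanishing[OF D _ m, where Z = "\<lambda>m. \<psi> (pair_sum b a \<rho> D m) - \<psi> (pair_sum a b \<rho> D m)"])
  fix c :: "nat \<Rightarrow> complex" assume c: "inj_on c D"
  interpret gf: gaudin_family scal D "\<lambda>d e. wconst (1 / (c d - c e))" "w.rooted_sum c D" "w.gaudin c D"
   by (rule w.gaudin_family_rooted_sum[OF D c])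
  have eq: "(\<Sum>m\<in>exponents D n. pconst (\<Prod>i\<in>D. c i ^ m i) * pair_sum b a \<rho> D m)
    = (\<Sum>m\<in>exponents D n. pconst (\<Prod>i\<in>D. c i ^ m i) * pair_sum a b \<rho> D m)"
   unfolding lookup_series_product[OF D c, symmetric]
   by (subst gf.series_commute) (rule refl)
  have ev: "\<psi> (\<Sum>m\<in>exponents D n. pconst (\<Prod>i\<in>D. c i ^ m i) * h m) = (\<Sum>m\<in>exponents D n. (\<Prod>i\<in>D. c i ^ m i) * \<psi> (h m))" for h
   by (simp add: additive.sum[OF \<psi>(1)] \<psi>(2))
  show "(\<Sum>m\<in>exponents D n. (\<Prod>i\<in>D. c i ^ m i) * (\<psi> (pair_sum b a \<rho> D m) - \<psi> (pair_sum a b \<rho> D m))) = 0"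
   using arg_cong[OF eq, of \<psi>] unfolding ev by (simp add: right_diff_distrib sum_subtractf)
 qed
 then show ?thesis by simp
qed

text \<open>The functional \<open>L\<close>: it kills \<open>1\<close> and maps \<open>s\<^sup>k\<^sup>+\<^sup>1\<close> to \<open>\<eta>\<^sub>k\<close>, with \<open>s\<close> the polynomial variable.\<close>

definition resid :: "(nat \<Rightarrow> 'k) \<Rightarrow> 'k poly \<Rightarrow> 'k" where
 "resid \<eta> g = (\<Sum>k\<le>degree g. coeff g (Suc k) * \<eta> k)"

lemma resid_bound: "degree g \<le> N \<Longrightarrow> resid \<eta> g = (\<Sum>k\<le>N. coeff g (Suc k) * \<eta> k)"
 unfolding resid_def by (intro sum.mono_neutral_left) (auto simp: coeff_eq_0)

lemma resid_add: "resid \<eta> (f + g) = resid \<eta> f + resid \<eta> g"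
proof -
 let ?N = "max (degree f) (degree g)"
 have "degree (f + g) \<le> ?N" by (rule degree_add_le_max)
 then show ?thesis by (simp add: resid_bound[of _ ?N] distrib_right sum.distrib)
qed

lemma resid_additive: "additive (resid \<eta>)"
 by (simp add: additive_def resid_add)

lemma resid_const_mult: "resid \<eta> ([:z:] * g) = z * resid \<eta> g"
proof -
 have "degree ([:z:] * g) \<le> degree g" by (simp add: degree_smult_le)
 then have "resid \<eta> ([:z:] * g) = (\<Sum>k\<le>degree g. coeff ([:z:] * g) (Suc k) * \<eta> k)" by (rule resid_bound)
 then show ?thesis by (simp add: resid_def sum_distrib_left mult.assoc)
qed

lemma resid_monom: "resid \<eta> (monom z (Suc k)) = z * \<eta> k" "resid \<eta> (monom z 0) = 0"
proof -
 have "resid \<eta> (monom z (Suc k)) = (\<Sum>j\<le>Suc k. coeff (monom z (Suc k)) (Suc j) * \<eta> j)"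
  by (rule resid_bound) (rule degree_monom_le)
 also have "... = (\<Sum>j\<le>Suc k. if j = k then z * \<eta> k else 0)"
  by (intro sum.cong) auto
 finally show "resid \<eta> (monom z (Suc k)) = z * \<eta> k" by simp
 show "resid \<eta> (monom z 0) = 0" by (simp add: resid_def monom_0)
qed

definition wresid :: "(nat \<Rightarrow> 'k) \<Rightarrow> 'k poly fps \<Rightarrow> 'k poly fps" where
 "wresid \<eta> w = Abs_fps (\<lambda>n. [:resid \<eta> (fps_nth w n):])"

lemma wresid_additive: "additive (wresid \<eta>)"
 unfolding additive_def by (intro allI fps_ext) (simp add: wresid_def resid_add)

lemma wresid_const_coeffs:
 assumes "\<And>n. \<exists>z. fps_nth k n = [:z:]"
 shows "wresid \<eta> (k * w) = k * wresid \<eta> w"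
proof (rule fps_ext)
 fix n
 from assms obtain z where z: "\<And>n. fps_nth k n = [:z n:]" by metis
 have "resid \<eta> (\<Sum>i=0..n. [:z i:] * fps_nth w (n - i)) = (\<Sum>i=0..n. z i * resid \<eta> (fps_nth w (n - i)))"
  by (simp only: additive.sum[OF resid_additive] resid_const_mult)
 moreover have "(\<Sum>i=0..n. [:z i:] * [:resid \<eta> (fps_nth w (n - i)):]) = [:\<Sum>i=0..n. z i * resid \<eta> (fps_nth w (n - i)):]"
 proof -
  have "(\<Sum>i\<in>I. [:g i:]) = [:\<Sum>i\<in>I. g i:]" for I :: "nat set" and g :: "nat \<Rightarrow> 'k"
   by (induction I rule: infinite_finite_induct) auto
  from this[of "\<lambda>i. z i * resid \<eta> (fps_nth w (n - i))" "{0..n}"] show ?thesis by (simp add: mult.commute)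
 qed
 ultimately show "fps_nth (wresid \<eta> (k * w)) n = fps_nth (k * wresid \<eta> w) n"
  unfolding wresid_def fps_mult_nth z by simp
qed

text \<open>The grading variable is replaced by its product with \<open>s\<close>, so that \<open>geom (c e)\<close> becomes the \<open>y\<^sub>e\<close> of
 \<open>residue_theorem\<close>.\<close>

definition embed_series :: "complex fps \<Rightarrow> 'k poly fps" where
 "embed_series g = Abs_fps (\<lambda>k. monom (\<kappa> (fps_nth g k)) k)"

lemma embed_series_mult: "embed_series g * embed_series h = embed_series (g * h)"
proof (rule fps_ext)
 fix n
 have ms: "(\<Sum>i\<in>I. monom (u i) n) = monom (\<Sum>i\<in>I. u i) n" for I :: "nat set" and u :: "nat \<Rightarrow> 'k"
  by (induction I rule: infinite_finite_induct) (auto simp: add_monom)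
 have "fps_nth (embed_series g * embed_series h) n = (\<Sum>i=0..n. monom (\<kappa> (fps_nth g i) * \<kappa> (fps_nth h (n - i))) n)"
  unfolding fps_mult_nth embed_series_def by (intro sum.cong) (auto simp: mult_monom)
 also have "... = fps_nth (embed_series (g * h)) n"
  unfolding ms by (simp add: embed_series_def fps_mult_nth emb.hom_sum emb_mult)
 finally show "fps_nth (embed_series g * embed_series h) n = fps_nth (embed_series (g * h)) n" .
qed

lemma embed_series_diff: "embed_series (g - h) = embed_series g - embed_series h"
 by (rule fps_ext) (simp add: embed_series_def emb.hom_diff diff_monom)

lemma embed_series_const_mult: "embed_series (fps_const z * g) = wconst z * embed_series g"
 by (rule fps_ext) (simp add: embed_series_def wconst_def pconst_def emb_mult smult_monom)

lemma wresid_embed_series: "fps_nth (wresid \<eta> (embed_series g)) n = (if n = 0 then 0 else [:\<kappa> (fps_nth g n) * \<eta> (n - 1):])"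
 by (cases n) (simp_all add: wresid_def embed_series_def resid_monom)

lemma geom_square: "fps_nth (geom z * geom z) n = of_nat (n - 1) * z ^ (n - 2)"
proof -
 have "fps_nth (geom z * geom z) n = (\<Sum>i=0..n. if i = 0 \<or> i = n then 0 else z ^ (n - 2))"
  unfolding fps_mult_nth
 proof (intro sum.cong refl)
  fix i assume i: "i \<in> {0..n}"
  show "fps_nth (geom z) i * fps_nth (geom z) (n - i) = (if i = 0 \<or> i = n then 0 else z ^ (n - 2))"
  proof (cases "i = 0 \<or> i = n")
   case False
   then have "i - 1 + (n - i - 1) = n - 2" "0 < i" "i < n" using i by auto
   then show ?thesis using False by (simp add: geom_def power_add[symmetric])
  qed (auto simp: geom_def)
 qed
 also have "... = (\<Sum>i\<in>{1..<n}. z ^ (n - 2))"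
  by (intro sum.mono_neutral_cong_right) auto
 finally show ?thesis by simp
qed

text \<open>The weights \<open>P\<^sub>k - s\<^sup>k\<close> and \<open>Q\<^sub>k + s\<^sup>k\<close> shift the node series of \<open>P\<close> and \<open>Q\<close> by \<open>\<mp>y\<close>, and Newton's identity
 for \<open>\<eta>\<close> is the hypothesis on \<open>L(y\<^sub>d\<^sup>2)\<close> of \<open>residue_theorem\<close>.\<close>

lemma pair_sum_residue:
 fixes \<psi> :: "'k \<Rightarrow> complex"
 assumes newton: "\<And>n. of_nat n * \<eta> n = (\<Sum>j=1..n. (P j - Q j) * \<eta> (n - j))"
  and D: "finite D" and m: "m \<in> exponents D n"
  and \<psi>: "additive \<psi>" "\<And>z g. \<psi> (\<kappa> z * g) = z * \<psi> g"
 shows "\<psi> (resid \<eta> (pair_sum (\<lambda>k. [:Q k:] + monom 1 k) (\<lambda>k. [:P k:] - monom 1 k) \<rho> D m)) = 0"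
proof (rule poly_vanishing[OF D _ m, where Z = "\<lambda>m. \<psi> (resid \<eta> (pair_sum (\<lambda>k. [:Q k:] + monom 1 k) (\<lambda>k. [:P k:] - monom 1 k) \<rho> D m))"])
 let ?ps = "pair_sum (\<lambda>k. [:Q k:] + monom 1 k) (\<lambda>k. [:P k:] - monom 1 k) \<rho> D"
 fix c :: "nat \<Rightarrow> complex" assume c: "inj_on c D"
 interpret gf: gaudin_family scal D "\<lambda>d e. wconst (1 / (c d - c e))" "w.rooted_sum c D" "w.gaudin c D"
  by (rule w.gaudin_family_rooted_sum[OF D c])
 have ne: "c u \<noteq> c v" if "u \<in> D" "v \<in> D" "u \<noteq> v" for u v
  using c that unfolding inj_on_def by blast
 define B where "B = node_series c (\<lambda>k. [:Q k:])"
 define A where "A = node_series c (\<lambda>k. [:P k:])"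
 define y where "y e = embed_series (geom (c e))" for e
 have sc: "k \<in> gf.linear_scalars (wresid \<eta>)" if "\<And>n. \<exists>z. fps_nth k n = [:z:]" for k
  using that wresid_const_coeffs[of k \<eta>] by (simp add: gf.linear_scalars_def)
 have nB: "node_series c (\<lambda>k. [:Q k:] + monom 1 k) e = B e + y e" for e
  by (rule fps_ext) (auto simp: node_series_def B_def y_def embed_series_def geom_def distrib_right smult_add_right pconst_def smult_monom monom_0)
 have nA: "node_series c (\<lambda>k. [:P k:] - monom 1 k) e = A e - y e" for e
  by (rule fps_ext) (auto simp: node_series_def A_def y_def embed_series_def geom_def left_diff_distrib smult_diff_right pconst_def smult_monom monom_0)
 have yy: "y d * y e = wconst (1 / (c d - c e)) * (y d - y e)" if "d \<in> D" "e \<in> D" "d \<noteq> e" for d e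
  unfolding y_def embed_series_mult geom_mult[OF ne[OF that]] embed_series_const_mult embed_series_diff ..
 have Lyy: "wresid \<eta> (y d * y d) = (A d - B d) * wresid \<eta> (y d)" for d
 proof (rule fps_ext)
  fix n
  let ?z = "c d"
  have AB: "fps_nth (A d - B d) j = (if j = 0 then 0 else [:(P j - Q j) * \<kappa> (?z ^ (j - 1)):])" for j
   by (simp add: A_def B_def node_series_def pconst_def left_diff_distrib)
  have W: "fps_nth (wresid \<eta> (y d)) j = (if j = 0 then 0 else [:\<kappa> (?z ^ (j - 1)) * \<eta> (j - 1):])" for j
   by (simp add: y_def wresid_embed_series geom_def)
  have cs: "(\<Sum>i\<in>I. [:g i:]) = [:\<Sum>i\<in>I. g i:]" for I :: "nat set" and g :: "nat \<Rightarrow> 'k"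
   by (induction I rule: infinite_finite_induct) auto
  have "fps_nth ((A d - B d) * wresid \<eta> (y d)) n
    = (\<Sum>j=0..n. if j = 0 \<or> j = n then 0 else [:\<kappa> (?z ^ (n - 2)) * ((P j - Q j) * \<eta> (n - 1 - j)):])"
   unfolding fps_mult_nth
  proof (intro sum.cong refl)
   fix j assume j: "j \<in> {0..n}"
   show "fps_nth (A d - B d) j * fps_nth (wresid \<eta> (y d)) (n - j)
    = (if j = 0 \<or> j = n then 0 else [:\<kappa> (?z ^ (n - 2)) * ((P j - Q j) * \<eta> (n - 1 - j)):])"
   proof (cases "j = 0 \<or> j = n")
    case False
    then have e: "n - 2 = (j - 1) + (n - j - 1)" "0 < j" "j < n" using j by auto
    have "\<kappa> (?z ^ (n - 2)) = \<kappa> (?z ^ (j - 1)) * \<kappa> (?z ^ (n - j - 1))"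
     unfolding e(1) power_add emb_mult ..
    then show ?thesis unfolding AB W using e(2,3) by (simp add: mult_ac)
   qed (auto simp: A_def B_def node_series_def W)
  qed
  also have "... = (\<Sum>j\<in>{1..<n}. [:\<kappa> (?z ^ (n - 2)) * ((P j - Q j) * \<eta> (n - 1 - j)):])"
   by (intro sum.mono_neutral_cong_right) auto
  also have "... = [:\<kappa> (?z ^ (n - 2)) * (\<Sum>j\<in>{1..<n}. (P j - Q j) * \<eta> (n - 1 - j)):]"
   unfolding cs by (simp add: sum_distrib_left)
  also have "(\<Sum>j\<in>{1..<n}. (P j - Q j) * \<eta> (n - 1 - j)) = of_nat (n - 1) * \<eta> (n - 1)"
  proof -
   have "{1..<n} = {1..n - 1}" by auto
   then show ?thesis using newton[of "n - 1"] by simp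
  qed
  finally have R: "fps_nth ((A d - B d) * wresid \<eta> (y d)) n = [:\<kappa> (?z ^ (n - 2)) * (of_nat (n - 1) * \<eta> (n - 1)):]" .
  have on: "\<kappa> (of_nat k) = of_nat k" for k
   by (induction k) (simp_all add: emb_add emb_1)
  have "fps_nth (wresid \<eta> (y d * y d)) n = (if n = 0 then 0 else [:\<kappa> (of_nat (n - 1) * ?z ^ (n - 2)) * \<eta> (n - 1):])"
   unfolding y_def embed_series_mult wresid_embed_series geom_square ..
  also have "... = [:\<kappa> (?z ^ (n - 2)) * (of_nat (n - 1) * \<eta> (n - 1)):]"
   unfolding emb_mult on by (simp add: mult_ac)
  finally show "fps_nth (wresid \<eta> (y d * y d)) n = fps_nth ((A d - B d) * wresid \<eta> (y d)) n"
   using R by simp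
 qed
 have const_ff: "\<exists>z. fps_nth (lookup (w.rooted_sum c D E * w.rooted_sum c D F) \<rho>) n = [:z:]" for E F n
 proof -
  have "lookup (w.rooted_sum c D E * w.rooted_sum c D F) \<rho>
   = wconst (\<Sum>(\<sigma>, \<tau>) | \<sigma> \<in> perms_on D \<and> \<tau> \<in> perms_on D \<and> \<sigma> * \<tau> = \<rho>. rooted_weight c E D \<sigma> * rooted_weight c F D \<tau>)"
   unfolding w.rooted_sum_def lookup_on_perms_product[OF D D] w.hom_sum case_prod_unfold w.hom_mult ..
  then show ?thesis by (auto simp: wconst_def pconst_def intro: exI[of _ 0])
 qed
 have "wresid \<eta> (lookup (gf.series (\<lambda>e. B e + y e) * gf.series (\<lambda>e. A e - y e)) \<rho>) = 0"
 proof (rule gf.residue_theorem[where l = "\<lambda>z. lookup z \<rho>" and L = "wresid \<eta>" and b = B and a = A and y = y])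
  show "additive (\<lambda>z. lookup z \<rho>)" by (simp add: additive_def lookup_add)
  show "wconst (1 / (c d - c e)) \<in> gf.linear_scalars (wresid \<eta>)" for d e
   by (rule sc) (auto simp: wconst_def pconst_def intro: exI[of _ 0])
  show "B d \<in> gf.linear_scalars (wresid \<eta>)" for d
   by (rule sc) (auto simp: B_def node_series_def pconst_def intro: exI[of _ 0])
  show "A d \<in> gf.linear_scalars (wresid \<eta>)" for d
   by (rule sc) (auto simp: A_def node_series_def pconst_def intro: exI[of _ 0])
  show "wresid \<eta> 1 = 0"
  proof (rule fps_ext)
   fix n show "fps_nth (wresid \<eta> 1) n = fps_nth 0 n"
    by (simp add: wresid_def resid_def)
  qed
 qed (simp_all add: wresid_additive lookup_scal_mult sc const_ff yy Lyy)
 then have "fps_nth (wresid \<eta> (lookup (gf.series (node_series c (\<lambda>k. [:Q k:] + monom 1 k)) * gf.series (node_series c (\<lambda>k. [:P k:] - monom 1 k))) \<rho>)) (card D + card D + n) = 0"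
  unfolding nA[abs_def] nB[abs_def] by simp
 then have "resid \<eta> (\<Sum>m\<in>exponents D n. pconst (\<Prod>i\<in>D. c i ^ m i) * ?ps m) = 0"
  unfolding wresid_def by (simp add: lookup_series_product[OF D c])
 then have "(\<Sum>m\<in>exponents D n. \<kappa> (\<Prod>i\<in>D. c i ^ m i) * resid \<eta> (?ps m)) = 0"
  by (simp only: additive.sum[OF resid_additive] pconst_def resid_const_mult)
 then have "\<psi> (\<Sum>m\<in>exponents D n. \<kappa> (\<Prod>i\<in>D. c i ^ m i) * resid \<eta> (?ps m)) = 0"
  by (simp only: additive.zero[OF \<psi>(1)])
 then show "(\<Sum>m\<in>exponents D n. (\<Prod>i\<in>D. c i ^ m i) * \<psi> (resid \<eta> (?ps m))) = 0"
  by (simp only: additive.sum[OF \<psi>(1)] \<psi>(2))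
qed

end

section \<open>Removing the points that occur once\<close>

lemma swap_involution: "(\<sigma> * swap a b) * swap a b = \<sigma>" "swap a b * (swap a b * \<sigma>) = \<sigma>"
 by (rule perm_eqI, simp add: apply_times apply_swap)+

lemma cycle_product_cong:
 assumes "affected \<sigma> \<subseteq> X" "\<And>i. i \<in> X \<Longrightarrow> l i = l' i"
 shows "cycle_product b X \<sigma> l = cycle_product b X \<sigma> l'"
 unfolding cycle_product_def
proof (rule prod.cong[OF refl])
 fix C assume "C \<in> orbit \<sigma> ` X"
 then have "C \<subseteq> X" using orbit_subset_support[OF assms(1)] by auto
 then have "(\<Sum>i\<in>C. Suc (l i)) = (\<Sum>i\<in>C. Suc (l' i))" using assms(2) by (intro sum.cong) auto
 then show "b (\<Sum>i\<in>C. Suc (l i)) = b (\<Sum>i\<in>C. Suc (l' i))" by simp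
qed

text \<open>A contracted point passes its length on to another point \<open>y\<close> of the cycle.\<close>

lemma cycle_product_contract:
 assumes X: "finite X" "affected \<sigma> \<subseteq> X" and w: "act \<sigma> w = x" "w \<noteq> x"
  and y: "y \<in> orbit \<sigma> x" "y \<noteq> x" "Suc (l' y) = Suc (l y) + Suc (l x)"
  and l: "\<And>i. i \<in> X \<Longrightarrow> i \<noteq> x \<Longrightarrow> i \<noteq> y \<Longrightarrow> l' i = l i"
 shows "cycle_product b (X - {x}) (\<sigma> * swap w x) l' = cycle_product b X \<sigma> l"
proof -
 let ?O = "orbit \<sigma> w" and ?R = "orbit \<sigma> ` X - {orbit \<sigma> w}"
 have xO: "x \<in> ?O" using w(1) by auto
 then have Ox: "orbit \<sigma> x = ?O" by (simp add: orbit_eq_iff)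
 have wX: "w \<in> X" using w X(2) by (auto simp: in_affected)
 have yO: "y \<in> ?O" using y(1) Ox by simp
 have OX: "?O \<subseteq> X" by (rule orbit_subset_support[OF X(2) wX])
 have "(\<Sum>i\<in>?O - {x}. Suc (l' i)) = Suc (l' y) + (\<Sum>i\<in>?O - {x} - {y}. Suc (l' i))"
  using yO y(2) by (intro sum.remove) auto
 also have "(\<Sum>i\<in>?O - {x} - {y}. Suc (l' i)) = (\<Sum>i\<in>?O - {x} - {y}. Suc (l i))"
  using l OX by (intro sum.cong) auto
 also have "Suc (l' y) + (\<Sum>i\<in>?O - {x} - {y}. Suc (l i)) = Suc (l x) + (Suc (l y) + (\<Sum>i\<in>?O - {x} - {y}. Suc (l i)))"
  unfolding y(3) by simp
 also have "Suc (l y) + (\<Sum>i\<in>?O - {x} - {y}. Suc (l i)) = (\<Sum>i\<in>?O - {x}. Suc (l i))"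
  using yO y(2) by (intro sum.remove[symmetric]) auto
 also have "Suc (l x) + (\<Sum>i\<in>?O - {x}. Suc (l i)) = (\<Sum>i\<in>?O. Suc (l i))"
  using xO by (intro sum.remove[symmetric]) auto
 finally have O: "(\<Sum>i\<in>?O - {x}. Suc (l' i)) = (\<Sum>i\<in>?O. Suc (l i))" .
 have R: "(\<Sum>i\<in>C. Suc (l' i)) = (\<Sum>i\<in>C. Suc (l i))" if C: "C \<in> ?R" for C
 proof (rule sum.cong[OF refl])
  fix i assume i: "i \<in> C"
  have CX: "C \<subseteq> X" using C orbit_subset_support[OF X(2)] by auto
  have "C \<inter> ?O = {}" using C wX by (intro orbits_disjoint[of _ \<sigma> X _ X]) auto
  then have "i \<noteq> x" "i \<noteq> y" using i xO yO by auto
  then show "Suc (l' i) = Suc (l i)" using l i CX by auto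
 qed
 have "cycle_product b (X - {x}) (\<sigma> * swap w x) l' = b (\<Sum>i\<in>?O - {x}. Suc (l' i)) * (\<Prod>C\<in>?R. b (\<Sum>i\<in>C. Suc (l' i)))"
  unfolding cycle_product_def by (rule prod_orbits_contract[OF X w])
 also have "... = b (\<Sum>i\<in>?O. Suc (l i)) * (\<Prod>C\<in>?R. b (\<Sum>i\<in>C. Suc (l i)))"
  unfolding O using R by simp
 also have "... = cycle_product b X \<sigma> l"
  unfolding cycle_product_def using X(1) wX by (intro prod_orbits_remove[symmetric]) auto
 finally show ?thesis .
qed

lemma cycle_product_insert_fixed:
 assumes "finite X" "affected \<sigma> \<subseteq> X" "x \<notin> X"
 shows "cycle_product b (insert x X) \<sigma> l = b (Suc (l x)) * cycle_product b X \<sigma> l"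
proof -
 have o: "orbit \<sigma> x = {x}" using assms by (auto simp: not_in_affected_iff_orbit_eq_singleton[symmetric])
 have "{x} \<notin> orbit \<sigma> ` X" using assms(3) orbit_subset_support[OF assms(2)] by auto
 then show ?thesis using assms(1) by (simp add: cycle_product_def o)
qed

lemma orbit_conjugate: "orbit (\<rho> * \<pi> * inverse \<rho>) (act \<rho> i) = act \<rho> ` orbit \<pi> i"
proof -
 have "act ((\<rho> * \<pi> * inverse \<rho>) ^ n) (act \<rho> i) = act \<rho> (act (\<pi> ^ n) i)" for n
  by (induction n) (simp_all add: apply_times)
 then show ?thesis by (auto simp: orbit_def)
qed

lemma cycle_product_conjugate:
 assumes "affected \<rho> \<subseteq> D"
 shows "cycle_product b D (\<rho> * \<pi> * inverse \<rho>) l = cycle_product b D \<pi> (\<lambda>i. l (act \<rho> i))"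
proof -
 have inj: "inj_on (act \<rho>) A" for A by (auto simp: inj_on_def apply_inj)
 have D: "act \<rho> ` D = D"
 proof
  show "act \<rho> ` D \<subseteq> D" using apply_mem_iff[OF assms] by auto
  show "D \<subseteq> act \<rho> ` D"
  proof
   fix d assume "d \<in> D"
   then have "act (inverse \<rho>) d \<in> D" using apply_mem_iff[OF assms, of "act (inverse \<rho>) d"] by simp
   then show "d \<in> act \<rho> ` D" by (metis apply_inverse_cancel(1) image_eqI)
  qed
 qed
 have "orbit (\<rho> * \<pi> * inverse \<rho>) ` D = orbit (\<rho> * \<pi> * inverse \<rho>) ` (act \<rho> ` D)" by (simp only: D)
 also have "... = image (act \<rho>) ` (orbit \<pi> ` D)" by (simp add: image_image orbit_conjugate)
 finally have O: "orbit (\<rho> * \<pi> * inverse \<rho>) ` D = image (act \<rho>) ` (orbit \<pi> ` D)" .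
 have inj2: "inj_on (image (act \<rho>)) (orbit \<pi> ` D)"
  by (rule inj_onI) (metis inj inj_image_eq_iff)
 show ?thesis
  unfolding cycle_product_def O by (subst prod.reindex[OF inj2]) (simp add: sum.reindex[OF inj])
qed

text \<open>\<open>B\<close> is the set of points of \<open>S\<close> that belong to the support of \<open>\<pi>\<close>. The exponent \<open>n d\<close> counts the points
 already contracted at \<open>d \<in> D\<close>, and \<open>l d\<close> of them were on the side of \<open>\<pi>\<close>. These form a path ending at \<open>d\<close>,
 and a point on the path can have been on that side only if the preceding point can lie in the
 support of \<open>\<pi>\<close>; hence the condition on the preimage of \<open>d\<close>.\<close>

definition assignments :: "nat perm \<Rightarrow> nat set \<Rightarrow> nat set \<Rightarrow> (nat \<Rightarrow> nat) \<Rightarrow> (nat set \<times> (nat \<Rightarrow> nat) \<times> nat perm \<times> nat perm) set" where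
 "assignments \<rho> S D n = {(B, l, \<sigma>, \<pi>). B \<subseteq> S \<and> (\<forall>i. l i \<le> n i) \<and> (\<forall>i. i \<notin> D \<longrightarrow> l i = 0)
   \<and> (\<forall>i. 0 < l (act \<rho> i) \<longrightarrow> i \<in> B \<union> D)
   \<and> affected \<sigma> \<subseteq> (S - B) \<union> D \<and> affected \<pi> \<subseteq> B \<union> D \<and> \<sigma> * \<pi> = \<rho>}"

text \<open>On the side of \<open>\<pi>\<close> the extra length \<open>l d\<close> sits at the preimage of \<open>d\<close>, because there a contracted
 point is merged with its predecessor in the cycle.\<close>

definition assignment_weight :: "(nat \<Rightarrow> 'v) \<Rightarrow> (nat \<Rightarrow> 'v) \<Rightarrow> nat perm \<Rightarrow> nat set \<Rightarrow> nat set \<Rightarrow> (nat \<Rightarrow> nat)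
  \<Rightarrow> nat set \<times> (nat \<Rightarrow> nat) \<times> nat perm \<times> nat perm \<Rightarrow> 'v::comm_ring_1" where
 "assignment_weight a b \<rho> S D n = (\<lambda>(B, l, \<sigma>, \<pi>). cycle_product a ((S - B) \<union> D) \<sigma> (\<lambda>i. n i - l i)
   * cycle_product b (B \<union> D) \<pi> (\<lambda>i. l (act \<rho> i) + (if i \<in> D then 0 else n i)))"

definition mixed_sum :: "(nat \<Rightarrow> 'v) \<Rightarrow> (nat \<Rightarrow> 'v) \<Rightarrow> nat perm \<Rightarrow> nat set \<Rightarrow> nat set \<Rightarrow> (nat \<Rightarrow> nat) \<Rightarrow> 'v::comm_ring_1" where
 "mixed_sum a b \<rho> S D n = (\<Sum>t\<in>assignments \<rho> S D n. assignment_weight a b \<rho> S D n t)"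

lemma assignmentsD:
 assumes "(B, l, \<sigma>, \<pi>) \<in> assignments \<rho> S D n"
 shows "B \<subseteq> S" "\<And>i. l i \<le> n i" "\<And>i. i \<notin> D \<Longrightarrow> l i = 0" "\<And>i. 0 < l (act \<rho> i) \<Longrightarrow> i \<in> B \<union> D"
  "affected \<sigma> \<subseteq> (S - B) \<union> D" "affected \<pi> \<subseteq> B \<union> D" "\<sigma> * \<pi> = \<rho>"
  "\<And>i. act \<sigma> (act \<pi> i) = act \<rho> i"
  "\<And>i. i \<notin> (S - B) \<union> D \<Longrightarrow> act \<sigma> i = i" "\<And>i. i \<notin> B \<union> D \<Longrightarrow> act \<pi> i = i"
proof -
 show "B \<subseteq> S" "\<And>i. l i \<le> n i" "\<And>i. i \<notin> D \<Longrightarrow> l i = 0" "\<And>i. 0 < l (act \<rho> i) \<Longrightarrow> i \<in> B \<union> D"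
  and s: "affected \<sigma> \<subseteq> (S - B) \<union> D" and p: "affected \<pi> \<subseteq> B \<union> D" and m: "\<sigma> * \<pi> = \<rho>"
  using assms by (auto simp: assignments_def)
 show "act \<sigma> (act \<pi> i) = act \<rho> i" for i
  unfolding m[symmetric] by (simp add: apply_times)
 show "act \<sigma> i = i" if "i \<notin> (S - B) \<union> D" for i by (rule fixed_outside[OF s that])
 show "act \<pi> i = i" if "i \<notin> B \<union> D" for i by (rule fixed_outside[OF p that])
qed

lemma assignmentsI:
 assumes "B \<subseteq> S" "\<And>i. l i \<le> n i" "\<And>i. i \<notin> D \<Longrightarrow> l i = 0" "\<And>i. 0 < l (act \<rho> i) \<Longrightarrow> i \<in> B \<union> D"
  "affected \<sigma> \<subseteq> (S - B) \<union> D" "affected \<pi> \<subseteq> B \<union> D" "\<sigma> * \<pi> = \<rho>"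
 shows "(B, l, \<sigma>, \<pi>) \<in> assignments \<rho> S D n"
 unfolding assignments_def using assms(1-3,5-7) assms(4) by (simp only: mem_Collect_eq prod.case) blast

lemma contracted_apply:
 assumes "act \<rho> w = x"
 shows "act (\<rho> * swap w x) i = (if i = w then act \<rho> x else if i = x then x else act \<rho> i)"
 using assms by (simp add: apply_times apply_swap)

lemma swap_mult_contract:
 assumes "act \<rho> w = x"
 shows "swap x (act \<rho> x) * \<rho> = \<rho> * swap w x"
 using assms by (simp add: perm_mult_swap)

text \<open>Let \<open>x \<in> S\<close> be followed by \<open>v \<in> D\<close> in \<open>\<rho>\<close> and preceded by \<open>w\<close>. If \<open>x \<in> B\<close> then \<open>\<sigma>\<close> fixes \<open>x\<close>, so \<open>\<pi>\<close> maps \<open>w\<close>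
 to \<open>x\<close>, and \<open>x\<close> is contracted in \<open>\<pi>\<close>; otherwise \<open>\<pi>\<close> fixes \<open>x\<close>, so \<open>\<sigma>\<close> maps \<open>x\<close> to \<open>v\<close>, and \<open>x\<close> is contracted
 in \<open>\<sigma>\<close>. The new value of \<open>l v\<close> is positive in the first case and zero in the second, so the
 contraction can be undone.\<close>

lemma mixed_sum_path:
 fixes a b :: "nat \<Rightarrow> 'v::comm_ring_1"
 assumes fin: "finite S" "finite D" "S \<inter> D = {}" and x: "x \<in> S" and v: "act \<rho> x = v" "v \<in> D"
  and w: "act \<rho> w = x" and n: "\<And>i. i \<notin> D \<Longrightarrow> n i = 0"
 shows "mixed_sum a b \<rho> S D n = mixed_sum a b (\<rho> * swap w x) (S - {x}) D (n(v := Suc (n v)))"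
proof -
 let ?r = "\<rho> * swap w x" and ?n = "n(v := Suc (n v))"
 let ?J = "\<lambda>(B, l, \<sigma>, \<pi>). if x \<in> B then (B - {x}, l(v := Suc (l v)), \<sigma>, \<pi> * swap w x) else (B, l, swap x v * \<sigma>, \<pi>)"
 let ?I = "\<lambda>(B, l, \<sigma>, \<pi>). if 0 < l v then (insert x B, l(v := l v - 1), \<sigma>, \<pi> * swap w x) else (B, l, swap x v * \<sigma>, \<pi>)"
 note r = contracted_apply[OF w]
 have ne: "x \<noteq> v" "x \<notin> D" "w \<noteq> x" using x v w fin(3) by auto
 have rv: "act \<rho> i = v \<longleftrightarrow> i = x" for i using v(1) by (metis apply_inj)
 have sw: "swap x v * \<rho> = ?r" using swap_mult_contract[OF w] v(1) by simp
 have sw': "swap x v * ?r = \<rho>" unfolding sw[symmetric] by (rule swap_involution)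
 have fB: "(B - {x}, l(v := Suc (l v)), \<sigma>, \<pi> * swap w x) \<in> assignments ?r (S - {x}) D ?n \<and>
   assignment_weight a b ?r (S - {x}) D ?n (B - {x}, l(v := Suc (l v)), \<sigma>, \<pi> * swap w x) = assignment_weight a b \<rho> S D n (B, l, \<sigma>, \<pi>)"
  if t: "(B, l, \<sigma>, \<pi>) \<in> assignments \<rho> S D n" and xB: "x \<in> B" for B l \<sigma> \<pi>
 proof
  note A = assignmentsD[OF t]
  have sx: "act \<sigma> x = x" using xB ne by (intro A(9)) auto
  have pw: "act \<pi> w = x" using A(8)[of w] w sx by (metis apply_inj)
  have wY: "w \<in> B \<union> D" using A(10)[of w] pw ne by auto
  have aff: "affected (\<pi> * swap w x) \<subseteq> B \<union> D" using wY xB A(6) by (intro affected_mult_subset affected_swap_subset) auto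
  have "act (\<pi> * swap w x) x = x" using pw by (simp add: apply_times)
  then have aff': "affected (\<pi> * swap w x) \<subseteq> (B - {x}) \<union> D" using aff by (auto simp: in_affected)
  show "(B - {x}, l(v := Suc (l v)), \<sigma>, \<pi> * swap w x) \<in> assignments ?r (S - {x}) D ?n"
  proof (rule assignmentsI[OF _ _ _ _ _ aff'])
   show "B - {x} \<subseteq> S - {x}" using A(1) by auto
   show "(l(v := Suc (l v))) i \<le> ?n i" for i using A(2) by simp
   show "(l(v := Suc (l v))) i = 0" if "i \<notin> D" for i using A(3) v(2) that by auto
   show "i \<in> B - {x} \<union> D" if "0 < (l(v := Suc (l v))) (act ?r i)" for i
   proof (cases "i = w \<or> i = x")
    case True
    then show ?thesis using that wY ne v A(3)[of x] by (auto simp: r)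
   next
    case False
    then show ?thesis using that A(4)[of i] rv[of i] by (auto simp: r)
   qed
   show "affected \<sigma> \<subseteq> S - {x} - (B - {x}) \<union> D" using A(5) xB by auto
   show "\<sigma> * (\<pi> * swap w x) = ?r" unfolding A(7)[symmetric] by (simp add: mult.assoc)
  qed
  have 1: "S - {x} - (B - {x}) = S - B" using xB by auto
  have 2: "(\<lambda>i. ?n i - (l(v := Suc (l v))) i) = (\<lambda>i. n i - l i)" by auto
  have 3: "B - {x} \<union> D = (B \<union> D) - {x}" using ne by auto
  have "cycle_product b ((B \<union> D) - {x}) (\<pi> * swap w x) (\<lambda>i. (l(v := Suc (l v))) (act ?r i) + (if i \<in> D then 0 else ?n i))
   = cycle_product b (B \<union> D) \<pi> (\<lambda>i. l (act \<rho> i) + (if i \<in> D then 0 else n i))"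
  proof (rule cycle_product_contract[where y = w])
   have "act \<pi> w \<in> orbit \<pi> w" by simp
   then show "w \<in> orbit \<pi> x" unfolding pw by (simp add: orbit_eq_iff[symmetric])
   show "finite (B \<union> D)" using fin A(1) by (auto intro: finite_subset)
   show "Suc ((l(v := Suc (l v))) (act ?r w) + (if w \<in> D then 0 else ?n w))
     = Suc (l (act \<rho> w) + (if w \<in> D then 0 else n w)) + Suc (l (act \<rho> x) + (if x \<in> D then 0 else n x))"
    using w v ne A(3)[of x] n by (auto simp: r)
   show "(l(v := Suc (l v))) (act ?r i) + (if i \<in> D then 0 else ?n i)
     = l (act \<rho> i) + (if i \<in> D then 0 else n i)" if "i \<noteq> x" "i \<noteq> w" for i
    using that rv[of i] v(2) by (auto simp: r)
  qed (use A(6) pw ne in auto)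
  then show "assignment_weight a b ?r (S - {x}) D ?n (B - {x}, l(v := Suc (l v)), \<sigma>, \<pi> * swap w x) = assignment_weight a b \<rho> S D n (B, l, \<sigma>, \<pi>)"
   unfolding assignment_weight_def prod.case 1 2 3 by simp
 qed
 have fN: "(B, l, swap x v * \<sigma>, \<pi>) \<in> assignments ?r (S - {x}) D ?n \<and> l v = 0 \<and>
   assignment_weight a b ?r (S - {x}) D ?n (B, l, swap x v * \<sigma>, \<pi>) = assignment_weight a b \<rho> S D n (B, l, \<sigma>, \<pi>)"
  if t: "(B, l, \<sigma>, \<pi>) \<in> assignments \<rho> S D n" and xB: "x \<notin> B" for B l \<sigma> \<pi>
 proof (intro conjI)
  note A = assignmentsD[OF t]
  have px: "act \<pi> x = x" using xB ne by (intro A(10)) auto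
  have sx: "act \<sigma> x = v" using A(8)[of x] px v by simp
  define u where "u = act (inverse \<sigma>) x"
  have su: "act \<sigma> u = x" by (simp add: u_def)
  have ux: "u \<noteq> x" using su sx ne by auto
  have ss: "swap x v * \<sigma> = \<sigma> * swap u x" using swap_mult_contract[OF su] sx by simp
  show lv: "l v = 0" using A(4)[of x] v xB ne by auto
  have aff: "affected (swap x v * \<sigma>) \<subseteq> (S - B) \<union> D" using xB x v A(5) by (intro affected_mult_subset affected_swap_subset) auto
  have "act (swap x v * \<sigma>) x = x" using sx by (simp add: apply_times)
  then have aff': "affected (swap x v * \<sigma>) \<subseteq> (S - {x} - B) \<union> D" using aff by (auto simp: in_affected)
  show "(B, l, swap x v * \<sigma>, \<pi>) \<in> assignments ?r (S - {x}) D ?n"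
  proof (rule assignmentsI[OF _ _ _ _ aff'])
   show "B \<subseteq> S - {x}" using A(1) xB by auto
   show "l i \<le> ?n i" for i using A(2)[of i] by auto
   show "l i = 0" if "i \<notin> D" for i using A(3) that by auto
   show "i \<in> B \<union> D" if "0 < l (act ?r i)" for i
    using that v lv A(3)[of x] ne A(4)[of i] by (auto simp: r split: if_splits)
   show "affected \<pi> \<subseteq> B \<union> D" by (rule A(6))
   show "swap x v * \<sigma> * \<pi> = ?r" using sw A(7) by (simp add: mult.assoc)
  qed
  have 1: "S - {x} - B \<union> D = ((S - B) \<union> D) - {x}" using ne by auto
  have "cycle_product a (((S - B) \<union> D) - {x}) (\<sigma> * swap u x) (\<lambda>i. ?n i - l i) = cycle_product a ((S - B) \<union> D) \<sigma> (\<lambda>i. n i - l i)"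
  proof (rule cycle_product_contract[where y = v])
   show "v \<in> orbit \<sigma> x" using sx by auto
   show "finite ((S - B) \<union> D)" using fin by auto
   show "Suc (?n v - l v) = Suc (n v - l v) + Suc (n x - l x)" using lv n[of x] ne by simp
  qed (use A(5) su ux ne in auto)
  moreover have "cycle_product b (B \<union> D) \<pi> (\<lambda>i. l (act ?r i) + (if i \<in> D then 0 else ?n i))
   = cycle_product b (B \<union> D) \<pi> (\<lambda>i. l (act \<rho> i) + (if i \<in> D then 0 else n i))"
  proof (rule cycle_product_cong[OF A(6)])
   fix i assume "i \<in> B \<union> D"
   then have "i \<noteq> x" using xB ne by auto
   then show "l (act ?r i) + (if i \<in> D then 0 else ?n i) = l (act \<rho> i) + (if i \<in> D then 0 else n i)"
    using lv v w A(3)[of x] ne by (auto simp: r)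
  qed
  ultimately show "assignment_weight a b ?r (S - {x}) D ?n (B, l, swap x v * \<sigma>, \<pi>) = assignment_weight a b \<rho> S D n (B, l, \<sigma>, \<pi>)"
   unfolding assignment_weight_def prod.case 1 ss by simp
 qed
 have bB: "(insert x B, l(v := l v - 1), \<sigma>, \<pi> * swap w x) \<in> assignments \<rho> S D n"
  if t: "(B, l, \<sigma>, \<pi>) \<in> assignments ?r (S - {x}) D ?n" and lv: "0 < l v" for B l \<sigma> \<pi>
 proof (rule assignmentsI)
  note A = assignmentsD[OF t]
  have wY: "w \<in> B \<union> D" using A(4)[of w] lv v by (simp add: r)
  show "insert x B \<subseteq> S" using A(1) x by auto
  show "(l(v := l v - 1)) i \<le> n i" for i using A(2)[of i] by (auto split: if_splits)
  show "(l(v := l v - 1)) i = 0" if "i \<notin> D" for i using A(3)[of i] that by auto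
  show "i \<in> insert x B \<union> D" if "0 < (l(v := l v - 1)) (act \<rho> i)" for i
  proof (cases "i = x \<or> i = w")
   case False
   then have "0 < l (act ?r i)" using that rv[of i] by (simp add: r)
   then show ?thesis using A(4)[of i] by auto
  qed (use wY in auto)
  show "affected \<sigma> \<subseteq> S - insert x B \<union> D" using A(5) by auto
  show "affected (\<pi> * swap w x) \<subseteq> insert x B \<union> D" using wY A(6) by (intro affected_mult_subset affected_swap_subset) auto
  show "\<sigma> * (\<pi> * swap w x) = \<rho>" unfolding mult.assoc[symmetric] A(7) by (rule swap_involution)
 qed
 have bN: "(B, l, swap x v * \<sigma>, \<pi>) \<in> assignments \<rho> S D n"
  if t: "(B, l, \<sigma>, \<pi>) \<in> assignments ?r (S - {x}) D ?n" and lv: "l v = 0" for B l \<sigma> \<pi>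
 proof (rule assignmentsI)
  note A = assignmentsD[OF t]
  show "B \<subseteq> S" using A(1) by auto
  show "l i \<le> n i" for i using A(2)[of i] lv by (auto split: if_splits)
  show "l i = 0" if "i \<notin> D" for i using A(3)[of i] that by auto
  show "i \<in> B \<union> D" if "0 < l (act \<rho> i)" for i
  proof -
   have "i \<noteq> w" "i \<noteq> x" using that A(3)[of x] v w ne lv by auto
   then show ?thesis using that A(4)[of i] by (simp add: r)
  qed
  show "affected (swap x v * \<sigma>) \<subseteq> S - B \<union> D" using A(1,5) x v by (intro affected_mult_subset affected_swap_subset) auto
  show "affected \<pi> \<subseteq> B \<union> D" by (rule A(6))
  show "swap x v * \<sigma> * \<pi> = \<rho>" unfolding mult.assoc A(7) by (rule sw')
 qed
 show ?thesis
  unfolding mixed_sum_def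
 proof (rule sum.reindex_bij_witness[where j = ?J and i = ?I], goal_cases)
  case (1 t)
  obtain B l \<sigma> \<pi> where t: "t = (B, l, \<sigma>, \<pi>)" by (cases t) auto
  show ?case using 1 fN[of B l \<sigma> \<pi>] unfolding t by (auto simp: swap_involution)
 next
  case (2 t)
  obtain B l \<sigma> \<pi> where t: "t = (B, l, \<sigma>, \<pi>)" by (cases t) auto
  show ?case using 2 fN[of B l \<sigma> \<pi>] fB[of B l \<sigma> \<pi>] unfolding t by simp
 next
  case (3 t)
  obtain B l \<sigma> \<pi> where t: "t = (B, l, \<sigma>, \<pi>)" by (cases t) auto
  have "x \<notin> B" using 3 assignmentsD(1)[of B l \<sigma> \<pi>] unfolding t by blast
  then show ?case unfolding t by (auto simp: swap_involution)
 next
  case (4 t)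
  obtain B l \<sigma> \<pi> where t: "t = (B, l, \<sigma>, \<pi>)" by (cases t) auto
  show ?case using 4 bN[of B l \<sigma> \<pi>] bB[of B l \<sigma> \<pi>] unfolding t by simp
 next
  case (5 t)
  obtain B l \<sigma> \<pi> where t: "t = (B, l, \<sigma>, \<pi>)" by (cases t) auto
  show ?case using 5 fN[of B l \<sigma> \<pi>] fB[of B l \<sigma> \<pi>] unfolding t by simp
 qed
qed

text \<open>If \<open>\<rho>\<close> maps \<open>S\<close> to itself, each of its cycles in \<open>S\<close> is contained in \<open>B\<close> or disjoint from it: \<open>\<sigma>\<close> agrees
 with \<open>\<rho>\<close> on \<open>S - B\<close>, so \<open>\<rho>\<close> maps this finite set to itself.\<close>

lemma assignments_closed:
 assumes t: "(B, l, \<sigma>, \<pi>) \<in> assignments \<rho> S D n" and fin: "finite S" "S \<inter> D = {}"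
  and cl: "\<And>i. i \<in> S \<Longrightarrow> act \<rho> i \<in> S" and y: "y \<in> S"
 shows "act \<rho> y \<in> B \<longleftrightarrow> y \<in> B"
proof -
 note A = assignmentsD[OF t]
 have N: "act \<rho> i \<in> S - B" if "i \<in> S - B" for i
 proof -
  have "act \<pi> i = i" using that fin(2) by (intro A(10)) auto
  then have s: "act \<sigma> i = act \<rho> i" using A(8)[of i] by simp
  have "act \<sigma> i \<in> (S - B) \<union> D" using apply_mem_iff[OF A(5), of i] that by auto
  then show ?thesis using s cl[of i] that fin(2) by auto
 qed
 have inj: "inj_on (act \<rho>) (S - B)" by (auto simp: inj_on_def apply_inj)
 have im: "act \<rho> ` (S - B) = S - B"
  using N inj fin(1) by (intro endo_inj_surj) auto
 show ?thesis
 proof (cases "y \<in> B")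
  case True
  have "act \<rho> y \<notin> S - B"
  proof
   assume "act \<rho> y \<in> S - B"
   then obtain z where "z \<in> S - B" "act \<rho> y = act \<rho> z" using im by (metis imageE)
   then show False using True by (simp add: apply_inj)
  qed
  then show ?thesis using True cl[OF y] by auto
 next
  case False
  then show ?thesis using N[of y] y by auto
 qed
qed

text \<open>As in \<open>mixed_sum_path\<close>, but the side of \<open>x\<close> is now recovered from the side of \<open>v\<close>, and the length of \<open>x\<close> is
 recorded at \<open>v\<close> for both sides.\<close>

lemma mixed_sum_cycle:
 fixes a b :: "nat \<Rightarrow> 'v::comm_ring_1"
 assumes fin: "finite S" "finite D" "S \<inter> D = {}" and cl: "\<And>i. i \<in> S \<Longrightarrow> act \<rho> i \<in> S"
  and x: "x \<in> S" and v: "act \<rho> x = v" "v \<noteq> x" and w: "act \<rho> w = x"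
 shows "mixed_sum a b \<rho> S D n = mixed_sum a b (\<rho> * swap w x) (S - {x}) D (n(v := n v + Suc (n x)))"
proof -
 let ?r = "\<rho> * swap w x" and ?n = "n(v := n v + Suc (n x))"
 let ?J = "\<lambda>(B, l, \<sigma>, \<pi>). if x \<in> B then (B - {x}, l, \<sigma>, \<pi> * swap w x) else (B, l, swap x v * \<sigma>, \<pi>)"
 let ?I = "\<lambda>(B, l, \<sigma>, \<pi>). if v \<in> B then (insert x B, l, \<sigma>, \<pi> * swap w x) else (B, l, swap x v * \<sigma>, \<pi>)"
 note r = contracted_apply[OF w]
 have inj: "inj_on (act \<rho>) S" by (auto simp: inj_on_def apply_inj)
 have im: "act \<rho> ` S = S" using cl inj fin(1) by (intro endo_inj_surj) auto
 have wS: "w \<in> S" using x im w by (metis apply_inj imageE)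
 have vS: "v \<in> S" using cl[OF x] v by simp
 have ne: "x \<notin> D" "v \<notin> D" "w \<notin> D" "w \<noteq> x" using x vS wS v w fin(3) by auto
 have cl': "act ?r i \<in> S - {x}" if "i \<in> S - {x}" for i
  using that cl[of i] v w vS by (auto simp: r) (metis apply_inj)
 have sw: "swap x v * \<rho> = ?r" using swap_mult_contract[OF w] v(1) by simp
 have sw': "swap x v * ?r = \<rho>" unfolding sw[symmetric] by (rule swap_involution)
 have ac: "x \<in> B \<longleftrightarrow> v \<in> B" "w \<in> B \<longleftrightarrow> x \<in> B"
  if t: "(B, l, \<sigma>, \<pi>) \<in> assignments \<rho> S D n" for B l \<sigma> \<pi>
  using assignments_closed[OF t fin(1,3) cl x] assignments_closed[OF t fin(1,3) cl wS] v w by auto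
 have ac': "w \<in> B \<longleftrightarrow> v \<in> B"
  if t: "(B, l, \<sigma>, \<pi>) \<in> assignments ?r (S - {x}) D ?n" for B l \<sigma> \<pi>
  using assignments_closed[OF t _ _ cl', of w] fin wS ne v by (auto simp: r)
 have lS: "l i = 0" if "(B, l, \<sigma>, \<pi>) \<in> assignments \<rho>' S' D n'" "i \<in> S" for B l \<sigma> \<pi> \<rho>' S' n' i
  using assignmentsD(3)[OF that(1), of i] that(2) fin(3) by auto
 have fB: "(B - {x}, l, \<sigma>, \<pi> * swap w x) \<in> assignments ?r (S - {x}) D ?n \<and>
   assignment_weight a b ?r (S - {x}) D ?n (B - {x}, l, \<sigma>, \<pi> * swap w x) = assignment_weight a b \<rho> S D n (B, l, \<sigma>, \<pi>)"
  if t: "(B, l, \<sigma>, \<pi>) \<in> assignments \<rho> S D n" and xB: "x \<in> B" for B l \<sigma> \<pi>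
 proof
  note A = assignmentsD[OF t] and l0 = lS[OF t]
  have vB: "v \<in> B" and wB: "w \<in> B" using ac[OF t] xB by auto
  have sx: "act \<sigma> x = x" using xB ne by (intro A(9)) auto
  have sv: "act \<sigma> v = v" using vB ne by (intro A(9)) auto
  have pw: "act \<pi> w = x" using A(8)[of w] w sx by (metis apply_inj)
  have px: "act \<pi> x = v" using A(8)[of x] v sv by (metis apply_inj)
  have aff: "affected (\<pi> * swap w x) \<subseteq> B \<union> D" using wB xB A(6) by (intro affected_mult_subset affected_swap_subset) auto
  have "act (\<pi> * swap w x) x = x" using pw by (simp add: apply_times)
  then have aff': "affected (\<pi> * swap w x) \<subseteq> (B - {x}) \<union> D" using aff by (auto simp: in_affected)
  have rr: "l (act ?r i) = l (act \<rho> i)" for i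
   using v w l0[of x] l0[of v] x vS by (auto simp: r)
  show "(B - {x}, l, \<sigma>, \<pi> * swap w x) \<in> assignments ?r (S - {x}) D ?n"
  proof (rule assignmentsI[OF _ _ _ _ _ aff'])
   show "B - {x} \<subseteq> S - {x}" using A(1) by auto
   show "l i \<le> ?n i" for i using A(2)[of i] A(2)[of v] by auto
   show "l i = 0" if "i \<notin> D" for i using A(3) that by auto
   show "i \<in> B - {x} \<union> D" if "0 < l (act ?r i)" for i
    using that A(4)[of i] v l0[of v] vS unfolding rr by auto
   show "affected \<sigma> \<subseteq> S - {x} - (B - {x}) \<union> D" using A(5) xB by auto
   show "\<sigma> * (\<pi> * swap w x) = ?r" unfolding A(7)[symmetric] by (simp add: mult.assoc)
  qed
  have 1: "S - {x} - (B - {x}) = S - B" using xB by auto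
  have 3: "B - {x} \<union> D = (B \<union> D) - {x}" using ne by auto
  have 2: "cycle_product a (S - B \<union> D) \<sigma> (\<lambda>i. ?n i - l i) = cycle_product a (S - B \<union> D) \<sigma> (\<lambda>i. n i - l i)"
   by (rule cycle_product_cong[OF A(5)]) (use vB ne in auto)
  have "cycle_product b ((B \<union> D) - {x}) (\<pi> * swap w x) (\<lambda>i. l (act ?r i) + (if i \<in> D then 0 else ?n i))
   = cycle_product b (B \<union> D) \<pi> (\<lambda>i. l (act \<rho> i) + (if i \<in> D then 0 else n i))"
  proof (rule cycle_product_contract[where y = v])
   show "v \<in> orbit \<pi> x" unfolding px[symmetric] by simp
   show "finite (B \<union> D)" using fin A(1) by (auto intro: finite_subset)
   show "Suc (l (act ?r v) + (if v \<in> D then 0 else ?n v))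
     = Suc (l (act \<rho> v) + (if v \<in> D then 0 else n v)) + Suc (l (act \<rho> x) + (if x \<in> D then 0 else n x))"
    using ne v l0[of v] vS l0[of "act \<rho> v"] cl[OF vS] unfolding rr by simp
  qed (use A(6) pw ne v in \<open>auto simp: rr\<close>)
  then show "assignment_weight a b ?r (S - {x}) D ?n (B - {x}, l, \<sigma>, \<pi> * swap w x) = assignment_weight a b \<rho> S D n (B, l, \<sigma>, \<pi>)"
   unfolding assignment_weight_def prod.case 1 2 3 by simp
 qed
 have fN: "(B, l, swap x v * \<sigma>, \<pi>) \<in> assignments ?r (S - {x}) D ?n \<and>
   assignment_weight a b ?r (S - {x}) D ?n (B, l, swap x v * \<sigma>, \<pi>) = assignment_weight a b \<rho> S D n (B, l, \<sigma>, \<pi>)"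
  if t: "(B, l, \<sigma>, \<pi>) \<in> assignments \<rho> S D n" and xB: "x \<notin> B" for B l \<sigma> \<pi>
 proof (intro conjI)
  note A = assignmentsD[OF t] and l0 = lS[OF t]
  have vB: "v \<notin> B" using ac[OF t] xB by auto
  have px: "act \<pi> x = x" using xB ne by (intro A(10)) auto
  have sx: "act \<sigma> x = v" using A(8)[of x] px v by simp
  define u where "u = act (inverse \<sigma>) x"
  have su: "act \<sigma> u = x" by (simp add: u_def)
  have ux: "u \<noteq> x" using su sx v by auto
  have ss: "swap x v * \<sigma> = \<sigma> * swap u x" using swap_mult_contract[OF su] sx by simp
  have aff: "affected (swap x v * \<sigma>) \<subseteq> (S - B) \<union> D" using xB x vB vS A(5) by (intro affected_mult_subset affected_swap_subset) auto
  have "act (swap x v * \<sigma>) x = x" using sx by (simp add: apply_times)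
  then have aff': "affected (swap x v * \<sigma>) \<subseteq> (S - {x} - B) \<union> D" using aff by (auto simp: in_affected)
  have rr: "l (act ?r i) = l (act \<rho> i)" for i
   using v w l0[of x] l0[of v] x vS by (auto simp: r)
  show "(B, l, swap x v * \<sigma>, \<pi>) \<in> assignments ?r (S - {x}) D ?n"
  proof (rule assignmentsI[OF _ _ _ _ aff'])
   show "B \<subseteq> S - {x}" using A(1) xB by auto
   show "l i \<le> ?n i" for i using A(2)[of i] A(2)[of v] by auto
   show "l i = 0" if "i \<notin> D" for i using A(3) that by auto
   show "i \<in> B \<union> D" if "0 < l (act ?r i)" for i using that A(4)[of i] unfolding rr by auto
   show "affected \<pi> \<subseteq> B \<union> D" by (rule A(6))
   show "swap x v * \<sigma> * \<pi> = ?r" using sw A(7) by (simp add: mult.assoc)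
  qed
  have 1: "S - {x} - B \<union> D = ((S - B) \<union> D) - {x}" using ne by auto
  have "cycle_product a (((S - B) \<union> D) - {x}) (\<sigma> * swap u x) (\<lambda>i. ?n i - l i) = cycle_product a ((S - B) \<union> D) \<sigma> (\<lambda>i. n i - l i)"
  proof (rule cycle_product_contract[where y = v])
   show "v \<in> orbit \<sigma> x" using sx by auto
   show "finite ((S - B) \<union> D)" using fin by auto
   show "Suc (?n v - l v) = Suc (n v - l v) + Suc (n x - l x)" using l0[of v] l0[of x] x vS by simp
  qed (use A(5) su ux v in auto)
  moreover have "cycle_product b (B \<union> D) \<pi> (\<lambda>i. l (act ?r i) + (if i \<in> D then 0 else ?n i))
   = cycle_product b (B \<union> D) \<pi> (\<lambda>i. l (act \<rho> i) + (if i \<in> D then 0 else n i))"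
   by (rule cycle_product_cong[OF A(6)]) (use vB ne in \<open>auto simp: rr\<close>)
  ultimately show "assignment_weight a b ?r (S - {x}) D ?n (B, l, swap x v * \<sigma>, \<pi>) = assignment_weight a b \<rho> S D n (B, l, \<sigma>, \<pi>)"
   unfolding assignment_weight_def prod.case 1 ss by simp
 qed
 have b: "l i \<le> n i \<and> (0 < l (act \<rho> i) \<longrightarrow> i \<in> B \<union> D)"
  if t: "(B, l, \<sigma>, \<pi>) \<in> assignments ?r (S - {x}) D ?n" for B l \<sigma> \<pi> i
 proof
  note A = assignmentsD[OF t]
  show "l i \<le> n i" using A(2)[of i] A(3)[OF ne(2)] by (auto split: if_splits)
  show "0 < l (act \<rho> i) \<longrightarrow> i \<in> B \<union> D"
  proof
   assume h: "0 < l (act \<rho> i)"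
   have "l x = 0" using assignmentsD(3)[OF t ne(1)] .
   then have "i \<noteq> w" "i \<noteq> x" using h assignmentsD(3)[OF t ne(2)] v w by auto
   then show "i \<in> B \<union> D" using h A(4)[of i] by (simp add: r)
  qed
 qed
 have bB: "(insert x B, l, \<sigma>, \<pi> * swap w x) \<in> assignments \<rho> S D n"
  if t: "(B, l, \<sigma>, \<pi>) \<in> assignments ?r (S - {x}) D ?n" and vB: "v \<in> B" for B l \<sigma> \<pi>
 proof (rule assignmentsI)
  note A = assignmentsD[OF t]
  have wB: "w \<in> B" using ac'[OF t] vB by simp
  show "insert x B \<subseteq> S" using A(1) x by auto
  show "l i \<le> n i" for i using b[OF t] by blast
  show "l i = 0" if "i \<notin> D" for i using A(3)[of i] that by auto
  show "i \<in> insert x B \<union> D" if "0 < l (act \<rho> i)" for i using b[OF t, of i] that by blast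
  show "affected \<sigma> \<subseteq> S - insert x B \<union> D" using A(5) by auto
  show "affected (\<pi> * swap w x) \<subseteq> insert x B \<union> D" using wB A(6) by (intro affected_mult_subset affected_swap_subset) auto
  show "\<sigma> * (\<pi> * swap w x) = \<rho>" unfolding mult.assoc[symmetric] A(7) by (rule swap_involution)
 qed
 have bN: "(B, l, swap x v * \<sigma>, \<pi>) \<in> assignments \<rho> S D n"
  if t: "(B, l, \<sigma>, \<pi>) \<in> assignments ?r (S - {x}) D ?n" and vB: "v \<notin> B" for B l \<sigma> \<pi>
 proof (rule assignmentsI)
  note A = assignmentsD[OF t]
  show "B \<subseteq> S" using A(1) by auto
  show "l i \<le> n i" for i using b[OF t] by blast
  show "l i = 0" if "i \<notin> D" for i using A(3)[of i] that by auto
  show "i \<in> B \<union> D" if "0 < l (act \<rho> i)" for i using b[OF t, of i] that by blast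
  show "affected (swap x v * \<sigma>) \<subseteq> S - B \<union> D" using A(1,5) x vS vB by (intro affected_mult_subset affected_swap_subset) auto
  show "affected \<pi> \<subseteq> B \<union> D" by (rule A(6))
  show "swap x v * \<sigma> * \<pi> = \<rho>" unfolding mult.assoc A(7) by (rule sw')
 qed
 show ?thesis
  unfolding mixed_sum_def
 proof (rule sum.reindex_bij_witness[where j = ?J and i = ?I], goal_cases)
  case (1 t)
  obtain B l \<sigma> \<pi> where t: "t = (B, l, \<sigma>, \<pi>)" by (cases t) auto
  show ?case using ac(1)[of B l \<sigma> \<pi>] 1 v(2) unfolding t by (auto simp: swap_involution)
 next
  case (2 t)
  obtain B l \<sigma> \<pi> where t: "t = (B, l, \<sigma>, \<pi>)" by (cases t) auto
  show ?case using 2 fN[of B l \<sigma> \<pi>] fB[of B l \<sigma> \<pi>] unfolding t by simp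
 next
  case (3 t)
  obtain B l \<sigma> \<pi> where t: "t = (B, l, \<sigma>, \<pi>)" by (cases t) auto
  have "x \<notin> B" using 3 assignmentsD(1)[of B l \<sigma> \<pi>] unfolding t by blast
  then show ?case unfolding t by (auto simp: swap_involution)
 next
  case (4 t)
  obtain B l \<sigma> \<pi> where t: "t = (B, l, \<sigma>, \<pi>)" by (cases t) auto
  show ?case using 4 bN[of B l \<sigma> \<pi>] bB[of B l \<sigma> \<pi>] unfolding t by simp
 next
  case (5 t)
  obtain B l \<sigma> \<pi> where t: "t = (B, l, \<sigma>, \<pi>)" by (cases t) auto
  show ?case using 5 fN[of B l \<sigma> \<pi>] fB[of B l \<sigma> \<pi>] unfolding t by simp
 qed
qed

lemma mixed_sum_fixed:
 fixes a b :: "nat \<Rightarrow> 'v::comm_ring_1"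
 assumes fin: "finite S" "finite D" "S \<inter> D = {}" and x: "x \<in> S" "act \<rho> x = x"
 shows "mixed_sum a b \<rho> S D n = (a (Suc (n x)) + b (Suc (n x))) * mixed_sum a b \<rho> (S - {x}) D n"
proof -
 let ?f = "\<lambda>e. if e then b (Suc (n x)) else a (Suc (n x))"
 let ?W = "assignment_weight a b \<rho> (S - {x}) D n"
 have xD: "x \<notin> D" using x fin(3) by auto
 have fwd: "(B - {x}, l, \<sigma>, \<pi>) \<in> assignments \<rho> (S - {x}) D n \<and>
   assignment_weight a b \<rho> S D n (B, l, \<sigma>, \<pi>) = ?f (x \<in> B) * ?W (B - {x}, l, \<sigma>, \<pi>)"
  if t: "(B, l, \<sigma>, \<pi>) \<in> assignments \<rho> S D n" for B l \<sigma> \<pi>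
 proof -
  note A = assignmentsD[OF t]
  have f: "act \<sigma> x = x" "act \<pi> x = x"
  proof -
   have "act \<sigma> x = x \<or> act \<pi> x = x" using A(9)[of x] A(10)[of x] xD by auto
   then have "act \<sigma> x = x \<and> act \<pi> x = x" using A(8)[of x] x(2) by (metis apply_inj)
   then show "act \<sigma> x = x" "act \<pi> x = x" by auto
  qed
  have s: "affected \<sigma> \<subseteq> S - {x} - (B - {x}) \<union> D" using A(5) f by (auto simp: in_affected)
  have p: "affected \<pi> \<subseteq> B - {x} \<union> D" using A(6) f by (auto simp: in_affected)
  have m: "(B - {x}, l, \<sigma>, \<pi>) \<in> assignments \<rho> (S - {x}) D n"
  proof (rule assignmentsI[OF _ _ _ _ s p])
   show "i \<in> B - {x} \<union> D" if "0 < l (act \<rho> i)" for i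
    using that A(4)[of i] A(3)[OF xD] x(2) by auto
  qed (use A in auto)
  have fX: "finite (S - {x} - (B - {x}) \<union> D)" "finite (B - {x} \<union> D)" using fin A(1) by (auto intro: finite_subset)
  have lx: "l x = 0" by (rule A(3)[OF xD])
  show ?thesis
  proof (cases "x \<in> B")
   case True
   then have e: "S - B \<union> D = S - {x} - (B - {x}) \<union> D" "B \<union> D = insert x (B - {x} \<union> D)" by auto
   show ?thesis using True m fX p xD lx x(2)
    unfolding assignment_weight_def prod.case e
    by (simp add: cycle_product_insert_fixed mult_ac)
  next
   case False
   then have e: "S - B \<union> D = insert x (S - {x} - (B - {x}) \<union> D)" "B \<union> D = B - {x} \<union> D" using x by auto
   show ?thesis using False m
    unfolding assignment_weight_def prod.case e(1) unfolding e(2)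
    using fX(1) s xD lx by (subst cycle_product_insert_fixed) (simp_all add: mult_ac)
  qed
 qed
 have bwd: "(if e then insert x B else B, l, \<sigma>, \<pi>) \<in> assignments \<rho> S D n"
  if t: "(B, l, \<sigma>, \<pi>) \<in> assignments \<rho> (S - {x}) D n" for e B l \<sigma> \<pi>
 proof (rule assignmentsI)
  note A = assignmentsD[OF t]
  show "(if e then insert x B else B) \<subseteq> S" using A(1) x by auto
  show "i \<in> (if e then insert x B else B) \<union> D" if "0 < l (act \<rho> i)" for i using A(4)[OF that] by auto
  show "affected \<sigma> \<subseteq> S - (if e then insert x B else B) \<union> D" using A(5) by auto
  show "affected \<pi> \<subseteq> (if e then insert x B else B) \<union> D" using A(6) by auto
 qed (use assignmentsD[OF t] in auto)
 have "mixed_sum a b \<rho> S D n = (\<Sum>z\<in>UNIV \<times> assignments \<rho> (S - {x}) D n. ?f (fst z) * ?W (snd z))"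
  unfolding mixed_sum_def
 proof (rule sum.reindex_bij_witness[where j = "\<lambda>(B, l, \<sigma>, \<pi>). (x \<in> B, (B - {x}, l, \<sigma>, \<pi>))"
    and i = "\<lambda>(e, (B, l, \<sigma>, \<pi>)). (if e then insert x B else B, l, \<sigma>, \<pi>)"], goal_cases)
  case (1 t)
  then show ?case by (cases t) (auto simp: insert_absorb)
 next
  case (2 t)
  obtain B l \<sigma> \<pi> where t: "t = (B, l, \<sigma>, \<pi>)" by (cases t) auto
  show ?case using 2 fwd[of B l \<sigma> \<pi>] unfolding t by simp
 next
  case (3 z)
  obtain e B l \<sigma> \<pi> where z: "z = (e, B, l, \<sigma>, \<pi>)" by (cases z) auto
  have "x \<notin> B" using 3 assignmentsD(1)[of B l \<sigma> \<pi>] unfolding z by blast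
  then show ?case unfolding z by simp
 next
  case (4 z)
  obtain e B l \<sigma> \<pi> where z: "z = (e, B, l, \<sigma>, \<pi>)" by (cases z) auto
  show ?case using 4 bwd[of B l \<sigma> \<pi> e] unfolding z by simp
 next
  case (5 t)
  obtain B l \<sigma> \<pi> where t: "t = (B, l, \<sigma>, \<pi>)" by (cases t) auto
  show ?case using 5 fwd[of B l \<sigma> \<pi>] unfolding t by simp
 qed
 also have "... = (\<Sum>e\<in>UNIV. \<Sum>t\<in>assignments \<rho> (S - {x}) D n. ?f e * ?W t)"
  by (simp only: sum.cartesian_product case_prod_unfold)
 also have "... = (\<Sum>e\<in>UNIV. ?f e * mixed_sum a b \<rho> (S - {x}) D n)"
  by (simp only: mixed_sum_def sum_distrib_left)
 also have "... = (a (Suc (n x)) + b (Suc (n x))) * mixed_sum a b \<rho> (S - {x}) D n"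
  by (simp add: UNIV_bool algebra_simps)
 finally show ?thesis .
qed

text \<open>Conjugating \<open>\<pi>\<close> by \<open>\<rho>\<close> reverses the order of the factors and moves the exponents from the preimages to the
 points themselves.\<close>

lemma mixed_sum_no_singles:
 fixes a b :: "nat \<Rightarrow> 'v::comm_ring_1"
 assumes D: "finite D"
 shows "mixed_sum a b \<rho> {} D n = pair_sum b a \<rho> D (\<lambda>i. if i \<in> D then n i else 0)"
proof -
 let ?m = "\<lambda>i. if i \<in> D then n i else 0"
 let ?L = "{l. \<forall>i. l i \<le> ?m i}" and ?P = "{(\<pi>, \<sigma>). \<pi> \<in> perms_on D \<and> \<sigma> \<in> perms_on D \<and> \<pi> * \<sigma> = \<rho>}"
 have "pair_sum b a \<rho> D ?m = (\<Sum>z\<in>?L \<times> ?P. cycle_product b D (fst (snd z)) (fst z) * cycle_product a D (snd (snd z)) (\<lambda>i. ?m i - fst z i))"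
  unfolding pair_sum_def by (simp add: sum.cartesian_product case_prod_unfold)
 also have "... = mixed_sum a b \<rho> {} D n"
  unfolding mixed_sum_def
 proof (rule sum.reindex_bij_witness[where j = "\<lambda>z. ({}, fst z, snd (snd z), inverse \<rho> * fst (snd z) * \<rho>)"
    and i = "\<lambda>(B, l, \<sigma>, \<pi>). (l, \<rho> * \<pi> * inverse \<rho>, \<sigma>)"], goal_cases)
  case (1 z)
  then show ?case by (cases z) (auto intro!: perm_eqI simp: apply_times)
 next
  case (2 z)
  obtain l \<pi> \<sigma> where z: "z = (l, \<pi>, \<sigma>)" by (cases z) auto
  have h: "\<And>i. l i \<le> ?m i" "affected \<pi> \<subseteq> D" "affected \<sigma> \<subseteq> D" and ps: "\<pi> * \<sigma> = \<rho>"
   using 2 unfolding z by (auto simp: perms_on_def split: if_splits)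
  have r: "affected \<rho> \<subseteq> D" unfolding ps[symmetric] by (rule affected_mult_subset[OF h(2,3)])
  have "({}, l, \<sigma>, inverse \<rho> * \<pi> * \<rho>) \<in> assignments \<rho> {} D n"
  proof (rule assignmentsI)
   show l0: "l i = 0" if "i \<notin> D" for i using h(1)[of i] that by simp
   show "l i \<le> n i" for i using h(1)[of i] by (cases "i \<in> D") auto
   show "i \<in> {} \<union> D" if "0 < l (act \<rho> i)" for i
    using that l0[of "act \<rho> i"] apply_mem_iff[OF r, of i] by auto
   show "affected \<sigma> \<subseteq> {} - {} \<union> D" using h by simp
   have "affected (inverse \<rho> * \<pi> * \<rho>) \<subseteq> D" using r h by (intro affected_mult_subset) auto
   then show "affected (inverse \<rho> * \<pi> * \<rho>) \<subseteq> {} \<union> D" by simp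
   have k: "act \<sigma> (act (inverse \<rho>) (act \<pi> y)) = y" for y
   proof -
    have "act \<pi> (act \<sigma> (act (inverse \<rho>) (act \<pi> y))) = act \<rho> (act (inverse \<rho>) (act \<pi> y))"
     unfolding ps[symmetric] by (simp add: apply_times)
    then show ?thesis by (simp add: apply_inj)
   qed
   show "\<sigma> * (inverse \<rho> * \<pi> * \<rho>) = \<rho>"
    by (rule perm_eqI) (simp add: apply_times k)
  qed simp
  then show ?case unfolding z by simp
 next
  case (3 t)
  obtain B l \<sigma> \<pi> where t: "t = (B, l, \<sigma>, \<pi>)" by (cases t) auto
  have "B = {}" using 3 assignmentsD(1)[of B l \<sigma> \<pi>] unfolding t by blast
  then show ?case unfolding t by (auto intro!: perm_eqI simp: apply_times)
 next
  case (4 t)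
  obtain B l \<sigma> \<pi> where t: "t = (B, l, \<sigma>, \<pi>)" by (cases t) auto
  have m: "(B, l, \<sigma>, \<pi>) \<in> assignments \<rho> {} D n" using 4 unfolding t .
  note A = assignmentsD[OF m]
  have h: "affected \<pi> \<subseteq> D" "affected \<sigma> \<subseteq> D" using A(1,5,6) by auto
  have r: "affected \<rho> \<subseteq> D" unfolding A(7)[symmetric] by (rule affected_mult_subset[OF h(2,1)])
  have "affected (\<rho> * \<pi> * inverse \<rho>) \<subseteq> D" using r h by (intro affected_mult_subset) auto
  moreover have "\<rho> * \<pi> * inverse \<rho> * \<sigma> = \<rho>"
  proof (rule perm_eqI)
   fix i
   have "act \<rho> (act \<pi> (act (inverse \<rho>) (act \<sigma> i))) = act \<rho> i"
   proof -
    have "act \<sigma> (act \<pi> (act (inverse \<rho>) (act \<sigma> i))) = act \<sigma> i"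
     unfolding A(8) by simp
    then show ?thesis by (simp add: apply_inj)
   qed
   then show "act (\<rho> * \<pi> * inverse \<rho> * \<sigma>) i = act \<rho> i" by (simp add: apply_times)
  qed
  ultimately show ?case using h A(2,3) unfolding t by (auto simp: perms_on_def)
 next
  case (5 z)
  obtain l \<pi> \<sigma> where z: "z = (l, \<pi>, \<sigma>)" by (cases z) auto
  have h: "\<And>i. l i \<le> ?m i" "affected \<pi> \<subseteq> D" "affected \<sigma> \<subseteq> D" and ps: "\<pi> * \<sigma> = \<rho>"
   using 5 unfolding z by (auto simp: perms_on_def split: if_splits)
  have r: "affected \<rho> \<subseteq> D" unfolding ps[symmetric] by (rule affected_mult_subset[OF h(2,3)])
  have r': "affected (inverse \<rho> * \<pi> * \<rho>) \<subseteq> D" using r h by (intro affected_mult_subset) auto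
  have c: "\<rho> * (inverse \<rho> * \<pi> * \<rho>) * inverse \<rho> = \<pi>" by (rule perm_eqI) (simp add: apply_times)
  have "cycle_product b D (inverse \<rho> * \<pi> * \<rho>) (\<lambda>i. l (act \<rho> i) + (if i \<in> D then 0 else n i))
   = cycle_product b D (inverse \<rho> * \<pi> * \<rho>) (\<lambda>i. l (act \<rho> i))"
   by (rule cycle_product_cong[OF r']) auto
  also have "... = cycle_product b D \<pi> l"
   unfolding cycle_product_conjugate[OF r, symmetric] c ..
  finally have "cycle_product b D (inverse \<rho> * \<pi> * \<rho>) (\<lambda>i. l (act \<rho> i) + (if i \<in> D then 0 else n i)) = cycle_product b D \<pi> l" .
  moreover have "cycle_product a D \<sigma> (\<lambda>i. n i - l i) = cycle_product a D \<sigma> (\<lambda>i. ?m i - l i)"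
   by (rule cycle_product_cong[OF h(3)]) auto
  ultimately show ?case unfolding z by (simp add: assignment_weight_def mult.commute)
 qed
 finally show ?thesis by simp
qed

text \<open>The output data depend on \<open>\<rho>\<close>, \<open>S\<close>, \<open>D\<close> and \<open>n\<close> but not on the weights. First come the points of \<open>S\<close> that are followed by a
 point of \<open>D\<close>; when none is left, \<open>\<rho>\<close> maps \<open>S\<close> to itself (or there is no assignment at all), and the cycles
 in \<open>S\<close> are contracted to fixed points and split off.\<close>

theorem mixed_sum_reduction:
 fixes \<rho> :: "nat perm"
 assumes "finite S" "finite D" "S \<inter> D = {}" "(\<forall>i. i \<notin> D \<longrightarrow> n i = 0) \<or> (\<forall>i\<in>S. act \<rho> i \<in> S)"
 shows "(\<forall>a b :: nat \<Rightarrow> 'v::comm_ring_1. mixed_sum a b \<rho> S D n = 0) \<or>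
  (\<exists>ks \<rho>' m. (\<forall>i. i \<notin> D \<longrightarrow> m i = 0) \<and> (\<forall>a b :: nat \<Rightarrow> 'v. mixed_sum a b \<rho> S D n = (\<Prod>k\<leftarrow>ks. a k + b k) * pair_sum b a \<rho>' D m))"
 using assms
proof (induction "card S" arbitrary: S \<rho> n)
 case 0
 then have S: "S = {}" by simp
 show ?case
  by (rule disjI2, rule exI[of _ "[]"], rule exI[of _ \<rho>], rule exI[of _ "\<lambda>i. if i \<in> D then n i else 0"])
   (simp add: S mixed_sum_no_singles[OF 0(3)])
next
 case (Suc N)
 note fin = Suc.prems(1-3)
 show ?case
 proof (cases "\<exists>x\<in>S. act \<rho> x \<in> D")
  case True
  then obtain x where x: "x \<in> S" "act \<rho> x \<in> D" by blast
  then have n: "\<And>i. i \<notin> D \<Longrightarrow> n i = 0" using Suc.prems(3,4) by auto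
  let ?w = "act (inverse \<rho>) x" and ?n = "n(act \<rho> x := Suc (n (act \<rho> x)))"
  have eq: "mixed_sum a b \<rho> S D n = mixed_sum a b (\<rho> * swap ?w x) (S - {x}) D ?n" for a b :: "nat \<Rightarrow> 'v"
   by (rule mixed_sum_path[OF fin x(1) refl x(2) _ n]) simp_all
  show ?thesis unfolding eq
   by (rule Suc.hyps(1)) (use Suc.hyps(2) Suc.prems x n in auto)
 next
  case noD: False
  show ?thesis
  proof (cases "affected \<rho> \<subseteq> S \<union> D")
   case False
   have "assignments \<rho> S D n = {}"
   proof (rule ccontr)
    assume "assignments \<rho> S D n \<noteq> {}"
    then obtain t where t: "t \<in> assignments \<rho> S D n" by blast
    obtain B l \<sigma> \<pi> where "t = (B, l, \<sigma>, \<pi>)" by (cases t) auto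
    with t have t: "(B, l, \<sigma>, \<pi>) \<in> assignments \<rho> S D n" by simp
    have "affected (\<sigma> * \<pi>) \<subseteq> S \<union> D" using assignmentsD(1,5,6)[OF t] by (intro affected_mult_subset) auto
    then show False using False assignmentsD(7)[OF t] by simp
   qed
   then show ?thesis by (simp add: mixed_sum_def)
  next
   case True
   have cl: "act \<rho> i \<in> S" if "i \<in> S" for i
    using apply_mem_iff[OF True, of i] that noD by auto
   from Suc.hyps(2) obtain x where x: "x \<in> S" by fastforce
   let ?w = "act (inverse \<rho>) x" and ?v = "act \<rho> x"
   show ?thesis
   proof (cases "?v = x")
    case fx: True
    have eq: "mixed_sum a b \<rho> S D n = (a (Suc (n x)) + b (Suc (n x))) * mixed_sum a b \<rho> (S - {x}) D n" for a b :: "nat \<Rightarrow> 'v"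
     by (rule mixed_sum_fixed[OF fin x fx])
    have "(\<forall>i\<in>S - {x}. act \<rho> i \<in> S - {x})" using cl fx by (metis DiffD1 DiffD2 DiffI apply_inj singletonD singletonI)
    then have "(\<forall>a b :: nat \<Rightarrow> 'v. mixed_sum a b \<rho> (S - {x}) D n = 0) \<or>
     (\<exists>ks \<rho>' m. (\<forall>i. i \<notin> D \<longrightarrow> m i = 0) \<and> (\<forall>a b :: nat \<Rightarrow> 'v. mixed_sum a b \<rho> (S - {x}) D n = (\<Prod>k\<leftarrow>ks. a k + b k) * pair_sum b a \<rho>' D m))"
     by (intro Suc.hyps(1)) (use Suc.hyps(2) Suc.prems x in auto)
    then show ?thesis
    proof (elim disjE exE conjE)
     assume "\<forall>a b :: nat \<Rightarrow> 'v. mixed_sum a b \<rho> (S - {x}) D n = 0"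
     then show ?thesis unfolding eq by simp
    next
     fix ks \<rho>' m
     assume "\<forall>i. i \<notin> D \<longrightarrow> m i = 0" "\<forall>a b :: nat \<Rightarrow> 'v. mixed_sum a b \<rho> (S - {x}) D n = (\<Prod>k\<leftarrow>ks. a k + b k) * pair_sum b a \<rho>' D m"
     then show ?thesis unfolding eq
      by (intro disjI2 exI[of _ "Suc (n x) # ks"] exI[of _ \<rho>'] exI[of _ m]) (simp add: mult.assoc)
    qed
   next
    case nfx: False
    have eq: "mixed_sum a b \<rho> S D n = mixed_sum a b (\<rho> * swap ?w x) (S - {x}) D (n(?v := n ?v + Suc (n x)))" for a b :: "nat \<Rightarrow> 'v"
     by (rule mixed_sum_cycle[OF fin cl x refl nfx]) simp_all
    have cl': "act (\<rho> * swap ?w x) i \<in> S - {x}" if "i \<in> S - {x}" for i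
    proof -
     have "act \<rho> ?w = x" by simp
     note r = contracted_apply[OF this, of i]
     show ?thesis
     proof (cases "i = ?w")
      case True
      then show ?thesis using r cl[OF x] nfx by simp
     next
      case F: False
      then have "act \<rho> i \<noteq> x" by auto
      then show ?thesis using r F that cl[of i] by auto
     qed
    qed
    show ?thesis unfolding eq
     by (rule Suc.hyps(1)) (use Suc.hyps(2) Suc.prems x cl' in auto)
   qed
  qed
 qed
qed

section \<open>The adjoints on products of power sums\<close>

instance mps :: (comm_ring_1) comm_ring_1
proof
 fix f g :: "'a mps"
 show "f * g = g * f"
 proof (rule mps_eqI)
  fix \<alpha>
  have "(\<Sum>p\<in>splits \<alpha>. mcoeff f (fst p) * mcoeff g (snd p)) = (\<Sum>p\<in>splits \<alpha>. mcoeff g (fst p) * mcoeff f (snd p))"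
   by (rule sum.reindex_bij_witness[where i = prod.swap and j = prod.swap])
    (auto simp: splits_def add.commute mult.commute)
  then show "mcoeff (f * g) \<alpha> = mcoeff (g * f) \<alpha>" by (simp add: mcoeff_times)
 qed
qed (simp_all add: distrib_right)

lemma symmetric_psum: "symmetric_mps (psum k)"
 unfolding symmetric_mps_def
proof (intro allI impI)
 fix \<pi> :: "nat \<Rightarrow> nat" and \<alpha> :: monom assume b: "bij \<pi>"
 have "(\<exists>i. map_key \<pi> \<alpha> = single i k) \<longleftrightarrow> (\<exists>i. \<alpha> = single i k)"
 proof
  assume "\<exists>i. map_key \<pi> \<alpha> = single i k"
  then obtain i where i: "map_key \<pi> \<alpha> = single i k" by blast
  have "\<alpha> = single (\<pi> i) k"
  proof (rule poly_mapping_eqI)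
   fix j
   obtain j' where j: "j = \<pi> j'" using b by (metis bij_pointE)
   have "lookup \<alpha> j = lookup (single i k) j'"
    unfolding i[symmetric] lookup_map_key_bij[OF b] j ..
   then show "lookup \<alpha> j = lookup (single (\<pi> i) k) j"
    using b j by (auto simp: lookup_single when_def bij_def inj_def)
  qed
  then show "\<exists>i. \<alpha> = single i k" by blast
 next
  assume "\<exists>i. \<alpha> = single i k"
  then obtain i where i: "\<alpha> = single i k" by blast
  obtain i' where i': "i = \<pi> i'" using b by (metis bij_pointE)
  have "map_key \<pi> \<alpha> = single i' k"
   by (rule poly_mapping_eqI) (use b in \<open>auto simp: lookup_map_key_bij[OF b] i i' lookup_single when_def bij_def inj_def\<close>)
  then show "\<exists>i. map_key \<pi> \<alpha> = single i k" by blast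
 qed
 then show "mcoeff (psum k) (map_key \<pi> \<alpha>) = mcoeff (psum k) \<alpha>" by (simp add: psum_def)
qed

lemma symmetric_one: "symmetric_mps (1 :: 'a::ring_1 mps)"
 using symmetric_hsym[of 0] by (simp add: hsym_0)

lemma keys_splits: "p \<in> splits \<alpha> \<Longrightarrow> keys (fst p) \<subseteq> keys \<alpha> \<and> keys (snd p) \<subseteq> keys \<alpha>"
 by (auto simp: splits_def in_keys_iff lookup_add)

lemma hperp_times:
 fixes f g :: "'a::comm_ring_1 mps"
 assumes "symmetric_mps f" "symmetric_mps g"
 shows "hperp k (f * g) = (\<Sum>i\<le>k. hperp i f * hperp (k - i) g)"
proof (rule mps_eqI)
 fix \<alpha>
 have l: "lookup \<alpha> (fresh \<alpha>) = 0" using keys_fresh[of \<alpha>] by (auto simp: in_keys_iff)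
 have "mcoeff (hperp k (f * g)) \<alpha>
  = (\<Sum>i\<le>k. \<Sum>q\<in>splits \<alpha>. mcoeff f (fst q + single (fresh \<alpha>) (k - i)) * mcoeff g (snd q + single (fresh \<alpha>) i))"
  unfolding mcoeff_hperp mcoeff_times by (rule sum_splits_add_single[OF l])
 also have "... = (\<Sum>i\<le>k. \<Sum>q\<in>splits \<alpha>. mcoeff (hperp (k - i) f) (fst q) * mcoeff (hperp i g) (snd q))"
 proof (intro sum.cong refl)
  fix i q assume "q \<in> splits \<alpha>"
  then have "keys (fst q) \<subseteq> {..<fresh \<alpha>}" "keys (snd q) \<subseteq> {..<fresh \<alpha>}"
   using keys_splits keys_fresh[of \<alpha>] by blast+
  then show "mcoeff f (fst q + single (fresh \<alpha>) (k - i)) * mcoeff g (snd q + single (fresh \<alpha>) i)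
   = mcoeff (hperp (k - i) f) (fst q) * mcoeff (hperp i g) (snd q)"
   by (simp add: hperp_any_fresh[OF assms(1)] hperp_any_fresh[OF assms(2)])
 qed
 also have "... = mcoeff (\<Sum>i\<le>k. hperp (k - i) f * hperp i g) \<alpha>"
  by (simp add: mcoeff_sum mcoeff_times)
 also have "(\<Sum>i\<le>k. hperp (k - i) f * hperp i g) = (\<Sum>i\<le>k. hperp i f * hperp (k - i) g)"
  by (rule sum.reindex_bij_witness[where i = "\<lambda>i. k - i" and j = "\<lambda>i. k - i"]) auto
 finally show "mcoeff (hperp k (f * g)) \<alpha> = mcoeff (\<Sum>i\<le>k. hperp i f * hperp (k - i) g) \<alpha>" .
qed

text \<open>In a fresh variable \<open>z\<close> the power sum becomes \<open>p\<^sub>c + z\<^sup>c\<close>.\<close>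

lemma hperp_psum:
 assumes c: "c > 0"
 shows "hperp i (psum c) = (if i = 0 then psum c else if i = c then 1 else 0)"
proof (rule mps_eqI)
 fix \<alpha>
 let ?N = "fresh \<alpha>"
 have l: "lookup \<alpha> ?N = 0" using keys_fresh[of \<alpha>] by (auto simp: in_keys_iff)
 have "(\<exists>j. \<alpha> + single ?N i = single j c) \<longleftrightarrow> i = c \<and> \<alpha> = 0" if "i \<noteq> 0"
 proof
  assume "\<exists>j. \<alpha> + single ?N i = single j c"
  then obtain j where j: "\<alpha> + single ?N i = single j c" by blast
  have "lookup (single j c) ?N = i"
   unfolding j[symmetric] using l by (simp add: lookup_add)
  then have jN: "j = ?N" "i = c" using that by (auto simp: lookup_single when_def split: if_splits)
  then show "i = c \<and> \<alpha> = 0" using j by simp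
 next
  assume "i = c \<and> \<alpha> = 0"
  then show "\<exists>j. \<alpha> + single ?N i = single j c" by auto
 qed
 then show "mcoeff (hperp i (psum c)) \<alpha> = mcoeff (if i = 0 then psum c else if i = c then 1 else 0) \<alpha>"
  using c by (cases "i = 0") (auto simp: mcoeff_hperp psum_def one_mps.rep_eq zero_mps.rep_eq)
qed

lemma hperp_0 [simp]: "hperp 0 f = f"
 by (rule mps_eqI) (simp add: mcoeff_hperp)

lemma hperp_psum_times:
 fixes f :: "'a::comm_ring_1 mps"
 assumes "c > 0" "symmetric_mps f"
 shows "hperp k (psum c * f) = psum c * hperp k f + (if c \<le> k then hperp (k - c) f else 0)"
proof -
 have "hperp k (psum c * f) = (\<Sum>i\<le>k. (if i = 0 then psum c * hperp k f else 0) + (if i = c then hperp (k - c) f else 0))"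
  unfolding hperp_times[OF symmetric_psum assms(2)] hperp_psum[OF assms(1)]
  using assms(1) by (intro sum.cong) auto
 then show ?thesis by (simp add: sum.distrib)
qed

definition signed_eperp :: "nat \<Rightarrow> 'a::comm_ring_1 mps \<Rightarrow> 'a mps" where
 "signed_eperp n f = Abs_mps (\<lambda>\<alpha>. (-1) ^ n * mcoeff (eperp n f) \<alpha>)"

lemma eperp_additive:
 fixes f g :: "'a::ring_1 mps"
 shows "mcoeff (eperp k (f + g)) \<alpha> = mcoeff (eperp k f) \<alpha> + mcoeff (eperp k g) \<alpha>"
proof (induction k arbitrary: f g \<alpha> rule: less_induct)
 case (less k)
 show ?case
 proof (cases k)
  case (Suc k')
  have h: "hperp j (f + g) = hperp j f + hperp j g" for j
   by (rule mps_eqI) (simp add: mcoeff_hperp plus_mps.rep_eq)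
  have "(\<Sum>i\<le>k'. (-1) ^ i * mcoeff (eperp (k' - i) (hperp (Suc i) (f + g))) \<alpha>)
   = (\<Sum>i\<le>k'. (-1) ^ i * mcoeff (eperp (k' - i) (hperp (Suc i) f)) \<alpha> + (-1) ^ i * mcoeff (eperp (k' - i) (hperp (Suc i) g)) \<alpha>)"
   unfolding h using Suc by (intro sum.cong refl) (simp add: less.IH distrib_left)
  then show ?thesis using Suc by (simp add: sum.distrib)
 qed (simp add: plus_mps.rep_eq)
qed

lemma signed_eperp_add: "signed_eperp k (f + g) = signed_eperp k f + signed_eperp k g"
 by (rule mps_eqI) (simp add: signed_eperp_def eperp_additive plus_mps.rep_eq distrib_left)

lemma signed_eperp_0 [simp]: "signed_eperp 0 f = f"
 by (rule mps_eqI) (simp add: signed_eperp_def)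

lemma signed_eperp_zero [simp]: "signed_eperp k 0 = 0"
 using signed_eperp_add[of k 0 0] by simp

lemma signed_eperp_Suc: "signed_eperp (Suc k) f = - (\<Sum>i\<le>k. signed_eperp (k - i) (hperp (Suc i) f))"
proof (rule mps_eqI)
 fix \<alpha>
 have "(-1) ^ k * (-1) ^ i = ((-1) ^ (k - i) :: 'a)" if "i \<le> k" for i
 proof -
  have e: "(-1) ^ k = ((-1) ^ (k - i) * (-1) ^ i :: 'a)" using that by (simp add: power_add[symmetric])
  show ?thesis unfolding e by (simp add: mult.assoc power_mult_distrib[symmetric])
 qed
 then have "(-1) ^ k * ((-1) ^ i * z) = ((-1) ^ (k - i) * z :: 'a)" if "i \<le> k" for i z
  using that by (simp add: mult.assoc[symmetric])
 then show "mcoeff (signed_eperp (Suc k) f) \<alpha> = mcoeff (- (\<Sum>i\<le>k. signed_eperp (k - i) (hperp (Suc i) f))) \<alpha>"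
  by (simp add: signed_eperp_def mcoeff_minus mcoeff_sum sum_distrib_left sum_negf)
qed

lemma signed_eperp_hperp:
 "(\<Sum>j\<le>n. signed_eperp (n - j) (hperp j f)) = (if n = 0 then f else 0)"
proof (cases n)
 case (Suc k)
 have "(\<Sum>j\<le>Suc k. signed_eperp (Suc k - j) (hperp j f)) = signed_eperp (Suc k) f + (\<Sum>i\<le>k. signed_eperp (k - i) (hperp (Suc i) f))"
  unfolding sum.atMost_Suc_shift by simp
 then show ?thesis using Suc by (simp add: signed_eperp_Suc)
qed simp

text \<open>Induction on \<open>n\<close>, using that \<open>\<Sum> e\<^sub>n\<^sub>-\<^sub>j\<^sup>\<bottom> h\<^sub>j\<^sup>\<bottom>\<close> with signs vanishes for \<open>n > 0\<close> (\<open>signed_eperp_hperp\<close>) and the rule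
 \<open>p\<^sub>c \<mapsto> p\<^sub>c + z\<^sup>c\<close> for \<open>h\<^sup>\<bottom>\<close>.\<close>

lemma signed_eperp_psum_times:
 fixes f :: "'a::comm_ring_1 mps"
 assumes c: "c > 0" and f: "symmetric_mps f"
 shows "signed_eperp n (psum c * f) = psum c * signed_eperp n f - (if c \<le> n then signed_eperp (n - c) f else 0)"
 using f
proof (induction n arbitrary: f rule: less_induct)
 case (less n)
 note f = less.prems
 show ?case
 proof (cases "n = 0")
  case True
  then show ?thesis using c by simp
 next
  case False
  define E where "E = (signed_eperp :: nat \<Rightarrow> 'a mps \<Rightarrow> 'a mps)"
  let ?p = "psum c :: 'a mps"
  have R: "(\<Sum>j\<le>m. E (m - j) (hperp j f)) = (if m = 0 then f else 0)" for m
   unfolding E_def by (rule signed_eperp_hperp)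
  have R': "(\<Sum>j\<in>{1..m}. E (m - j) (hperp j f)) = (if m = 0 then 0 else - E m f)" for m
  proof -
   have "(\<Sum>j\<le>m. E (m - j) (hperp j f)) = E m f + (\<Sum>j\<in>{1..m}. E (m - j) (hperp j f))"
    by (subst sum.remove[of _ 0]) (auto intro!: sum.cong simp: E_def)
   then show ?thesis using R[of m] by (auto simp: E_def add_eq_0_iff)
  qed
  have "(\<Sum>j\<le>n. E (n - j) (hperp j (?p * f))) = E n (?p * f) + (\<Sum>j\<in>{1..n}. E (n - j) (hperp j (?p * f)))"
   by (subst sum.remove[of _ 0]) (auto intro!: sum.cong simp: E_def)
  moreover have "(\<Sum>j\<le>n. E (n - j) (hperp j (?p * f))) = 0"
   using False unfolding E_def signed_eperp_hperp by simp
  ultimately have 1: "E n (?p * f) = - (\<Sum>j\<in>{1..n}. E (n - j) (hperp j (?p * f)))"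
   by (simp add: add_eq_0_iff)
  have "(\<Sum>j\<in>{1..n}. E (n - j) (hperp j (?p * f)))
   = (\<Sum>j\<in>{1..n}. ?p * E (n - j) (hperp j f) - (if c \<le> n - j then E (n - j - c) (hperp j f) else 0)
     + (if c \<le> j then E (n - j) (hperp (j - c) f) else 0))"
  proof (rule sum.cong[OF refl])
   fix j assume j: "j \<in> {1..n}"
   have "E (n - j) (hperp j (?p * f)) = E (n - j) (?p * hperp j f) + (if c \<le> j then E (n - j) (hperp (j - c) f) else 0)"
    unfolding hperp_psum_times[OF c f] by (simp add: E_def signed_eperp_add)
   also have "E (n - j) (?p * hperp j f) = ?p * E (n - j) (hperp j f) - (if c \<le> n - j then E (n - j - c) (hperp j f) else 0)"
    unfolding E_def using j False by (intro less.IH symmetric_hperp f) auto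
   finally show "E (n - j) (hperp j (?p * f)) = ?p * E (n - j) (hperp j f) - (if c \<le> n - j then E (n - j - c) (hperp j f) else 0)
     + (if c \<le> j then E (n - j) (hperp (j - c) f) else 0)" .
  qed
  also have "... = ?p * (\<Sum>j\<in>{1..n}. E (n - j) (hperp j f)) - (\<Sum>j\<in>{1..n}. if c \<le> n - j then E (n - j - c) (hperp j f) else 0)
    + (\<Sum>j\<in>{1..n}. if c \<le> j then E (n - j) (hperp (j - c) f) else 0)"
   by (simp add: sum.distrib sum_subtractf sum_distrib_left)
  also have "(\<Sum>j\<in>{1..n}. if c \<le> n - j then E (n - j - c) (hperp j f) else 0)
    = (if c \<le> n then if n = c then 0 else - E (n - c) f else 0)"
  proof (cases "c \<le> n")
   case True
   have "(\<Sum>j\<in>{1..n}. if c \<le> n - j then E (n - j - c) (hperp j f) else 0) = (\<Sum>j\<in>{1..n - c}. E (n - c - j) (hperp j f))"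
    using True c by (intro sum.mono_neutral_cong_right) (auto simp: add.commute)
   then show ?thesis using True unfolding R' by auto
  next
   case False
   then show ?thesis by (intro trans[OF sum.neutral]) auto
  qed
  also have "(\<Sum>j\<in>{1..n}. if c \<le> j then E (n - j) (hperp (j - c) f) else 0) = (if c \<le> n then if n = c then f else 0 else 0)"
  proof (cases "c \<le> n")
   case True
   have "(\<Sum>j\<in>{1..n}. if c \<le> j then E (n - j) (hperp (j - c) f) else 0) = (\<Sum>j\<in>{c..n}. E (n - j) (hperp (j - c) f))"
    using c by (intro sum.mono_neutral_cong_right) auto
   also have "... = (\<Sum>j\<le>n - c. E (n - c - j) (hperp j f))"
    using True by (intro sum.reindex_bij_witness[where i = "\<lambda>j. j + c" and j = "\<lambda>j. j - c"]) auto
   finally show ?thesis using True unfolding R by auto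
  next
   case False
   then show ?thesis by (intro trans[OF sum.neutral]) auto
  qed
  also have "(\<Sum>j\<in>{1..n}. E (n - j) (hperp j f)) = - E n f" unfolding R' using False by simp
  finally show ?thesis unfolding 1[unfolded E_def] by (auto simp: E_def)
 qed
qed

lemma perp_power_sums:
 fixes ks :: "'i \<Rightarrow> nat"
 assumes "finite I" "\<And>i. i \<in> I \<Longrightarrow> ks i > 0"
 shows "symmetric_mps (\<Prod>i\<in>I. psum (ks i) :: 'a::comm_ring_1 mps)
  \<and> (\<forall>n. signed_eperp n (\<Prod>i\<in>I. psum (ks i) :: 'a mps) = coeff (\<Prod>i\<in>I. [:psum (ks i):] - monom 1 (ks i)) n)
  \<and> (\<forall>n. hperp n (\<Prod>i\<in>I. psum (ks i) :: 'a mps) = coeff (\<Prod>i\<in>I. [:psum (ks i):] + monom 1 (ks i)) n)"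
 using assms
proof (induction I rule: finite_induct)
 case empty
 have h: "hperp n (1 :: 'a mps) = (if n = 0 then 1 else 0)" for n
  using hperp_psum[of 1 n] by (intro mps_eqI) (auto simp: mcoeff_hperp one_mps.rep_eq zero_mps.rep_eq dest: arg_cong[where f = mdeg])
 have "signed_eperp n (1 :: 'a mps) = (if n = 0 then 1 else 0)" for n
 proof (cases n)
  case (Suc k)
  then show ?thesis by (simp add: signed_eperp_Suc h)
 qed simp
 then show ?case using h by (simp add: symmetric_one)
next
 case (insert i I)
 then have IH: "symmetric_mps (\<Prod>i\<in>I. psum (ks i) :: 'a mps)"
  "\<And>n. signed_eperp n (\<Prod>i\<in>I. psum (ks i) :: 'a mps) = coeff (\<Prod>i\<in>I. [:psum (ks i):] - monom 1 (ks i)) n"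
  "\<And>n. hperp n (\<Prod>i\<in>I. psum (ks i) :: 'a mps) = coeff (\<Prod>i\<in>I. [:psum (ks i):] + monom 1 (ks i)) n"
  by simp_all
 have c: "ks i > 0" using insert.prems by simp
 show ?case unfolding prod.insert[OF insert.hyps]
  by (intro conjI allI symmetric_times symmetric_psum IH(1))
   (simp_all add: signed_eperp_psum_times[OF c IH(1)] hperp_psum_times[OF c IH(1)] IH(2,3)
    left_diff_distrib distrib_right coeff_monom_mult)
qed

section \<open>The coefficients of the tau function\<close>

lemma lookup_z_inv: "finite X \<Longrightarrow> lookup (z_inv X) i = (if i \<in> X then 1 else 0)"
 by (simp add: z_inv_def lookup_sum' lookup_single when_def sum.delta)

lemma keys_z_inv: "finite X \<Longrightarrow> keys (z_inv X) = X"
 by (auto simp: in_keys_iff lookup_z_inv split: if_splits)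

lemma mcoeff_psum_partition_of_complex:
 "mcoeff (psum_partition \<mu> :: 'a::complex_algebra_1 mps) \<alpha> = of_complex (mcoeff (psum_partition \<mu>) \<alpha>)"
proof (induction \<mu> arbitrary: \<alpha>)
 case Nil
 show ?case by (simp add: psum_partition_def one_mps.rep_eq of_complex_1 of_complex_0)
next
 case (Cons k \<mu>)
 have p: "mcoeff (psum k :: 'a mps) \<alpha> = of_complex (mcoeff (psum k) \<alpha>)" for \<alpha>
  by (simp add: psum_def of_complex_1 of_complex_0)
 have e: "psum_partition (k # \<mu>) = psum k * psum_partition \<mu>" by (simp add: psum_partition_def)
 have e': "psum_partition (k # \<mu>) = (psum k * psum_partition \<mu> :: complex mps)" by (simp add: psum_partition_def)
 show ?case unfolding e e' mcoeff_times of_complex_sum by (intro sum.cong refl) (simp add: Cons.IH p of_complex_mult)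
qed

definition cycle_psum :: "nat set \<Rightarrow> nat perm \<Rightarrow> 'a::comm_ring_1 mps" where
 "cycle_psum X \<sigma> = (\<Prod>C\<in>orbit \<sigma> ` X. psum (card C))"

lemma psum_partition_cyc: "psum_partition (cyc (\<sigma>, X)) = (cycle_psum X \<sigma> :: 'a::comm_ring_1 mps)"
proof -
 let ?xs = "map psum (cyc (\<sigma>, X)) :: 'a mps list"
 have "psum_partition (cyc (\<sigma>, X)) = prod_mset (mset ?xs)"
  by (simp only: psum_partition_def prod_mset_prod_list)
 also have "mset ?xs = image_mset (\<lambda>C. psum (card C)) (mset_set (orbit \<sigma> ` X))"
  by (simp add: cyc_def mset_map multiset.map_comp comp_def)
 finally show ?thesis by (simp only: cycle_psum_def prod_unfold_prod_mset)
qed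

lemma mcoeff_tau_term:
 "mcoeff (mcoeff (tau_term (\<sigma>, X)) \<alpha>) m = (if m = z_inv X then single \<sigma> (mcoeff (cycle_psum X \<sigma> :: complex mps) \<alpha>) else 0)"
proof -
 have "mcoeff (mcoeff (tau_term (\<sigma>, X)) \<alpha>) m
   = mcoeff (mmonom (z_inv X) (single \<sigma> 1)) m * of_complex (mcoeff (cycle_psum X \<sigma> :: complex mps) \<alpha>)"
  unfolding tau_term_def prod.case mcoeff_mmonom_0_times mcoeff_psum_partition_of_complex
   of_complex_mps_def mcoeff_times_mmonom_0 psum_partition_cyc ..
 then show ?thesis by (simp add: mmonom_def of_complex_poly_mapping_def of_complex_complex_def mult_single)
qed

lemma supported_perms_iff: "(\<sigma>, X) \<in> supported_perms \<longleftrightarrow> finite X \<and> \<sigma> \<in> perms_on X"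
 using bij_apply[of \<sigma>] by (auto simp: supported_perms_def perms_on_def permutes_def in_affected bij_iff)

lemma mcoeff_tau_infinity:
 "mcoeff (mcoeff tau_infinity \<alpha>) m = (if m = z_inv (keys m)
   then on_perms (keys m) (\<lambda>\<sigma>. mcoeff (cycle_psum (keys m) \<sigma>) \<alpha>) else 0)"
proof -
 let ?X = "keys m" and ?c = "\<lambda>\<sigma>X. mcoeff (mcoeff (tau_term \<sigma>X) \<alpha>) m"
 let ?A = "{\<sigma>X. \<sigma>X \<in> supported_perms \<and> ?c \<sigma>X \<noteq> 0}"
 have A: "Y = ?X \<and> m = z_inv ?X" if "(\<sigma>, Y) \<in> ?A" for \<sigma> Y
 proof -
  have "finite Y" "m = z_inv Y" using that by (auto simp: supported_perms_iff mcoeff_tau_term split: if_splits)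
  then show ?thesis by (simp add: keys_z_inv)
 qed
 have "mcoeff (mcoeff tau_infinity \<alpha>) m = sum ?c ?A" by (simp add: tau_infinity_def)
 also have "... = (if m = z_inv ?X then on_perms ?X (\<lambda>\<sigma>. mcoeff (cycle_psum ?X \<sigma>) \<alpha>) else 0)"
 proof (cases "m = z_inv ?X")
  case True
  have "sum ?c ?A = sum ?c ((\<lambda>\<sigma>. (\<sigma>, ?X)) ` perms_on ?X)"
  proof (rule sum.mono_neutral_left)
   show "?A \<subseteq> (\<lambda>\<sigma>. (\<sigma>, ?X)) ` perms_on ?X"
   proof
    fix p assume p: "p \<in> ?A"
    obtain \<sigma> Y where [simp]: "p = (\<sigma>, Y)" by (cases p) auto
    have "Y = ?X" using A p by simp
    then show "p \<in> (\<lambda>\<sigma>. (\<sigma>, ?X)) ` perms_on ?X" using p by (auto simp: supported_perms_iff)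
   qed
   show "\<forall>p\<in>(\<lambda>\<sigma>. (\<sigma>, ?X)) ` perms_on ?X - ?A. ?c p = 0" by (auto simp: supported_perms_iff)
  qed simp
  also have "... = on_perms ?X (\<lambda>\<sigma>. mcoeff (cycle_psum ?X \<sigma>) \<alpha>)"
   using True by (subst sum.reindex) (auto simp: inj_on_def on_perms_def mcoeff_tau_term intro: sum.cong)
  finally show ?thesis using True by simp
 next
  case False
  then have E: "?A = {}" using A by auto
  show ?thesis unfolding E using False by simp
 qed
 finally show ?thesis .
qed

text \<open>The shape of all series that arise from \<open>\<tau>\<^sub>\<infinity>\<close>: squarefree monomials in the \<open>z\<^sub>i\<^sup>-\<^sup>1\<close>, with permutations
 supported on the variables present.\<close>

definition concentrated :: "perm_series \<Rightarrow> (nat set \<Rightarrow> nat perm \<Rightarrow> complex) \<Rightarrow> bool" where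
 "concentrated F f \<longleftrightarrow> (\<forall>m. mcoeff F m = (if m = z_inv (keys m) then on_perms (keys m) (f (keys m)) else 0))"

lemma concentratedD:
 assumes "concentrated F f"
 shows "mcoeff F m \<noteq> 0 \<Longrightarrow> z_inv (keys m) = m"
  "finite X \<Longrightarrow> mcoeff F (z_inv X) = on_perms X (f X)"
 using assms[unfolded concentrated_def, rule_format, of m] assms[unfolded concentrated_def, rule_format, of "z_inv X"]
 by (metis, simp add: keys_z_inv)

text \<open>A pair \<open>(X, Y)\<close> with \<open>z\<^sub>X\<^sup>-\<^sup>1 z\<^sub>Y\<^sup>-\<^sup>1 = m\<close> is determined by the set \<open>B = Y - D\<close>, which is an arbitrary
 subset of \<open>S\<close>.\<close>

lemma lookup_concentrated_product:
 fixes m :: monom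
 assumes F: "concentrated F f" and G: "concentrated G g"
 defines "S \<equiv> {i. lookup m i = 1}" and "D \<equiv> {i. lookup m i = 2}"
 shows "lookup (mcoeff (F * G) m) \<rho> = (if \<forall>i. lookup m i \<le> 2
  then \<Sum>(B, l, \<sigma>, \<pi>)\<in>assignments \<rho> S D (\<lambda>_. 0). f (S - B \<union> D) \<sigma> * g (B \<union> D) \<pi> else 0)"
proof -
 let ?P = "{(X, Y). finite X \<and> finite Y \<and> z_inv X + z_inv Y = m}"
 let ?Q = "\<lambda>X Y. {(\<sigma>, \<pi>). \<sigma> \<in> perms_on X \<and> \<pi> \<in> perms_on Y \<and> \<sigma> * \<pi> = \<rho>}"
 let ?z = "\<lambda>(X, Y). (z_inv X, z_inv Y)"
 have inj: "inj_on ?z ?P"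
 proof (rule inj_onI)
  fix p q assume p: "p \<in> ?P" and q: "q \<in> ?P" and e: "?z p = ?z q"
  obtain X Y X' Y' where pq: "p = (X, Y)" "q = (X', Y')" by (metis prod.exhaust)
  have "keys (z_inv X) = keys (z_inv X')" "keys (z_inv Y) = keys (z_inv Y')"
   using e unfolding pq by simp_all
  then show "p = q" using p q unfolding pq by (simp add: keys_z_inv)
 qed
 have zP: "?z ` ?P \<subseteq> splits m" by (auto simp: splits_def)
 have finP: "finite ?P" using finite_imageD[OF finite_subset[OF zP finite_splits] inj] .
 have finQ: "finite (?Q X Y)" if "finite X" "finite Y" for X Y
  using that by (intro finite_subset[of "?Q X Y" "perms_on X \<times> perms_on Y"]) auto
 have "mcoeff (F * G) m = (\<Sum>p\<in>?z ` ?P. mcoeff F (fst p) * mcoeff G (snd p))"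
  unfolding mcoeff_times
 proof (rule sum.mono_neutral_right[OF finite_splits zP], rule ballI, rule ccontr)
  fix p assume p: "p \<in> splits m - ?z ` ?P" and nz: "mcoeff F (fst p) * mcoeff G (snd p) \<noteq> 0"
  let ?X = "keys (fst p)" and ?Y = "keys (snd p)"
  have "mcoeff F (fst p) \<noteq> 0" "mcoeff G (snd p) \<noteq> 0" using nz by auto
  then have z: "z_inv ?X = fst p" "z_inv ?Y = snd p" using concentratedD(1) F G by blast+
  have "p = ?z (?X, ?Y)" by (simp add: z)
  moreover have "(?X, ?Y) \<in> ?P" using p by (simp add: z) (simp add: splits_def case_prod_unfold)
  ultimately show False using p by blast
 qed
 also have "... = (\<Sum>(X, Y)\<in>?P. on_perms X (f X) * on_perms Y (g Y))"
  unfolding sum.reindex[OF inj] using F G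
  by (intro sum.cong) (auto simp: concentratedD(2))
 finally have "lookup (mcoeff (F * G) m) \<rho> = (\<Sum>(X, Y)\<in>?P. \<Sum>(\<sigma>, \<pi>)\<in>?Q X Y. f X \<sigma> * g Y \<pi>)"
  unfolding lookup_sum' by (auto simp: lookup_sum' case_prod_unfold lookup_on_perms_product intro!: sum.cong)
 also have "... = (\<Sum>z\<in>(SIGMA p:?P. ?Q (fst p) (snd p)). f (fst (fst z)) (fst (snd z)) * g (snd (fst z)) (snd (snd z)))"
  using finP finQ by (simp add: case_prod_unfold) (subst sum.Sigma, auto simp: case_prod_unfold)
 finally have L: "lookup (mcoeff (F * G) m) \<rho> = ..." .
 have P: "(X, Y) \<in> ?P \<longleftrightarrow> finite X \<and> finite Y \<and> (\<forall>i. (if i \<in> X then 1 else 0) + (if i \<in> Y then 1 else 0) = lookup m i)" for X Y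
  by (simp add: poly_mapping_eq_iff fun_eq_iff lookup_add lookup_z_inv cong: conj_cong)
 show ?thesis
 proof (cases "\<forall>i. lookup m i \<le> 2")
  case True
  have fin: "finite S" "finite D"
   by (rule finite_subset[OF _ finite_keys[of m]], auto simp: S_def D_def in_keys_iff)+
  have PE: "X = S - (Y - D) \<union> D" "Y = (Y - D) \<union> D" "Y - D \<subseteq> S" if "(X, Y) \<in> ?P" for X Y
  proof -
   have e: "lookup m i = (if i \<in> X then 1 else 0) + (if i \<in> Y then 1 else 0)" for i
    using that unfolding P by simp
   have "D = X \<inter> Y" "S = (X - Y) \<union> (Y - X)" unfolding S_def D_def e by auto
   then show "X = S - (Y - D) \<union> D" "Y = (Y - D) \<union> D" "Y - D \<subseteq> S" by auto
  qed
  have PI: "(S - B \<union> D, B \<union> D) \<in> ?P" if "B \<subseteq> S" for B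
   unfolding P
  proof (intro conjI allI)
   fix i
   have "lookup m i = 0 \<or> lookup m i = 1 \<or> lookup m i = 2"
    using True[rule_format, of i] by linarith
   then show "(if i \<in> S - B \<union> D then 1 else 0) + (if i \<in> B \<union> D then 1 else 0) = lookup m i"
    using that by (auto simp: S_def D_def)
  qed (use fin that in \<open>auto intro: finite_subset\<close>)
  have "(\<Sum>z\<in>(SIGMA p:?P. ?Q (fst p) (snd p)). f (fst (fst z)) (fst (snd z)) * g (snd (fst z)) (snd (snd z)))
   = (\<Sum>(B, l, \<sigma>, \<pi>)\<in>assignments \<rho> S D (\<lambda>_. 0). f (S - B \<union> D) \<sigma> * g (B \<union> D) \<pi>)"
  proof (rule sum.reindex_bij_witness[where j = "\<lambda>((X, Y), (\<sigma>, \<pi>)). (Y - D, \<lambda>_. 0, \<sigma>, \<pi>)"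
     and i = "\<lambda>(B, l, \<sigma>, \<pi>). ((S - B \<union> D, B \<union> D), (\<sigma>, \<pi>))"], goal_cases)
   case (1 z)
   obtain X Y \<sigma> \<pi> where z: "z = ((X, Y), (\<sigma>, \<pi>))" by (metis prod.exhaust)
   have p: "(X, Y) \<in> ?P" using 1 unfolding z by simp
   show ?case unfolding z prod.case using PE(1,2)[OF p, symmetric] by simp
  next
   case (2 z)
   obtain X Y \<sigma> \<pi> where z: "z = ((X, Y), (\<sigma>, \<pi>))" by (metis prod.exhaust)
   have p: "(X, Y) \<in> ?P" and q: "affected \<sigma> \<subseteq> X" "affected \<pi> \<subseteq> Y" "\<sigma> * \<pi> = \<rho>" using 2 unfolding z by (auto simp: perms_on_def)
   show ?case unfolding z prod.case
   proof (rule assignmentsI)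
    show "affected \<sigma> \<subseteq> S - (Y - D) \<union> D" using q(1) PE(1)[OF p] by simp
    show "affected \<pi> \<subseteq> Y - D \<union> D" using q(2) PE(2)[OF p] by simp
   qed (use PE(3)[OF p] q(3) in auto)
  next
   case (3 t)
   obtain B l \<sigma> \<pi> where t: "t = (B, l, \<sigma>, \<pi>)" by (cases t) auto
   have m: "(B, l, \<sigma>, \<pi>) \<in> assignments \<rho> S D (\<lambda>_. 0)" using 3 unfolding t .
   have "l = (\<lambda>_. 0)" using assignmentsD(2)[OF m] by auto
   moreover have "B \<union> D - D = B" using assignmentsD(1)[OF m] by (auto simp: S_def D_def)
   ultimately show ?case unfolding t by simp
  next
   case (4 t)
   obtain B l \<sigma> \<pi> where t: "t = (B, l, \<sigma>, \<pi>)" by (cases t) auto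
   have m: "(B, l, \<sigma>, \<pi>) \<in> assignments \<rho> S D (\<lambda>_. 0)" using 4 unfolding t .
   show ?case unfolding t using PI[OF assignmentsD(1)[OF m]] assignmentsD(5-7)[OF m] by (simp add: perms_on_def)
  next
   case (5 z)
   obtain X Y \<sigma> \<pi> where z: "z = ((X, Y), (\<sigma>, \<pi>))" by (metis prod.exhaust)
   have p: "(X, Y) \<in> ?P" using 5 unfolding z by simp
   show ?case unfolding z using PE(1,2)[OF p] by simp
  qed
  then show ?thesis unfolding L using True by simp
 next
  case False
  have E: "?P = {}"
  proof (rule ccontr)
   assume "?P \<noteq> {}"
   then obtain X Y where p: "(X, Y) \<in> ?P" by auto
   have "lookup m i = (if i \<in> X then 1 else 0) + (if i \<in> Y then 1 else 0)" for i
    using p unfolding P by simp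
   then have "lookup m i \<le> 2" for i by simp
   then show False using False by simp
  qed
  show ?thesis unfolding L E if_not_P[OF False] by simp
 qed
qed

section \<open>Newton's identities\<close>

lemma mcoeff_psum_times:
 assumes j: "j > 0"
 shows "mcoeff (psum j * f) \<alpha> = (\<Sum>i | i \<in> keys \<alpha> \<and> j \<le> lookup \<alpha> i. mcoeff f (\<alpha> - single i j))"
proof -
 let ?A = "{i. i \<in> keys \<alpha> \<and> j \<le> lookup \<alpha> i}" and ?s = "\<lambda>i. (single i j, \<alpha> - single i j)"
 have inj: "inj_on ?s ?A"
 proof (rule inj_onI)
  fix a b assume "?s a = ?s b"
  then have "lookup (single a j) a = lookup (single b j) a" by simp
  then show "a = b" using j by (auto simp: lookup_single when_def split: if_splits)
 qed
 have "mcoeff (psum j * f) \<alpha> = (\<Sum>p\<in>?s ` ?A. mcoeff (psum j) (fst p) * mcoeff f (snd p))"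
  unfolding mcoeff_times
 proof (rule sum.mono_neutral_right)
  show "?s ` ?A \<subseteq> splits \<alpha>"
   by (auto simp: splits_def lookup_add lookup_minus lookup_single when_def intro!: poly_mapping_eqI)
  show "\<forall>p\<in>splits \<alpha> - ?s ` ?A. mcoeff (psum j) (fst p) * mcoeff f (snd p) = 0"
  proof (rule ballI, rule ccontr)
   fix p assume p: "p \<in> splits \<alpha> - ?s ` ?A" and "mcoeff (psum j) (fst p) * mcoeff f (snd p) \<noteq> 0"
   then obtain i where i: "fst p = single i j" by (auto simp: psum_def split: if_splits)
   have a: "\<alpha> = single i j + snd p" using p i by (auto simp: splits_def)
   have "i \<in> ?A" using j unfolding a by (simp add: in_keys_iff lookup_add)
   moreover have "p = ?s i" unfolding a by (simp add: prod_eq_iff i)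
   ultimately show False using p by blast
  qed
 qed simp
 also have "... = (\<Sum>i\<in>?A. mcoeff f (\<alpha> - single i j))"
  unfolding sum.reindex[OF inj] by (intro sum.cong) (auto simp: psum_def)
 finally show ?thesis .
qed

lemma mcoeff_of_nat_times: "mcoeff (of_nat n * f) \<alpha> = of_nat n * mcoeff f \<alpha>" for f :: "'a::ring_1 mps"
 by (induction n) (simp_all add: distrib_right plus_mps.rep_eq zero_mps.rep_eq)

text \<open>The coefficient of \<open>\<alpha>\<close> on the right counts the pairs of a variable \<open>i\<close> and \<open>1 \<le> j \<le> \<alpha>\<^sub>i\<close>.\<close>

lemma hsym_newton: "of_nat n * hsym n = (\<Sum>j=1..n. psum j * hsym (n - j) :: 'a::comm_ring_1 mps)"
proof (rule mps_eqI)
 fix \<alpha> :: monom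
 let ?A = "\<lambda>j. {i. i \<in> keys \<alpha> \<and> j \<le> lookup \<alpha> i}"
 have le: "lookup \<alpha> i \<le> mdeg \<alpha>" if "i \<in> keys \<alpha>" for i
  using that unfolding mdeg_def by (intro member_le_sum) simp_all
 have t: "mcoeff (psum j * hsym (n - j) :: 'a mps) \<alpha> = (if mdeg \<alpha> = n then of_nat (card (?A j)) else 0)" if "j \<in> {1..n}" for j
 proof -
  have "mcoeff (hsym (n - j) :: 'a mps) (\<alpha> - single i j) = (if mdeg \<alpha> = n then 1 else 0)" if i: "i \<in> ?A j" for i
  proof -
   have "\<alpha> = single i j + (\<alpha> - single i j)"
    using i by (intro poly_mapping_eqI) (auto simp: lookup_add lookup_minus lookup_single when_def)
   then have "mdeg \<alpha> = j + mdeg (\<alpha> - single i j)" by (metis mdeg_add mdeg_single)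
   then show ?thesis using \<open>j \<in> {1..n}\<close> by (auto simp: hsym_def)
  qed
  then show ?thesis using that by (simp add: mcoeff_psum_times)
 qed
 have "(\<Sum>j=1..n. mcoeff (psum j * hsym (n - j) :: 'a mps) \<alpha>) = (\<Sum>j=1..n. if mdeg \<alpha> = n then of_nat (card (?A j)) else 0)"
  by (rule sum.cong[OF refl t])
 then have "mcoeff (\<Sum>j=1..n. psum j * hsym (n - j) :: 'a mps) \<alpha> = (if mdeg \<alpha> = n then of_nat (\<Sum>j=1..n. card (?A j)) else 0)"
  unfolding mcoeff_sum by (simp only: if_distrib sum.neutral_const of_nat_sum) (simp del: of_nat_sum add: of_nat_sum[symmetric])
 also have "... = (if mdeg \<alpha> = n then of_nat n else 0)"
 proof (cases "mdeg \<alpha> = n")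
  case True
  have "(\<Sum>j=1..n. card (?A j)) = (\<Sum>j=1..n. \<Sum>i\<in>keys \<alpha>. if j \<le> lookup \<alpha> i then 1 else 0)"
   by (intro sum.cong refl) (simp add: sum.If_cases Int_def)
  also have "... = (\<Sum>i\<in>keys \<alpha>. \<Sum>j=1..n. if j \<le> lookup \<alpha> i then 1 else 0)" by (rule sum.swap)
  also have "... = (\<Sum>i\<in>keys \<alpha>. lookup \<alpha> i)"
  proof (rule sum.cong[OF refl])
   fix i assume "i \<in> keys \<alpha>"
   then have "{1..n} \<inter> {j. j \<le> lookup \<alpha> i} = {1..lookup \<alpha> i}" using le[of i] True by auto
   then show "(\<Sum>j=1..n. if j \<le> lookup \<alpha> i then 1 else 0) = lookup \<alpha> i"
    by (simp add: sum.If_cases)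
  qed
  finally have "(\<Sum>j=1..n. card (?A j)) = n" using True by (simp add: mdeg_def)
  then show ?thesis by simp
 qed simp
 finally show "mcoeff (of_nat n * hsym n) \<alpha> = mcoeff (\<Sum>j=1..n. psum j * hsym (n - j) :: 'a mps) \<alpha>"
  by (auto simp: mcoeff_of_nat_times hsym_def)
qed

lemma hsym_esym_inverse:
 "(\<Sum>i\<le>n. hsym i * ((-1) ^ (n - i) * esym (n - i))) = (if n = 0 then 1 else 0 :: 'a::comm_ring_1 mps)"
proof (cases "n = 0")
 case False
 have m: "mcoeff ((-1) ^ k * f) \<alpha> = (-1) ^ k * mcoeff f \<alpha>" for k and f :: "'a mps" and \<alpha>
  by (induction k) (simp_all add: mcoeff_minus)
 have s: "(-1) ^ (n - i) = ((-1) ^ n * (-1) ^ i :: 'a mps)" if "i \<le> n" for i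
 proof -
  have "(-1) ^ n = ((-1) ^ (n - i) * (-1) ^ i :: 'a mps)" using that by (simp add: power_add[symmetric])
  then show ?thesis by (simp add: mult.assoc power_mult_distrib[symmetric])
 qed
 have "(\<Sum>i\<le>n. hsym i * ((-1) ^ (n - i) * esym (n - i)) :: 'a mps) = (-1) ^ n * (\<Sum>i\<le>n. (-1) ^ i * (hsym i * esym (n - i)))"
  unfolding sum_distrib_left by (intro sum.cong refl) (simp add: s mult_ac)
 also have "(\<Sum>i\<le>n. (-1) ^ i * (hsym i * esym (n - i)) :: 'a mps) = 0"
  using False by (intro mps_eqI) (simp add: mcoeff_sum m hsym_esym_convolution zero_mps.rep_eq)
 finally show ?thesis using False by simp
qed (simp add: hsym_0 esym_0)

locale symmetric_embedding =
 fixes \<iota> :: "complex mps \<Rightarrow> 'k::comm_ring_1"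
 assumes iota_add: "\<iota> (f + g) = \<iota> f + \<iota> g" and iota_mult: "\<iota> (f * g) = \<iota> f * \<iota> g" and iota_1: "\<iota> 1 = 1"
begin

lemma iota_0: "\<iota> 0 = 0" using iota_add[of 0 0] by simp

lemma iota_minus: "\<iota> (- f) = - \<iota> f" using iota_add[of f "- f"] by (simp add: iota_0 add_eq_0_iff)

lemma iota_sum: "\<iota> (\<Sum>i\<in>I. f i) = (\<Sum>i\<in>I. \<iota> (f i))"
 by (induction I rule: infinite_finite_induct) (simp_all add: iota_0 iota_add)

lemma iota_prod: "\<iota> (\<Prod>i\<in>I. f i) = (\<Prod>i\<in>I. \<iota> (f i))"
 by (induction I rule: infinite_finite_induct) (simp_all add: iota_1 iota_mult)

lemma iota_of_nat: "\<iota> (of_nat n) = of_nat n"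
 by (induction n) (simp_all add: iota_0 iota_add iota_1)

lemma iota_sign: "\<iota> ((-1) ^ n) = (-1) ^ n"
 by (induction n) (simp_all add: iota_1 iota_minus)

definition "H_fps = Abs_fps (\<lambda>n. \<iota> (hsym n))"
definition "E_fps = Abs_fps (\<lambda>n. (-1) ^ n * \<iota> (esym n))"
definition "P_fps = Abs_fps (\<lambda>n. \<iota> (psum (Suc n)))"

lemma deriv_H_fps: "fps_deriv H_fps = P_fps * H_fps"
proof (rule fps_ext)
 fix n
 have "of_nat (Suc n) * \<iota> (hsym (Suc n)) = \<iota> (of_nat (Suc n) * hsym (Suc n))"
  by (simp only: iota_mult iota_of_nat)
 also have "... = (\<Sum>j=1..Suc n. \<iota> (psum j) * \<iota> (hsym (Suc n - j)))"
  by (simp only: hsym_newton iota_sum iota_mult)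
 also have "... = (\<Sum>i=0..n. \<iota> (psum (Suc i)) * \<iota> (hsym (n - i)))"
  by (rule sum.reindex_bij_witness[where i = Suc and j = "\<lambda>j. j - 1"]) auto
 finally show "fps_nth (fps_deriv H_fps) n = fps_nth (P_fps * H_fps) n"
  by (simp add: H_fps_def P_fps_def fps_mult_nth)
qed

lemma H_fps_E_fps: "H_fps * E_fps = 1"
proof (rule fps_ext)
 fix n
 have "fps_nth (H_fps * E_fps) n = (\<Sum>i\<le>n. \<iota> (hsym i * ((-1) ^ (n - i) * esym (n - i))))"
  by (simp add: H_fps_def E_fps_def fps_mult_nth atLeast0AtMost iota_mult iota_sign)
 also have "... = \<iota> (if n = 0 then 1 else 0)" unfolding iota_sum[symmetric] hsym_esym_inverse ..
 finally show "fps_nth (H_fps * E_fps) n = fps_nth 1 n" by (simp add: iota_0 iota_1)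
qed

text \<open>Differentiate \<open>H E = 1\<close>.\<close>

lemma deriv_E_fps: "fps_deriv E_fps = - P_fps * E_fps"
proof -
 have "P_fps + H_fps * fps_deriv E_fps = P_fps * (H_fps * E_fps) + H_fps * fps_deriv E_fps"
  by (simp add: H_fps_E_fps)
 also have "... = fps_deriv (H_fps * E_fps)" by (simp add: deriv_H_fps mult.assoc)
 also have "... = 0" by (simp add: H_fps_E_fps)
 finally have "(P_fps + H_fps * fps_deriv E_fps) * E_fps = 0" by simp
 then have "P_fps * E_fps + (H_fps * E_fps) * fps_deriv E_fps = 0" by (simp add: algebra_simps)
 then have "P_fps * E_fps + fps_deriv E_fps = 0" by (simp only: H_fps_E_fps mult_1)
 then show ?thesis by (simp add: add_eq_0_iff)
qed

end

section \<open>Two sets of variables\<close>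

text \<open>Series in \<open>x\<close> and \<open>y\<close> are series in \<open>y\<close> whose coefficients are series in \<open>x\<close>; \<open>inner\<close> and \<open>outer\<close>
 insert a series as one in \<open>x\<close> and in \<open>y\<close>.\<close>

definition inner :: "complex mps \<Rightarrow> complex mps mps" where "inner f = mmonom 0 f"
definition outer :: "complex mps \<Rightarrow> complex mps mps" where "outer g = Abs_mps (\<lambda>\<beta>. mmonom 0 (mcoeff g \<beta>))"

lemma mmonom_0_add: "mmonom 0 (a + b) = mmonom 0 a + mmonom 0 (b :: 'a::ring_1)"
 by (rule mps_eqI) (simp add: mmonom_def plus_mps.rep_eq)

lemma mmonom_0_mult: "mmonom 0 (a * b) = mmonom 0 a * mmonom 0 (b :: 'a::ring_1)"
 by (rule mps_eqI) (simp add: mcoeff_mmonom_0_times, simp add: mmonom_def)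

lemma mmonom_0_sum: "mmonom 0 (\<Sum>i\<in>I. a i) = (\<Sum>i\<in>I. mmonom 0 (a i :: 'a::ring_1))"
proof (induction I rule: infinite_finite_induct)
 case (insert x I)
 then show ?case by (simp add: mmonom_0_add)
qed (auto intro: mps_eqI simp: mmonom_def zero_mps.rep_eq)

lemma mmonom_0_one: "mmonom 0 (1 :: 'a::ring_1) = 1"
 by (rule mps_eqI) (simp add: mmonom_def one_mps.rep_eq)

interpretation inner: symmetric_embedding inner
 by unfold_locales (simp_all add: inner_def mmonom_0_add mmonom_0_mult mmonom_0_one)

interpretation outer: symmetric_embedding outer
proof unfold_locales
 show "outer (f + g) = outer f + outer g" for f g
  by (rule mps_eqI) (simp add: outer_def plus_mps.rep_eq mmonom_0_add)
 show "outer (f * g) = outer f * outer g" for f g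
  by (rule mps_eqI) (simp add: outer_def mcoeff_times mmonom_0_sum mmonom_0_mult)
 show "outer 1 = 1"
  by (rule mps_eqI, rule mps_eqI) (simp add: outer_def mmonom_def one_mps.rep_eq zero_mps.rep_eq)
qed

lemma mcoeff_inner_outer: "mcoeff (mcoeff (inner f * outer g) \<beta>) \<alpha> = mcoeff f \<alpha> * mcoeff g \<beta>"
 by (simp add: inner_def outer_def mcoeff_mmonom_0_times mcoeff_times_mmonom_0)

definition eta :: "nat \<Rightarrow> complex mps mps" where
 "eta n = fps_nth (inner.H_fps * outer.E_fps) n"

lemma eta_newton: "of_nat n * eta n = (\<Sum>j=1..n. (inner (psum j) - outer (psum j)) * eta (n - j))"
proof (cases n)
 case (Suc k)
 define N where "N = inner.H_fps * outer.E_fps"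
 have "fps_deriv N = (inner.P_fps - outer.P_fps) * N"
  unfolding N_def by (simp add: inner.deriv_H_fps outer.deriv_E_fps algebra_simps)
 from arg_cong[OF this, of "\<lambda>g. fps_nth g k"]
 have "of_nat (Suc k) * eta (Suc k) = (\<Sum>i=0..k. (inner (psum (Suc i)) - outer (psum (Suc i))) * eta (k - i))"
  by (simp add: eta_def N_def[symmetric] fps_mult_nth inner.P_fps_def outer.P_fps_def)
 also have "... = (\<Sum>j=1..Suc k. (inner (psum j) - outer (psum j)) * eta (Suc k - j))"
  by (rule sum.reindex_bij_witness[where j = Suc and i = "\<lambda>j. j - 1"]) auto
 finally show ?thesis using Suc by simp
qed simp

section \<open>The bilinear identity\<close>

lemma times_sign: "x * ((-1) ^ n * y) = (-1) ^ n * (x * y)" for x y :: "'a::ring_1"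
 by (induction n) (simp_all add: mult.assoc)

lemma additive_sign: "additive \<phi> \<Longrightarrow> \<phi> ((-1) ^ n * z) = (-1) ^ n * \<phi> z" for z :: "'a::ring_1" and \<phi> :: "'a \<Rightarrow> 'b::ring_1"
 by (induction n) (simp_all add: additive.minus mult.assoc)

definition multilinear :: "monom \<Rightarrow> bool" where
 "multilinear \<gamma> \<longleftrightarrow> (\<forall>i. lookup \<gamma> i \<le> 1)"

lemma mcoeff_genfun_hsym: "mcoeff (genfun hsym u) \<gamma> = u ^ mdeg \<gamma>"
proof -
 have "(\<Sum>k\<le>mdeg \<gamma>. fls_const (mcoeff (hsym k) \<gamma>) * u ^ k) = (\<Sum>k\<le>mdeg \<gamma>. if k = mdeg \<gamma> then u ^ k else 0)"
  by (intro sum.cong) (auto simp: hsym_def)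
 then show ?thesis by (simp add: genfun_def)
qed

lemma mcoeff_genfun_esym: "mcoeff (genfun esym u) \<gamma> = (if multilinear \<gamma> then u ^ mdeg \<gamma> else 0)"
proof -
 have "(\<Sum>k\<le>mdeg \<gamma>. fls_const (mcoeff (esym k) \<gamma>) * u ^ k) = (\<Sum>k\<le>mdeg \<gamma>. if k = mdeg \<gamma> then (if multilinear \<gamma> then u ^ k else 0) else 0)"
  by (intro sum.cong) (auto simp: esym_def multilinear_def)
 then show ?thesis by (simp add: genfun_def)
qed

text \<open>The coefficients of \<open>H(t)\<close> and \<open>E(-t)\<close> at a monomial are signed powers of \<open>t\<close> or zero; they only shift
 the exponent of \<open>s\<close> to be extracted.\<close>

lemma KP_coefficient:
 fixes \<tau> :: "'a::complex_algebra_1 mps"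
 assumes sym: "symmetric_mps \<tau>"
 shows "fls_nth (mcoeff (KP_B \<tau>) \<alpha> * mcoeff (KP_B_perp \<tau>) \<beta>) 1
  = (\<Sum>p\<in>splits \<alpha>. \<Sum>q\<in>splits \<beta>. if multilinear (fst q) then (-1) ^ mdeg (fst q) *
    (\<Sum>i\<le>Suc (mdeg (fst p) + mdeg (fst q)). ((-1) ^ i * mcoeff (eperp i \<tau>) (snd p)) * mcoeff (hperp (Suc (mdeg (fst p) + mdeg (fst q)) - i) \<tau>) (snd q)) else 0)"
proof -
 define F where "F \<delta> = Abs_fps (\<lambda>k. (-1) ^ k * mcoeff (eperp k \<tau>) \<delta>)" for \<delta>
 define G where "G \<delta> = Abs_fps (\<lambda>k. mcoeff (hperp k \<tau>) \<delta>)" for \<delta>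
 have pF: "mcoeff (perp_genfun esym (-1) \<tau>) \<delta> = fps_to_fls (F \<delta>)" for \<delta>
  by (simp add: perp_genfun_def F_def extend_scalars_perp_esym[OF sym])
 have pG: "mcoeff (perp_genfun hsym 1 \<tau>) \<delta> = fps_to_fls (G \<delta>)" for \<delta>
  by (simp add: perp_genfun_def G_def extend_scalars_perp_hsym[OF sym])
 have t: "fls_nth (fls_X_inv ^ g * fps_to_fls (F \<delta>) * ((- fls_X_inv) ^ h * fps_to_fls (G \<epsilon>))) 1
  = (-1) ^ h * (\<Sum>i\<le>Suc (g + h). fps_nth (F \<delta>) i * fps_nth (G \<epsilon>) (Suc (g + h) - i))" for g h \<delta> \<epsilon>
 proof -
  have "fls_X_inv ^ g * fps_to_fls (F \<delta>) * ((- fls_X_inv) ^ h * fps_to_fls (G \<epsilon>))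
   = (-1) ^ h * (fls_X_inv ^ g * fps_to_fls (F \<delta>) * (fls_X_inv ^ h * fps_to_fls (G \<epsilon>)))"
   by (subst power_minus) (simp only: mult.assoc times_sign)
  also have "fls_X_inv ^ g * fps_to_fls (F \<delta>) * (fls_X_inv ^ h * fps_to_fls (G \<epsilon>)) = fls_shift (int g + int h) (fps_to_fls (F \<delta> * G \<epsilon>))"
   by (simp only: fls_X_inv_power_times_conv_shift fls_times_both_shifted_simp fls_times_fps_to_fls)
  finally have "fls_nth (fls_X_inv ^ g * fps_to_fls (F \<delta>) * ((- fls_X_inv) ^ h * fps_to_fls (G \<epsilon>))) 1
   = (-1) ^ h * fls_nth (fls_shift (int g + int h) (fps_to_fls (F \<delta> * G \<epsilon>))) 1"
   by (simp only: additive_sign[where \<phi> = "\<lambda>f. fls_nth f 1"] additive_def fls_plus_nth simp_thms)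
  (* multiplication by t to the power g + h moves the coefficient at s to the index 1 + g + h *)
  also have "nat (1 + (int g + int h)) = Suc (g + h)" by simp
  then have "fls_nth (fls_shift (int g + int h) (fps_to_fls (F \<delta> * G \<epsilon>))) 1 = fps_nth (F \<delta> * G \<epsilon>) (Suc (g + h))"
   by simp
  finally show ?thesis by (simp only: fps_mult_nth atLeast0AtMost)
 qed
 have "mcoeff (KP_B \<tau>) \<alpha> * mcoeff (KP_B_perp \<tau>) \<beta> = (\<Sum>p\<in>splits \<alpha>. \<Sum>q\<in>splits \<beta>. if multilinear (fst q)
   then fls_X_inv ^ mdeg (fst p) * fps_to_fls (F (snd p)) * ((- fls_X_inv) ^ mdeg (fst q) * fps_to_fls (G (snd q))) else 0)"
  unfolding KP_B_def KP_B_perp_def mcoeff_times sum_product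
  by (intro sum.cong refl) (simp add: mcoeff_genfun_hsym mcoeff_genfun_esym pF pG)
 then have "fls_nth (mcoeff (KP_B \<tau>) \<alpha> * mcoeff (KP_B_perp \<tau>) \<beta>) 1 = (\<Sum>p\<in>splits \<alpha>. \<Sum>q\<in>splits \<beta>. if multilinear (fst q)
   then fls_nth (fls_X_inv ^ mdeg (fst p) * fps_to_fls (F (snd p)) * ((- fls_X_inv) ^ mdeg (fst q) * fps_to_fls (G (snd q)))) 1 else 0)"
  by (simp only: fls_nth_sum if_distrib[of "\<lambda>f. fls_nth f 1"] fls_zero_nth)
 then show ?thesis unfolding t by (simp only: F_def G_def fps_nth_Abs_fps)
qed

text \<open>The recursion for \<open>eperp\<close> involves only sums and signs, so it commutes with any additive map of the
 coefficients. This reduces the action on \<open>\<tau>\<^sub>\<infinity>\<close> to products of power sums over the complex numbers.\<close>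

lemma eperp_coefficientwise:
 fixes f :: "'a::ring_1 mps" and \<phi> :: "'a \<Rightarrow> complex"
 assumes "additive \<phi>"
 shows "\<phi> (mcoeff (eperp k f) \<alpha>) = mcoeff (eperp k (Abs_mps (\<lambda>\<alpha>. \<phi> (mcoeff f \<alpha>)))) \<alpha>"
proof (induction k arbitrary: f \<alpha> rule: less_induct)
 case (less k)
 show ?case
 proof (cases k)
  case (Suc k')
  have h: "hperp j (Abs_mps (\<lambda>\<alpha>. \<phi> (mcoeff f \<alpha>))) = Abs_mps (\<lambda>\<alpha>. \<phi> (mcoeff (hperp j f) \<alpha>))" for j
   by (rule mps_eqI) (simp add: mcoeff_hperp)
  have "\<phi> (mcoeff (eperp k f) \<alpha>) = (\<Sum>i\<le>k'. (-1) ^ i * \<phi> (mcoeff (eperp (k' - i) (hperp (Suc i) f)) \<alpha>))"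
   using Suc by (simp add: additive.sum[OF assms] additive_sign[OF assms])
  also have "... = (\<Sum>i\<le>k'. (-1) ^ i * mcoeff (eperp (k' - i) (hperp (Suc i) (Abs_mps (\<lambda>\<alpha>. \<phi> (mcoeff f \<alpha>))))) \<alpha>)"
   unfolding h using Suc by (intro sum.cong refl arg_cong2[where f = "(*)"] less.IH) simp
  finally show ?thesis using Suc by simp
 qed simp
qed

abbreviation coefficient :: "monom \<Rightarrow> nat perm \<Rightarrow> perm_series \<Rightarrow> complex" where
 "coefficient m \<rho> z \<equiv> lookup (mcoeff z m) \<rho>"

lemma additive_coefficient: "additive (coefficient m \<rho>)"
 by (simp add: additive_def plus_mps.rep_eq lookup_add)

lemma coefficient_tau: "coefficient m \<rho> (mcoeff tau_infinity \<alpha>)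
  = (if m = z_inv (keys m) \<and> \<rho> \<in> perms_on (keys m) then mcoeff (cycle_psum (keys m) \<rho>) \<alpha> else 0)"
 by (simp add: mcoeff_tau_infinity lookup_on_perms)

lemma concentratedI:
 assumes "\<And>m \<rho>. coefficient m \<rho> F = (if m = z_inv (keys m) \<and> \<rho> \<in> perms_on (keys m) then f (keys m) \<rho> else 0)"
 shows "concentrated F f"
 unfolding concentrated_def by (intro allI poly_mapping_eqI) (simp add: assms lookup_on_perms)

lemma concentrated_tau: "concentrated (mcoeff tau_infinity \<alpha>) (\<lambda>X \<sigma>. mcoeff (cycle_psum X \<sigma>) \<alpha>)"
 by (rule concentratedI) (rule coefficient_tau)

lemma concentrated_hperp_tau: "concentrated (mcoeff (hperp k tau_infinity) \<alpha>) (\<lambda>X \<sigma>. mcoeff (hperp k (cycle_psum X \<sigma>)) \<alpha>)"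
 unfolding mcoeff_hperp by (rule concentrated_tau)

lemma concentrated_eperp_tau:
 "concentrated ((-1) ^ k * mcoeff (eperp k tau_infinity) \<alpha>) (\<lambda>X \<sigma>. mcoeff (signed_eperp k (cycle_psum X \<sigma>)) \<alpha>)"
proof (rule concentratedI)
 fix m :: monom and \<rho>
 let ?X = "keys m"
 have z: "mcoeff (eperp k (0 :: complex mps)) \<alpha> = 0" using eperp_additive[of k "0 :: complex mps" 0 \<alpha>] by simp
 have A: "Abs_mps (\<lambda>\<alpha>. coefficient m \<rho> (mcoeff tau_infinity \<alpha>)) = (if m = z_inv ?X \<and> \<rho> \<in> perms_on ?X then cycle_psum ?X \<rho> else 0)"
  by (rule mps_eqI) (simp only: mcoeff_Abs_mps coefficient_tau if_distrib[of mcoeff] if_distribR zero_mps.rep_eq)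
 show "coefficient m \<rho> ((-1) ^ k * mcoeff (eperp k tau_infinity) \<alpha>)
  = (if m = z_inv ?X \<and> \<rho> \<in> perms_on ?X then mcoeff (signed_eperp k (cycle_psum ?X \<rho>)) \<alpha> else 0)"
  unfolding additive_sign[OF additive_coefficient] eperp_coefficientwise[OF additive_coefficient] A
 proof (cases "m = z_inv ?X \<and> \<rho> \<in> perms_on ?X")
  case True
  show "(-1) ^ k * mcoeff (eperp k (if m = z_inv ?X \<and> \<rho> \<in> perms_on ?X then cycle_psum ?X \<rho> else 0)) \<alpha>
   = (if m = z_inv ?X \<and> \<rho> \<in> perms_on ?X then mcoeff (signed_eperp k (cycle_psum ?X \<rho>)) \<alpha> else 0)"
   unfolding if_P[OF True] by (simp only: signed_eperp_def mcoeff_Abs_mps)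
 next
  case False
  show "(-1) ^ k * mcoeff (eperp k (if m = z_inv ?X \<and> \<rho> \<in> perms_on ?X then cycle_psum ?X \<rho> else (0 :: complex mps))) \<alpha>
   = (if m = z_inv ?X \<and> \<rho> \<in> perms_on ?X then mcoeff (signed_eperp k (cycle_psum ?X \<rho>)) \<alpha> else 0)"
   unfolding if_not_P[OF False] by (simp only: z mult_zero_right)
 qed
qed

lemma (in symmetric_embedding) coeff_prod_embed:
 assumes "finite I"
 shows "coeff (\<Prod>i\<in>I. [:\<iota> (f i):] + monom (\<iota> e) (k i)) n = \<iota> (coeff (\<Prod>i\<in>I. [:f i:] + monom e (k i)) n)"
 using assms
proof (induction I arbitrary: n rule: finite_induct)
 case empty
 show ?case by (simp add: iota_0 iota_1)
next
 case (insert i I)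
 show ?case unfolding prod.insert[OF insert.hyps]
  by (simp add: distrib_right coeff_monom_mult insert.IH iota_add iota_mult iota_0)
qed

lemma minus_monom_one: "p - monom 1 k = p + monom (-1) k" for p :: "'a::comm_ring_1 poly"
 by (simp add: minus_monom[symmetric])

lemma cycle_psum_perps:
 assumes "finite X"
 shows "symmetric_mps (cycle_psum X \<sigma> :: 'a::comm_ring_1 mps)"
  "signed_eperp n (cycle_psum X \<sigma>) = coeff (\<Prod>C\<in>orbit \<sigma> ` X. [:psum (card C) :: 'a mps:] + monom (-1) (card C)) n"
  "hperp n (cycle_psum X \<sigma>) = coeff (\<Prod>C\<in>orbit \<sigma> ` X. [:psum (card C) :: 'a mps:] + monom 1 (card C)) n"
proof -
 have "card C > 0" if "C \<in> orbit \<sigma> ` X" for C using that by (auto simp: card_gt_0_iff)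
 note P = perp_power_sums[of "orbit \<sigma> ` X" card, OF finite_imageI[OF assms] this, unfolded minus_monom_one, folded cycle_psum_def]
 show "symmetric_mps (cycle_psum X \<sigma> :: 'a mps)"
  "signed_eperp n (cycle_psum X \<sigma>) = coeff (\<Prod>C\<in>orbit \<sigma> ` X. [:psum (card C) :: 'a mps:] + monom (-1) (card C)) n"
  "hperp n (cycle_psum X \<sigma>) = coeff (\<Prod>C\<in>orbit \<sigma> ` X. [:psum (card C) :: 'a mps:] + monom 1 (card C)) n"
  using P by blast+
qed

lemma symmetric_tau_infinity: "symmetric_mps tau_infinity"
 unfolding symmetric_mps_def
proof (intro allI impI)
 fix \<pi> :: "nat \<Rightarrow> nat" and \<alpha> :: monom assume b: "bij \<pi>"
 show "mcoeff tau_infinity (map_key \<pi> \<alpha>) = mcoeff tau_infinity \<alpha>"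
 proof (rule mps_eqI, rule poly_mapping_eqI)
  fix m :: monom and \<rho>
  have "mcoeff (cycle_psum (keys m) \<rho> :: complex mps) (map_key \<pi> \<alpha>) = mcoeff (cycle_psum (keys m) \<rho>) \<alpha>"
   using cycle_psum_perps(1)[of "keys m" \<rho>, where 'a = complex] b by (simp add: symmetric_mps_def)
  then show "coefficient m \<rho> (mcoeff tau_infinity (map_key \<pi> \<alpha>)) = coefficient m \<rho> (mcoeff tau_infinity \<alpha>)"
   by (simp only: coefficient_tau)
 qed
qed

abbreviation xy_coeff :: "monom \<Rightarrow> monom \<Rightarrow> complex mps mps \<Rightarrow> complex" where
 "xy_coeff \<alpha> \<beta> g \<equiv> mcoeff (mcoeff g \<beta>) \<alpha>"

lemma mcoeff_outer_inner: "xy_coeff \<alpha> \<beta> (outer g * inner f) = mcoeff f \<alpha> * mcoeff g \<beta>"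
 by (subst mult.commute) (rule mcoeff_inner_outer)

lemma additive_xy_coeff: "additive (xy_coeff \<alpha> \<beta>)"
 by (simp add: additive_def plus_mps.rep_eq)

lemma xy_coeff_scalar: "xy_coeff \<alpha> \<beta> (of_complex z * g) = z * xy_coeff \<alpha> \<beta> g"
 by (simp add: of_complex_mps_def of_complex_complex_def mcoeff_mmonom_0_times)

interpretation emb: scalar_embedding "of_complex :: complex \<Rightarrow> complex mps mps"
 by unfold_locales (rule of_complex_add of_complex_mult of_complex_1)+

lemma sum_swap_pair: "(\<Sum>i\<in>I. \<Sum>p\<in>P. \<Sum>q\<in>Q. h i p q) = (\<Sum>p\<in>P. \<Sum>q\<in>Q. \<Sum>i\<in>I. h i p q)"
 by (subst sum.swap, intro sum.cong refl, rule sum.swap)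

text \<open>The coefficients \<open>h\<^sub>r(x)\<close> and \<open>(-1)\<^sup>s e\<^sub>s(y)\<close> of \<open>\<eta>\<close> reproduce the sums over the splittings of \<open>\<alpha>\<close> and \<open>\<beta>\<close> in
 \<open>KP_coefficient\<close>: the splitting fixes \<open>r\<close> and \<open>s\<close>, hence the index of \<open>\<eta>\<close>.\<close>

lemma xy_coeff_resid:
 fixes A B :: "complex mps mps poly"
 assumes A: "\<And>i. coeff A i = inner (a i)" and B: "\<And>j. coeff B j = outer (b j)"
 shows "xy_coeff \<alpha> \<beta> (emb.resid eta (A * B)) = (\<Sum>p\<in>splits \<alpha>. \<Sum>q\<in>splits \<beta>. if multilinear (fst q) then (-1) ^ mdeg (fst q) *
   (\<Sum>i\<le>Suc (mdeg (fst p) + mdeg (fst q)). mcoeff (a i) (snd p) * mcoeff (b (Suc (mdeg (fst p) + mdeg (fst q)) - i)) (snd q)) else 0)"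
proof -
 (* large enough for every term of the product and for every splitting of the two monomials *)
 let ?M = "degree (A * B) + mdeg \<alpha> + mdeg \<beta>"
 let ?u = "\<lambda>k i p q. mcoeff (a i) (snd p) * mcoeff (b (Suc k - i)) (snd q)"
 let ?w = "\<lambda>k r p q. mdeg (fst p) = r \<and> mdeg (fst q) = k - r \<and> multilinear (fst q)"
 note sum_xy = additive.sum[OF additive_xy_coeff]
 have t: "xy_coeff \<alpha> \<beta> (inner (a i) * outer (b (Suc k - i)) * (inner (hsym r) * ((-1) ^ (k - r) * outer (esym (k - r)))))
   = (\<Sum>p\<in>splits \<alpha>. \<Sum>q\<in>splits \<beta>. if ?w k r p q then (-1) ^ (k - r) * ?u k i p q else 0)" for k i r
 proof -
  have "inner (a i) * outer (b (Suc k - i)) * (inner (hsym r) * ((-1) ^ (k - r) * outer (esym (k - r))))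
    = inner (hsym r * a i) * outer ((-1) ^ (k - r) * (esym (k - r) * b (Suc k - i)))"
   by (simp add: inner.iota_mult outer.iota_mult outer.iota_sign mult_ac)
  then have "xy_coeff \<alpha> \<beta> (inner (a i) * outer (b (Suc k - i)) * (inner (hsym r) * ((-1) ^ (k - r) * outer (esym (k - r)))))
    = mcoeff (hsym r * a i) \<alpha> * ((-1) ^ (k - r) * mcoeff (esym (k - r) * b (Suc k - i)) \<beta>)"
   by (simp only: mcoeff_inner_outer mcoeff_signed)
  also have "... = (\<Sum>p\<in>splits \<alpha>. \<Sum>q\<in>splits \<beta>. if ?w k r p q then (-1) ^ (k - r) * ?u k i p q else 0)"
   unfolding mcoeff_times sum_distrib_left[of "(-1) ^ (k - r)"] sum_product
   by (intro sum.cong refl) (auto simp: hsym_def esym_def multilinear_def)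
  finally show ?thesis .
 qed
 have "emb.resid eta (A * B) = (\<Sum>k\<le>?M. coeff (A * B) (Suc k) * eta k)"
  by (rule emb.resid_bound) simp
 also have "... = (\<Sum>k\<le>?M. \<Sum>i\<le>Suc k. \<Sum>r\<le>k. inner (a i) * outer (b (Suc k - i)) * (inner (hsym r) * ((-1) ^ (k - r) * outer (esym (k - r)))))"
  unfolding coeff_mult eta_def fps_mult_nth inner.H_fps_def outer.E_fps_def A B
  by (intro sum.cong refl) (simp only: fps_nth_Abs_fps sum_product atLeast0AtMost)
 finally have "xy_coeff \<alpha> \<beta> (emb.resid eta (A * B))
  = (\<Sum>k\<le>?M. \<Sum>i\<le>Suc k. \<Sum>r\<le>k. \<Sum>p\<in>splits \<alpha>. \<Sum>q\<in>splits \<beta>. if ?w k r p q then (-1) ^ (k - r) * ?u k i p q else 0)"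
  by (simp only: sum_xy t)
 also have "... = (\<Sum>p\<in>splits \<alpha>. \<Sum>q\<in>splits \<beta>. \<Sum>k\<le>?M. \<Sum>r\<le>k. \<Sum>i\<le>Suc k. if ?w k r p q then (-1) ^ (k - r) * ?u k i p q else 0)"
 proof -
  have "(\<Sum>k\<le>?M. \<Sum>i\<le>Suc k. \<Sum>r\<le>k. \<Sum>p\<in>splits \<alpha>. \<Sum>q\<in>splits \<beta>. g k r i p q)
    = (\<Sum>p\<in>splits \<alpha>. \<Sum>q\<in>splits \<beta>. \<Sum>k\<le>?M. \<Sum>r\<le>k. \<Sum>i\<le>Suc k. g k r i p q)" for g :: "nat \<Rightarrow> nat \<Rightarrow> nat \<Rightarrow> monom \<times> monom \<Rightarrow> monom \<times> monom \<Rightarrow> complex"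
  proof -
   have 1: "(\<Sum>i\<le>Suc k. \<Sum>r\<le>k. \<Sum>p\<in>splits \<alpha>. \<Sum>q\<in>splits \<beta>. g k r i p q)
    = (\<Sum>p\<in>splits \<alpha>. \<Sum>q\<in>splits \<beta>. \<Sum>r\<le>k. \<Sum>i\<le>Suc k. g k r i p q)" for k
   proof -
    have "(\<Sum>i\<le>Suc k. \<Sum>r\<le>k. \<Sum>p\<in>splits \<alpha>. \<Sum>q\<in>splits \<beta>. g k r i p q)
     = (\<Sum>r\<le>k. \<Sum>i\<le>Suc k. \<Sum>p\<in>splits \<alpha>. \<Sum>q\<in>splits \<beta>. g k r i p q)"
     by (rule sum.swap)
    also have "... = (\<Sum>r\<le>k. \<Sum>p\<in>splits \<alpha>. \<Sum>q\<in>splits \<beta>. \<Sum>i\<le>Suc k. g k r i p q)"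
     by (rule sum.cong[OF refl]) (rule sum_swap_pair)
    also have "... = (\<Sum>p\<in>splits \<alpha>. \<Sum>q\<in>splits \<beta>. \<Sum>r\<le>k. \<Sum>i\<le>Suc k. g k r i p q)"
     by (rule sum_swap_pair)
    finally show ?thesis .
   qed
   show ?thesis unfolding 1 by (rule sum_swap_pair)
  qed
  then show ?thesis .
 qed
 also have "... = (\<Sum>p\<in>splits \<alpha>. \<Sum>q\<in>splits \<beta>. if multilinear (fst q) then (-1) ^ mdeg (fst q) *
   (\<Sum>i\<le>Suc (mdeg (fst p) + mdeg (fst q)). ?u (mdeg (fst p) + mdeg (fst q)) i p q) else 0)"
 proof (intro sum.cong refl)
  fix p q assume p: "p \<in> splits \<alpha>" and q: "q \<in> splits \<beta>"
  let ?g = "mdeg (fst p)" and ?h = "mdeg (fst q)"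
  have "mdeg \<alpha> = ?g + mdeg (snd p)" "mdeg \<beta> = ?h + mdeg (snd q)" using p q by (auto simp: splits_def)
  then have le: "?g + ?h \<le> ?M" by simp
  let ?c = "\<lambda>k. if multilinear (fst q) then (-1) ^ ?h * (\<Sum>i\<le>Suc k. ?u k i p q) else 0"
  have "(\<Sum>r\<le>k. \<Sum>i\<le>Suc k. if ?w k r p q then (-1) ^ (k - r) * ?u k i p q else 0) = (if k = ?g + ?h then ?c k else 0)" for k
  proof -
   have "(\<Sum>r\<le>k. \<Sum>i\<le>Suc k. if ?w k r p q then (-1) ^ (k - r) * ?u k i p q else 0)
    = (\<Sum>r\<le>k. if r = ?g then (if k = ?g + ?h then ?c k else 0) else 0)"
   proof (rule sum.cong[OF refl])
    fix r assume r: "r \<in> {..k}"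
    have "?w k r p q \<longleftrightarrow> r = ?g \<and> k = ?g + ?h \<and> multilinear (fst q)" using r by auto
    then show "(\<Sum>i\<le>Suc k. if ?w k r p q then (-1) ^ (k - r) * ?u k i p q else 0) = (if r = ?g then (if k = ?g + ?h then ?c k else 0) else 0)"
     by (cases "?w k r p q") (simp_all only: if_True if_False sum_distrib_left sum.neutral_const, auto)
   qed
   then show ?thesis by simp
  qed
  then have "(\<Sum>k\<le>?M. \<Sum>r\<le>k. \<Sum>i\<le>Suc k. if ?w k r p q then (-1) ^ (k - r) * ?u k i p q else 0) = (\<Sum>k\<le>?M. if k = ?g + ?h then ?c k else 0)"
   by (intro sum.cong refl)
  also have "... = ?c (?g + ?h)" using le by (simp only: sum.delta finite_atMost atMost_iff if_True)
  finally show "(\<Sum>k\<le>?M. \<Sum>r\<le>k. \<Sum>i\<le>Suc k. if ?w k r p q then (-1) ^ (k - r) * ?u k i p q else 0) = ?c (?g + ?h)" .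
 qed
 finally show ?thesis .
qed

text \<open>A commuting set lies in its own commutant, so its bicommutant lies in the commutant too and commutes
 with itself.\<close>

lemma bicommutant_commutative_subalgebra:
 fixes Z :: "'a::complex_algebra_1 set"
 assumes "\<And>x y. x \<in> Z \<Longrightarrow> y \<in> Z \<Longrightarrow> x * y = y * x"
 defines "R \<equiv> {x. \<forall>y. (\<forall>z\<in>Z. y * z = z * y) \<longrightarrow> x * y = y * x}"
 shows "commutative_subalgebra R" "Z \<subseteq> R"
proof -
 show Z: "Z \<subseteq> R" unfolding R_def by auto
 have comm: "a * b = b * a" if "a \<in> R" "b \<in> R" for a b
 proof -
  have "\<forall>z\<in>Z. b * z = z * b" using that(2) assms(1) unfolding R_def by blast
  then show ?thesis using that(1) unfolding R_def by blast
 qed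
 have "a * b \<in> R" if "a \<in> R" "b \<in> R" for a b
  unfolding R_def
 proof (intro CollectI allI impI)
  fix y assume y: "\<forall>z\<in>Z. y * z = z * y"
  then have "a * y = y * a" "b * y = y * b" using that unfolding R_def by blast+
  then show "a * b * y = y * (a * b)" by (metis mult.assoc)
 qed
 moreover have "a + b \<in> R" if "a \<in> R" "b \<in> R" for a b
  using that unfolding R_def by (simp add: distrib_left distrib_right)
 moreover have "range of_complex \<subseteq> R" unfolding R_def by (auto simp: of_complex_commute)
 ultimately show "commutative_subalgebra R" using comm unfolding commutative_subalgebra_def by blast
qed

section \<open>The tau function\<close>

lemma cycle_product_zero: "cycle_product b X \<sigma> (\<lambda>_. 0) = (\<Prod>C\<in>orbit \<sigma> ` X. b (card C))"
 by (simp add: cycle_product_def)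

lemma assignment_weight_zero:
 assumes "(B, l, \<sigma>, \<pi>) \<in> assignments \<rho> S D (\<lambda>_. 0)"
 shows "assignment_weight a b \<rho> S D (\<lambda>_. 0) (B, l, \<sigma>, \<pi>) = cycle_product a (S - B \<union> D) \<sigma> (\<lambda>_. 0) * cycle_product b (B \<union> D) \<pi> (\<lambda>_. 0)"
proof -
 have "l = (\<lambda>_. 0)" using assignmentsD(2)[OF assms] by auto
 then show ?thesis by (simp add: assignment_weight_def)
qed

abbreviation kp_a :: "nat \<Rightarrow> complex mps mps poly" where "kp_a \<equiv> \<lambda>k. [:inner (psum k):] - monom 1 k"
abbreviation kp_b :: "nat \<Rightarrow> complex mps mps poly" where "kp_b \<equiv> \<lambda>k. [:outer (psum k):] + monom 1 k"

lemma coeff_cycle_product_a: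
 assumes "finite X"
 shows "coeff (cycle_product kp_a X \<sigma> (\<lambda>_. 0)) i = inner (signed_eperp i (cycle_psum X \<sigma>))"
proof -
 have m: "(-1 :: complex mps mps) = inner (-1)" by (simp add: inner.iota_minus inner.iota_1)
 show ?thesis
  unfolding cycle_product_zero minus_monom_one cycle_psum_perps(2)[OF assms] m
  by (rule inner.coeff_prod_embed) (simp add: assms)
qed

lemma coeff_cycle_product_b:
 assumes "finite X"
 shows "coeff (cycle_product kp_b X \<sigma> (\<lambda>_. 0)) j = outer (hperp j (cycle_psum X \<sigma>))"
proof -
 have m: "monom (1 :: complex mps mps) k = monom (outer 1) k" for k by (simp add: outer.iota_1)
 show ?thesis
  unfolding cycle_product_zero cycle_psum_perps(3)[OF assms] m
  by (rule outer.coeff_prod_embed) (simp add: assms)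
qed

text \<open>The factors \<open>a\<^sub>k + b\<^sub>k = p\<^sub>k(x) + p\<^sub>k(y)\<close> split off by the reduction are free of \<open>s\<close>, so they pass through the
 residue functional.\<close>

lemma mixed_sum_residue:
 assumes fin: "finite S" "finite D" "S \<inter> D = {}"
 shows "xy_coeff \<alpha> \<beta> (emb.resid eta (mixed_sum kp_a kp_b \<rho> S D (\<lambda>_. 0))) = 0"
proof -
 let ?a = "\<lambda>k. [:inner (psum k):] - monom 1 k :: complex mps mps poly"
 let ?b = "\<lambda>k. [:outer (psum k):] + monom 1 k :: complex mps mps poly"
 consider (zero) "mixed_sum ?a ?b \<rho> S D (\<lambda>_. 0) = 0"
  | (pair) ks \<rho>' m where "\<forall>i. i \<notin> D \<longrightarrow> m i = 0"
   "mixed_sum ?a ?b \<rho> S D (\<lambda>_. 0) = (\<Prod>k\<leftarrow>ks. ?a k + ?b k) * pair_sum ?b ?a \<rho>' D m"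
  using mixed_sum_reduction[OF fin, of "\<lambda>_. 0" \<rho>, where 'v = "complex mps mps poly"] by blast
 then show ?thesis
 proof cases
  case zero
  then show ?thesis by (simp add: emb.resid_def zero_mps.rep_eq)
 next
  case pair
  have ab: "?a k + ?b k = [:inner (psum k) + outer (psum k):]" for k by simp
  have "\<exists>z. (\<Prod>k\<leftarrow>ks. ?a k + ?b k) = [:z:]" unfolding ab
  proof (induction ks)
   case Nil
   show ?case by (rule exI[of _ 1]) simp
  next
   case (Cons k ks)
   then obtain z where z: "(\<Prod>k\<leftarrow>ks. [:inner (psum k) + outer (psum k):]) = [:z:]" by blast
   show ?case by (rule exI[of _ "(inner (psum k) + outer (psum k)) * z"]) (simp only: list.map prod_list.Cons z, simp)
  qed
  then obtain z where z: "(\<Prod>k\<leftarrow>ks. ?a k + ?b k) = [:z:]" by blast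
  have "(\<lambda>g. xy_coeff \<alpha> \<beta> (z * g)) (emb.resid eta (pair_sum ?b ?a \<rho>' D m)) = 0"
  proof (rule emb.pair_sum_residue[where P = "\<lambda>k. inner (psum k)" and Q = "\<lambda>k. outer (psum k)" and n = "sum m D"])
   show "additive (\<lambda>g. xy_coeff \<alpha> \<beta> (z * g))"
    using additive_xy_coeff by (simp add: additive_def distrib_left)
   show "xy_coeff \<alpha> \<beta> (z * (of_complex c * g)) = c * xy_coeff \<alpha> \<beta> (z * g)" for c g
    by (simp only: mult.left_commute[of z] xy_coeff_scalar)
   show "m \<in> exponents D (sum m D)" using pair(1) by (simp add: exponents_def)
  qed (use fin eta_newton in auto)
  then show ?thesis unfolding pair(2) z emb.resid_const_mult .
 qed
qed

lemma KP_coefficient_tau_zero: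
 "coefficient m \<rho> (fls_nth (mcoeff (KP_B tau_infinity) \<alpha> * mcoeff (KP_B_perp tau_infinity) \<beta>) 1) = 0"
proof -
 define S where "S = {i. lookup m i = 1}"
 define D where "D = {i. lookup m i = 2}"
 let ?T = "assignments \<rho> S D (\<lambda>_. 0)"
 define a where "a t i = (signed_eperp i (cycle_psum (S - fst t \<union> D) (fst (snd (snd t)))) :: complex mps)"
  for t :: "nat set \<times> (nat \<Rightarrow> nat) \<times> nat perm \<times> nat perm" and i
 define b where "b t j = (hperp j (cycle_psum (fst t \<union> D) (snd (snd (snd t)))) :: complex mps)"
  for t :: "nat set \<times> (nat \<Rightarrow> nat) \<times> nat perm \<times> nat perm" and j
 let ?N = "\<lambda>p q :: monom \<times> monom. Suc (mdeg (fst p) + mdeg (fst q))"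
 let ?F = "\<lambda>i p. (-1) ^ i * mcoeff (eperp i tau_infinity) (snd p)"
 let ?G = "\<lambda>j q. mcoeff (hperp j tau_infinity) (snd q)"
 have fin: "finite S" "finite D" "S \<inter> D = {}"
  by (rule finite_subset[OF _ finite_keys[of m]], auto simp: S_def D_def in_keys_iff)+
 have "coefficient m \<rho> (fls_nth (mcoeff (KP_B tau_infinity) \<alpha> * mcoeff (KP_B_perp tau_infinity) \<beta>) 1)
  = (\<Sum>p\<in>splits \<alpha>. \<Sum>q\<in>splits \<beta>. if multilinear (fst q) then (-1) ^ mdeg (fst q) *
    (\<Sum>i\<le>?N p q. coefficient m \<rho> (?F i p * ?G (?N p q - i) q)) else 0)"
  unfolding KP_coefficient[OF symmetric_tau_infinity]
  by (simp only: additive.sum[OF additive_coefficient] if_distrib[of "coefficient m \<rho>"]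
    additive_sign[OF additive_coefficient] additive.zero[OF additive_coefficient])
 also have "... = 0"
 proof (cases "\<forall>i. lookup m i \<le> 2")
  case False
  have z: "coefficient m \<rho> (?F i p * ?G j q) = 0" for i j and p q :: "monom \<times> monom"
   unfolding lookup_concentrated_product[OF concentrated_eperp_tau concentrated_hperp_tau] if_not_P[OF False] ..
  show ?thesis by (simp only: z sum.neutral_const mult_zero_right if_cancel)
 next
  case True
  have "coefficient m \<rho> (?F i p * ?G j q) = (\<Sum>t\<in>?T. mcoeff (a t i) (snd p) * mcoeff (b t j) (snd q))" for i j and p q :: "monom \<times> monom"
   unfolding lookup_concentrated_product[OF concentrated_eperp_tau concentrated_hperp_tau] if_P[OF True]
   unfolding S_def[symmetric] D_def[symmetric] a_def b_def case_prod_unfold ..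
  then have "(\<Sum>p\<in>splits \<alpha>. \<Sum>q\<in>splits \<beta>. if multilinear (fst q) then (-1) ^ mdeg (fst q) *
    (\<Sum>i\<le>?N p q. coefficient m \<rho> (?F i p * ?G (?N p q - i) q)) else 0)
   = (\<Sum>p\<in>splits \<alpha>. \<Sum>q\<in>splits \<beta>. if multilinear (fst q) then (-1) ^ mdeg (fst q) *
    (\<Sum>i\<le>?N p q. \<Sum>t\<in>?T. mcoeff (a t i) (snd p) * mcoeff (b t (?N p q - i)) (snd q)) else 0)"
   by (simp only:)
  also have "... = (\<Sum>p\<in>splits \<alpha>. \<Sum>q\<in>splits \<beta>. \<Sum>t\<in>?T. if multilinear (fst q) then (-1) ^ mdeg (fst q) *
    (\<Sum>i\<le>?N p q. mcoeff (a t i) (snd p) * mcoeff (b t (?N p q - i)) (snd q)) else 0)"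
  proof (intro sum.cong refl)
   fix p q :: "monom \<times> monom"
   have "(\<Sum>i\<le>?N p q. \<Sum>t\<in>?T. mcoeff (a t i) (snd p) * mcoeff (b t (?N p q - i)) (snd q))
    = (\<Sum>t\<in>?T. \<Sum>i\<le>?N p q. mcoeff (a t i) (snd p) * mcoeff (b t (?N p q - i)) (snd q))"
    by (rule sum.swap)
   then show "(if multilinear (fst q) then (-1) ^ mdeg (fst q) *
     (\<Sum>i\<le>?N p q. \<Sum>t\<in>?T. mcoeff (a t i) (snd p) * mcoeff (b t (?N p q - i)) (snd q)) else 0)
    = (\<Sum>t\<in>?T. if multilinear (fst q) then (-1) ^ mdeg (fst q) *
     (\<Sum>i\<le>?N p q. mcoeff (a t i) (snd p) * mcoeff (b t (?N p q - i)) (snd q)) else 0)"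
    by (cases "multilinear (fst q)") (simp_all only: if_True if_False sum_distrib_left sum.neutral_const)
  qed
  also have "... = (\<Sum>t\<in>?T. \<Sum>p\<in>splits \<alpha>. \<Sum>q\<in>splits \<beta>. if multilinear (fst q) then (-1) ^ mdeg (fst q) *
    (\<Sum>i\<le>?N p q. mcoeff (a t i) (snd p) * mcoeff (b t (?N p q - i)) (snd q)) else 0)"
   by (rule sum_swap_pair[symmetric])
  also have "... = (\<Sum>t\<in>?T. xy_coeff \<alpha> \<beta> (emb.resid eta
    (assignment_weight kp_a kp_b \<rho> S D (\<lambda>_. 0) t)))"
  proof (rule sum.cong[OF refl])
   fix t assume t: "t \<in> ?T"
   obtain B l \<sigma> \<pi> where e: "t = (B, l, \<sigma>, \<pi>)" by (cases t) auto
   have "B \<subseteq> S" using t assignmentsD(1)[of B l \<sigma> \<pi>] unfolding e by blast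
   then have f: "finite (S - B \<union> D)" "finite (B \<union> D)" using fin by (auto intro: finite_subset)
   show "(\<Sum>p\<in>splits \<alpha>. \<Sum>q\<in>splits \<beta>. if multilinear (fst q) then (-1) ^ mdeg (fst q) *
    (\<Sum>i\<le>?N p q. mcoeff (a t i) (snd p) * mcoeff (b t (?N p q - i)) (snd q)) else 0)
    = xy_coeff \<alpha> \<beta> (emb.resid eta (assignment_weight kp_a kp_b \<rho> S D (\<lambda>_. 0) t))"
    unfolding e assignment_weight_zero[OF t[unfolded e]]
    by (rule xy_coeff_resid[symmetric]) (simp_all only: coeff_cycle_product_a[OF f(1)] coeff_cycle_product_b[OF f(2)] a_def b_def fst_conv snd_conv)
  qed
  also have "... = xy_coeff \<alpha> \<beta> (emb.resid eta (mixed_sum kp_a kp_b \<rho> S D (\<lambda>_. 0)))"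
   unfolding mixed_sum_def additive.sum[OF emb.resid_additive] additive.sum[OF additive_xy_coeff] ..
  also have "... = 0" by (rule mixed_sum_residue[OF fin])
  finally show ?thesis .
 qed
 finally show ?thesis .
qed

text \<open>Exchanging the two coefficients exchanges the weights \<open>p\<^sub>k(x)\<close> and \<open>p\<^sub>k(y)\<close> in the sum over assignments. The
 reduction is the same for both, its factors \<open>a\<^sub>k + b\<^sub>k\<close> are symmetric, and the remaining sum is symmetric by
 \<open>pair_sum_commute\<close>.\<close>

lemma tau_infinity_coefficients_commute:
 "mcoeff tau_infinity \<alpha> * mcoeff tau_infinity \<beta> = mcoeff tau_infinity \<beta> * mcoeff tau_infinity \<alpha>"
proof (rule mps_eqI, rule poly_mapping_eqI)
 fix m :: monom and \<rho>
 define S where "S = {i. lookup m i = 1}"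
 define D where "D = {i. lookup m i = 2}"
 let ?T = "assignments \<rho> S D (\<lambda>_. 0)"
 let ?a = "\<lambda>k. [:inner (psum k):] :: complex mps mps poly" and ?b = "\<lambda>k. [:outer (psum k):] :: complex mps mps poly"
 let ?\<Psi> = "\<lambda>g. xy_coeff \<alpha> \<beta> (coeff g 0)"
 have fin: "finite S" "finite D" "S \<inter> D = {}"
  by (rule finite_subset[OF _ finite_keys[of m]], auto simp: S_def D_def in_keys_iff)+
 have add: "additive ?\<Psi>" by (simp add: additive_def plus_mps.rep_eq)
 have w: "cycle_product (\<lambda>k. [:\<iota> (psum k):]) X \<sigma> (\<lambda>_. 0) = [:\<iota> (cycle_psum X \<sigma>):]"
  if "symmetric_embedding \<iota>" "finite X" for \<iota> :: "complex mps \<Rightarrow> complex mps mps" and X \<sigma>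
 proof -
  interpret symmetric_embedding \<iota> by fact
  have p: "(\<Prod>i\<in>I. [:h i:]) = [:\<Prod>i\<in>I. h i:]" for I :: "nat set set" and h :: "nat set \<Rightarrow> complex mps mps"
   by (induction I rule: infinite_finite_induct) (auto simp: one_pCons)
  show ?thesis unfolding cycle_product_zero p cycle_psum_def iota_prod ..
 qed
 note wa = w[OF inner.symmetric_embedding_axioms] and wb = w[OF outer.symmetric_embedding_axioms]
 have sets: "finite (S - B \<union> D)" "finite (B \<union> D)" if "(B, l, \<sigma>, \<pi>) \<in> ?T" for B l \<sigma> \<pi>
  using assignmentsD(1)[OF that] fin by (auto intro: finite_subset)
 have ab: "(\<Sum>(B, l, \<sigma>, \<pi>)\<in>?T. mcoeff (cycle_psum (S - B \<union> D) \<sigma>) \<alpha> * mcoeff (cycle_psum (B \<union> D) \<pi>) \<beta>) = ?\<Psi> (mixed_sum ?a ?b \<rho> S D (\<lambda>_. 0))"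
  unfolding mixed_sum_def additive.sum[OF add]
 proof (rule sum.cong[OF refl], clarify)
  fix B l \<sigma> \<pi> assume t: "(B, l, \<sigma>, \<pi>) \<in> ?T"
  show "mcoeff (cycle_psum (S - B \<union> D) \<sigma>) \<alpha> * mcoeff (cycle_psum (B \<union> D) \<pi>) \<beta> = ?\<Psi> (assignment_weight ?a ?b \<rho> S D (\<lambda>_. 0) (B, l, \<sigma>, \<pi>))"
   unfolding assignment_weight_zero[OF t] wa[OF sets(1)[OF t]] wb[OF sets(2)[OF t]]
   by (simp add: mcoeff_inner_outer mcoeff_outer_inner mult.commute)
 qed
 have ba: "(\<Sum>(B, l, \<sigma>, \<pi>)\<in>?T. mcoeff (cycle_psum (S - B \<union> D) \<sigma>) \<beta> * mcoeff (cycle_psum (B \<union> D) \<pi>) \<alpha>) = ?\<Psi> (mixed_sum ?b ?a \<rho> S D (\<lambda>_. 0))"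
  unfolding mixed_sum_def additive.sum[OF add]
 proof (rule sum.cong[OF refl], clarify)
  fix B l \<sigma> \<pi> assume t: "(B, l, \<sigma>, \<pi>) \<in> ?T"
  show "mcoeff (cycle_psum (S - B \<union> D) \<sigma>) \<beta> * mcoeff (cycle_psum (B \<union> D) \<pi>) \<alpha> = ?\<Psi> (assignment_weight ?b ?a \<rho> S D (\<lambda>_. 0) (B, l, \<sigma>, \<pi>))"
   unfolding assignment_weight_zero[OF t] wb[OF sets(1)[OF t]] wa[OF sets(2)[OF t]]
   by (simp add: mcoeff_inner_outer mcoeff_outer_inner mult.commute)
 qed
 have "?\<Psi> (mixed_sum ?a ?b \<rho> S D (\<lambda>_. 0)) = ?\<Psi> (mixed_sum ?b ?a \<rho> S D (\<lambda>_. 0))"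
 proof -
  consider (zero) "\<forall>a b :: nat \<Rightarrow> complex mps mps poly. mixed_sum a b \<rho> S D (\<lambda>_. 0) = 0"
   | (pair) ks \<rho>' n where "\<forall>i. i \<notin> D \<longrightarrow> n i = 0"
    "\<forall>a b :: nat \<Rightarrow> complex mps mps poly. mixed_sum a b \<rho> S D (\<lambda>_. 0) = (\<Prod>k\<leftarrow>ks. a k + b k) * pair_sum b a \<rho>' D n"
   using mixed_sum_reduction[OF fin, of "\<lambda>_. 0" \<rho>, where 'v = "complex mps mps poly"] by blast
  then show ?thesis
  proof cases
   case pair
   let ?p = "\<Prod>k\<leftarrow>ks. ?a k + ?b k"
   have "(\<lambda>g. ?\<Psi> (?p * g)) (pair_sum ?b ?a \<rho>' D n) = (\<lambda>g. ?\<Psi> (?p * g)) (pair_sum ?a ?b \<rho>' D n)"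
   proof (rule emb.pair_sum_commute[where n = "sum n D"])
    show "additive (\<lambda>g. ?\<Psi> (?p * g))" using add by (simp add: additive_def distrib_left)
    show "?\<Psi> (?p * (emb.pconst c * g)) = c * ?\<Psi> (?p * g)" for c g
    proof -
     have "?p * (emb.pconst c * g) = emb.pconst c * (?p * g)" by (rule mult.left_commute)
     then show ?thesis by (simp add: emb.pconst_def xy_coeff_scalar del: mult_pCons_right)
    qed
    show "n \<in> exponents D (sum n D)" using pair(1) by (simp add: exponents_def)
   qed (rule fin)
   moreover have "(\<Prod>k\<leftarrow>ks. ?b k + ?a k) = ?p" by (simp only: add.commute)
   ultimately show ?thesis using pair(2) by (simp only:)
  qed simp
 qed
 then have e: "(\<Sum>(B, l, \<sigma>, \<pi>)\<in>?T. mcoeff (cycle_psum (S - B \<union> D) \<sigma>) \<alpha> * mcoeff (cycle_psum (B \<union> D) \<pi>) \<beta> :: complex)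
  = (\<Sum>(B, l, \<sigma>, \<pi>)\<in>?T. mcoeff (cycle_psum (S - B \<union> D) \<sigma>) \<beta> * mcoeff (cycle_psum (B \<union> D) \<pi>) \<alpha>)"
  unfolding ab ba .
 show "coefficient m \<rho> (mcoeff tau_infinity \<alpha> * mcoeff tau_infinity \<beta>) = coefficient m \<rho> (mcoeff tau_infinity \<beta> * mcoeff tau_infinity \<alpha>)"
  unfolding lookup_concentrated_product[OF concentrated_tau concentrated_tau] S_def[symmetric] D_def[symmetric] e ..
qed

theorem theorem5p25:
 shows "\<exists>R :: perm_series set. KP_tau_function R tau_infinity"
proof -
 let ?Z = "range (mcoeff tau_infinity)"
 let ?R = "{x. \<forall>y. (\<forall>z\<in>?Z. y * z = z * y) \<longrightarrow> x * y = y * x}"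
 have comm: "x * y = y * x" if "x \<in> ?Z" "y \<in> ?Z" for x y
  using that tau_infinity_coefficients_commute by auto
 note R = bicommutant_commutative_subalgebra[OF comm]
 have "KP_tau_function ?R tau_infinity"
  unfolding KP_tau_function_def tensor_coeff_def Sym_hat_def
 proof (intro conjI allI CollectI symmetric_tau_infinity)
  show "commutative_subalgebra ?R" by (rule R(1))
  show "?Z \<subseteq> ?R" by (rule R(2))
  show "fls_nth (mcoeff (KP_B tau_infinity) \<alpha> * mcoeff (KP_B_perp tau_infinity) \<beta>) 1 = 0" for \<alpha> \<beta>
   by (rule mps_eqI, rule poly_mapping_eqI) (simp add: KP_coefficient_tau_zero zero_mps.rep_eq)
 qed
 then show ?thesis by blast
qed

end
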